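(* Let $\theta>0$, $m\in\mathbb{N}$, and let $\{\lambda(N)\}_{N\ge1}$, $\lambda(N)\in\mathbb{GT}_N$, be a Vershik–Kerov sequence with boundary point $\omega=(\alpha^\pm,\beta^\pm,\gamma^\pm)$. Let $$\Psi(z;\omega,\theta)=\exp\left(\gamma^+(z-1)+\gamma^-(z^{-1}-1)\right)\prod_{i=1}^\infty\frac{(1+\beta_i^+(z-1))}{(1-\alpha_i^+(z-1)/\theta)^\theta}\,\frac{(1+\beta_i^-(z^{-1}-1))}{(1-\alpha_i^-(z^{-1}-1)/\theta)^\theta},$$ where the powers $u^\theta=\exp(\theta\ln u)$ have their principal values. Then $\Psi(\cdot;\omega,\theta)$ is holomorphic on a neighborhood of the unit circle, and there exists $\delta>0$, small enough that $\Psi(\cdot;\omega,\theta)$ is holomorphic on $\{z\in\mathbb{C}:1-\delta<|z|<1+\delta\}$, such that $$\lim_{N\to\infty}J_{\lambda(N)}(z_1,\dots,z_m;N,\theta)=\prod_{i=1}^m\Psi(z_i;\omega,\theta)$$ holds uniformly over $(z_1,\dots,z_m)$ with $z_1,\dots,z_m\in\{z\in\mathbb{C}:1-\delta<|z|<1+\delta\}$.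
   Context: $\mathbb{N}=\{1,2,\dots\}$. $\mathbb{GT}_N$ is the set of signatures of length $N$, i.e. integer sequences $\lambda=(\lambda_1\ge\dots\ge\lambda_N)$; $\mathbb{GT}^+_N$ is the subset with $\lambda_N\ge 0$; $|\lambda|=\sum_i\lambda_i$. Jack polynomials: for $\theta>0$ and $\lambda\in\mathbb{GT}_N^+$, $J_\lambda(x_1,\dots,x_N;\theta)$ is the Jack symmetric polynomial with Jack parameter $\alpha=1/\theta$, normalized so that the coefficient of $x_1^{\lambda_1}\cdots x_N^{\lambda_N}$ is $1$ (the limit $q\to1$, $t=q^\theta$, of Macdonald polynomials $P_\lambda(\cdot;q,t)$). Explicitly it is determined by $J_{(\lambda_1)}(x_1;\theta)=x_1^{\lambda_1}$ and the branching rule $J_\lambda(x_1,\dots,x_{N+1};\theta)=\sum_{\mu\prec\lambda}\psi_{\lambda/\mu}(\theta)\,x_{N+1}^{|\lambda|-|\mu|}J_\mu(x_1,\dots,x_N;\theta)$ for $\lambda\in\mathbb{GT}^+_{N+1}$, where the sum is over $\mu\in\mathbb{GT}^+_N$ with $\lambda_{N+1}\le\mu_N\le\lambda_N\le\dots\le\mu_1\le\lambda_1$, and, with $(a)_n=a(a+1)\cdots(a+n-1)$, $$\psi_{\lambda/\mu}(\theta)=\prod_{1\le i\le j\le N}\frac{(\mu_i-\mu_j+\theta(j-i)+\theta)_{\mu_j-\lambda_{j+1}}}{(\mu_i-\mu_j+\theta(j-i)+1)_{\mu_j-\lambda_{j+1}}}\cdot\frac{(\lambda_i-\mu_j+\theta(j-i)+1)_{\mu_j-\lambda_{j+1}}}{(\lambda_i-\mu_j+\theta(j-i)+\theta)_{\mu_j-\lambda_{j+1}}}.$$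 For general $\lambda\in\mathbb{GT}_N$, $J_\lambda(x_1,\dots,x_N;\theta)=(x_1\cdots x_N)^{-K}J_{(\lambda_1+K,\dots,\lambda_N+K)}(x_1,\dots,x_N;\theta)$ for any integer $K\ge0$ with $\lambda_N+K\ge0$ (independent of $K$). Jack characters: for $1\le m\le N$ and $\lambda\in\mathbb{GT}_N$, $J_\lambda(x_1,\dots,x_m;N,\theta)=J_\lambda(x_1,\dots,x_m,1^{N-m};\theta)/J_\lambda(1^N;\theta)$, where $1^k$ is a string of $k$ ones (the denominator is nonzero). Limits as $N\to\infty$ are over $N\ge m$. Vershik–Kerov (VK) sequences: for $\lambda(N)\in\mathbb{GT}_N$ let $\lambda^+(N),\lambda^-(N)\in\mathbb{GT}_N^+$ be $\lambda_i^+(N)=\max(\lambda_i(N),0)$ and $\lambda_i^-(N)=\max(-\lambda_{N+1-i}(N),0)$, viewed as partitions. Let $d(\lambda^\pm(N))$ be the number of diagonal boxes $(k,k)$ of the Young diagram of $\lambda^\pm(N)$, let $\lambda^\pm(N)'$ be the conjugate partition, and let the modified Frobenius coordinates be $a_i^\pm(N)=\lambda_i^\pm(N)-i+\frac12$, $b_i^\pm(N)=\lambda^\pm(N)_i'-i+\frac12$ for $1\le i\le d(\lambda^\pm(N))$ (and $a_i^\pm(N)=b_i^\pm(N)=0$ for larger $i$). The sequence $\{\lambda(N)\}_{N\ge1}$ is a Vershik–Kerov sequence if the limits $\alpha_i^\pm=\lim_{N}a_i^\pm(N)/N$, $\beta_i^\pm=\lim_N b_i^\pm(N)/N$ ($i=1,2,\dots$)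 and $\delta^\pm=\lim_N|\lambda^\pm(N)|/N$ exist and are finite. Then $\delta^\pm\ge\sum_i(\alpha_i^\pm+\beta_i^\pm)$; set $\gamma^\pm=\delta^\pm-\sum_{i\ge1}(\alpha_i^\pm+\beta_i^\pm)\ge0$. The tuple $\omega=(\alpha^\pm,\beta^\pm,\gamma^\pm)$ is the boundary point of the sequence. *)

theory Defs
  imports "HOL-Complex_Analysis.Complex_Analysis"
begin

section \<open>Signatures\<close>

text \<open>
  A signature of length \<open>N\<close> is a weakly decreasing integer list of length \<open>N\<close>. Indices are
  1-based throughout: \<open>part lam i\<close> is its \<open>i\<close>-th entry for \<open>1 \<le> i \<le> length lam\<close>.
\<close>

abbreviation part :: "int list \<Rightarrow> nat \<Rightarrow> int" where
  "part lam i \<equiv> lam ! (i - 1)"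

definition GT :: "nat \<Rightarrow> int list set" where
  "GT N = {lam. length lam = N \<and> sorted_wrt (\<ge>) lam}"

definition GT_pos :: "nat \<Rightarrow> int list set" where
  "GT_pos N = {lam \<in> GT N. \<forall>a\<in>set lam. 0 \<le> a}"


section \<open>Jack polynomials and Jack characters\<close>

definition interlacing :: "nat \<Rightarrow> int list \<Rightarrow> int list set" where
  "interlacing N lam =
     {mu \<in> GT_pos N. \<forall>j\<in>{1..N}. part lam (j + 1) \<le> part mu j \<and> part mu j \<le> part lam j}"

definition jack_branch :: "real \<Rightarrow> nat \<Rightarrow> int list \<Rightarrow> int list \<Rightarrow> real" where
  "jack_branch \<theta> N lam mu =
     (\<Prod>j = 1..N. \<Prod>i = 1..j.
        let n = nat (part mu j - part lam (j + 1));
            a = real_of_int (part mu i - part mu j) + \<theta> * (real j - real i);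
            b = real_of_int (part lam i - part mu j) + \<theta> * (real j - real i)
        in pochhammer (a + \<theta>) n / pochhammer (a + 1) n
             * (pochhammer (b + 1) n / pochhammer (b + \<theta>) n))"

text \<open>
  Jack polynomials are represented by the polynomial functions they define on complex arguments;
  only the values \<open>x 1, \<dots>, x N\<close> matter. The case of zero variables is a convention and
  is not used by the other equations.
\<close>

fun jack_pos :: "real \<Rightarrow> nat \<Rightarrow> int list \<Rightarrow> (nat \<Rightarrow> complex) \<Rightarrow> complex" where
  "jack_pos \<theta> 0 lam x = 1"
| "jack_pos \<theta> (Suc 0) lam x = x 1 ^ nat (part lam 1)"
| "jack_pos \<theta> (Suc (Suc n)) lam x =
     (\<Sum>mu\<in>interlacing (Suc n) lam.
        of_real (jack_branch \<theta> (Suc n) lam mu)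
          * x (Suc (Suc n)) ^ nat (sum_list lam - sum_list mu)
          * jack_pos \<theta> (Suc n) mu x)"

text \<open>
  For a signature with negative entries we shift by the least \<open>K \<ge> 0\<close> with
  \<open>part lam N + K \<ge> 0\<close>; any larger shift gives the same value where no \<open>x i\<close> vanishes.
\<close>

definition jack :: "real \<Rightarrow> nat \<Rightarrow> int list \<Rightarrow> (nat \<Rightarrow> complex) \<Rightarrow> complex" where
  "jack \<theta> N lam x =
     (let K = nat (- part lam N)
      in jack_pos \<theta> N (map (\<lambda>a. a + int K) lam) x / (\<Prod>i = 1..N. x i) ^ K)"

definition jack_char ::
    "real \<Rightarrow> nat \<Rightarrow> nat \<Rightarrow> int list \<Rightarrow> (nat \<Rightarrow> complex) \<Rightarrow> complex" where
  "jack_char \<theta> N m lam x =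
     jack \<theta> N lam (\<lambda>i. if i \<le> m then x i else 1) / jack \<theta> N lam (\<lambda>i. 1)"


section \<open>Vershik--Kerov sequences\<close>

definition pos_part :: "int list \<Rightarrow> int list" where
  "pos_part lam = map (\<lambda>a. max a 0) lam"

definition neg_part :: "int list \<Rightarrow> int list" where
  "neg_part lam = map (\<lambda>a. max (- a) 0) (rev lam)"

definition young :: "int list \<Rightarrow> (nat \<times> nat) set" where
  "young lam = {(i, j). i \<in> {1..length lam} \<and> 1 \<le> j \<and> int j \<le> part lam i}"

definition diag_len :: "int list \<Rightarrow> nat" where
  "diag_len lam = card {k. (k, k) \<in> young lam}"

definition conj_part :: "int list \<Rightarrow> nat \<Rightarrow> nat" where
  "conj_part lam j = card {i. (i, j) \<in> young lam}"

definition frob_a :: "int list \<Rightarrow> nat \<Rightarrow> real" where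
  "frob_a lam i =
     (if i \<in> {1..diag_len lam} then real_of_int (part lam i) - real i + 1/2 else 0)"

definition frob_b :: "int list \<Rightarrow> nat \<Rightarrow> real" where
  "frob_b lam i =
     (if i \<in> {1..diag_len lam} then real (conj_part lam i) - real i + 1/2 else 0)"

text \<open>One sign of the defining limits; \<open>\<alpha>\<close> and \<open>\<beta>\<close> are indexed from 1.\<close>

definition vk_limits ::
    "(nat \<Rightarrow> int list) \<Rightarrow> (nat \<Rightarrow> real) \<Rightarrow> (nat \<Rightarrow> real) \<Rightarrow> real \<Rightarrow> bool" where
  "vk_limits nu \<alpha> \<beta> \<gamma> \<longleftrightarrow>
     (\<forall>i\<ge>1. (\<lambda>N. frob_a (nu N) i / real N) \<longlonglongrightarrow> \<alpha> i) \<and>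
     (\<forall>i\<ge>1. (\<lambda>N. frob_b (nu N) i / real N) \<longlonglongrightarrow> \<beta> i) \<and>
     (\<exists>\<delta>. (\<lambda>N. real_of_int (sum_list (nu N)) / real N) \<longlonglongrightarrow> \<delta> \<and>
          \<gamma> = \<delta> - (\<Sum>i. \<alpha> (Suc i) + \<beta> (Suc i)))"

record boundary_point =
  alpha_pos :: "nat \<Rightarrow> real"
  beta_pos :: "nat \<Rightarrow> real"
  gamma_pos :: real
  alpha_neg :: "nat \<Rightarrow> real"
  beta_neg :: "nat \<Rightarrow> real"
  gamma_neg :: real

definition vk_sequence :: "(nat \<Rightarrow> int list) \<Rightarrow> boundary_point \<Rightarrow> bool" where
  "vk_sequence lam \<omega> \<longleftrightarrow>
     (\<forall>N\<ge>1. lam N \<in> GT N) \<and>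
     vk_limits (\<lambda>N. pos_part (lam N)) (alpha_pos \<omega>) (beta_pos \<omega>) (gamma_pos \<omega>) \<and>
     vk_limits (\<lambda>N. neg_part (lam N)) (alpha_neg \<omega>) (beta_neg \<omega>) (gamma_neg \<omega>)"


section \<open>The limit function\<close>

definition Psi_factor :: "boundary_point \<Rightarrow> real \<Rightarrow> nat \<Rightarrow> complex \<Rightarrow> complex" where
  "Psi_factor \<omega> \<theta> i z =
     (1 + of_real (beta_pos \<omega> i) * (z - 1))
       / (1 - of_real (alpha_pos \<omega> i) * (z - 1) / of_real \<theta>) powr of_real \<theta>
     * ((1 + of_real (beta_neg \<omega> i) * (inverse z - 1))
       / (1 - of_real (alpha_neg \<omega> i) * (inverse z - 1) / of_real \<theta>) powr of_real \<theta>)"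

definition Psi :: "boundary_point \<Rightarrow> real \<Rightarrow> complex \<Rightarrow> complex" where
  "Psi \<omega> \<theta> z =
     exp (of_real (gamma_pos \<omega>) * (z - 1) + of_real (gamma_neg \<omega>) * (inverse z - 1))
     * (\<Prod>i. Psi_factor \<omega> \<theta> (Suc i) z)"

definition annulus :: "real \<Rightarrow> complex set" where
  "annulus \<delta> = {z. 1 - \<delta> < norm z \<and> norm z < 1 + \<delta>}"

end

theory Submission
  imports Defs
begin

text \<open>
  The branching rule writes a Jack character as an expectation
  \<open>E (\<Prod>i \<le> m. z i powi \<xi> i)\<close> over random interlacing chains of signatures, where the
  increments \<open>\<xi> i\<close> of the chain sums are exchangeable by the symmetry of Jack polynomials.
  A Pieri-type identity, which for irrational \<open>\<theta>\<close>, where no Gamma function meets a pole, reduces to a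
  rational kernel identity and extends to all \<open>\<theta>\<close> by continuity, evaluates
  \<open>E (\<Gamma>(u - \<xi>) / \<Gamma>(u - \<xi> + \<theta> N))\<close> for one increment as a product over the rows of the
  signature, hence over the boxes of its positive and negative Young diagrams. When \<open>u / N \<rightarrow> v\<close> the
  weight tends to \<open>(1 + \<theta> / v) powi \<xi>\<close> and, summing over the principal hooks, the box product tends
  to \<open>\<Psi> (1 + \<theta> / v)\<close>. Taking \<open>v\<close> large and positive or negative bounds exponential moments of the
  increments; taking \<open>v\<close> along a ray gives the limit at real points \<open>x > 1\<close> near 1. Conditioning on the
  chain above a level adds one variable at a time, because the product for the smaller signature is
  close to that for the full one, and Montel's theorem extends the limit from the real segment to an annulus.
\<close>

section \<open>A rational kernel identity\<close>

text \<open>The Pieri-type identity is triangular: filling the leading rows gives the one term not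
  yet known, so Pieri sums, the value at the zero signature and the shift by all ones determine a
  functional on signatures. Value at ones, symmetry and the Gamma transform are three uses of this
  uniqueness. For several variables the obstacle is that the transform Y of a lower level is random
  while the target X, the transform at the top, is a constant, and nothing is known about the law of
  the lower signature. A box-moving inequality bounds Y times a factor near 1 by X, and
  exchangeability makes the means of Y and X asymptotically equal; a one-sided bound with equal
  means forces closeness in mean. Exponential moments then admit the monomials of the variables
  already treated as extra factors. The choice v = \<theta> / (x - 1) makes the weight tend to x
  powi k, and x > 1 near 1 puts v above the largest scaled row, where all weights are positive;
  negative v only serve the tail of negative increments.\<close>

definition pole_poly :: "nat \<Rightarrow> real \<Rightarrow> (real \<Rightarrow> real) \<Rightarrow> bool" where
  "pole_poly d c f \<longleftrightarrow> (\<exists>p. degree p \<le> d \<and> poly.coeff p d = c \<and> (\<forall>x. poly p x = f x))"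

lemma pole_poly_const: "pole_poly 0 c (\<lambda>x. c)"
  unfolding pole_poly_def by (rule exI[of _ "[:c:]"]) simp

lemma pole_poly_mult:
  assumes "pole_poly d c f" "pole_poly e b g"
  shows "pole_poly (d + e) (c * b) (\<lambda>x. f x * g x)"
proof -
  obtain p q where p: "degree p \<le> d" "poly.coeff p d = c" "\<And>x. poly p x = f x"
    and q: "degree q \<le> e" "poly.coeff q e = b" "\<And>x. poly q x = g x"
    using assms unfolding pole_poly_def by auto
  have "poly.coeff (p * q) (d + e) = c * b"
  proof (cases "degree p = d \<and> degree q = e")
    case True
    then show ?thesis using p q coeff_mult_degree_sum[of p q] by auto
  next
    case False
    then have "degree p < d \<or> degree q < e" using p q by auto
    moreover have "degree p < d \<Longrightarrow> c = 0" "degree q < e \<Longrightarrow> b = 0"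
      using p q coeff_eq_0 by auto
    moreover have "degree (p * q) < d + e"
      using degree_mult_le[of p q] p q False by linarith
    ultimately show ?thesis by (auto simp: coeff_eq_0)
  qed
  moreover have "degree (p * q) \<le> d + e" using degree_mult_le[of p q] p q by linarith
  ultimately show ?thesis unfolding pole_poly_def using p q by (intro exI[of _ "p * q"]) auto
qed

lemma pole_poly_add:
  assumes "pole_poly d c f" "pole_poly d b g"
  shows "pole_poly d (c + b) (\<lambda>x. f x + g x)"
proof -
  obtain p q where "degree p \<le> d" "poly.coeff p d = c" "\<And>x. poly p x = f x"
    "degree q \<le> d" "poly.coeff q d = b" "\<And>x. poly q x = g x"
    using assms unfolding pole_poly_def by auto
  then show ?thesis unfolding pole_poly_def
    by (intro exI[of _ "p + q"]) (auto intro: degree_add_le)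
qed

lemma pole_poly_cmult: "pole_poly d c f \<Longrightarrow> pole_poly d (b * c) (\<lambda>x. b * f x)"
  using pole_poly_mult[OF pole_poly_const] by fastforce

lemma pole_poly_sum:
  assumes "finite A" "\<And>i. i \<in> A \<Longrightarrow> pole_poly d (c i) (f i)"
  shows "pole_poly d (\<Sum>i\<in>A. c i) (\<lambda>x. \<Sum>i\<in>A. f i x)"
  using assms
proof (induction A rule: finite_induct)
  case empty
  show ?case unfolding pole_poly_def by (rule exI[of _ 0]) simp
qed (auto intro!: pole_poly_add)

lemma pole_poly_diff: "pole_poly 1 1 (\<lambda>x. x - b)" "pole_poly 1 (-1) (\<lambda>x. b - x)"
  unfolding pole_poly_def
  by (rule exI[of _ "[:-b, 1:]"], simp) (rule exI[of _ "[:b, -1:]"], simp)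

lemma pole_poly_prod_diff:
  assumes "finite A"
  shows "pole_poly (card A) 1 (\<lambda>x. \<Prod>i\<in>A. x - b i)"
    "pole_poly (card A) ((-1) ^ card A) (\<lambda>x. \<Prod>i\<in>A. b i - x)"
  using assms
proof (induction A rule: finite_induct)
  case empty
  { case 1 show ?case using pole_poly_const[of 1] by simp }
  { case 2 show ?case using pole_poly_const[of 1] by simp }
next
  case (insert i A)
  { case 1 show ?case using pole_poly_mult[OF pole_poly_diff(1)[of "b i"] insert(3)] insert(1,2) by simp }
  { case 2 show ?case using pole_poly_mult[OF pole_poly_diff(2)[of "b i"] insert(4)] insert(1,2) by simp }
qed

text \<open>Fixing the coefficient at x^d leaves d unknown coefficients, so d points suffice, one
  fewer than for a polynomial of degree at most d.\<close>

lemma pole_poly_unique: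
  assumes "pole_poly d c f" "pole_poly d c g" "card A \<ge> d" "\<And>x. x \<in> A \<Longrightarrow> f x = g x"
  shows "f = g"
proof -
  obtain p q where p: "degree p \<le> d" "poly.coeff p d = c" "\<And>x. poly p x = f x"
    and q: "degree q \<le> d" "poly.coeff q d = c" "\<And>x. poly q x = g x"
    using assms unfolding pole_poly_def by auto
  then have "p = q" using assms by (intro poly_eqI_degree_lead_coeff[of p d q A]) auto
  then show ?thesis using p q by auto
qed

section \<open>Subset sums attached to two finite point sets\<close>

definition kernel_term :: "real \<Rightarrow> real set \<Rightarrow> real set \<Rightarrow> real set \<Rightarrow> real" where
  "kernel_term a S T I = (\<Prod>i\<in>I. \<Prod>j\<in>S - I. (i - j + a) / (i - j))
     * (\<Prod>i\<in>I. \<Prod>k\<in>T. i - k - a) * (\<Prod>i\<in>S - I. \<Prod>k\<in>T. i - k)"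

definition kernel_sum :: "real \<Rightarrow> real \<Rightarrow> real set \<Rightarrow> real set \<Rightarrow> real" where
  "kernel_sum s a S T = (\<Sum>I\<in>Pow S. s ^ card I * kernel_term a S T I)"

lemma neg_ratio:
  fixes i x a :: real
  assumes "i \<noteq> x"
  shows "(x - i) * ((i - x + a) / (i - x)) = x - (i + a)"
proof -
  have "(x - i) * ((i - x + a) / (i - x)) = - ((i - x) * ((i - x + a) / (i - x)))"
    by (simp only: minus_diff_eq[symmetric, of x i] mult_minus_left minus_minus)
  then show ?thesis using assms by simp
qed

lemma sum_Pow_insert:
  assumes "finite A" "x \<notin> A"
  shows "(\<Sum>I\<in>Pow (insert x A). f I) = (\<Sum>I\<in>Pow A. f I + f (insert x I))"
proof -
  have "inj_on (insert x) (Pow A)" using assms(2) by (auto simp: inj_on_def)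
  then show ?thesis using assms
    by (subst Pow_insert, subst sum.union_disjoint)
       (auto simp: sum.reindex sum.distrib)
qed

lemma kernel_term_insert_left:
  assumes "finite S" "x \<notin> S" "I \<subseteq> S"
  shows "kernel_term a (insert x S) T I =
      kernel_term a S T I * (\<Prod>i\<in>I. (i - x + a) / (i - x)) * (\<Prod>k\<in>T. x - k)"
    and "kernel_term a (insert x S) T (insert x I) =
      kernel_term a S T I * (\<Prod>j\<in>S - I. (x - j + a) / (x - j)) * (\<Prod>k\<in>T. x - k - a)"
proof -
  have fin: "finite I" using assms finite_subset by blast
  have "insert x S - I = insert x (S - I)" using assms by auto
  moreover have "(\<Prod>i\<in>I. \<Prod>j\<in>insert x (S - I). (i - j + a) / (i - j)) =
      (\<Prod>i\<in>I. (i - x + a) / (i - x)) * (\<Prod>i\<in>I. \<Prod>j\<in>S - I. (i - j + a) / (i - j))"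
    unfolding prod.distrib[symmetric] using assms by (intro prod.cong) auto
  ultimately show "kernel_term a (insert x S) T I =
      kernel_term a S T I * (\<Prod>i\<in>I. (i - x + a) / (i - x)) * (\<Prod>k\<in>T. x - k)"
    using assms unfolding kernel_term_def by (simp add: prod.distrib)
  have "insert x S - insert x I = S - I" "x \<notin> I" using assms by auto
  then show "kernel_term a (insert x S) T (insert x I) =
      kernel_term a S T I * (\<Prod>j\<in>S - I. (x - j + a) / (x - j)) * (\<Prod>k\<in>T. x - k - a)"
    using fin unfolding kernel_term_def by simp
qed

lemma kernel_term_insert_right:
  assumes "finite T" "y \<notin> T"
  shows "kernel_term a S (insert y T) I =
      kernel_term a S T I * (\<Prod>i\<in>I. i - y - a) * (\<Prod>i\<in>S - I. i - y)"
  using assms unfolding kernel_term_def by (simp add: prod.distrib)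

lemma kernel_sum_insert_left:
  assumes "finite S" "x \<notin> S"
  shows "kernel_sum s a (insert x S) T =
    (\<Sum>I\<in>Pow S. s ^ card I * kernel_term a S T I *
       ((\<Prod>i\<in>I. (i - x + a) / (i - x)) * (\<Prod>k\<in>T. x - k)
        + s * (\<Prod>j\<in>S - I. (x - j + a) / (x - j)) * (\<Prod>k\<in>T. x - k - a)))"
  unfolding kernel_sum_def
proof (subst sum_Pow_insert[OF assms], rule sum.cong[OF refl])
  fix I assume I: "I \<in> Pow S"
  then have "card (insert x I) = Suc (card I)" 
    using assms finite_subset by (intro card_insert_disjoint) auto
  then show "s ^ card I * kernel_term a (insert x S) T I
      + s ^ card (insert x I) * kernel_term a (insert x S) T (insert x I) =
    s ^ card I * kernel_term a S T I *
       ((\<Prod>i\<in>I. (i - x + a) / (i - x)) * (\<Prod>k\<in>T. x - k)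
        + s * (\<Prod>j\<in>S - I. (x - j + a) / (x - j)) * (\<Prod>k\<in>T. x - k - a))"
    using I assms by (simp add: kernel_term_insert_left algebra_simps)
qed

text \<open>A common point x kills every term with x outside I through the factor x - x. In the
  surviving terms x - x - a is - a, and the remaining dependence on x collapses to the same two
  products for every I.\<close>

lemma kernel_sum_insert_both:
  assumes "finite S" "x \<notin> S" "finite T" "x \<notin> T"
  shows "kernel_sum s a (insert x S) (insert x T) =
    - a * s * (\<Prod>k\<in>T. x - k - a) * (\<Prod>i\<in>S. i - x - a) * kernel_sum s a S T"
proof -
  have "(\<Prod>i\<in>I. i - x - a) * (\<Prod>i\<in>S - I. i - x) * (\<Prod>j\<in>S - I. (x - j + a) / (x - j))
      = (\<Prod>i\<in>S. i - x - a)" if "I \<subseteq> S" for I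
  proof -
    have "(\<Prod>i\<in>S - I. i - x) * (\<Prod>j\<in>S - I. (x - j + a) / (x - j)) = (\<Prod>i\<in>S - I. i - x - a)"
      unfolding prod.distrib[symmetric] 
    proof (rule prod.cong[OF refl])
      fix i assume "i \<in> S - I"
      then have "i \<noteq> x" using assms by auto
      then show "(i - x) * ((x - i + a) / (x - i)) = i - x - a" by (simp add: field_simps)
    qed
    then show ?thesis using prod.subset_diff[OF that assms(1), of "\<lambda>i. i - x - a"] by (simp add: mult_ac)
  qed
  then have "s ^ card I * kernel_term a S (insert x T) I * ((\<Prod>i\<in>I. (i - x + a) / (i - x)) * (\<Prod>k\<in>insert x T. x - k)
        + s * (\<Prod>j\<in>S - I. (x - j + a) / (x - j)) * (\<Prod>k\<in>insert x T. x - k - a))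
      = - a * s * (\<Prod>k\<in>T. x - k - a) * (\<Prod>i\<in>S. i - x - a) * (s ^ card I * kernel_term a S T I)"
    if "I \<in> Pow S" for I
    using that[unfolded Pow_iff] assms(3,4)
    by (simp add: kernel_term_insert_right flip: \<open>\<And>I. I \<subseteq> S \<Longrightarrow> _ = prod _ S\<close>)
  then show ?thesis
    unfolding kernel_sum_insert_left[OF assms(1,2)] unfolding kernel_sum_def sum_distrib_left
    by (intro sum.cong refl)
qed

text \<open>As a function of the added point x the sum has at most simple poles at S, which the
  product of the x - j clears. The values at S are then residues, and these cancel in pairs of sets
  differing by x. The factor 1 + s in the top coefficient counts x outside and inside I.\<close>

lemma kernel_sum_left_poly:
  assumes S: "finite S" and T: "finite T"
  obtains f where "pole_poly (card S + card T) ((1 + s) * kernel_sum s a S T) f"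
    "\<And>x. x \<notin> S \<Longrightarrow> f x = (\<Prod>j\<in>S. x - j) * kernel_sum s a (insert x S) T"
    "\<And>x. x \<in> S \<Longrightarrow> f x = 0"
proof
  \<comment> \<open>\<open>f1\<close> and \<open>f2\<close> are the cleared contributions of the
    sets without and with the new point; both are monic of degree \<open>card S + card T\<close> in
    x.\<close>
  define f1 where "f1 = (\<lambda>I x. (\<Prod>i\<in>I. x - (i + a)) * (\<Prod>j\<in>S - I. x - j) * (\<Prod>k\<in>T. x - k))"
  define f2 where "f2 = (\<lambda>I x. (\<Prod>i\<in>I. x - i) * (\<Prod>j\<in>S - I. x - (j - a)) * (\<Prod>k\<in>T. x - (k + a)))"
  define f where "f = (\<lambda>x. \<Sum>I\<in>Pow S. s ^ card I * kernel_term a S T I * (f1 I x + s * f2 I x))"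
  have pd: "pole_poly (card S + card T) (s ^ card I * kernel_term a S T I * (1 + s))
      (\<lambda>x. s ^ card I * kernel_term a S T I * (f1 I x + s * f2 I x))" if "I \<subseteq> S" for I
  proof -
    have fI: "finite I" "finite (S - I)" and c: "card I + card (S - I) = card S"
      using that S by (auto simp: finite_subset card_Diff_subset card_mono)
    have "pole_poly (card I + card (S - I) + card T) (1 * 1 * 1) (f1 I)"
      "pole_poly (card I + card (S - I) + card T) (1 * 1 * 1) (f2 I)"
      unfolding f1_def f2_def by (intro pole_poly_mult pole_poly_prod_diff fI T)+
    then have "pole_poly (card S + card T) (1 + s * 1) (\<lambda>x. f1 I x + s * f2 I x)"
      unfolding c by (intro pole_poly_add pole_poly_cmult) auto
    then show ?thesis by (intro pole_poly_cmult) simp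
  qed
  show "pole_poly (card S + card T) ((1 + s) * kernel_sum s a S T) f"
    using pole_poly_sum[of "Pow S" "card S + card T", OF _ pd] S
    unfolding f_def kernel_sum_def by (simp add: sum_distrib_left mult_ac)
  show "f x = (\<Prod>j\<in>S. x - j) * kernel_sum s a (insert x S) T" if x: "x \<notin> S" for x
    unfolding f_def kernel_sum_insert_left[OF S x] sum_distrib_left
  proof (rule sum.cong[OF refl])
    fix I assume I: "I \<in> Pow S"
    have "(\<Prod>i\<in>I. x - i) * (\<Prod>i\<in>I. (i - x + a) / (i - x)) = (\<Prod>i\<in>I. x - (i + a))"
      unfolding prod.distrib[symmetric]
      by (rule prod.cong[OF refl], rule neg_ratio) (use x I in auto)
    moreover have "(\<Prod>i\<in>S - I. x - i) * (\<Prod>i\<in>S - I. (x - i + a) / (x - i)) = (\<Prod>i\<in>S - I. x - (i - a))"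
      unfolding prod.distrib[symmetric]
      by (rule prod.cong[OF refl]) (use x I in auto)
    moreover have "(\<Prod>k\<in>T. x - (k + a)) = (\<Prod>k\<in>T. x - k - a)" by (simp add: algebra_simps)
    moreover have "(\<Prod>j\<in>S. x - j) = (\<Prod>i\<in>I. x - i) * (\<Prod>i\<in>S - I. x - i)"
      using prod.subset_diff[of I S] I S by (simp add: mult.commute)
    ultimately show "s ^ card I * kernel_term a S T I * (f1 I x + s * f2 I x) = (\<Prod>j\<in>S. x - j) *
      (s ^ card I * kernel_term a S T I *
       ((\<Prod>i\<in>I. (i - x + a) / (i - x)) * (\<Prod>k\<in>T. x - k)
        + s * (\<Prod>j\<in>S - I. (x - j + a) / (x - j)) * (\<Prod>k\<in>T. x - k - a)))"
      unfolding f1_def f2_def by (simp add: algebra_simps)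
  qed
  show "f x = 0" if x: "x \<in> S" for x
  proof -
    \<comment> \<open>Here x already lies in S. Splitting it off allows the pairing of I with
      \<open>insert x I\<close>: two of the four contributions vanish at x and the other two
      cancel.\<close>
    define U where "U = S - {x}"
    have U: "finite U" "x \<notin> U" "S = insert x U" using S x by (auto simp: U_def)
    show ?thesis unfolding f_def U(3)
    proof (subst sum_Pow_insert[OF U(1,2)], rule sum.neutral, rule ballI)
      fix I assume I: "I \<in> Pow U"
      then have "finite I" using U finite_subset by auto
      with I have xI: "x \<notin> I" "finite I" "x \<in> S - I" and c: "card (insert x I) = Suc (card I)"
        and d: "S - insert x I = U - I" "S - I = insert x (U - I)"
        using U by (auto intro!: card_insert_disjoint)
      have z: "f1 I x = 0" "f2 (insert x I) x = 0"
        using xI S x unfolding f1_def f2_def by auto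
      have z1: "f1 (insert x I) x = - a * (\<Prod>i\<in>I. x - (i + a)) * (\<Prod>j\<in>U - I. x - j) * (\<Prod>k\<in>T. x - k)"
        using xI unfolding f1_def d by simp
      have z2: "f2 I x = a * (\<Prod>i\<in>I. x - i) * (\<Prod>j\<in>U - I. x - (j - a)) * (\<Prod>k\<in>T. x - (k + a))"
        using U xI unfolding f2_def d by simp
      have e1: "(\<Prod>i\<in>I. x - i) * (\<Prod>i\<in>I. (i - x + a) / (i - x)) = (\<Prod>i\<in>I. x - (i + a))"
        unfolding prod.distrib[symmetric]
        by (rule prod.cong[OF refl], rule neg_ratio) (use xI in auto)
      have e2: "(\<Prod>i\<in>U - I. x - i) * (\<Prod>i\<in>U - I. (x - i + a) / (x - i)) = (\<Prod>i\<in>U - I. x - (i - a))"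
        unfolding prod.distrib[symmetric]
        by (rule prod.cong[OF refl]) (use U in auto)
      have e3: "(\<Prod>k\<in>T. x - (k + a)) = (\<Prod>k\<in>T. x - k - a)" by (simp add: algebra_simps)
      have "kernel_term a S T I * f2 I x + kernel_term a S T (insert x I) * f1 (insert x I) x = 0"
        using I kernel_term_insert_left[OF U(1,2), of I a T] unfolding z1 z2 U(3)[symmetric]
        by (simp add: mult_ac e3 flip: e1 e2)
      then have "s ^ Suc (card I) * (kernel_term a S T I * f2 I x + kernel_term a S T (insert x I) * f1 (insert x I) x) = 0"
        by simp
      then show "s ^ card I * kernel_term a (insert x U) T I * (f1 I x + s * f2 I x)
        + s ^ card (insert x I) * kernel_term a (insert x U) T (insert x I)
          * (f1 (insert x I) x + s * f2 (insert x I) x) = 0"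
        unfolding z c U(3)[symmetric] by (simp add: algebra_simps)
    qed
  qed
qed

text \<open>A point added to the second set creates no poles; the product of the x - j is multiplied
  in only to give this side the same degree and the same zeros as the other one.\<close>

lemma kernel_sum_right_poly:
  assumes S: "finite S" and T: "finite T"
  obtains f where "pole_poly (card S + card T) ((-1) ^ card T * kernel_sum s a T S) f"
    "\<And>x. x \<notin> S \<Longrightarrow> f x = (\<Prod>j\<in>S. x - j) * kernel_sum s a T (insert x S)"
    "\<And>x. x \<in> S \<Longrightarrow> f x = 0"
proof
  define f where "f = (\<lambda>x. (\<Prod>j\<in>S. x - j) * (\<Sum>J\<in>Pow T. s ^ card J * kernel_term a T S J
     * ((\<Prod>i\<in>J. (i - a) - x) * (\<Prod>i\<in>T - J. i - x))))"
  have pd: "pole_poly (card T) (s ^ card J * kernel_term a T S J * (-1) ^ card T)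
      (\<lambda>x. s ^ card J * kernel_term a T S J * ((\<Prod>i\<in>J. (i - a) - x) * (\<Prod>i\<in>T - J. i - x)))" if "J \<subseteq> T" for J
  proof -
    have fJ: "finite J" "finite (T - J)" and c: "card J + card (T - J) = card T"
      using that T by (auto simp: finite_subset card_Diff_subset card_mono)
    have "pole_poly (card J + card (T - J)) ((-1) ^ card J * (-1) ^ card (T - J))
        (\<lambda>x. (\<Prod>i\<in>J. (i - a) - x) * (\<Prod>i\<in>T - J. i - x))"
      by (intro pole_poly_mult pole_poly_prod_diff fJ)
    then show ?thesis unfolding power_add[symmetric] c by (intro pole_poly_cmult)
  qed
  have "pole_poly (card S + card T) (1 * (\<Sum>J\<in>Pow T. s ^ card J * kernel_term a T S J * (-1) ^ card T)) f"
    unfolding f_def using T pd by (intro pole_poly_mult pole_poly_sum pole_poly_prod_diff S) auto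
  then show "pole_poly (card S + card T) ((-1) ^ card T * kernel_sum s a T S) f"
    unfolding kernel_sum_def by (simp add: sum_distrib_left mult_ac)
  show "f x = (\<Prod>j\<in>S. x - j) * kernel_sum s a T (insert x S)" if "x \<notin> S" for x
    unfolding f_def kernel_sum_def using kernel_term_insert_right[OF S that]
    by (simp add: algebra_simps)
  show "f x = 0" if "x \<in> S" for x
    unfolding f_def using S that by auto
qed

section \<open>Duality of the two kernel sums by interpolation\<close>

definition kernel_dual :: "real \<Rightarrow> real \<Rightarrow> real set \<Rightarrow> real set \<Rightarrow> bool" where
  "kernel_dual s a S T \<longleftrightarrow> (1 + s) ^ card T * kernel_sum s a S T =
     (-1) ^ (card S * card T) * (1 + s) ^ card S * kernel_sum s (- a) T S"

lemma kernel_dual_insert_both: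
  assumes "finite S" "x \<notin> S" "finite T" "x \<notin> T" "kernel_dual s a S T"
  shows "kernel_dual s a (insert x S) (insert x T)"
proof -
  have "(\<Prod>i\<in>S. i - x - a) = (-1) ^ card S * (\<Prod>i\<in>S. x - i - - a)"
    "(\<Prod>i\<in>T. i - x - - a) = (-1) ^ card T * (\<Prod>i\<in>T. x - i - a)"
    unfolding prod_constant[symmetric] prod.distrib[symmetric] by (auto intro!: prod.cong)
  then show ?thesis
    using assms unfolding kernel_dual_def
    by (simp add: kernel_sum_insert_both power_add mult_ac)
qed

text \<open>Multiplied by the product of the x - j, both sides are polynomials in x of degree at
  most \<open>card S + card T\<close>. They vanish on S, agree on T by the case of a common point,
  and have equal top coefficients by the duality for S and T. Disjointness makes the number of
  points large enough.\<close>

lemma kernel_dual_insert: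
  assumes S: "finite S" and T: "finite T" and disj: "S \<inter> T = {}" and x: "x \<notin> S"
    and ST: "kernel_dual s a S T" and ST': "\<And>y. y \<in> T \<Longrightarrow> kernel_dual s a S (T - {y})"
  shows "kernel_dual s a (insert x S) T"
proof -
  obtain f where f: "pole_poly (card S + card T) ((1 + s) * kernel_sum s a S T) f"
    "\<And>x. x \<notin> S \<Longrightarrow> f x = (\<Prod>j\<in>S. x - j) * kernel_sum s a (insert x S) T"
    "\<And>x. x \<in> S \<Longrightarrow> f x = 0"
    using kernel_sum_left_poly[OF S T] by blast
  obtain g where g: "pole_poly (card S + card T) ((-1) ^ card T * kernel_sum s (- a) T S) g"
    "\<And>x. x \<notin> S \<Longrightarrow> g x = (\<Prod>j\<in>S. x - j) * kernel_sum s (- a) T (insert x S)"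
    "\<And>x. x \<in> S \<Longrightarrow> g x = 0"
    using kernel_sum_right_poly[OF S T] by blast
  define F where "F = (\<lambda>x. (1 + s) ^ card T * f x)"
  define G where "G = (\<lambda>x. (-1) ^ (Suc (card S) * card T) * (1 + s) ^ Suc (card S) * g x)"
  have FG: "F y = G y" if "y \<notin> S" "kernel_dual s a (insert y S) T" for y
    using that S unfolding F_def G_def kernel_dual_def by (simp add: f g mult_ac)
  have sgn: "(-1::real) ^ card T * (-1) ^ card T = 1" 
    by (metis mult_minus1 mult_minus1_right left_minus_one_mult_self mult.right_neutral)
  have "F = G"
  proof (rule pole_poly_unique)
    show "pole_poly (card S + card T) ((1 + s) ^ card T * ((1 + s) * kernel_sum s a S T)) F"
      unfolding F_def by (intro pole_poly_cmult f)
    have "(1 + s) ^ card T * ((1 + s) * kernel_sum s a S T) =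
       (-1) ^ (Suc (card S) * card T) * (1 + s) ^ Suc (card S) * ((-1) ^ card T * kernel_sum s (- a) T S)"
      using ST sgn unfolding kernel_dual_def by (simp add: power_add mult_ac)
    then show "pole_poly (card S + card T) ((1 + s) ^ card T * ((1 + s) * kernel_sum s a S T)) G"
      unfolding G_def by (metis (no_types) pole_poly_cmult[OF g(1)])
    show "card S + card T \<le> card (S \<union> T)" using S T disj by (simp add: card_Un_disjoint)
    fix y assume y: "y \<in> S \<union> T"
    show "F y = G y"
    proof (cases "y \<in> S")
      case True
      then show ?thesis by (simp add: F_def G_def f g)
    next
      case False
      then have "y \<in> T" using y by auto
      then have "T = insert y (T - {y})" by auto
      then have "kernel_dual s a (insert y S) T"
        using kernel_dual_insert_both[of S y "T - {y}" s a] ST'[OF \<open>y \<in> T\<close>] S T False by auto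
      then show ?thesis using FG False by blast
    qed
  qed
  then have "F x = G x" by simp
  then have "(\<Prod>j\<in>S. x - j) * ((1 + s) ^ card T * kernel_sum s a (insert x S) T) = (\<Prod>j\<in>S. x - j) * 
      ((-1) ^ (Suc (card S) * card T) * (1 + s) ^ Suc (card S) * kernel_sum s (- a) T (insert x S))"
    unfolding F_def G_def f(2)[OF x] g(2)[OF x] by (simp only: mult_ac)
  moreover have "(\<Prod>j\<in>S. x - j) \<noteq> 0" using S x by auto
  ultimately show ?thesis using S x unfolding kernel_dual_def by simp
qed

lemma kernel_sum_empty_left: "kernel_sum s a {} T = 1"
  by (simp add: kernel_sum_def kernel_term_def)

text \<open>The interpolation step with T empty, iterated over S; the dual sum over the empty set is
  1.\<close>

lemma kernel_sum_empty_right: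
  assumes "finite S"
  shows "kernel_sum s a S {} = (1 + s) ^ card S"
proof -
  have "kernel_dual s a S {}"
    using assms
  proof (induction S rule: finite_induct)
    case empty
    then show ?case by (simp add: kernel_dual_def kernel_sum_empty_left)
  next
    case (insert x S)
    then show ?case by (intro kernel_dual_insert) auto
  qed
  then show ?thesis by (simp add: kernel_dual_def kernel_sum_empty_left)
qed

text \<open>Induction on the size of S with T arbitrary, because the interpolation step refers to T
  and to T without a point. If the sets meet, a common point is removed from both instead.\<close>

theorem kernel_identity:
  assumes "finite S" "finite T"
  shows "(1 + s) ^ card T * kernel_sum s a S T =
     (-1) ^ (card S * card T) * (1 + s) ^ card S * kernel_sum s (- a) T S"
proof -
  have "kernel_dual s a S T" if "card S = n" "finite S" "finite T" for n S T
    using that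
  proof (induction n arbitrary: S T)
    case 0
    then show ?case by (simp add: kernel_dual_def kernel_sum_empty_left kernel_sum_empty_right)
  next
    case (Suc n)
    show ?case
    proof (cases "S \<inter> T = {}")
      case True
      obtain x U where U: "S = insert x U" "x \<notin> U" "card U = n" "finite U"
        using Suc.prems by (metis card_Suc_eq finite_insert)
      show ?thesis unfolding U(1)
        by (rule kernel_dual_insert) (use Suc U True in auto)
    next
      case False
      then obtain x where x: "x \<in> S" "x \<in> T" by blast
      have "kernel_dual s a (insert x (S - {x})) (insert x (T - {x}))"
        using x Suc by (intro kernel_dual_insert_both) auto
      then show ?thesis using x by (simp add: insert_absorb)
    qed
  qed
  then show ?thesis using assms unfolding kernel_dual_def by blast
qed

section \<open>The intertwining relation between consecutive levels\<close>

lemma kernel_sum_image: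
  assumes "finite A" "inj_on l A" "inj_on y B"
  shows "kernel_sum s a (l ` A) (y ` B) = (\<Sum>I\<in>Pow A. s ^ card I *
    ((\<Prod>i\<in>I. \<Prod>j\<in>A - I. (l i - l j + a) / (l i - l j))
     * (\<Prod>i\<in>I. \<Prod>k\<in>B. l i - y k - a) * (\<Prod>i\<in>A - I. \<Prod>k\<in>B. l i - y k)))"
proof -
  have inj: "inj_on (image l) (Pow A)" using assms(2) inj_on_image_Pow by blast
  have "Pow (l ` A) = image l ` Pow A" by (simp add: image_Pow_surj)
  then have "kernel_sum s a (l ` A) (y ` B) = (\<Sum>I\<in>Pow A. s ^ card (l ` I) * kernel_term a (l ` A) (y ` B) (l ` I))"
    unfolding kernel_sum_def by (simp add: sum.reindex[OF inj])
  also have "\<dots> = (\<Sum>I\<in>Pow A. s ^ card I *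
    ((\<Prod>i\<in>I. \<Prod>j\<in>A - I. (l i - l j + a) / (l i - l j))
     * (\<Prod>i\<in>I. \<Prod>k\<in>B. l i - y k - a) * (\<Prod>i\<in>A - I. \<Prod>k\<in>B. l i - y k)))"
  proof (rule sum.cong[OF refl])
    fix I assume I: "I \<in> Pow A"
    then have inj: "inj_on l I" "inj_on l (A - I)" and d: "l ` A - l ` I = l ` (A - I)"
      using assms(2) by (auto simp: inj_on_diff inj_on_image_set_diff intro: inj_on_subset)
    show "s ^ card (l ` I) * kernel_term a (l ` A) (y ` B) (l ` I) = s ^ card I *
    ((\<Prod>i\<in>I. \<Prod>j\<in>A - I. (l i - l j + a) / (l i - l j))
     * (\<Prod>i\<in>I. \<Prod>k\<in>B. l i - y k - a) * (\<Prod>i\<in>A - I. \<Prod>k\<in>B. l i - y k))"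
      unfolding kernel_term_def d using inj assms(3) by (simp add: prod.reindex card_image)
  qed
  finally show ?thesis .
qed

text \<open>Infinitely many values of s determine a polynomial. Positive s are enough, and for them
  the duality may be divided by powers of 1 + s.\<close>

lemma graded_coeff_eq:
  fixes f :: "'i \<Rightarrow> real" and g :: "'j \<Rightarrow> real"
  assumes "finite A" "finite B"
    and "\<And>s. s > 0 \<Longrightarrow> (\<Sum>i\<in>A. s ^ c i * f i) = (\<Sum>j\<in>B. s ^ d j * g j)"
  shows "(\<Sum>i | i \<in> A \<and> c i = r. f i) = (\<Sum>j | j \<in> B \<and> d j = r. g j)"
proof -
  define p q where "p = (\<Sum>i\<in>A. monom (f i) (c i))" and "q = (\<Sum>j\<in>B. monom (g j) (d j))"
  have "poly (p - q) s = 0" if "s > 0" for s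
    using assms(3)[OF that] by (simp add: p_def q_def poly_sum poly_monom mult.commute)
  then have "{0<..} \<subseteq> {s. poly (p - q) s = 0}" by auto
  then have "p = q" using infinite_Ioi[of "0::real"] poly_roots_finite[of "p - q"]
    by (metis finite_subset right_minus_eq)
  then have "poly.coeff p r = poly.coeff q r" by simp
  then have "(\<Sum>i\<in>A. if c i = r then f i else 0) = (\<Sum>j\<in>B. if d j = r then g j else 0)"
    by (simp add: p_def q_def coeff_sum)
  then show ?thesis using assms(1,2) by (simp add: sum.inter_filter)
qed

section \<open>Shifted coordinates and the kernel between adjacent levels\<close>

definition shifted :: "real \<Rightarrow> (nat \<Rightarrow> int) \<Rightarrow> nat \<Rightarrow> real" where
  "shifted \<theta> a i = of_int (a i) - \<theta> * real i"

definition ind :: "nat set \<Rightarrow> nat \<Rightarrow> int" where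
  "ind I i = (if i \<in> I then 1 else 0)"

text \<open>The Pieri coefficients of the elementary symmetric polynomials for Jack polynomials
  normalized at (1, ..., 1).\<close>

definition pieri_coeff :: "real \<Rightarrow> nat \<Rightarrow> (nat \<Rightarrow> int) \<Rightarrow> nat set \<Rightarrow> real" where
  "pieri_coeff \<theta> N a I = (\<Prod>i\<in>I. \<Prod>j\<in>{1..N} - I.
     (shifted \<theta> a i - shifted \<theta> a j + \<theta>) / (shifted \<theta> a i - shifted \<theta> a j))"

text \<open>The same product with \<theta> replaced by 1 - \<theta>. This is the form that the
  kernel identity with parameter 1 - \<theta> produces; conjugation by \<open>pair_norm\<close>
  relates it to \<open>pieri_coeff\<close>.\<close>

definition dual_coeff :: "real \<Rightarrow> nat \<Rightarrow> (nat \<Rightarrow> int) \<Rightarrow> nat set \<Rightarrow> real" where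
  "dual_coeff \<theta> N a I = (\<Prod>i\<in>I. \<Prod>j\<in>{1..N} - I.
     (shifted \<theta> a i - shifted \<theta> a j + (1 - \<theta>)) / (shifted \<theta> a i - shifted \<theta> a j))"

text \<open>Written with the entire function \<open>rGamma\<close>, whose zeros at x = -1, -2, ...
  will encode interlacing.\<close>

definition gamma_quot :: "real \<Rightarrow> real \<Rightarrow> real" where
  "gamma_quot \<theta> x = Gamma (x + \<theta>) * rGamma (x + 1)"

definition pairs :: "nat \<Rightarrow> (nat \<times> nat) set" where
  "pairs n = {(i, j). 1 \<le> i \<and> i < j \<and> j \<le> n}"

lemma finite_pairs [simp]: "finite (pairs n)"
  by (rule finite_subset[of _ "{1..n} \<times> {1..n}"]) (auto simp: pairs_def)

definition vander :: "nat \<Rightarrow> (nat \<Rightarrow> real) \<Rightarrow> real" where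
  "vander n x = (\<Prod>(i, j)\<in>pairs n. x i - x j)"

text \<open>The two cases pick the order of the difference that is nonnegative when the signatures
  interlace.\<close>

definition link :: "real \<Rightarrow> (nat \<Rightarrow> int) \<Rightarrow> (nat \<Rightarrow> int) \<Rightarrow> nat \<Rightarrow> nat \<Rightarrow> real" where
  "link \<theta> a b j k = (if j \<le> k then gamma_quot \<theta> (shifted \<theta> a j - shifted \<theta> b k)
     else gamma_quot \<theta> (shifted \<theta> b k - shifted \<theta> a j - \<theta>))"

text \<open>The branching coefficient up to factors that depend on one level only, but defined for
  arbitrary integer vectors, so that sums need not be restricted to interlacing ones.\<close>

definition level_kernel :: "real \<Rightarrow> nat \<Rightarrow> (nat \<Rightarrow> int) \<Rightarrow> (nat \<Rightarrow> int) \<Rightarrow> real" where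
  "level_kernel \<theta> n a b = vander n (shifted \<theta> b) * (\<Prod>j\<in>{1..Suc n}. \<Prod>k\<in>{1..n}. link \<theta> a b j k)"

lemma irrational_combination_nonzero:
  fixes \<theta> :: real
  assumes "\<theta> \<notin> \<rat>" "q \<in> \<int>" "q \<noteq> 0" "p \<in> \<int>"
  shows "p + \<theta> * q \<notin> \<int>"
proof
  assume "p + \<theta> * q \<in> \<int>"
  then have "\<theta> * q \<in> \<int>" using Ints_diff[OF _ assms(4), of "p + \<theta> * q"] by simp
  then have "\<theta> * q / q \<in> \<rat>" using assms(2) by (metis Ints_subset_Rats Rats_divide subsetD)
  then show False using assms by simp
qed

lemma Gamma_plus1_non_int: "x \<notin> \<int> \<Longrightarrow> Gamma (x + 1) = x * Gamma (x::real)"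
  using nonpos_Ints_subset_Ints by (intro Gamma_plus1) auto

lemma gamma_quot_base:
  assumes "x + \<theta> \<notin> \<int>"
  shows "gamma_quot \<theta> x = Gamma (x + \<theta>) * rGamma (x + 2) * (x + 1)"
    "gamma_quot \<theta> (x + 1) = Gamma (x + \<theta>) * rGamma (x + 2) * (x + \<theta>)"
proof -
  have "rGamma (x + 1) = (x + 1) * rGamma (x + 2)"
    using rGamma_plus1[of "x + 1"] by (simp add: add_ac)
  then show "gamma_quot \<theta> x = Gamma (x + \<theta>) * rGamma (x + 2) * (x + 1)"
    unfolding gamma_quot_def by simp
  have e: "x + 1 + \<theta> = (x + \<theta>) + 1" "x + 1 + 1 = x + 2" by auto
  show "gamma_quot \<theta> (x + 1) = Gamma (x + \<theta>) * rGamma (x + 2) * (x + \<theta>)"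
    unfolding gamma_quot_def e Gamma_plus1_non_int[OF assms] by simp
qed

text \<open>Raising \<open>a j\<close> and lowering \<open>b k\<close> by one have the same effect on \<open>link\<close>.\<close>

lemma link_factor:
  assumes "\<theta> \<notin> \<rat>"
  obtains \<beta> where
    "\<And>a' b'. a' j - b' k = a j - b k \<Longrightarrow> link \<theta> a' b' j k = \<beta> * (shifted \<theta> a j - (shifted \<theta> b k - 1))"
    "\<And>a' b'. a' j - b' k = a j - b k + 1 \<Longrightarrow> link \<theta> a' b' j k = \<beta> * (shifted \<theta> a j - (shifted \<theta> b k - 1) - (1 - \<theta>))"
proof -
  define u where "u = shifted \<theta> a j - shifted \<theta> b k"
  have u: "u = of_int (a j - b k) + \<theta> * of_int (int k - int j)"
    by (simp add: u_def shifted_def algebra_simps)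
  have same: "shifted \<theta> a' j - shifted \<theta> b' k = u" "shifted \<theta> b' k - shifted \<theta> a' j - \<theta> = - u - \<theta>"
    if "a' j - b' k = a j - b k" for a' b'
  proof -
    have "real_of_int (a' j) - of_int (b' k) = of_int (a j) - of_int (b k)"
      using that by (simp flip: of_int_diff)
    then show "shifted \<theta> a' j - shifted \<theta> b' k = u" "shifted \<theta> b' k - shifted \<theta> a' j - \<theta> = - u - \<theta>"
      by (auto simp: shifted_def u_def)
  qed
  have up: "shifted \<theta> a' j - shifted \<theta> b' k = u + 1" "shifted \<theta> b' k - shifted \<theta> a' j - \<theta> = - u - \<theta> - 1"
    if "a' j - b' k = a j - b k + 1" for a' b'
  proof -
    have "real_of_int (a' j) - of_int (b' k) = of_int (a j) - of_int (b k) + 1"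
      using that by (metis of_int_1 of_int_add of_int_diff)
    then show "shifted \<theta> a' j - shifted \<theta> b' k = u + 1" "shifted \<theta> b' k - shifted \<theta> a' j - \<theta> = - u - \<theta> - 1"
      by (auto simp: shifted_def u_def)
  qed
  have rhs: "shifted \<theta> a j - (shifted \<theta> b k - 1) = u + 1"
    "shifted \<theta> a j - (shifted \<theta> b k - 1) - (1 - \<theta>) = u + \<theta>"
    by (auto simp: u_def)
  show ?thesis
  proof (cases "j \<le> k")
    case True
    \<comment> \<open>Irrationality enters here: k + 1 - j > 0, so the argument u + \<theta> of the
      Gamma factor is no integer. In the other case k - j < 0 does the same for the argument - u -
      1.\<close>
    have "of_int (a j - b k) + \<theta> * of_int (int (Suc k) - int j) \<notin> \<int>"
      using True by (intro irrational_combination_nonzero assms) auto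
    moreover have "of_int (a j - b k) + \<theta> * of_int (int (Suc k) - int j) = u + \<theta>"
      unfolding u by (simp add: algebra_simps)
    ultimately have "u + \<theta> \<notin> \<int>" by (simp only: not_False_eq_True)
    from gamma_quot_base[OF this] show ?thesis
      by (intro that[of "Gamma (u + \<theta>) * rGamma (u + 2)"])
         (use True in \<open>auto simp: link_def same up rhs\<close>)
  next
    case False
    have "u \<notin> \<int>"
      unfolding u using False by (intro irrational_combination_nonzero assms) auto
    then have "- u - \<theta> - 1 + \<theta> \<notin> \<int>" using Ints_add[of "- u - 1" 1] by (auto simp: minus_in_Ints_iff)
    moreover have e: "- u - \<theta> - 1 + \<theta> = - u - 1" "- u - \<theta> - 1 + 2 = - u - \<theta> + 1"
      "- u - \<theta> - 1 + 1 = - u - \<theta>" by auto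
    ultimately have "gamma_quot \<theta> (- u - \<theta>) = - (Gamma (- u - 1) * rGamma (- u - \<theta> + 1)) * (u + 1)"
      "gamma_quot \<theta> (- u - \<theta> - 1) = - (Gamma (- u - 1) * rGamma (- u - \<theta> + 1)) * (u + \<theta>)"
      using gamma_quot_base[of "- u - \<theta> - 1" \<theta>] unfolding e by (simp_all add: right_diff_distrib distrib_left)
    then show ?thesis
      by (intro that[of "- (Gamma (- u - 1) * rGamma (- u - \<theta> + 1))"])
         (use False in \<open>auto simp: link_def same up rhs\<close>)
  qed
qed

text \<open>A pair with exactly one index in J corresponds to one element of J times its complement.
  The factor \<open>r\<close> always receives the index from J first, so pairs of either order feed
  the same double product.\<close>

lemma prod_pairs_update:
  fixes f :: "nat \<Rightarrow> nat \<Rightarrow> real"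
  assumes J: "J \<subseteq> {1..n}"
    and 1: "\<And>i j. \<lbrakk>(i, j) \<in> pairs n; i \<in> J; j \<notin> J\<rbrakk> \<Longrightarrow> f' i j = f i j * r i j"
    and 2: "\<And>i j. \<lbrakk>(i, j) \<in> pairs n; i \<notin> J; j \<in> J\<rbrakk> \<Longrightarrow> f' i j = f i j * r j i"
    and 3: "\<And>i j. \<lbrakk>(i, j) \<in> pairs n; i \<in> J \<longleftrightarrow> j \<in> J\<rbrakk> \<Longrightarrow> f' i j = f i j"
  shows "(\<Prod>(i, j)\<in>pairs n. f' i j) = (\<Prod>(i, j)\<in>pairs n. f i j) * (\<Prod>i\<in>J. \<Prod>j\<in>{1..n} - J. r i j)"
proof -
  define P where "P = {(i, j) \<in> pairs n. i \<in> J \<and> j \<notin> J}"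
  define Q where "Q = {(i, j) \<in> pairs n. i \<notin> J \<and> j \<in> J}"
  have fin: "finite P" "finite Q" "finite J" using finite_pairs J
    by (auto simp: P_def Q_def finite_subset intro: finite_subset[of _ "pairs n"])
  have "f' i j = f i j * ((if (i, j) \<in> P then r i j else 1) * (if (i, j) \<in> Q then r j i else 1))"
    if "(i, j) \<in> pairs n" for i j
    using that 1 2 3 by (auto simp: P_def Q_def)
  then have "(\<Prod>(i, j)\<in>pairs n. f' i j) = (\<Prod>(i, j)\<in>pairs n. f i j *
      ((if (i, j) \<in> P then r i j else 1) * (if (i, j) \<in> Q then r j i else 1)))"
    by (intro prod.cong) auto
  also have "\<dots> = (\<Prod>(i, j)\<in>pairs n. f i j) * ((\<Prod>x\<in>pairs n. if x \<in> P then case x of (i, j) \<Rightarrow> r i j else 1)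
     * (\<Prod>x\<in>pairs n. if x \<in> Q then case x of (i, j) \<Rightarrow> r j i else 1))"
    by (simp only: prod.distrib[symmetric]) (auto intro!: prod.cong)
  also have "(\<Prod>x\<in>pairs n. if x \<in> P then case x of (i, j) \<Rightarrow> r i j else 1) = (\<Prod>(i, j)\<in>P. r i j)"
    by (subst prod.inter_restrict[symmetric]) (auto simp: P_def intro!: prod.cong)
  also have "(\<Prod>x\<in>pairs n. if x \<in> Q then case x of (i, j) \<Rightarrow> r j i else 1) = (\<Prod>(i, j)\<in>Q. r j i)"
    by (subst prod.inter_restrict[symmetric]) (auto simp: Q_def intro!: prod.cong)
  also have "(\<Prod>(i, j)\<in>Q. r j i) = (\<Prod>(i, j)\<in>prod.swap ` Q. r i j)"
    by (subst prod.reindex) (auto simp: inj_on_def case_prod_unfold)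
  also have "(\<Prod>(i, j)\<in>P. r i j) * (\<Prod>(i, j)\<in>prod.swap ` Q. r i j) = (\<Prod>(i, j)\<in>P \<union> prod.swap ` Q. r i j)"
    using fin by (subst prod.union_disjoint) (auto simp: P_def Q_def pairs_def)
  also have "P \<union> prod.swap ` Q = J \<times> ({1..n} - J)"
    using J by (auto simp: P_def Q_def pairs_def image_iff) (metis atLeastAtMost_iff linorder_neqE_nat subsetD)+
  finally show ?thesis by (simp add: prod.cartesian_product)
qed

definition raise :: "nat set \<Rightarrow> (nat \<Rightarrow> int) \<Rightarrow> nat \<Rightarrow> int" where
  "raise I a i = a i + ind I i"

definition lower :: "nat set \<Rightarrow> (nat \<Rightarrow> int) \<Rightarrow> nat \<Rightarrow> int" where
  "lower I a i = a i - ind I i"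

lemma shifted_raise: "shifted \<theta> (raise I a) i = shifted \<theta> a i + (if i \<in> I then 1 else 0)"
  by (simp add: shifted_def raise_def ind_def)

lemma shifted_lower: "shifted \<theta> (lower I a) i = shifted \<theta> a i - (if i \<in> I then 1 else 0)"
  by (simp add: shifted_def lower_def ind_def)

lemma shifted_diff_non_int:
  assumes "\<theta> \<notin> \<rat>" "i \<noteq> j"
  shows "shifted \<theta> a i - shifted \<theta> b j \<notin> \<int>"
proof -
  have "shifted \<theta> a i - shifted \<theta> b j = of_int (a i - b j) + \<theta> * of_int (int j - int i)"
    by (simp add: shifted_def algebra_simps)
  then show ?thesis using irrational_combination_nonzero[OF assms(1), of "of_int (int j - int i)"] assms(2)
    by (metis Ints_of_int eq_iff_diff_eq_0 of_int_eq_0_iff of_nat_eq_iff)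
qed

text \<open>A mixed difference d of the Vandermonde product changes by (d - 1) / d. Its numerator
  cancels the denominator of the Pieri coefficient at the lowered vector and leaves the kernel
  factor with parameter - (1 - \<theta>) at the unlowered one.\<close>

lemma vander_lower:
  assumes "\<theta> \<notin> \<rat>" "J \<subseteq> {1..n}"
  shows "pieri_coeff \<theta> n (lower J b) J * vander n (shifted \<theta> (lower J b)) =
     vander n (shifted \<theta> b) * (\<Prod>i\<in>J. \<Prod>j\<in>{1..n} - J.
        (shifted \<theta> b i - shifted \<theta> b j - (1 - \<theta>)) / (shifted \<theta> b i - shifted \<theta> b j))"
proof -
  let ?m = "shifted \<theta> b"
  have nz: "?m i - ?m j \<noteq> 0" "?m i - ?m j - 1 \<noteq> 0" if "i \<noteq> j" for i j
    using shifted_diff_non_int[OF assms(1) that, of b b] by (metis Ints_0, metis Ints_1 eq_iff_diff_eq_0)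
  have "vander n (shifted \<theta> (lower J b)) = vander n ?m *
      (\<Prod>i\<in>J. \<Prod>j\<in>{1..n} - J. (?m i - ?m j - 1) / (?m i - ?m j))"
    unfolding vander_def
  proof (rule prod_pairs_update[OF assms(2)])
    fix i j assume "(i, j) \<in> pairs n"
    then have "i \<noteq> j" by (auto simp: pairs_def)
    note nz = nz[OF this] nz[OF this[symmetric]]
    show "shifted \<theta> (lower J b) i - shifted \<theta> (lower J b) j = (?m i - ?m j) * ((?m i - ?m j - 1) / (?m i - ?m j))"
      if "i \<in> J" "j \<notin> J"
      using that nz by (simp add: shifted_lower)
    have "(?m i - ?m j) * ((?m j - ?m i - 1) / (?m j - ?m i)) = - ((?m j - ?m i) * ((?m j - ?m i - 1) / (?m j - ?m i)))"
      by (simp only: minus_diff_eq[symmetric, of "?m i" "?m j"] mult_minus_left minus_minus)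
    then show "shifted \<theta> (lower J b) i - shifted \<theta> (lower J b) j = (?m i - ?m j) * ((?m j - ?m i - 1) / (?m j - ?m i))"
      if "i \<notin> J" "j \<in> J"
      using that nz by (simp add: shifted_lower)
    show "shifted \<theta> (lower J b) i - shifted \<theta> (lower J b) j = ?m i - ?m j" if "i \<in> J \<longleftrightarrow> j \<in> J"
      using that by (auto simp: shifted_lower)
  qed
  moreover have "pieri_coeff \<theta> n (lower J b) J = (\<Prod>i\<in>J. \<Prod>j\<in>{1..n} - J. (?m i - ?m j - 1 + \<theta>) / (?m i - ?m j - 1))"
    unfolding pieri_coeff_def by (intro prod.cong) (auto simp: shifted_lower algebra_simps)
  moreover have "(\<Prod>i\<in>J. \<Prod>j\<in>{1..n} - J. (?m i - ?m j - 1 + \<theta>) / (?m i - ?m j - 1)) *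
      (\<Prod>i\<in>J. \<Prod>j\<in>{1..n} - J. (?m i - ?m j - 1) / (?m i - ?m j)) =
      (\<Prod>i\<in>J. \<Prod>j\<in>{1..n} - J. (?m i - ?m j - (1 - \<theta>)) / (?m i - ?m j))"
    unfolding prod.distrib[symmetric]
  proof (intro prod.cong refl)
    fix i j assume "i \<in> J" "j \<in> {1..n} - J"
    then have "i \<noteq> j" by auto
    show "(?m i - ?m j - 1 + \<theta>) / (?m i - ?m j - 1) * ((?m i - ?m j - 1) / (?m i - ?m j)) = (?m i - ?m j - (1 - \<theta>)) / (?m i - ?m j)"
      using nz[OF \<open>i \<noteq> j\<close>] by simp
  qed
  ultimately show ?thesis by (simp add: mult_ac)
qed

text \<open>Raising \<open>a\<close> on I or lowering \<open>b\<close> on J changes each difference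
  \<open>a j - b k\<close> by 0 or 1. Hence one factor \<beta> is common to all these kernels, and
  what remains is a kernel term for the points \<open>shifted \<theta> a i\<close> and
  \<open>shifted \<theta> b k - 1\<close>.\<close>

lemma level_kernel_factor:
  assumes "\<theta> \<notin> \<rat>"
  obtains \<beta> where
    "\<And>I. I \<subseteq> {1..Suc n} \<Longrightarrow> level_kernel \<theta> n (raise I a) b = \<beta> *
       ((\<Prod>i\<in>I. \<Prod>k\<in>{1..n}. shifted \<theta> a i - (shifted \<theta> b k - 1) - (1 - \<theta>))
        * (\<Prod>i\<in>{1..Suc n} - I. \<Prod>k\<in>{1..n}. shifted \<theta> a i - (shifted \<theta> b k - 1)))"
    "\<And>J. J \<subseteq> {1..n} \<Longrightarrow> pieri_coeff \<theta> n (lower J b) J * level_kernel \<theta> n a (lower J b) = \<beta> *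
       ((\<Prod>i\<in>J. \<Prod>j\<in>{1..n} - J. (shifted \<theta> b i - shifted \<theta> b j - (1 - \<theta>)) / (shifted \<theta> b i - shifted \<theta> b j))
        * (\<Prod>k\<in>J. \<Prod>i\<in>{1..Suc n}. shifted \<theta> a i - (shifted \<theta> b k - 1) - (1 - \<theta>))
        * (\<Prod>k\<in>{1..n} - J. \<Prod>i\<in>{1..Suc n}. shifted \<theta> a i - (shifted \<theta> b k - 1)))"
proof -
  let ?u = "\<lambda>i k. shifted \<theta> a i - (shifted \<theta> b k - 1)"
  have "\<forall>j k. \<exists>\<beta>. (\<forall>a' b'. a' j - b' k = a j - b k \<longrightarrow> link \<theta> a' b' j k = \<beta> * ?u j k) \<and>
    (\<forall>a' b'. a' j - b' k = a j - b k + 1 \<longrightarrow> link \<theta> a' b' j k = \<beta> * (?u j k - (1 - \<theta>)))"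
    using link_factor[OF assms] by metis
  then obtain \<beta> where \<beta>: "\<And>j k a' b'. a' j - b' k = a j - b k \<Longrightarrow> link \<theta> a' b' j k = \<beta> j k * ?u j k"
    "\<And>j k a' b'. a' j - b' k = a j - b k + 1 \<Longrightarrow> link \<theta> a' b' j k = \<beta> j k * (?u j k - (1 - \<theta>))"
    by metis
  define B where "B = (\<Prod>j\<in>{1..Suc n}. \<Prod>k\<in>{1..n}. \<beta> j k)"
  have split: "prod f A = (\<Prod>i\<in>I. f i) * (\<Prod>i\<in>A - I. f i)" if "I \<subseteq> A" "finite A" for I A and f :: "nat \<Rightarrow> real"
    using prod.subset_diff[OF that] by (simp add: mult.commute)
  show ?thesis
  proof (rule that[of "vander n (shifted \<theta> b) * B"])
    fix I assume I: "I \<subseteq> {1..Suc n}"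
    have "(\<Prod>j\<in>{1..Suc n}. \<Prod>k\<in>{1..n}. link \<theta> (raise I a) b j k) =
      (\<Prod>j\<in>{1..Suc n}. \<Prod>k\<in>{1..n}. \<beta> j k * (if j \<in> I then ?u j k - (1 - \<theta>) else ?u j k))"
    proof (intro prod.cong refl)
      fix j k
      show "link \<theta> (raise I a) b j k = \<beta> j k * (if j \<in> I then ?u j k - (1 - \<theta>) else ?u j k)"
        using \<beta>(1)[of "raise I a" j b k] \<beta>(2)[of "raise I a" j b k] by (cases "j \<in> I") (simp_all add: raise_def ind_def)
    qed
    also have "\<dots> = B * (\<Prod>j\<in>{1..Suc n}. \<Prod>k\<in>{1..n}. if j \<in> I then ?u j k - (1 - \<theta>) else ?u j k)"
      unfolding B_def by (simp only: prod.distrib)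
    also have "(\<Prod>j\<in>{1..Suc n}. \<Prod>k\<in>{1..n}. if j \<in> I then ?u j k - (1 - \<theta>) else ?u j k) =
       (\<Prod>i\<in>I. \<Prod>k\<in>{1..n}. ?u i k - (1 - \<theta>)) * (\<Prod>i\<in>{1..Suc n} - I. \<Prod>k\<in>{1..n}. ?u i k)"
      by (subst split[OF I]) (auto intro!: arg_cong2[where f = "(*)"] prod.cong)
    finally show "level_kernel \<theta> n (raise I a) b = vander n (shifted \<theta> b) * B *
       ((\<Prod>i\<in>I. \<Prod>k\<in>{1..n}. ?u i k - (1 - \<theta>)) * (\<Prod>i\<in>{1..Suc n} - I. \<Prod>k\<in>{1..n}. ?u i k))"
      unfolding level_kernel_def by (simp only: mult_ac)
  next
    fix J assume J: "J \<subseteq> {1..n}"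
    have "(\<Prod>j\<in>{1..Suc n}. \<Prod>k\<in>{1..n}. link \<theta> a (lower J b) j k) =
      (\<Prod>j\<in>{1..Suc n}. \<Prod>k\<in>{1..n}. \<beta> j k * (if k \<in> J then ?u j k - (1 - \<theta>) else ?u j k))"
    proof (intro prod.cong refl)
      fix j k
      show "link \<theta> a (lower J b) j k = \<beta> j k * (if k \<in> J then ?u j k - (1 - \<theta>) else ?u j k)"
        using \<beta>(1)[of a j "lower J b" k] \<beta>(2)[of a j "lower J b" k] by (cases "k \<in> J") (simp_all add: lower_def ind_def)
    qed
    also have "\<dots> = B * (\<Prod>j\<in>{1..Suc n}. \<Prod>k\<in>{1..n}. if k \<in> J then ?u j k - (1 - \<theta>) else ?u j k)"
      unfolding B_def by (simp only: prod.distrib)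
    also have "(\<Prod>j\<in>{1..Suc n}. \<Prod>k\<in>{1..n}. if k \<in> J then ?u j k - (1 - \<theta>) else ?u j k) =
       (\<Prod>k\<in>J. \<Prod>i\<in>{1..Suc n}. ?u i k - (1 - \<theta>)) * (\<Prod>k\<in>{1..n} - J. \<Prod>i\<in>{1..Suc n}. ?u i k)"
      by (subst prod.swap, subst split[OF J]) (auto intro!: arg_cong2[where f = "(*)"] prod.cong)
    finally have *: "(\<Prod>j\<in>{1..Suc n}. \<Prod>k\<in>{1..n}. link \<theta> a (lower J b) j k) = B *
      ((\<Prod>k\<in>J. \<Prod>i\<in>{1..Suc n}. ?u i k - (1 - \<theta>)) * (\<Prod>k\<in>{1..n} - J. \<Prod>i\<in>{1..Suc n}. ?u i k))" .
    show "pieri_coeff \<theta> n (lower J b) J * level_kernel \<theta> n a (lower J b) = vander n (shifted \<theta> b) * B *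
       ((\<Prod>i\<in>J. \<Prod>j\<in>{1..n} - J. (shifted \<theta> b i - shifted \<theta> b j - (1 - \<theta>)) / (shifted \<theta> b i - shifted \<theta> b j))
        * (\<Prod>k\<in>J. \<Prod>i\<in>{1..Suc n}. ?u i k - (1 - \<theta>))
        * (\<Prod>k\<in>{1..n} - J. \<Prod>i\<in>{1..Suc n}. ?u i k))"
      unfolding level_kernel_def * mult.assoc[symmetric] vander_lower[OF assms J] by (simp only: mult_ac)
  qed
qed

text \<open>The kernel identity for the points of two adjacent levels. Their numbers differ by one,
  so a single factor 1 + s survives the cancellation; it records whether \<open>Suc n\<close>
  belongs to I, and the coefficient of s^r gives the claim.\<close>

lemma intertwining:
  assumes "\<theta> \<notin> \<rat>"
  shows "(\<Sum>I | I \<subseteq> {1..Suc n} \<and> card I = r. dual_coeff \<theta> (Suc n) a I * level_kernel \<theta> n (raise I a) b) =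
    (\<Sum>I | I \<subseteq> {1..Suc n} \<and> card I = r.
       pieri_coeff \<theta> n (lower (I - {Suc n}) b) (I - {Suc n}) * level_kernel \<theta> n a (lower (I - {Suc n}) b))"
proof -
  define l where "l = shifted \<theta> a"
  define y where "y = (\<lambda>k. shifted \<theta> b k - 1)"
  have inj: "inj_on l A" "inj_on y A" for A
    using shifted_diff_non_int[OF assms, of _ _ a a] shifted_diff_non_int[OF assms, of _ _ b b]
    by (auto simp: inj_on_def l_def y_def) (metis Ints_0 diff_self)+
  obtain \<beta> where
    \<beta>1: "\<And>I. I \<subseteq> {1..Suc n} \<Longrightarrow> level_kernel \<theta> n (raise I a) b = \<beta> *
       ((\<Prod>i\<in>I. \<Prod>k\<in>{1..n}. l i - y k - (1 - \<theta>)) * (\<Prod>i\<in>{1..Suc n} - I. \<Prod>k\<in>{1..n}. l i - y k))" and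
    \<beta>2: "\<And>J. J \<subseteq> {1..n} \<Longrightarrow> pieri_coeff \<theta> n (lower J b) J * level_kernel \<theta> n a (lower J b) = \<beta> *
       ((\<Prod>i\<in>J. \<Prod>j\<in>{1..n} - J. (y i - y j - (1 - \<theta>)) / (y i - y j))
        * (\<Prod>k\<in>J. \<Prod>i\<in>{1..Suc n}. l i - y k - (1 - \<theta>))
        * (\<Prod>k\<in>{1..n} - J. \<Prod>i\<in>{1..Suc n}. l i - y k))"
    using level_kernel_factor[OF assms, of n a b] unfolding l_def y_def by auto
  define f where "f = (\<lambda>I. dual_coeff \<theta> (Suc n) a I * level_kernel \<theta> n (raise I a) b)"
  define g where "g = (\<lambda>J. pieri_coeff \<theta> n (lower J b) J * level_kernel \<theta> n a (lower J b))"
  have L: "(\<Sum>I\<in>Pow {1..Suc n}. s ^ card I * f I) = \<beta> * kernel_sum s (1 - \<theta>) (l ` {1..Suc n}) (y ` {1..n})" for s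
    using kernel_sum_image[of "{1..Suc n}" l y "{1..n}" s "1 - \<theta>"] inj 
    unfolding sum_distrib_left f_def dual_coeff_def l_def[symmetric]
    by (simp add: \<beta>1 sum_distrib_left mult_ac)
  have R: "(\<Sum>J\<in>Pow {1..n}. s ^ card J * g J) =
      \<beta> * (-1) ^ (n * Suc n) * kernel_sum s (- (1 - \<theta>)) (y ` {1..n}) (l ` {1..Suc n})" for s
  proof -
    have sgn: "(\<Prod>i\<in>A. \<Prod>j\<in>{1..Suc n}. F i j) = (-1) ^ (card A * Suc n) * (\<Prod>i\<in>A. \<Prod>j\<in>{1..Suc n}. G i j)"
      if "\<And>i j. F i j = - G i j" for A and F G :: "nat \<Rightarrow> nat \<Rightarrow> real"
    proof -
      have "(\<Prod>i\<in>A. \<Prod>j\<in>{1..Suc n}. F i j) = (\<Prod>i\<in>A. \<Prod>j\<in>{1..Suc n}. (-1) * G i j)" using that by simp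
      then show ?thesis by (simp only: prod.distrib prod_constant card_atLeastAtMost power_mult[symmetric] mult.commute diff_Suc_1)
    qed
    have "s ^ card J * g J = \<beta> * (-1) ^ (n * Suc n) * (s ^ card J *
      ((\<Prod>i\<in>J. \<Prod>j\<in>{1..n} - J. (y i - y j + - (1 - \<theta>)) / (y i - y j))
        * (\<Prod>k\<in>J. \<Prod>i\<in>{1..Suc n}. y k - l i - - (1 - \<theta>))
        * (\<Prod>k\<in>{1..n} - J. \<Prod>i\<in>{1..Suc n}. y k - l i)))" if J: "J \<in> Pow {1..n}" for J
    proof -
      have "card J + card ({1..n} - J) = n" 
        using J card_mono[of "{1..n}" J] by (simp add: card_Diff_subset finite_subset[of J "{1..n}"])
      then have sg: "(-1::real) ^ (card J * Suc n) * (-1) ^ (card ({1..n} - J) * Suc n) = (-1) ^ (n * Suc n)"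
        by (metis add_mult_distrib power_add)
      have s1: "(\<Prod>k\<in>J. \<Prod>i\<in>{1..Suc n}. l i - y k - (1 - \<theta>)) =
          (-1) ^ (card J * Suc n) * (\<Prod>k\<in>J. \<Prod>i\<in>{1..Suc n}. y k - l i - - (1 - \<theta>))"
        by (rule sgn) simp
      have s2: "(\<Prod>k\<in>{1..n} - J. \<Prod>i\<in>{1..Suc n}. l i - y k) =
          (-1) ^ (card ({1..n} - J) * Suc n) * (\<Prod>k\<in>{1..n} - J. \<Prod>i\<in>{1..Suc n}. y k - l i)"
        by (rule sgn) simp
      have d: "y i - y j - (1 - \<theta>) = y i - y j + - (1 - \<theta>)" for i j by simp
      show ?thesis unfolding g_def \<beta>2[OF J[unfolded Pow_iff]] s1 s2 sg[symmetric] d by (simp only: mult_ac)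
    qed
    then show ?thesis
      unfolding kernel_sum_image[of "{1..n}" y l "{1..Suc n}" s "- (1 - \<theta>)", OF finite_atLeastAtMost inj(2) inj(1)]
        sum_distrib_left by (intro sum.cong refl)
  qed
  have "(\<Sum>I\<in>Pow {1..Suc n}. s ^ card I * f I) = (\<Sum>I\<in>Pow {1..Suc n}. s ^ card I * g (I - {Suc n}))"
    if "s > 0" for s
  proof -
    have "card (l ` {1..Suc n}) = Suc n" "card (y ` {1..n}) = n"
      using inj by (auto simp: card_image)
    then have "(1 + s) ^ n * kernel_sum s (1 - \<theta>) (l ` {1..Suc n}) (y ` {1..n}) =
        (1 + s) ^ n * ((1 + s) * (-1) ^ (n * Suc n) * kernel_sum s (- (1 - \<theta>)) (y ` {1..n}) (l ` {1..Suc n}))"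
      using kernel_identity[of "l ` {1..Suc n}" "y ` {1..n}" s "1 - \<theta>"] by (simp add: mult_ac)
    moreover have "(1 + s) ^ n \<noteq> 0" using that by simp
    ultimately have K: "kernel_sum s (1 - \<theta>) (l ` {1..Suc n}) (y ` {1..n}) =
        (1 + s) * (-1) ^ (n * Suc n) * kernel_sum s (- (1 - \<theta>)) (y ` {1..n}) (l ` {1..Suc n})"
      by (simp only: mult_cancel_left) blast
    have "(\<Sum>I\<in>Pow {1..Suc n}. s ^ card I * f I) = (1 + s) * (\<Sum>J\<in>Pow {1..n}. s ^ card J * g J)"
      unfolding L R K by (simp only: mult_ac)
    also have "\<dots> = (\<Sum>J\<in>Pow {1..n}. s ^ card J * g J + s ^ Suc (card J) * g J)"
      by (simp add: sum_distrib_left sum.distrib algebra_simps)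
    also have "\<dots> = (\<Sum>I\<in>Pow (insert (Suc n) {1..n}). s ^ card I * g (I - {Suc n}))"
    proof (subst sum_Pow_insert)
      show "(\<Sum>J\<in>Pow {1..n}. s ^ card J * g J + s ^ Suc (card J) * g J) = (\<Sum>I\<in>Pow {1..n}.
          s ^ card I * g (I - {Suc n}) + s ^ card (insert (Suc n) I) * g (insert (Suc n) I - {Suc n}))"
      proof (rule sum.cong[OF refl])
        fix J assume "J \<in> Pow {1..n}"
        then have "Suc n \<notin> J" "finite J" by (auto simp: finite_subset)
        then show "s ^ card J * g J + s ^ Suc (card J) * g J =
          s ^ card J * g (J - {Suc n}) + s ^ card (insert (Suc n) J) * g (insert (Suc n) J - {Suc n})" by simp
      qed
    qed auto
    also have "insert (Suc n) {1..n} = {1..Suc n}" by auto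
    finally show ?thesis .
  qed
  then have "(\<Sum>I | I \<in> Pow {1..Suc n} \<and> card I = r. f I) = (\<Sum>I | I \<in> Pow {1..Suc n} \<and> card I = r. g (I - {Suc n}))"
    by (intro graded_coeff_eq) auto
  then show ?thesis by (simp add: f_def g_def)
qed

section \<open>Sums over interlacing chains\<close>

definition entry :: "int list \<Rightarrow> nat \<Rightarrow> int" where
  "entry lam i = part lam i"

lemma GT_iff: "lam \<in> GT N \<longleftrightarrow> length lam = N \<and> (\<forall>i\<in>{1..<N}. entry lam (Suc i) \<le> entry lam i)"
proof -
  have "sorted_wrt (\<ge>) lam \<longleftrightarrow> (\<forall>i\<in>{1..<length lam}. entry lam (Suc i) \<le> entry lam i)"
  proof
    assume "sorted_wrt (\<ge>) lam"
    then show "\<forall>i\<in>{1..<length lam}. entry lam (Suc i) \<le> entry lam i"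
      by (auto simp: sorted_wrt_iff_nth_less entry_def)
  next
    assume *: "\<forall>i\<in>{1..<length lam}. entry lam (Suc i) \<le> entry lam i"
    have "lam ! Suc i \<le> lam ! i" if "Suc i < length lam" for i
      using bspec[OF *, of "Suc i"] that by (simp add: entry_def)
    then show "sorted_wrt (\<ge>) lam"
      by (subst sorted_wrt_iff_nth_Suc_transp) (auto simp: transp_def)
  qed
  then show ?thesis by (auto simp: GT_def)
qed

lemma GT_length: "lam \<in> GT N \<Longrightarrow> length lam = N"
  by (simp add: GT_def)

lemma GT_antimono:
  assumes "lam \<in> GT N" "1 \<le> i" "i \<le> j" "j \<le> N"
  shows "entry lam j \<le> entry lam i"
  using assms(3,4)
proof (induction j rule: dec_induct)
  case (step k)
  then have "entry lam (Suc k) \<le> entry lam k" using assms(1,2) by (auto simp: GT_iff)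
  then show ?case using step by auto
qed simp

lemma entry_eqI:
  assumes "length lam = N" "length mu = N" "\<And>i. i \<in> {1..N} \<Longrightarrow> entry lam i = entry mu i"
  shows "lam = mu"
proof (rule nth_equalityI)
  fix i assume "i < length lam"
  then show "lam ! i = mu ! i" using assms(3)[of "Suc i"] assms(1) by (simp add: entry_def)
qed (use assms in auto)

lemma in_set_entry:
  assumes "length lam = N" "x \<in> set lam"
  obtains i where "i \<in> {1..N}" "x = entry lam i"
  using assms by (metis Suc_leI atLeastAtMost_iff diff_Suc_1 in_set_conv_nth le_add1 plus_1_eq_Suc entry_def)

lemma sum_list_entry: "length lam = N \<Longrightarrow> sum_list lam = (\<Sum>i\<in>{1..N}. entry lam i)"
  by (simp add: sum_list_sum_nth entry_def sum.atLeast1_atMost_eq atLeast0LessThan)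

definition badd :: "nat set \<Rightarrow> int list \<Rightarrow> int list" where
  "badd I lam = map (\<lambda>i. raise I (entry lam) (Suc i)) [0..<length lam]"

definition bsub :: "nat set \<Rightarrow> int list \<Rightarrow> int list" where
  "bsub I lam = map (\<lambda>i. lower I (entry lam) (Suc i)) [0..<length lam]"

lemma length_badd [simp]: "length (badd I lam) = length lam" "length (bsub I lam) = length lam"
  by (simp_all add: badd_def bsub_def)

lemma entry_badd: "i \<in> {1..length lam} \<Longrightarrow> entry (badd I lam) i = raise I (entry lam) i"
  by (cases i) (auto simp: badd_def entry_def)

lemma entry_bsub: "i \<in> {1..length lam} \<Longrightarrow> entry (bsub I lam) i = lower I (entry lam) i"
  by (cases i) (auto simp: bsub_def entry_def)

lemma badd_bsub: "badd I (bsub I lam) = lam" "bsub I (badd I lam) = lam"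
  by (rule entry_eqI[of _ "length lam"]; simp add: entry_badd entry_bsub raise_def lower_def)+

lemma inj_badd: "inj_on (badd I) A"
  by (metis badd_bsub(2) inj_on_inverseI)

lemma sum_list_badd: 
  assumes "length lam = N" "I \<subseteq> {1..N}"
  shows "sum_list (badd I lam) = sum_list lam + int (card I)"
proof -
  have "sum_list (badd I lam) = (\<Sum>i\<in>{1..N}. entry lam i + ind I i)"
    using assms by (subst sum_list_entry[of _ N]) (auto simp: entry_badd raise_def intro!: sum.cong)
  also have "\<dots> = sum_list lam + (\<Sum>i\<in>{1..N}. if i \<in> I then 1 else 0)"
    using sum_list_entry[OF assms(1)] by (simp add: sum.distrib ind_def)
  also have "(\<Sum>i\<in>{1..N}. if i \<in> I then 1 else 0) = int (card I)"
    using assms(2) by (simp add: sum.If_cases Int_absorb1)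
  finally show ?thesis .
qed

section \<open>Interlacing signatures and weighted sums over chains\<close>

definition below :: "nat \<Rightarrow> int list \<Rightarrow> int list set" where
  "below n lam = {mu \<in> GT n. \<forall>j\<in>{1..n}. entry lam (Suc j) \<le> entry mu j \<and> entry mu j \<le> entry lam j}"

lemma below_GT: "mu \<in> below n lam \<Longrightarrow> mu \<in> GT n"
  by (simp add: below_def)

lemma finite_GT_box: "finite {mu \<in> GT n. \<forall>i\<in>{1..n}. lo \<le> entry mu i \<and> entry mu i \<le> hi}" (is "finite ?B")
proof (rule finite_subset)
  show "?B \<subseteq> {mu. set mu \<subseteq> {lo..hi} \<and> length mu = n}"
  proof
    fix mu assume mu: "mu \<in> ?B"
    then have l: "length mu = n" by (simp add: GT_length)
    have "x \<in> {lo..hi}" if x: "x \<in> set mu" for x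
    proof -
      obtain i where "i \<in> {1..n}" "x = entry mu i" using in_set_entry[OF l x] by blast
      then show ?thesis using mu by auto
    qed
    then show "mu \<in> {mu. set mu \<subseteq> {lo..hi} \<and> length mu = n}" using l by auto
  qed
qed (rule finite_lists_length_eq, simp)

lemma finite_below: "finite (below n lam)"
proof (cases "n = 0")
  case True
  then have "below n lam \<subseteq> {[]}" by (auto simp: below_def GT_def)
  then show ?thesis by (rule finite_subset) simp
next
  case False
  define lo where "lo = Min (entry lam ` {1..Suc n})"
  define hi where "hi = Max (entry lam ` {1..Suc n})"
  have "lo \<le> entry lam i \<and> entry lam i \<le> hi" if "i \<in> {1..Suc n}" for i
    using that unfolding lo_def hi_def by (intro conjI Min_le Max_ge finite_imageI imageI) auto
  then have bd: "lo \<le> entry lam (Suc i)" "entry lam i \<le> hi" if "i \<in> {1..n}" for i using that by auto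
  have "below n lam \<subseteq> {mu \<in> GT n. \<forall>i\<in>{1..n}. lo \<le> entry mu i \<and> entry mu i \<le> hi}"
    unfolding below_def using bd order_trans by blast
  then show ?thesis by (rule finite_subset) (rule finite_GT_box)
qed

text \<open>The test function sees only the increments of the entry sums, since these are the
  exponents of the variables. Values in a real vector space let one development serve real weights
  and complex monomials.\<close>

fun step_sum :: "real \<Rightarrow> nat \<Rightarrow> int list \<Rightarrow> ((nat \<Rightarrow> int) \<Rightarrow> 'a::real_vector) \<Rightarrow> 'a" where
  "step_sum \<theta> 0 lam \<phi> = \<phi> (\<lambda>_. 0)"
| "step_sum \<theta> (Suc n) lam \<phi> = (\<Sum>mu\<in>below n lam. jack_branch \<theta> n lam mu *\<^sub>R
     step_sum \<theta> n mu (\<lambda>\<xi>. \<phi> (\<xi>(Suc n := sum_list lam - sum_list mu))))"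

text \<open>Up to a constant depending on \<theta> and N only, the value of the Jack polynomial at
  (1, ..., 1); see \<open>normed_sum_one\<close>.\<close>

definition level_norm :: "real \<Rightarrow> nat \<Rightarrow> (nat \<Rightarrow> int) \<Rightarrow> real" where
  "level_norm \<theta> N a = (\<Prod>(i, j)\<in>pairs N. Gamma (shifted \<theta> a i - shifted \<theta> a j + \<theta>) / Gamma (shifted \<theta> a i - shifted \<theta> a j))"

text \<open>A gauge factor: adding a set of boxes changes it by the quotient of
  \<open>pieri_coeff\<close> and \<open>dual_coeff\<close>.\<close>

definition pair_norm :: "real \<Rightarrow> nat \<Rightarrow> (nat \<Rightarrow> int) \<Rightarrow> real" where
  "pair_norm \<theta> N a = (\<Prod>(i, j)\<in>pairs N. Gamma (shifted \<theta> a i - shifted \<theta> a j + \<theta>) / Gamma (shifted \<theta> a i - shifted \<theta> a j + (1 - \<theta>)))"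

definition normed_sum :: "real \<Rightarrow> nat \<Rightarrow> int list \<Rightarrow> ((nat \<Rightarrow> int) \<Rightarrow> 'a::real_vector) \<Rightarrow> 'a" where
  "normed_sum \<theta> N lam \<phi> = (1 / level_norm \<theta> N (entry lam)) *\<^sub>R step_sum \<theta> N lam \<phi>"

lemma shifted_diff_ge:
  assumes "lam \<in> GT N" "(i, j) \<in> pairs N" "\<theta> > 0"
  shows "shifted \<theta> (entry lam) i - shifted \<theta> (entry lam) j \<ge> \<theta>"
proof -
  have "entry lam j \<le> entry lam i" "1 \<le> int j - int i"
    using assms GT_antimono[of lam N i j] by (auto simp: pairs_def)
  then have "real_of_int (entry lam j) \<le> real_of_int (entry lam i)" "\<theta> * 1 \<le> \<theta> * (real j - real i)"
    using assms(3) by (auto intro!: mult_left_mono)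
  then show ?thesis by (simp add: shifted_def algebra_simps)
qed

lemma level_norm_pos:
  assumes "lam \<in> GT N" "\<theta> > 0"
  shows "level_norm \<theta> N (entry lam) > 0"
  unfolding level_norm_def
proof (intro prod_pos ballI)
  fix x assume x: "x \<in> pairs N"
  obtain i j where [simp]: "x = (i, j)" by force
  have "shifted \<theta> (entry lam) i - shifted \<theta> (entry lam) j > 0" using shifted_diff_ge[OF assms(1) _ assms(2)] x assms(2) by force
  then show "0 < (case x of (i, j) \<Rightarrow> Gamma (shifted \<theta> (entry lam) i - shifted \<theta> (entry lam) j + \<theta>) / Gamma (shifted \<theta> (entry lam) i - shifted \<theta> (entry lam) j))"
    using assms(2) by (auto intro!: divide_pos_pos Gamma_real_pos)
qed

lemma prod_pairs: "(\<Prod>(i, j)\<in>pairs n. f i j) = (\<Prod>j\<in>{1..n}. \<Prod>i\<in>{1..<j}. f i j)"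
proof -
  have "(\<Prod>j\<in>{1..n}. \<Prod>i\<in>{1..<j}. f i j) = (\<Prod>(j, i)\<in>(SIGMA j:{1..n}. {1..<j}). f i j)"
    by (rule prod.Sigma) auto
  also have "\<dots> = (\<Prod>(i, j)\<in>pairs n. f i j)"
    by (rule prod.reindex_bij_witness[of _ prod.swap prod.swap]) (auto simp: pairs_def)
  finally show ?thesis by simp
qed

lemma prod_pairs_Suc: "(\<Prod>(i, j)\<in>pairs (Suc n). f i j) = (\<Prod>j\<in>{1..n}. \<Prod>i\<in>{1..j}. f i (Suc j))"
proof -
  have "(\<Prod>j\<in>{1..Suc n}. \<Prod>i\<in>{1..<j}. f i j) = (\<Prod>j\<in>{Suc 1..Suc n}. \<Prod>i\<in>{1..<j}. f i j)"
    by (subst prod.atLeast_Suc_atMost) auto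
  also have "\<dots> = (\<Prod>j\<in>{1..n}. \<Prod>i\<in>{1..<Suc j}. f i (Suc j))"
    by (rule prod.shift_bounds_cl_Suc_ivl)
  also have "\<dots> = (\<Prod>j\<in>{1..n}. \<Prod>i\<in>{1..j}. f i (Suc j))"
    by (simp add: atLeastLessThanSuc_atLeastAtMost)
  finally show ?thesis by (simp add: prod_pairs)
qed

lemma prod_triangle: "(\<Prod>j\<in>{1..n}. \<Prod>i\<in>{1..j}. f i j) = (\<Prod>j\<in>{1..n}. f j j) * (\<Prod>(i, j)\<in>pairs n. f i j)"
proof -
  have "{1..j} = insert j {1..<j}" if "j \<in> {1..n}" for j :: nat using that by auto
  then have "(\<Prod>j\<in>{1..n}. \<Prod>i\<in>{1..j}. f i j) = (\<Prod>j\<in>{1..n}. f j j * (\<Prod>i\<in>{1..<j}. f i j))"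
    by (intro prod.cong refl) auto
  then show ?thesis by (simp add: prod.distrib prod_pairs)
qed

lemma prod_triangle_swap:
  "(\<Prod>k\<in>{1..n}. \<Prod>j\<in>{k..n::nat}. f k j) = (\<Prod>j\<in>{1..n}. \<Prod>k\<in>{1..j}. f k j)"
proof -
  have "(\<Prod>k\<in>{1..n}. \<Prod>j\<in>{k..n}. f k j) = (\<Prod>(k, j)\<in>(SIGMA k:{1..n}. {k..n}). f k j)"
    by (rule prod.Sigma) auto
  also have "\<dots> = (\<Prod>(j, k)\<in>(SIGMA j:{1..n}. {1..j}). f k j)"
    by (rule prod.reindex_bij_witness[of _ prod.swap prod.swap]) auto
  also have "\<dots> = (\<Prod>j\<in>{1..n}. \<Prod>k\<in>{1..j}. f k j)"
    by (rule prod.Sigma[symmetric]) auto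
  finally show ?thesis .
qed

text \<open>The rectangle of links is cut along the diagonal and both halves are read over i \<le>
  j, the index set of the branching rule.\<close>

lemma prod_link:
  "(\<Prod>j\<in>{1..Suc n}. \<Prod>k\<in>{1..n}. link \<theta> a b j k) =
    (\<Prod>j\<in>{1..n}. \<Prod>i\<in>{1..j}. gamma_quot \<theta> (shifted \<theta> a i - shifted \<theta> b j)
       * gamma_quot \<theta> (shifted \<theta> b i - shifted \<theta> a (Suc j) - \<theta>))"
proof -
  have "(\<Prod>j\<in>{1..Suc n}. \<Prod>k\<in>{1..n}. link \<theta> a b j k) = (\<Prod>k\<in>{1..n}. \<Prod>j\<in>{1..Suc n}. link \<theta> a b j k)"
    by (rule prod.swap)
  also have "\<dots> = (\<Prod>k\<in>{1..n}. (\<Prod>j\<in>{1..k}. gamma_quot \<theta> (shifted \<theta> a j - shifted \<theta> b k))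
      * (\<Prod>j\<in>{k..n}. gamma_quot \<theta> (shifted \<theta> b k - shifted \<theta> a (Suc j) - \<theta>)))"
  proof (rule prod.cong[OF refl])
    fix k assume k: "k \<in> {1..n}"
    have "{1..Suc n} = {1..k} \<union> {Suc k..Suc n}" using k by auto
    then have "(\<Prod>j\<in>{1..Suc n}. link \<theta> a b j k) = (\<Prod>j\<in>{1..k}. link \<theta> a b j k) * (\<Prod>j\<in>{Suc k..Suc n}. link \<theta> a b j k)"
      by (simp add: prod.union_disjoint)
    also have "(\<Prod>j\<in>{Suc k..Suc n}. link \<theta> a b j k) = (\<Prod>j\<in>{k..n}. link \<theta> a b (Suc j) k)"
      by (rule prod.shift_bounds_cl_Suc_ivl)
    finally show "(\<Prod>j\<in>{1..Suc n}. link \<theta> a b j k) = (\<Prod>j\<in>{1..k}. gamma_quot \<theta> (shifted \<theta> a j - shifted \<theta> b k))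
      * (\<Prod>j\<in>{k..n}. gamma_quot \<theta> (shifted \<theta> b k - shifted \<theta> a (Suc j) - \<theta>))"
      by (simp add: link_def)
  qed
  also have "\<dots> = (\<Prod>k\<in>{1..n}. \<Prod>j\<in>{1..k}. gamma_quot \<theta> (shifted \<theta> a j - shifted \<theta> b k))
     * (\<Prod>k\<in>{1..n}. \<Prod>j\<in>{k..n}. gamma_quot \<theta> (shifted \<theta> b k - shifted \<theta> a (Suc j) - \<theta>))"
    by (rule prod.distrib)
  finally show ?thesis unfolding prod_triangle_swap by (simp only: prod.distrib)
qed

lemma gamma_quot_alt: "gamma_quot \<theta> x = Gamma (x + \<theta>) / Gamma (x + 1)"
  by (simp add: gamma_quot_def rGamma_inverse_Gamma divide_inverse)

lemma gamma_quot_pos: "x \<ge> 0 \<Longrightarrow> \<theta> > 0 \<Longrightarrow> gamma_quot \<theta> x > 0"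
  unfolding gamma_quot_alt by (intro divide_pos_pos Gamma_real_pos) auto

lemma pochhammer_gamma_quot:
  assumes "a \<ge> 0" "\<theta> > 0"
  shows "pochhammer (a + \<theta>) n / pochhammer (a + 1) n = gamma_quot \<theta> (a + real n) / gamma_quot \<theta> a"
    "pochhammer (a + 1) n / pochhammer (a + \<theta>) n = gamma_quot \<theta> a / gamma_quot \<theta> (a + real n)"
proof -
  have "a + \<theta> \<notin> \<int>\<^sub>\<le>\<^sub>0" "a + 1 \<notin> \<int>\<^sub>\<le>\<^sub>0" using assms by (auto elim!: nonpos_Ints_cases)
  moreover have "Gamma (a + \<theta>) > 0" "Gamma (a + 1) > 0" using assms by (auto intro!: Gamma_real_pos)
  ultimately show "pochhammer (a + \<theta>) n / pochhammer (a + 1) n = gamma_quot \<theta> (a + real n) / gamma_quot \<theta> a"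
    "pochhammer (a + 1) n / pochhammer (a + \<theta>) n = gamma_quot \<theta> a / gamma_quot \<theta> (a + real n)"
    by (simp_all add: pochhammer_Gamma gamma_quot_alt add_ac)
qed

text \<open>Quotients of Pochhammer symbols are quotients of \<open>gamma_quot\<close>. Interlacing
  makes all four arguments nonnegative, which avoids the poles and gives positivity.\<close>

lemma jack_branch_gamma:
  assumes lam: "lam \<in> GT (Suc n)" and mu: "mu \<in> below n lam" and \<theta>: "\<theta> > 0"
  defines "l \<equiv> shifted \<theta> (entry lam)" and "m \<equiv> shifted \<theta> (entry mu)"
  shows "jack_branch \<theta> n lam mu = (\<Prod>j\<in>{1..n}. \<Prod>i\<in>{1..j}.
     gamma_quot \<theta> (l i - m j) * gamma_quot \<theta> (m i - l (Suc j) - \<theta>)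
       / (gamma_quot \<theta> (m i - m j) * gamma_quot \<theta> (l i - l (Suc j) - \<theta>)))"
    and "jack_branch \<theta> n lam mu > 0"
proof -
  have pos: "0 \<le> l i - m j" "0 \<le> m i - l (Suc j) - \<theta>" "0 \<le> m i - m j" "0 \<le> l i - l (Suc j) - \<theta>"
    and int: "entry lam (Suc j) \<le> entry mu j" "entry mu j \<le> entry mu i" "entry mu j \<le> entry lam i"
    if ij: "j \<in> {1..n}" "i \<in> {1..j}" for i j
  proof -
    show 1: "entry lam (Suc j) \<le> entry mu j" "entry mu j \<le> entry mu i" using mu ij GT_antimono[of mu n i j] by (auto simp: below_def)
    have 2: "entry mu i \<le> entry lam i" using mu ij by (auto simp: below_def)
    then show "entry mu j \<le> entry lam i" using 1 by simp
    have "0 \<le> \<theta> * (real j - real i)" using \<theta> ij by auto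
    then show "0 \<le> l i - m j" "0 \<le> m i - l (Suc j) - \<theta>" "0 \<le> m i - m j" "0 \<le> l i - l (Suc j) - \<theta>"
      using 1 2 by (auto simp: l_def m_def shifted_def algebra_simps)
  qed
  show *: "jack_branch \<theta> n lam mu = (\<Prod>j\<in>{1..n}. \<Prod>i\<in>{1..j}.
     gamma_quot \<theta> (l i - m j) * gamma_quot \<theta> (m i - l (Suc j) - \<theta>)
       / (gamma_quot \<theta> (m i - m j) * gamma_quot \<theta> (l i - l (Suc j) - \<theta>)))"
    unfolding jack_branch_def Let_def
  proof (intro prod.cong refl)
    fix j i assume ij: "j \<in> {1..n}" "i \<in> {1..j}"
    \<comment> \<open>The Pochhammer length. Adding it to a difference with row j of
      \<open>mu\<close> replaces that row by row j + 1 of \<open>lam\<close>, at the price of one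
      \<theta> from the shifted coordinates.\<close>
    define k where "k = nat (entry mu j - entry lam (Suc j))"
    have k: "real k = of_int (entry mu j) - of_int (entry lam (Suc j))"
      using int[OF ij] by (simp add: k_def)
    have e: "real_of_int (part mu i - part mu j) + \<theta> * (real j - real i) = m i - m j"
      "real_of_int (part lam i - part mu j) + \<theta> * (real j - real i) = l i - m j"
      "m i - m j + real k = m i - l (Suc j) - \<theta>"
      "l i - m j + real k = l i - l (Suc j) - \<theta>"
      unfolding k by (auto simp: m_def l_def shifted_def entry_def algebra_simps)
    have k': "nat (part mu j - part lam (j + 1)) = k" by (simp add: k_def entry_def)
    show "pochhammer (real_of_int (part mu i - part mu j) + \<theta> * (real j - real i) + \<theta>) (nat (part mu j - part lam (j + 1))) /
        pochhammer (real_of_int (part mu i - part mu j) + \<theta> * (real j - real i) + 1) (nat (part mu j - part lam (j + 1))) *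
        (pochhammer (real_of_int (part lam i - part mu j) + \<theta> * (real j - real i) + 1) (nat (part mu j - part lam (j + 1))) /
        pochhammer (real_of_int (part lam i - part mu j) + \<theta> * (real j - real i) + \<theta>) (nat (part mu j - part lam (j + 1)))) =
      gamma_quot \<theta> (l i - m j) * gamma_quot \<theta> (m i - l (Suc j) - \<theta>)
       / (gamma_quot \<theta> (m i - m j) * gamma_quot \<theta> (l i - l (Suc j) - \<theta>))"
      unfolding e k' pochhammer_gamma_quot[OF pos(1)[OF ij] \<theta>] pochhammer_gamma_quot[OF pos(3)[OF ij] \<theta>] by simp
  qed
  show "jack_branch \<theta> n lam mu > 0" unfolding *
    by (intro prod_pos ballI divide_pos_pos mult_pos_pos gamma_quot_pos pos \<theta>)
qed

text \<open>The factors in \<open>lam\<close> alone and in \<open>mu\<close> alone are absorbed by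
  the norms. The power of \<open>Gamma \<theta>\<close> comes from the diagonal i = j of the
  triangle in \<open>mu\<close>, where \<open>gamma_quot\<close> is taken at 0.\<close>

lemma jack_branch_level_kernel:
  assumes lam: "lam \<in> GT (Suc n)" and mu: "mu \<in> below n lam" and \<theta>: "\<theta> > 0"
  shows "jack_branch \<theta> n lam mu = level_kernel \<theta> n (entry lam) (entry mu) * level_norm \<theta> (Suc n) (entry lam)
      / (Gamma \<theta> ^ n * pair_norm \<theta> (Suc n) (entry lam) * level_norm \<theta> n (entry mu))"
proof -
  define l m where "l = shifted \<theta> (entry lam)" and "m = shifted \<theta> (entry mu)"
  have mu': "mu \<in> GT n" using mu by (rule below_GT)
  have "level_norm \<theta> (Suc n) (entry lam) / pair_norm \<theta> (Suc n) (entry lam) =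
     (\<Prod>(i, j)\<in>pairs (Suc n). 1 / gamma_quot \<theta> (l i - l j - \<theta>))"
    unfolding level_norm_def pair_norm_def prod_dividef[symmetric] case_prod_unfold
  proof (intro prod.cong refl)
    fix x assume x: "x \<in> pairs (Suc n)"
    define d where "d = shifted \<theta> (entry lam) (fst x) - shifted \<theta> (entry lam) (snd x)"
    have "d \<ge> \<theta>" using shifted_diff_ge[OF lam _ \<theta>, of "fst x" "snd x"] x by (simp add: d_def)
    then have "Gamma (d + \<theta>) > 0" using \<theta> by (intro Gamma_real_pos) auto
    moreover have "gamma_quot \<theta> (d - \<theta>) = Gamma d / Gamma (d + (1 - \<theta>))"
      by (simp add: gamma_quot_alt algebra_simps)
    ultimately show "Gamma (shifted \<theta> (entry lam) (fst x) - shifted \<theta> (entry lam) (snd x) + \<theta>) / Gamma (shifted \<theta> (entry lam) (fst x) - shifted \<theta> (entry lam) (snd x)) /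
         (Gamma (shifted \<theta> (entry lam) (fst x) - shifted \<theta> (entry lam) (snd x) + \<theta>) / Gamma (shifted \<theta> (entry lam) (fst x) - shifted \<theta> (entry lam) (snd x) + (1 - \<theta>))) =
         1 / gamma_quot \<theta> (l (fst x) - l (snd x) - \<theta>)"
      unfolding l_def d_def[symmetric] by simp
  qed
  also have "\<dots> = (\<Prod>j\<in>{1..n}. \<Prod>i\<in>{1..j}. 1 / gamma_quot \<theta> (l i - l (Suc j) - \<theta>))"
    by (rule prod_pairs_Suc)
  finally have 1: "level_norm \<theta> (Suc n) (entry lam) / pair_norm \<theta> (Suc n) (entry lam) =
      (\<Prod>j\<in>{1..n}. \<Prod>i\<in>{1..j}. 1 / gamma_quot \<theta> (l i - l (Suc j) - \<theta>))" .
  have "vander n m / level_norm \<theta> n (entry mu) = (\<Prod>(i, j)\<in>pairs n. 1 / gamma_quot \<theta> (m i - m j))"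
    unfolding level_norm_def vander_def prod_dividef[symmetric] case_prod_unfold
  proof (intro prod.cong refl)
    fix x assume x: "x \<in> pairs n"
    define d where "d = shifted \<theta> (entry mu) (fst x) - shifted \<theta> (entry mu) (snd x)"
    have "d \<ge> \<theta>" using shifted_diff_ge[OF mu' _ \<theta>, of "fst x" "snd x"] x by (simp add: d_def)
    then have "Gamma (d + 1) = d * Gamma d" using \<theta> by (intro Gamma_plus1) (auto elim!: nonpos_Ints_cases)
    then show "(m (fst x) - m (snd x)) / (Gamma (shifted \<theta> (entry mu) (fst x) - shifted \<theta> (entry mu) (snd x) + \<theta>) /
          Gamma (shifted \<theta> (entry mu) (fst x) - shifted \<theta> (entry mu) (snd x))) =
         1 / gamma_quot \<theta> (m (fst x) - m (snd x))"
      unfolding m_def d_def[symmetric] by (simp add: gamma_quot_alt)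
  qed
  moreover have "(\<Prod>j\<in>{1..n}. 1 / gamma_quot \<theta> (m j - m j)) = 1 / Gamma \<theta> ^ n"
    by (simp add: gamma_quot_alt power_one_over)
  ultimately have 2: "vander n m / level_norm \<theta> n (entry mu) / Gamma \<theta> ^ n = (\<Prod>j\<in>{1..n}. \<Prod>i\<in>{1..j}. 1 / gamma_quot \<theta> (m i - m j))"
    unfolding prod_triangle by simp
  have "level_kernel \<theta> n (entry lam) (entry mu) * level_norm \<theta> (Suc n) (entry lam)
      / (Gamma \<theta> ^ n * pair_norm \<theta> (Suc n) (entry lam) * level_norm \<theta> n (entry mu)) =
     (vander n m / level_norm \<theta> n (entry mu) / Gamma \<theta> ^ n) * (level_norm \<theta> (Suc n) (entry lam) / pair_norm \<theta> (Suc n) (entry lam))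
     * (\<Prod>j\<in>{1..Suc n}. \<Prod>k\<in>{1..n}. link \<theta> (entry lam) (entry mu) j k)"
    unfolding level_kernel_def m_def by (simp add: mult_ac)
  also have "\<dots> = (\<Prod>j\<in>{1..n}. \<Prod>i\<in>{1..j}. 1 / gamma_quot \<theta> (m i - m j) * (1 / gamma_quot \<theta> (l i - l (Suc j) - \<theta>))
     * (gamma_quot \<theta> (l i - m j) * gamma_quot \<theta> (m i - l (Suc j) - \<theta>)))"
    unfolding 1 2 prod_link l_def[symmetric] m_def[symmetric] by (simp only: prod.distrib)
  also have "\<dots> = jack_branch \<theta> n lam mu"
    unfolding jack_branch_gamma(1)[OF lam mu \<theta>] l_def m_def by (intro prod.cong refl) simp
  finally show ?thesis by simp
qed

text \<open>The links at (i, i) and (i + 1, i) have the integer arguments \<open>a i - b i\<close>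
  and \<open>b i - a (Suc i)\<close>; a reciprocal Gamma value vanishes as soon as one of them is
  negative.\<close>

lemma level_kernel_nonzero:
  assumes "level_kernel \<theta> n a b \<noteq> 0" "i \<in> {1..n}"
  shows "a (Suc i) \<le> b i" "b i \<le> a i"
proof -
  have nz: "link \<theta> a b j k \<noteq> 0" if "j \<in> {1..Suc n}" "k \<in> {1..n}" for j k
  proof
    assume "link \<theta> a b j k = 0"
    then have "(\<Prod>k\<in>{1..n}. link \<theta> a b j k) = 0" using that(2) by (intro prod_zero) auto
    then have "\<exists>j\<in>{1..Suc n}. (\<Prod>k\<in>{1..n}. link \<theta> a b j k) = 0" using that(1) by blast
    then have "(\<Prod>j\<in>{1..Suc n}. \<Prod>k\<in>{1..n}. link \<theta> a b j k) = 0" by (rule prod_zero[OF finite_atLeastAtMost])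
    then show False using assms(1) by (simp add: level_kernel_def)
  qed
  have rG: "rGamma (of_int z + 1 :: real) = 0" if "z < 0" for z
  proof -
    have "of_int (z + 1) \<in> (\<int>\<^sub>\<le>\<^sub>0 :: real set)" using that by (subst of_int_in_nonpos_Ints_iff) simp
    then show ?thesis by (simp add: rGamma_eq_zero_iff)
  qed
  have "link \<theta> a b i i \<noteq> 0" "link \<theta> a b (Suc i) i \<noteq> 0" using nz assms(2) by auto
  moreover have "shifted \<theta> a i - shifted \<theta> b i = of_int (a i - b i)"
    "shifted \<theta> b i - shifted \<theta> a (Suc i) - \<theta> = of_int (b i - a (Suc i))"
    by (simp_all add: shifted_def algebra_simps)
  ultimately have "rGamma (of_int (a i - b i) + 1 :: real) \<noteq> 0" "rGamma (of_int (b i - a (Suc i)) + 1 :: real) \<noteq> 0"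
    by (auto simp: link_def gamma_quot_def)
  then show "a (Suc i) \<le> b i" "b i \<le> a i" using rG[of "a i - b i"] rG[of "b i - a (Suc i)"] by linarith+
qed

lemma level_kernel_cong:
  assumes "\<And>i. i \<in> {1..Suc n} \<Longrightarrow> a i = a' i" "\<And>i. i \<in> {1..n} \<Longrightarrow> b i = b' i"
  shows "level_kernel \<theta> n a b = level_kernel \<theta> n a' b'"
  unfolding level_kernel_def vander_def link_def
  by (intro arg_cong2[where f="(*)"] prod.cong refl) (auto simp: shifted_def assms pairs_def)

lemma pieri_coeff_cong:
  assumes "I \<subseteq> {1..N}" "\<And>i. i \<in> {1..N} \<Longrightarrow> a i = a' i"
  shows "pieri_coeff \<theta> N a I = pieri_coeff \<theta> N a' I"
  unfolding pieri_coeff_def using assms by (intro prod.cong refl) (auto simp: shifted_def subset_iff)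


text \<open>A unit shift of a difference x changes its Gamma ratio by (x + \<theta>) / (x + 1 -
  \<theta>), the quotient of the two kinds of coefficient. Since both vectors are signatures, every
  ordered difference stays at least \<theta> and no factor degenerates.\<close>

lemma pair_norm_badd:
  assumes lam: "lam \<in> GT N" and lamI: "badd I lam \<in> GT N" and I: "I \<subseteq> {1..N}" and \<theta>: "\<theta> > 0"
  shows "pieri_coeff \<theta> N (entry lam) I / pair_norm \<theta> N (entry (badd I lam)) =
    dual_coeff \<theta> N (entry lam) I / pair_norm \<theta> N (entry lam)"
proof -
  define l l' where "l = shifted \<theta> (entry lam)" and "l' = shifted \<theta> (entry (badd I lam))"
  define F where "F = (\<lambda>x. Gamma (x + \<theta>) / Gamma (x + (1 - \<theta>)))"
  have l': "l' i = l i + (if i \<in> I then 1 else 0)" if "i \<in> {1..N}" for i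
    using that entry_badd[of i lam I] GT_length[OF lam] shifted_raise[of \<theta> I "entry lam" i]
    by (simp add: l'_def l_def shifted_def)
  have ge: "l i - l j \<ge> \<theta>" "l' i - l' j \<ge> \<theta>" if "(i, j) \<in> pairs N" for i j
    using shifted_diff_ge[OF lam that \<theta>] shifted_diff_ge[OF lamI that \<theta>] by (simp_all add: l_def l'_def)
  have G1: "Gamma (x + 1) = x * Gamma x" if "x > 0" for x :: real
    using that by (intro Gamma_plus1) (auto elim!: nonpos_Ints_cases)
  have F1: "F (x + 1) = F x * ((x + \<theta>) / (x + (1 - \<theta>)))" if "x \<ge> \<theta>" for x
  proof -
    have e: "x + 1 + \<theta> = (x + \<theta>) + 1" "x + 1 + (1 - \<theta>) = (x + (1 - \<theta>)) + 1" by auto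
    have "x + \<theta> > 0" "x + (1 - \<theta>) > 0" using that \<theta> by auto
    then show ?thesis unfolding F_def e G1[OF \<open>x + \<theta> > 0\<close>] G1[OF \<open>x + (1 - \<theta>) > 0\<close>] by (simp add: mult.commute)
  qed
  have nz: "l i - l j + (1 - \<theta>) \<noteq> 0" "l i - l j + \<theta> \<noteq> 0" if "i \<in> I" "j \<in> {1..N} - I" for i j
  proof -
    have "i \<noteq> j" using that by auto
    then consider "i < j" | "j < i" by (metis linorder_neqE_nat)
    then have "l i - l j + (1 - \<theta>) \<noteq> 0 \<and> l i - l j + \<theta> \<noteq> 0"
    proof cases
      case 1
      then have "(i, j) \<in> pairs N" using that I by (auto simp: pairs_def)
      from ge[OF this] show ?thesis using \<theta> by auto
    next
      case 2
      then have "(j, i) \<in> pairs N" using that I by (auto simp: pairs_def)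
      from ge[OF this] show ?thesis using that I l'[of i] l'[of j] \<theta> by auto
    qed
    then show "l i - l j + (1 - \<theta>) \<noteq> 0" "l i - l j + \<theta> \<noteq> 0" by auto
  qed
  have "(\<Prod>(i, j)\<in>pairs N. F (l' i - l' j)) = (\<Prod>(i, j)\<in>pairs N. F (l i - l j)) *
     (\<Prod>i\<in>I. \<Prod>j\<in>{1..N} - I. (l i - l j + \<theta>) / (l i - l j + (1 - \<theta>)))"
  proof (rule prod_pairs_update[OF I])
    fix i j assume ij: "(i, j) \<in> pairs N"
    then have ij': "i \<in> {1..N}" "j \<in> {1..N}" by (auto simp: pairs_def)
    show "F (l' i - l' j) = F (l i - l j) * ((l i - l j + \<theta>) / (l i - l j + (1 - \<theta>)))" if "i \<in> I" "j \<notin> I"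
      using F1[OF ge(1)[OF ij]] that by (simp add: l'[OF ij'(1)] l'[OF ij'(2)] algebra_simps)
    show "F (l' i - l' j) = F (l i - l j) * ((l j - l i + \<theta>) / (l j - l i + (1 - \<theta>)))" if "i \<notin> I" "j \<in> I"
    proof -
      define x where "x = l' i - l' j"
      have x: "l i - l j = x + 1" "x \<ge> \<theta>" using that ge[OF ij] by (auto simp: x_def l'[OF ij'(1)] l'[OF ij'(2)])
      have e: "l j - l i + \<theta> = - (x + (1 - \<theta>))" "l j - l i + (1 - \<theta>) = - (x + \<theta>)" using x by auto
      have "A / B * (- B / - A) = 1" if "A \<noteq> 0" "B \<noteq> 0" for A B :: real using that by simp
      from this[of "x + \<theta>" "x + (1 - \<theta>)"] show ?thesis
        unfolding x(1) x_def[symmetric] F1[OF x(2)] e mult.assoc using x(2) \<theta> by auto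
    qed
    show "F (l' i - l' j) = F (l i - l j)" if "i \<in> I \<longleftrightarrow> j \<in> I"
      using that by (auto simp: l'[OF ij'(1)] l'[OF ij'(2)])
  qed
  then have q: "pair_norm \<theta> N (entry (badd I lam)) = pair_norm \<theta> N (entry lam) *
     (\<Prod>i\<in>I. \<Prod>j\<in>{1..N} - I. (l i - l j + \<theta>) / (l i - l j + (1 - \<theta>)))"
    unfolding pair_norm_def F_def l_def l'_def .
  have "pieri_coeff \<theta> N (entry lam) I = dual_coeff \<theta> N (entry lam) I *
     (\<Prod>i\<in>I. \<Prod>j\<in>{1..N} - I. (l i - l j + \<theta>) / (l i - l j + (1 - \<theta>)))"
    unfolding pieri_coeff_def dual_coeff_def prod.distrib[symmetric] l_def[symmetric]
    by (intro prod.cong refl) (use nz in auto)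
  moreover have "(\<Prod>i\<in>I. \<Prod>j\<in>{1..N} - I. (l i - l j + \<theta>) / (l i - l j + (1 - \<theta>))) \<noteq> 0"
    using nz I finite_subset[OF I] by (simp add: prod_zero_iff)
  ultimately show ?thesis unfolding q by simp
qed

text \<open>The factors \<open>level_norm\<close> telescope between the levels, so only the gauge
  factor of the top level remains outside the sum.\<close>

lemma normed_sum_Suc:
  assumes lam: "lam \<in> GT (Suc n)" and \<theta>: "\<theta> > 0"
  shows "normed_sum \<theta> (Suc n) lam \<phi> = (1 / (Gamma \<theta> ^ n * pair_norm \<theta> (Suc n) (entry lam))) *\<^sub>R
     (\<Sum>mu\<in>below n lam. level_kernel \<theta> n (entry lam) (entry mu) *\<^sub>R
        normed_sum \<theta> n mu (\<lambda>\<xi>. \<phi> (\<xi>(Suc n := sum_list lam - sum_list mu))))"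
proof -
  have "level_norm \<theta> (Suc n) (entry lam) > 0" by (rule level_norm_pos[OF lam \<theta>])
  then show ?thesis
    unfolding normed_sum_def step_sum.simps scaleR_sum_right scaleR_scaleR
    by (intro sum.cong refl) (simp add: jack_branch_level_kernel[OF lam _ \<theta>])
qed

lemma below_eq_if_kernel:
  assumes lam: "lam \<in> GT (Suc n)" and "length mu = n" "level_kernel \<theta> n (entry lam) (entry mu) \<noteq> 0"
  shows "mu \<in> below n lam"
proof -
  have *: "entry lam (Suc i) \<le> entry mu i" "entry mu i \<le> entry lam i" if "i \<in> {1..n}" for i
    using level_kernel_nonzero[OF assms(3) that] by auto
  have "entry mu (Suc i) \<le> entry mu i" if "i \<in> {1..<n}" for i
    using *(2)[of "Suc i"] *(1)[of i] that by auto
  then show ?thesis using * assms(2) by (auto simp: below_def GT_iff)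
qed

lemma card_subset_Suc_sum:
  fixes f :: "nat set \<Rightarrow> 'a::comm_monoid_add"
  shows "(\<Sum>I | I \<subseteq> {1..Suc n} \<and> card I = r. f I) =
    (\<Sum>J | J \<subseteq> {1..n} \<and> card J = r. f J) + (\<Sum>J | J \<subseteq> {1..n} \<and> Suc (card J) = r. f (insert (Suc n) J))"
proof -
  have *: "(\<Sum>I | I \<subseteq> A \<and> P I. g I) = (\<Sum>I\<in>Pow A. if P I then g I else 0)" if "finite A" for g :: "nat set \<Rightarrow> 'a" and A P
    using that sum.inter_filter[of "Pow A" g P] by simp
  have A: "{1..Suc n} = insert (Suc n) {1..n}" by auto
  have "(\<Sum>I\<in>Pow {1..Suc n}. if card I = r then f I else 0) =
     (\<Sum>I\<in>Pow {1..n}. (if card I = r then f I else 0) + (if Suc (card I) = r then f (insert (Suc n) I) else 0))"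
    unfolding A
  proof (subst sum_Pow_insert)
    have "card (insert (Suc n) I) = Suc (card I)" if "I \<subseteq> {1..n}" for I
      using that finite_subset[OF that] by (intro card_insert_disjoint) auto
    then show "(\<Sum>I\<in>Pow {1..n}. (if card I = r then f I else 0) + (if card (insert (Suc n) I) = r then f (insert (Suc n) I) else 0)) =
     (\<Sum>I\<in>Pow {1..n}. (if card I = r then f I else 0) + (if Suc (card I) = r then f (insert (Suc n) I) else 0))"
      by (intro sum.cong) auto
  qed auto
  then show ?thesis by (simp add: * sum.distrib)
qed

text \<open>For \<phi> a monomial with exponents \<xi> the right-hand side is an elementary
  symmetric polynomial times a normalized Jack polynomial, so this is the Pieri rule in terms of
  test functions.\<close>

definition pieri_holds :: "'a::real_vector itself \<Rightarrow> real \<Rightarrow> nat \<Rightarrow> bool" where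
  "pieri_holds T \<theta> N \<longleftrightarrow> (\<forall>lam\<in>GT N. \<forall>r. \<forall>\<phi> :: (nat \<Rightarrow> int) \<Rightarrow> 'a.
     (\<Sum>I | I \<subseteq> {1..N} \<and> card I = r. if badd I lam \<in> GT N then pieri_coeff \<theta> N (entry lam) I *\<^sub>R normed_sum \<theta> N (badd I lam) \<phi> else 0) =
     (\<Sum>I | I \<subseteq> {1..N} \<and> card I = r. normed_sum \<theta> N lam (\<lambda>\<xi>. \<phi> (\<lambda>i. \<xi> i + ind I i))))"

text \<open>Induction on the level. The gauge turns the Pieri sum into a sum with
  \<open>dual_coeff\<close>, \<open>intertwining\<close> moves the added boxes one level down, and
  the hypothesis for that level turns them into shifts of the increments; the last increment takes
  the remaining box, if any.\<close>

lemma pieri_irrational: "\<theta> > 0 \<Longrightarrow> \<theta> \<notin> \<rat> \<Longrightarrow> pieri_holds TYPE('a::real_vector) \<theta> N"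
proof (induction N)
  case 0
  show ?case unfolding pieri_holds_def
  proof (intro ballI allI)
    fix lam r and \<phi> :: "(nat \<Rightarrow> int) \<Rightarrow> 'a"
    assume "lam \<in> GT 0"
    then have "lam = []" by (simp add: GT_def)
    moreover have "{I :: nat set. I \<subseteq> {1..0} \<and> card I = r} = (if r = 0 then {{}} else {})" by auto
    ultimately show "(\<Sum>I | I \<subseteq> {1..0} \<and> card I = r. if badd I lam \<in> GT 0 then pieri_coeff \<theta> 0 (entry lam) I *\<^sub>R normed_sum \<theta> 0 (badd I lam) \<phi> else 0) =
     (\<Sum>I | I \<subseteq> {1..0} \<and> card I = r. normed_sum \<theta> 0 lam (\<lambda>\<xi>. \<phi> (\<lambda>i. \<xi> i + ind I i)))"
      by (simp add: normed_sum_def pieri_coeff_def level_norm_def pairs_def badd_def GT_def ind_def)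
  qed
next
  case (Suc n)
  have IH: "(\<Sum>I | I \<subseteq> {1..n} \<and> card I = r. if badd I nu \<in> GT n then pieri_coeff \<theta> n (entry nu) I *\<^sub>R normed_sum \<theta> n (badd I nu) \<phi> else 0) =
     (\<Sum>I | I \<subseteq> {1..n} \<and> card I = r. normed_sum \<theta> n nu (\<lambda>\<xi>. \<phi> (\<lambda>i. \<xi> i + ind I i)))"
    if "nu \<in> GT n" for nu r and \<phi> :: "(nat \<Rightarrow> int) \<Rightarrow> 'a"
    using Suc that unfolding pieri_holds_def by blast
  have \<theta>: "\<theta> > 0" by fact
  show ?case unfolding pieri_holds_def
  proof (intro ballI allI)
    fix lam r and \<phi> :: "(nat \<Rightarrow> int) \<Rightarrow> 'a"
    assume lam: "lam \<in> GT (Suc n)"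
    define S where "S = {I. I \<subseteq> {1..Suc n} \<and> card I = r}"
    \<comment> \<open>One finite range for the lower level, valid for all I; entries of the raised
      signature exceed those of \<open>lam\<close> by at most 1. Sums over \<open>below\<close>
      extend to B because the kernel vanishes on the rest.\<close>
    define B where "B = {mu \<in> GT n. \<forall>i\<in>{1..n}. entry lam (Suc n) \<le> entry mu i \<and> entry mu i \<le> entry lam 1 + 1}"
    define c where "c = 1 / (Gamma \<theta> ^ n * pair_norm \<theta> (Suc n) (entry lam))"
    \<comment> \<open>The entry sum of the upper level is \<open>sum_list lam + int r\<close> for
      every I of size r, so the lower-level value no longer depends on I.\<close>
    define G where "G = (\<lambda>mu. normed_sum \<theta> n mu (\<lambda>\<xi>. \<phi> (\<xi>(Suc n := sum_list lam + int r - sum_list mu))))"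
    have len: "length lam = Suc n" using lam by (rule GT_length)
    have finB: "finite B" unfolding B_def by (rule finite_GT_box)
    have BGT: "mu \<in> GT n" if "mu \<in> B" for mu using that by (simp add: B_def)
    have lam_bd: "entry lam (Suc n) \<le> entry lam i" "entry lam i \<le> entry lam 1" if "i \<in> {1..Suc n}" for i
      using that GT_antimono[OF lam, of i "Suc n"] GT_antimono[OF lam, of 1 i] by auto
    have below_B: "below n (badd I lam) \<subseteq> B" if "I \<subseteq> {1..Suc n}" for I
    proof
      fix mu assume mu: "mu \<in> below n (badd I lam)"
      show "mu \<in> B" unfolding B_def
      proof (intro CollectI conjI ballI)
        show "mu \<in> GT n" using mu by (rule below_GT)
        fix i assume i: "i \<in> {1..n}"
        then have "entry (badd I lam) (Suc i) \<le> entry mu i" "entry mu i \<le> entry (badd I lam) i"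
          using mu by (auto simp: below_def)
        moreover have "entry (badd I lam) (Suc i) \<ge> entry lam (Suc i)" "entry (badd I lam) i \<le> entry lam i + 1"
          using i len by (auto simp: entry_badd raise_def ind_def)
        moreover have "entry lam (Suc n) \<le> entry lam (Suc i)" "entry lam i \<le> entry lam 1" using lam_bd i by auto
        ultimately show "entry lam (Suc n) \<le> entry mu i" "entry mu i \<le> entry lam 1 + 1" by auto
      qed
    qed
    have L: "(if badd I lam \<in> GT (Suc n) then pieri_coeff \<theta> (Suc n) (entry lam) I *\<^sub>R normed_sum \<theta> (Suc n) (badd I lam) \<phi> else 0) =
       c *\<^sub>R (\<Sum>mu\<in>B. (dual_coeff \<theta> (Suc n) (entry lam) I * level_kernel \<theta> n (raise I (entry lam)) (entry mu)) *\<^sub>R G mu)"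
      if "I \<in> S" for I
    proof -
      have I: "I \<subseteq> {1..Suc n}" "card I = r" using that by (auto simp: S_def)
      have K: "level_kernel \<theta> n (raise I (entry lam)) (entry mu) = level_kernel \<theta> n (entry (badd I lam)) (entry mu)" for mu
        by (rule level_kernel_cong) (auto simp: entry_badd len)
      show ?thesis
      proof (cases "badd I lam \<in> GT (Suc n)")
        case True
        have "(\<Sum>mu\<in>below n (badd I lam). level_kernel \<theta> n (entry (badd I lam)) (entry mu) *\<^sub>R
            normed_sum \<theta> n mu (\<lambda>\<xi>. \<phi> (\<xi>(Suc n := sum_list (badd I lam) - sum_list mu)))) =
           (\<Sum>mu\<in>B. level_kernel \<theta> n (entry (badd I lam)) (entry mu) *\<^sub>R G mu)"
          unfolding G_def sum_list_badd[OF len I(1)] I(2)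
          using below_eq_if_kernel[OF True GT_length[OF BGT]]
          by (intro sum.mono_neutral_left finB below_B[OF I(1)] ballI) (metis DiffD1 DiffD2 scale_zero_left)
        moreover have "pieri_coeff \<theta> (Suc n) (entry lam) I * (1 / (Gamma \<theta> ^ n * pair_norm \<theta> (Suc n) (entry (badd I lam)))) =
            c * dual_coeff \<theta> (Suc n) (entry lam) I"
          using pair_norm_badd[OF lam True I(1) \<theta>] unfolding c_def
          by (simp add: mult.commute[of "Gamma \<theta> ^ n"] flip: divide_divide_eq_left)
        ultimately have "pieri_coeff \<theta> (Suc n) (entry lam) I *\<^sub>R normed_sum \<theta> (Suc n) (badd I lam) \<phi> =
            (c * dual_coeff \<theta> (Suc n) (entry lam) I) *\<^sub>R (\<Sum>mu\<in>B. level_kernel \<theta> n (entry (badd I lam)) (entry mu) *\<^sub>R G mu)"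
          unfolding normed_sum_Suc[OF True \<theta>] by (simp only: scaleR_scaleR)
        then show ?thesis using True unfolding K by (simp add: scaleR_sum_right mult.assoc)
      next
        case False
        have "level_kernel \<theta> n (entry (badd I lam)) (entry mu) = 0" if "mu \<in> B" for mu
        proof (rule ccontr)
          assume nz: "level_kernel \<theta> n (entry (badd I lam)) (entry mu) \<noteq> 0"
          have "entry (badd I lam) (Suc i) \<le> entry (badd I lam) i" if "i \<in> {1..<Suc n}" for i
            using level_kernel_nonzero[OF nz, of i] that by auto
          then have "badd I lam \<in> GT (Suc n)" using len by (simp add: GT_iff)
          then show False using False by simp
        qed
        then show ?thesis using False unfolding K by simp
      qed
    qed
    \<comment> \<open>The sets I split by membership of \<open>Suc n\<close>. With it, only r - 1
      boxes go to level n and the last coordinate grows by one; both cases give the same G.\<close>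
    have R1: "(\<Sum>I\<in>S. normed_sum \<theta> n nu (\<lambda>\<xi>. \<phi> (\<lambda>i. (\<xi>(Suc n := sum_list lam - sum_list nu)) i + ind I i))) =
       (\<Sum>I\<in>S. if badd (I - {Suc n}) nu \<in> GT n then pieri_coeff \<theta> n (entry nu) (I - {Suc n}) *\<^sub>R G (badd (I - {Suc n}) nu) else 0)"
      if nu: "nu \<in> GT n" for nu
    proof -
      have upd: "(\<lambda>i. (\<xi>(Suc n := x)) i + ind J i) = (\<lambda>i. \<xi> i + ind J i)(Suc n := x)"
        "(\<lambda>i. (\<xi>(Suc n := x)) i + ind (insert (Suc n) J) i) = (\<lambda>i. \<xi> i + ind J i)(Suc n := x + 1)"
        if "J \<subseteq> {1..n}" for J \<xi> x using that by (auto simp: ind_def fun_eq_iff)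
      have ins: "insert (Suc n) J - {Suc n} = J" "J - {Suc n} = J" if "J \<subseteq> {1..n}" for J using that by auto
      have GG: "normed_sum \<theta> n (badd J nu) (\<lambda>\<xi>. \<phi> (\<xi>(Suc n := x))) = G (badd J nu)"
        if "J \<subseteq> {1..n}" "x = sum_list lam + int r - sum_list nu - int (card J)" for J x
        unfolding G_def sum_list_badd[OF GT_length[OF nu] that(1)] that(2) by (simp add: algebra_simps)
      have "(\<Sum>I\<in>S. normed_sum \<theta> n nu (\<lambda>\<xi>. \<phi> (\<lambda>i. (\<xi>(Suc n := sum_list lam - sum_list nu)) i + ind I i))) =
        (\<Sum>J | J \<subseteq> {1..n} \<and> card J = r. normed_sum \<theta> n nu (\<lambda>\<xi>. \<phi> ((\<lambda>i. \<xi> i + ind J i)(Suc n := sum_list lam - sum_list nu)))) +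
        (\<Sum>J | J \<subseteq> {1..n} \<and> Suc (card J) = r. normed_sum \<theta> n nu (\<lambda>\<xi>. \<phi> ((\<lambda>i. \<xi> i + ind J i)(Suc n := sum_list lam - sum_list nu + 1))))"
        unfolding S_def card_subset_Suc_sum
        by (intro arg_cong2[where f = "(+)"] sum.cong refl) (auto simp only: upd mem_Collect_eq)
      also have "(\<Sum>J | J \<subseteq> {1..n} \<and> card J = r. normed_sum \<theta> n nu (\<lambda>\<xi>. \<phi> ((\<lambda>i. \<xi> i + ind J i)(Suc n := sum_list lam - sum_list nu)))) =
        (\<Sum>J | J \<subseteq> {1..n} \<and> card J = r. if badd J nu \<in> GT n then pieri_coeff \<theta> n (entry nu) J *\<^sub>R G (badd J nu) else 0)"
        using IH[OF nu, where r = r and \<phi> = "\<lambda>\<xi>. \<phi> (\<xi>(Suc n := sum_list lam - sum_list nu))"]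
        by (simp add: GG cong: sum.cong_simp if_cong)
      also have "(\<Sum>J | J \<subseteq> {1..n} \<and> Suc (card J) = r. normed_sum \<theta> n nu (\<lambda>\<xi>. \<phi> ((\<lambda>i. \<xi> i + ind J i)(Suc n := sum_list lam - sum_list nu + 1)))) =
        (\<Sum>J | J \<subseteq> {1..n} \<and> Suc (card J) = r. if badd J nu \<in> GT n then pieri_coeff \<theta> n (entry nu) J *\<^sub>R G (badd J nu) else 0)"
      proof (cases r)
        case (Suc q)
        have GG': "normed_sum \<theta> n (badd J nu) (\<lambda>\<xi>. \<phi> (\<xi>(Suc n := sum_list lam - sum_list nu + 1))) = G (badd J nu)"
          if "J \<subseteq> {1..n}" "card J = q" for J using that Suc by (intro GG) auto
        show ?thesis
          using IH[OF nu, where r = q and \<phi> = "\<lambda>\<xi>. \<phi> (\<xi>(Suc n := sum_list lam - sum_list nu + 1))"] unfolding Suc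
          by (simp add: GG' cong: sum.cong_simp if_cong)
      qed simp
      also have "(\<Sum>J | J \<subseteq> {1..n} \<and> card J = r. if badd J nu \<in> GT n then pieri_coeff \<theta> n (entry nu) J *\<^sub>R G (badd J nu) else 0) +
          (\<Sum>J | J \<subseteq> {1..n} \<and> Suc (card J) = r. if badd J nu \<in> GT n then pieri_coeff \<theta> n (entry nu) J *\<^sub>R G (badd J nu) else 0) =
        (\<Sum>I\<in>S. if badd (I - {Suc n}) nu \<in> GT n then pieri_coeff \<theta> n (entry nu) (I - {Suc n}) *\<^sub>R G (badd (I - {Suc n}) nu) else 0)"
        unfolding S_def card_subset_Suc_sum
        by (intro arg_cong2[where f = "(+)"] sum.cong refl) (simp_all only: ins mem_Collect_eq)
      finally show ?thesis .
    qed
    \<comment> \<open>Reindexing by mu = \<open>badd J nu\<close>. Elements of B that are not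
      reached contribute nothing, since a nonzero kernel at the lowered vector would make it
      interlace with \<open>lam\<close>.\<close>
    have R2: "(\<Sum>nu\<in>below n lam. level_kernel \<theta> n (entry lam) (entry nu) *\<^sub>R
          (if badd J nu \<in> GT n then pieri_coeff \<theta> n (entry nu) J *\<^sub>R G (badd J nu) else 0)) =
       (\<Sum>mu\<in>B. (pieri_coeff \<theta> n (lower J (entry mu)) J * level_kernel \<theta> n (entry lam) (lower J (entry mu))) *\<^sub>R G mu)"
      if J: "J \<subseteq> {1..n}" for J
    proof -
      define C where "C = {nu \<in> below n lam. badd J nu \<in> GT n}"
      define h where "h = (\<lambda>mu. (pieri_coeff \<theta> n (lower J (entry mu)) J * level_kernel \<theta> n (entry lam) (lower J (entry mu))) *\<^sub>R G mu)"
      have CB: "badd J ` C \<subseteq> B"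
      proof
        fix mu assume "mu \<in> badd J ` C"
        then obtain nu where nu: "mu = badd J nu" "nu \<in> below n lam" "mu \<in> GT n" by (auto simp: C_def)
        have "entry lam (Suc n) \<le> entry mu i \<and> entry mu i \<le> entry lam 1 + 1" if i: "i \<in> {1..n}" for i
        proof -
          have "entry lam (Suc i) \<le> entry nu i" "entry nu i \<le> entry lam i" using nu i by (auto simp: below_def)
          moreover have "entry mu i = entry nu i + ind J i"
            using i nu GT_length[OF below_GT[OF nu(2)]] by (simp add: entry_badd raise_def)
          moreover have "entry lam (Suc n) \<le> entry lam (Suc i)" "entry lam i \<le> entry lam 1" using lam_bd i by auto
          ultimately show ?thesis by (auto simp: ind_def)
        qed
        then show "mu \<in> B" using nu by (simp add: B_def)
      qed
      have ent: "i \<in> {1..n} \<Longrightarrow> lower J (entry (badd J nu)) i = entry nu i" if "nu \<in> GT n" for nu i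
        using GT_length[OF that] by (simp add: lower_def entry_badd raise_def)
      have "(\<Sum>nu\<in>below n lam. level_kernel \<theta> n (entry lam) (entry nu) *\<^sub>R
          (if badd J nu \<in> GT n then pieri_coeff \<theta> n (entry nu) J *\<^sub>R G (badd J nu) else 0)) =
        (\<Sum>nu\<in>C. level_kernel \<theta> n (entry lam) (entry nu) *\<^sub>R pieri_coeff \<theta> n (entry nu) J *\<^sub>R G (badd J nu))"
        unfolding C_def by (rule sum.mono_neutral_cong_right) (auto simp: finite_below)
      also have "\<dots> = (\<Sum>nu\<in>C. h (badd J nu))"
      proof (rule sum.cong[OF refl])
        fix nu assume "nu \<in> C"
        then have nu: "nu \<in> GT n" by (auto simp: C_def below_GT)
        have "pieri_coeff \<theta> n (lower J (entry (badd J nu))) J = pieri_coeff \<theta> n (entry nu) J"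
          "level_kernel \<theta> n (entry lam) (lower J (entry (badd J nu))) = level_kernel \<theta> n (entry lam) (entry nu)"
          by (intro pieri_coeff_cong level_kernel_cong J ent[OF nu] refl; assumption)+
        then show "level_kernel \<theta> n (entry lam) (entry nu) *\<^sub>R pieri_coeff \<theta> n (entry nu) J *\<^sub>R G (badd J nu) = h (badd J nu)"
          by (simp add: h_def mult.commute)
      qed
      also have "\<dots> = (\<Sum>mu\<in>badd J ` C. h mu)" by (simp add: sum.reindex inj_badd)
      also have "\<dots> = (\<Sum>mu\<in>B. h mu)"
      proof (rule sum.mono_neutral_left[OF finB CB], rule ballI, rule ccontr)
        fix mu assume mu: "mu \<in> B - badd J ` C" and nz: "h mu \<noteq> 0"
        have len': "length mu = n" using mu BGT GT_length by auto
        have "level_kernel \<theta> n (entry lam) (lower J (entry mu)) \<noteq> 0" using nz by (auto simp: h_def)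
        also have "level_kernel \<theta> n (entry lam) (lower J (entry mu)) = level_kernel \<theta> n (entry lam) (entry (bsub J mu))"
          by (rule level_kernel_cong) (auto simp: entry_bsub len')
        finally have "bsub J mu \<in> below n lam" using len' by (intro below_eq_if_kernel[OF lam]) auto
        then have "bsub J mu \<in> C" using mu BGT by (auto simp: C_def badd_bsub)
        then have "mu \<in> badd J ` C" by (metis badd_bsub(1) image_eqI)
        then show False using mu by simp
      qed
      finally show ?thesis unfolding h_def .
    qed
    have subn: "I - {Suc n} \<subseteq> {1..n}" if "I \<in> S" for I using that by (auto simp: S_def)
    have "(\<Sum>I\<in>S. if badd I lam \<in> GT (Suc n) then pieri_coeff \<theta> (Suc n) (entry lam) I *\<^sub>R normed_sum \<theta> (Suc n) (badd I lam) \<phi> else 0) =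
      c *\<^sub>R (\<Sum>I\<in>S. \<Sum>mu\<in>B. (dual_coeff \<theta> (Suc n) (entry lam) I * level_kernel \<theta> n (raise I (entry lam)) (entry mu)) *\<^sub>R G mu)"
      by (simp add: L scaleR_sum_right cong: sum.cong_simp)
    also have "\<dots> = c *\<^sub>R (\<Sum>mu\<in>B. (\<Sum>I\<in>S. dual_coeff \<theta> (Suc n) (entry lam) I * level_kernel \<theta> n (raise I (entry lam)) (entry mu)) *\<^sub>R G mu)"
      by (subst sum.swap) (simp only: scaleR_sum_left)
    also have "\<dots> = c *\<^sub>R (\<Sum>mu\<in>B. (\<Sum>I\<in>S. pieri_coeff \<theta> n (lower (I - {Suc n}) (entry mu)) (I - {Suc n}) *
         level_kernel \<theta> n (entry lam) (lower (I - {Suc n}) (entry mu))) *\<^sub>R G mu)"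
      unfolding S_def intertwining[OF Suc.prems(2)] ..
    also have "\<dots> = c *\<^sub>R (\<Sum>I\<in>S. \<Sum>mu\<in>B. (pieri_coeff \<theta> n (lower (I - {Suc n}) (entry mu)) (I - {Suc n}) *
         level_kernel \<theta> n (entry lam) (lower (I - {Suc n}) (entry mu))) *\<^sub>R G mu)"
      by (subst sum.swap) (simp only: scaleR_sum_left)
    also have "\<dots> = c *\<^sub>R (\<Sum>I\<in>S. \<Sum>nu\<in>below n lam. level_kernel \<theta> n (entry lam) (entry nu) *\<^sub>R
          (if badd (I - {Suc n}) nu \<in> GT n then pieri_coeff \<theta> n (entry nu) (I - {Suc n}) *\<^sub>R G (badd (I - {Suc n}) nu) else 0))"
      using R2[OF subn] by simp
    also have "\<dots> = c *\<^sub>R (\<Sum>nu\<in>below n lam. level_kernel \<theta> n (entry lam) (entry nu) *\<^sub>R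
          (\<Sum>I\<in>S. if badd (I - {Suc n}) nu \<in> GT n then pieri_coeff \<theta> n (entry nu) (I - {Suc n}) *\<^sub>R G (badd (I - {Suc n}) nu) else 0))"
      by (subst sum.swap) (simp only: scaleR_sum_right)
    also have "\<dots> = c *\<^sub>R (\<Sum>nu\<in>below n lam. level_kernel \<theta> n (entry lam) (entry nu) *\<^sub>R
          (\<Sum>I\<in>S. normed_sum \<theta> n nu (\<lambda>\<xi>. \<phi> (\<lambda>i. (\<xi>(Suc n := sum_list lam - sum_list nu)) i + ind I i))))"
      using R1[OF below_GT] by simp
    also have "\<dots> = (\<Sum>I\<in>S. normed_sum \<theta> (Suc n) lam (\<lambda>\<xi>. \<phi> (\<lambda>i. \<xi> i + ind I i)))"
      unfolding normed_sum_Suc[OF lam \<theta>] c_def[symmetric] scaleR_sum_right by (rule sum.swap)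
    finally show "(\<Sum>I | I \<subseteq> {1..Suc n} \<and> card I = r. if badd I lam \<in> GT (Suc n) then pieri_coeff \<theta> (Suc n) (entry lam) I *\<^sub>R normed_sum \<theta> (Suc n) (badd I lam) \<phi> else 0) =
      (\<Sum>I | I \<subseteq> {1..Suc n} \<and> card I = r. normed_sum \<theta> (Suc n) lam (\<lambda>\<xi>. \<phi> (\<lambda>i. \<xi> i + ind I i)))"
      unfolding S_def .
  qed
qed

section \<open>Normalization, exchangeability and a transform of the increments\<close>

lemma continuous_on_pochhammer_real:
  fixes f :: "real \<Rightarrow> real"
  shows "continuous_on A f \<Longrightarrow> continuous_on A (\<lambda>x. pochhammer (f x) n)"
  unfolding pochhammer_prod by (intro continuous_intros)

lemma continuous_jack_branch:
  assumes lam: "lam \<in> GT (Suc n)" and mu: "mu \<in> below n lam"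
  shows "continuous_on {0<..} (\<lambda>\<theta>. jack_branch \<theta> n lam mu)"
  unfolding jack_branch_def Let_def
proof (intro continuous_on_prod continuous_on_mult continuous_on_divide continuous_on_pochhammer_real continuous_intros ballI)
  fix j i \<theta> assume ij: "j \<in> {1..n}" "i \<in> {1..j}" and \<theta>: "\<theta> \<in> {0::real<..}"
  have "entry mu j \<le> entry mu i" "entry mu i \<le> entry lam i"
    using mu ij GT_antimono[of mu n i j] by (auto simp: below_def)
  moreover have "0 \<le> \<theta> * (real j - real i)" using \<theta> ij by auto
  ultimately have "real_of_int (part mu i - part mu j) + \<theta> * (real j - real i) \<ge> 0"
    "real_of_int (part lam i - part mu j) + \<theta> * (real j - real i) \<ge> 0"
    by (auto simp: entry_def)
  then show "pochhammer (real_of_int (part mu i - part mu j) + \<theta> * (real j - real i) + 1) (nat (part mu j - part lam (j + 1))) \<noteq> 0"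
    "pochhammer (real_of_int (part lam i - part mu j) + \<theta> * (real j - real i) + \<theta>) (nat (part mu j - part lam (j + 1))) \<noteq> 0"
    using \<theta> by (auto intro!: pochhammer_pos less_imp_neq[symmetric])
qed

lemma continuous_step_sum:
  fixes \<phi> :: "(nat \<Rightarrow> int) \<Rightarrow> 'a::real_normed_vector"
  assumes "lam \<in> GT N"
  shows "continuous_on {0<..} (\<lambda>\<theta>. step_sum \<theta> N lam \<phi>)"
  using assms
proof (induction N arbitrary: lam \<phi>)
  case (Suc n)
  then show ?case
    by (auto intro!: continuous_on_sum continuous_on_scaleR continuous_jack_branch simp: below_GT)
qed simp

lemma continuous_normed_sum:
  fixes \<phi> :: "(nat \<Rightarrow> int) \<Rightarrow> 'a::real_normed_vector"
  assumes "lam \<in> GT N"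
  shows "continuous_on {0<..} (\<lambda>\<theta>. normed_sum \<theta> N lam \<phi>)"
  unfolding normed_sum_def
proof (intro continuous_on_scaleR continuous_on_divide continuous_step_sum assms continuous_on_const ballI)
  show "level_norm \<theta> N (entry lam) \<noteq> 0" if "\<theta> \<in> {0<..}" for \<theta>
    using level_norm_pos[OF assms, of \<theta>] that by auto
  show "continuous_on {0<..} (\<lambda>\<theta>. level_norm \<theta> N (entry lam))"
    unfolding level_norm_def case_prod_unfold
  proof (rule continuous_on_prod)
    fix x assume x: "x \<in> pairs N"
    have d: "shifted \<theta> (entry lam) (fst x) - shifted \<theta> (entry lam) (snd x) > 0" if "\<theta> > 0" for \<theta>
      using shifted_diff_ge[OF assms, of "fst x" "snd x" \<theta>] x that by auto
    have "continuous_on {0<..} (Gamma :: real \<Rightarrow> real)" by (intro continuous_on_Gamma) (auto elim!: nonpos_Ints_cases)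
    note G = continuous_on_compose2[OF this]
    have c: "continuous_on {0<..} (\<lambda>\<theta>. shifted \<theta> (entry lam) (fst x) - shifted \<theta> (entry lam) (snd x))"
      unfolding shifted_def by (intro continuous_intros)
    have "continuous_on {0<..} (\<lambda>\<theta>. Gamma (shifted \<theta> (entry lam) (fst x) - shifted \<theta> (entry lam) (snd x)))"
      using d by (intro G c) auto
    moreover have "continuous_on {0<..} (\<lambda>\<theta>. Gamma (shifted \<theta> (entry lam) (fst x) - shifted \<theta> (entry lam) (snd x) + \<theta>))"
      using d by (intro G continuous_on_add c continuous_on_id) (auto intro!: add_pos_pos)
    moreover have "Gamma (shifted \<theta> (entry lam) (fst x) - shifted \<theta> (entry lam) (snd x)) \<noteq> 0" if "\<theta> > 0" for \<theta>
      using Gamma_real_pos[OF d[OF that]] by simp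
    ultimately show "continuous_on {0<..} (\<lambda>\<theta>. Gamma (shifted \<theta> (entry lam) (fst x) - shifted \<theta> (entry lam) (snd x) + \<theta>) /
        Gamma (shifted \<theta> (entry lam) (fst x) - shifted \<theta> (entry lam) (snd x)))"
      by (intro continuous_on_divide) auto
  qed
qed

lemma continuous_pieri_coeff:
  assumes "lam \<in> GT N" "I \<subseteq> {1..N}"
  shows "continuous_on {0<..} (\<lambda>\<theta>. pieri_coeff \<theta> N (entry lam) I)"
  unfolding pieri_coeff_def
proof (intro continuous_on_prod continuous_on_divide ballI)
  fix i j \<theta> assume ij: "i \<in> I" "j \<in> {1..N} - I" and \<theta>: "\<theta> \<in> {0::real<..}"
  have "i \<noteq> j" using ij by auto
  then have "(i, j) \<in> pairs N \<or> (j, i) \<in> pairs N" using ij assms(2) by (auto simp: pairs_def)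
  then show "shifted \<theta> (entry lam) i - shifted \<theta> (entry lam) j \<noteq> 0"
    using shifted_diff_ge[OF assms(1), of i j \<theta>] shifted_diff_ge[OF assms(1), of j i \<theta>] \<theta> by auto
qed (auto simp: shifted_def intro!: continuous_intros)

text \<open>The difference of both sides is continuous in \<theta>. The set where it is nonzero is
  open and consists of rationals, hence is empty, because a nonempty open set is not
  countable.\<close>

lemma pieri:
  assumes "\<theta> > 0"
  shows "pieri_holds TYPE('a::real_normed_vector) \<theta> N"
  unfolding pieri_holds_def
proof (intro ballI allI)
  fix lam r and \<phi> :: "(nat \<Rightarrow> int) \<Rightarrow> 'a"
  assume lam: "lam \<in> GT N"
  define F where "F = (\<lambda>\<theta>. (\<Sum>I | I \<subseteq> {1..N} \<and> card I = r. if badd I lam \<in> GT N then pieri_coeff \<theta> N (entry lam) I *\<^sub>R normed_sum \<theta> N (badd I lam) \<phi> else 0) -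
     (\<Sum>I | I \<subseteq> {1..N} \<and> card I = r. normed_sum \<theta> N lam (\<lambda>\<xi>. \<phi> (\<lambda>i. \<xi> i + ind I i))))"
  have "continuous_on {0<..} (\<lambda>\<theta>. if badd I lam \<in> GT N then pieri_coeff \<theta> N (entry lam) I *\<^sub>R normed_sum \<theta> N (badd I lam) \<phi> else 0)"
    if "I \<subseteq> {1..N}" for I
    using that by (cases "badd I lam \<in> GT N")
      (auto intro!: continuous_on_scaleR continuous_pieri_coeff continuous_normed_sum lam)
  then have "continuous_on {0<..} F" unfolding F_def
    by (intro continuous_on_diff continuous_on_sum continuous_normed_sum lam) auto
  then have "open (F -` (- {0}) \<inter> {0<..})"
    by (subst (asm) continuous_on_open_vimage) auto
  moreover have "countable \<rat>" by (rule countable_rat)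
  moreover have "F x = 0" if "x > 0" "x \<notin> \<rat>" for x
    using pieri_irrational[OF that, where 'a = 'a and N = N] lam unfolding pieri_holds_def F_def by auto
  ultimately have "F -` (- {0}) \<inter> {0<..} = {}"
    using open_minus_countable[of \<rat> "F -` (- {0}) \<inter> {0<..}"] by force
  then have "F \<theta> = 0" using assms by auto
  then show "(\<Sum>I | I \<subseteq> {1..N} \<and> card I = r. if badd I lam \<in> GT N then pieri_coeff \<theta> N (entry lam) I *\<^sub>R normed_sum \<theta> N (badd I lam) \<phi> else 0) =
     (\<Sum>I | I \<subseteq> {1..N} \<and> card I = r. normed_sum \<theta> N lam (\<lambda>\<xi>. \<phi> (\<lambda>i. \<xi> i + ind I i)))"
    by (simp add: F_def)
qed

section \<open>Induction on signatures and uniqueness for Pieri sums\<close>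

lemma sum_subset_initial_less:
  assumes "I \<subseteq> {1..N}" "card I = r" "I \<noteq> {1..r}"
  shows "(\<Sum>i\<in>{1..r}. int i) < (\<Sum>i\<in>I. int i)"
proof -
  have fin: "finite I" using assms finite_subset by blast
  have c: "card (I - {1..r}) = card ({1..r} - I)"
    using assms(2) fin by (metis card_Diff_subset_Int card_atLeastAtMost diff_Suc_1 finite_Int inf_commute finite_atLeastAtMost)
  have "\<not> I \<subseteq> {1..r}" using assms card_subset_eq[of "{1..r}" I] by auto
  then have pos: "card (I - {1..r}) > 0" using fin by (auto simp: card_gt_0_iff)
  have "(\<Sum>i\<in>{1..r} - I. int i) \<le> (\<Sum>i\<in>{1..r} - I. int r)" by (intro sum_mono) auto
  also have "\<dots> < int (card (I - {1..r})) * (int r + 1)" using pos c by simp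
  also have "\<dots> = (\<Sum>i\<in>I - {1..r}. int r + 1)" by simp
  also have "\<dots> \<le> (\<Sum>i\<in>I - {1..r}. int i)"
    using assms(1) by (intro sum_mono) auto
  finally have "(\<Sum>i\<in>{1..r} - I. int i) < (\<Sum>i\<in>I - {1..r}. int i)" .
  moreover have "(\<Sum>i\<in>{1..r}. int i) = (\<Sum>i\<in>{1..r} - I. int i) + (\<Sum>i\<in>{1..r} \<inter> I. int i)"
    by (subst sum.Int_Diff[of "{1..r}" _ I]) auto
  moreover have "(\<Sum>i\<in>I. int i) = (\<Sum>i\<in>I - {1..r}. int i) + (\<Sum>i\<in>{1..r} \<inter> I. int i)"
    using fin by (subst sum.Int_Diff[of I _ "{1..r}"]) (auto simp: Int_commute)
  ultimately show ?thesis by simp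
qed

text \<open>One box is stripped from each of the r longest rows. Any other way of adding r boxes to
  the result gives the same total but pushes boxes to later rows, so the sum of the i times entry i
  grows; this is the second component of the lexicographic measure. The rule \<open>down\<close>
  reaches signatures with negative entries.\<close>

lemma GT_induct:
  assumes lam: "lam \<in> GT N"
    and zero: "P (replicate N 0)"
    and up: "\<And>lam r. \<lbrakk>lam \<in> GT N; r \<in> {1..N}; P lam; badd {1..r} lam \<in> GT N;
       \<And>I. \<lbrakk>I \<subseteq> {1..N}; card I = r; I \<noteq> {1..r}; badd I lam \<in> GT N\<rbrakk> \<Longrightarrow> P (badd I lam)\<rbrakk> \<Longrightarrow> P (badd {1..r} lam)"
    and down: "\<And>lam. \<lbrakk>lam \<in> GT N; P (badd {1..N} lam)\<rbrakk> \<Longrightarrow> P lam"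
  shows "P lam"
proof -
  define wt where "wt = (\<lambda>lam. \<Sum>i\<in>{1..N}. int i * entry lam i)"
  define m where "m = (\<lambda>lam. (nat (sum_list lam), nat (int N * sum_list lam - wt lam)))"
  have nonneg: "P lam" if "lam \<in> GT N" "\<And>i. i \<in> {1..N} \<Longrightarrow> entry lam i \<ge> 0" for lam
    using that
  proof (induction "m lam" arbitrary: lam rule: wf_induct_rule[OF wf_lex_prod[OF wf_less_than wf_less_than]])
    case (1 lam)
    have len: "length lam = N" using 1 by (simp add: GT_length)
    have sum_ge: "sum_list mu \<ge> 0" "wt mu \<le> int N * sum_list mu"
      if "length mu = N" "\<And>i. i \<in> {1..N} \<Longrightarrow> entry mu i \<ge> 0" for mu
    proof -
      show "sum_list mu \<ge> 0" unfolding sum_list_entry[OF that(1)] using that(2) by (intro sum_nonneg) auto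
      show "wt mu \<le> int N * sum_list mu" unfolding sum_list_entry[OF that(1)] wt_def sum_distrib_left
        using that(2) by (intro sum_mono mult_right_mono) auto
    qed
    show ?case
    proof (cases "\<forall>i\<in>{1..N}. entry lam i = 0")
      case True
      then have "lam = replicate N 0" using len by (intro entry_eqI[of _ N]) (auto simp: entry_def)
      then show ?thesis using zero by simp
    next
      case False
      then have N: "N \<ge> 1" by (cases N) auto
      have "entry lam 1 \<noteq> 0"
      proof
        assume "entry lam 1 = 0"
        then have "entry lam i = 0" if "i \<in> {1..N}" for i
          using 1(3)[OF that] GT_antimono[OF 1(2), of 1 i] that by auto
        then show False using False by blast
      qed
      then have pos: "entry lam 1 \<ge> 1" using 1(3)[of 1] N by auto
      \<comment> \<open>The rows of maximal length form an initial segment, and shortening all of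
        them by one leaves a signature.\<close>
      define R where "R = {i \<in> {1..N}. entry lam i = entry lam 1}"
      define r where "r = Max R"
      have "1 \<in> R" "finite R" using N by (auto simp: R_def)
      then have rR: "r \<in> R" unfolding r_def by (intro Max_in) auto
      have R: "R = {1..r}"
      proof
        show "R \<subseteq> {1..r}" using \<open>finite R\<close> by (auto simp: r_def) (auto simp: R_def)
        show "{1..r} \<subseteq> R"
        proof
          fix i assume i: "i \<in> {1..r}"
          have "r \<le> N" "entry lam r = entry lam 1" using rR by (auto simp: R_def)
          then show "i \<in> R" using i GT_antimono[OF 1(2), of 1 i] GT_antimono[OF 1(2), of i r] by (auto simp: R_def)
        qed
      qed
      have rN: "r \<in> {1..N}" using rR by (auto simp: R_def)
      define nu where "nu = bsub {1..r} lam"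
      have nu_len: "length nu = N" by (simp add: nu_def len)
      have lam_nu: "lam = badd {1..r} nu" by (simp add: nu_def badd_bsub)
      have ent: "entry nu i = entry lam i - (if i \<in> R then 1 else 0)" if "i \<in> {1..N}" for i
        using that len by (simp add: nu_def entry_bsub lower_def ind_def R)
      have nu: "nu \<in> GT N"
        unfolding GT_iff
      proof (intro conjI nu_len ballI)
        fix i assume i: "i \<in> {1..<N}"
        then have "entry lam (Suc i) \<le> entry lam i" using 1(2) by (auto simp: GT_iff)
        moreover have "entry lam (Suc i) \<noteq> entry lam i" if "i \<in> R" "Suc i \<notin> R"
          using that i by (auto simp: R_def)
        ultimately show "entry nu (Suc i) \<le> entry nu i" using i ent[of i] ent[of "Suc i"] by auto
      qed
      have nu_nonneg: "entry nu i \<ge> 0" if "i \<in> {1..N}" for i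
        using ent[OF that] 1(3)[OF that] pos by (auto simp: R_def)
      have sum: "sum_list (badd I nu) = sum_list nu + int (card I)" if "I \<subseteq> {1..N}" for I
        by (rule sum_list_badd[OF nu_len that])
      have wt: "wt (badd I nu) = wt nu + (\<Sum>i\<in>I. int i)" if "I \<subseteq> {1..N}" for I
      proof -
        have "wt (badd I nu) = (\<Sum>i\<in>{1..N}. int i * entry nu i + (if i \<in> I then int i else 0))"
          unfolding wt_def using nu_len by (intro sum.cong refl) (auto simp: entry_badd raise_def ind_def algebra_simps)
        also have "\<dots> = wt nu + (\<Sum>i\<in>{1..N}. if i \<in> I then int i else 0)" by (simp add: wt_def sum.distrib)
        also have "(\<Sum>i\<in>{1..N}. if i \<in> I then int i else 0) = (\<Sum>i\<in>I. int i)"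
          using that by (subst sum.inter_restrict[symmetric]) (auto simp: Int_absorb1)
        finally show ?thesis .
      qed
      have r_sub: "{1..r} \<subseteq> {1..N}" using rN by auto
      have "P nu"
      proof (rule 1(1))
        have "sum_list lam = sum_list nu + int r" using sum[OF r_sub] lam_nu by simp
        then show "(m nu, m lam) \<in> less_than <*lex*> less_than"
          using sum_ge(1)[OF nu_len nu_nonneg] rN by (simp add: m_def)
      qed (use nu nu_nonneg in auto)
      moreover have "P (badd I nu)" if I: "I \<subseteq> {1..N}" "card I = r" "I \<noteq> {1..r}" "badd I nu \<in> GT N" for I
      proof (rule 1(1)[OF _ I(4)])
        show nn: "entry (badd I nu) i \<ge> 0" if "i \<in> {1..N}" for i
          using nu_nonneg[OF that] that nu_len by (simp add: entry_badd raise_def ind_def)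
        have s: "sum_list (badd I nu) = sum_list lam" using sum[OF I(1)] sum[OF r_sub] I(2) lam_nu by simp
        have "wt (badd I nu) > wt lam"
          using wt[OF I(1)] wt[OF r_sub] sum_subset_initial_less[OF I(1-3)] lam_nu by simp
        moreover have "wt (badd I nu) \<le> int N * sum_list (badd I nu)"
          using nu_len nn by (intro sum_ge) auto
        ultimately show "(m (badd I nu), m lam) \<in> less_than <*lex*> less_than"
          unfolding m_def s by simp
      qed
      moreover have "badd {1..r} nu \<in> GT N" using 1(2) lam_nu by simp
      ultimately have "P (badd {1..r} nu)" using nu rN by (intro up) auto
      then show ?thesis using lam_nu by simp
    qed
  qed
  have "P lam" if "lam \<in> GT N" "\<And>i. i \<in> {1..N} \<Longrightarrow> entry lam i \<ge> - int K" for K lam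
    using that
  proof (induction K arbitrary: lam)
    case 0
    then show ?case by (intro nonneg) auto
  next
    case (Suc K)
    have len: "length lam = N" using Suc by (simp add: GT_length)
    have ent: "entry (badd {1..N} lam) i = entry lam i + 1" if "i \<in> {1..N}" for i
      using that len by (simp add: entry_badd raise_def ind_def)
    have "P (badd {1..N} lam)"
    proof (rule Suc.IH)
      show "badd {1..N} lam \<in> GT N" using Suc.prems(1) len ent by (auto simp: GT_iff)
      show "entry (badd {1..N} lam) i \<ge> - int K" if "i \<in> {1..N}" for i using Suc.prems(2)[OF that] ent[OF that] by simp
    qed
    then show ?case using down Suc.prems(1) by blast
  qed
  moreover have "entry lam i \<ge> - int (nat (- entry lam N))" if "i \<in> {1..N}" for i
    using GT_antimono[OF lam, of i N] that by auto
  ultimately show ?thesis using lam by blast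
qed

lemma badd_all_GT: "lam \<in> GT N \<Longrightarrow> badd {1..N} lam \<in> GT N"
  by (auto simp: GT_iff entry_badd raise_def ind_def)

lemma pieri_coeff_initial_pos:
  assumes "lam \<in> GT N" "r \<le> N" "\<theta> > 0"
  shows "pieri_coeff \<theta> N (entry lam) {1..r} > 0"
  unfolding pieri_coeff_def
proof (intro prod_pos ballI)
  fix i j assume "i \<in> {1..r}" "j \<in> {1..N} - {1..r}"
  then have "(i, j) \<in> pairs N" by (auto simp: pairs_def)
  from shifted_diff_ge[OF assms(1) this assms(3)]
  show "0 < (shifted \<theta> (entry lam) i - shifted \<theta> (entry lam) j + \<theta>) / (shifted \<theta> (entry lam) i - shifted \<theta> (entry lam) j)"
    using assms(3) by auto
qed

text \<open>If the result is no signature, then I contains i + 1 but not i for two equal rows, and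
  their shifted coordinates differ by exactly - \<theta>, which makes a numerator vanish.\<close>

lemma pieri_coeff_zero:
  assumes lam: "lam \<in> GT N" and I: "I \<subseteq> {1..N}" and "badd I lam \<notin> GT N"
  shows "pieri_coeff \<theta> N (entry lam) I = 0"
proof -
  have len: "length lam = N" using lam by (rule GT_length)
  obtain i where i: "i \<in> {1..<N}" "entry (badd I lam) (Suc i) > entry (badd I lam) i"
    using assms(3) len by (auto simp: GT_iff not_le)
  have "entry lam (Suc i) \<le> entry lam i" using lam i(1) by (auto simp: GT_iff)
  moreover have "entry lam (Suc i) + ind I (Suc i) > entry lam i + ind I i"
    using i len by (simp add: entry_badd raise_def)
  ultimately have I': "Suc i \<in> I" "i \<notin> I" "entry lam (Suc i) = entry lam i" by (auto simp: ind_def split: if_splits)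
  have fin: "finite I" using I finite_subset by blast
  have "shifted \<theta> (entry lam) (Suc i) - shifted \<theta> (entry lam) i + \<theta> = 0" using I' by (simp add: shifted_def algebra_simps)
  then have "(\<Prod>j\<in>{1..N} - I. (shifted \<theta> (entry lam) (Suc i) - shifted \<theta> (entry lam) j + \<theta>) / (shifted \<theta> (entry lam) (Suc i) - shifted \<theta> (entry lam) j)) = 0"
    using i(1) I' by (intro prod_zero bexI[of _ i]) auto
  then have "\<exists>k\<in>I. (\<Prod>j\<in>{1..N} - I. (shifted \<theta> (entry lam) k - shifted \<theta> (entry lam) j + \<theta>) / (shifted \<theta> (entry lam) k - shifted \<theta> (entry lam) j)) = 0"
    using I'(1) by blast
  then show ?thesis unfolding pieri_coeff_def by (rule prod_zero[OF fin])
qed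

definition pieri_sum :: "real \<Rightarrow> nat \<Rightarrow> int list \<Rightarrow> nat \<Rightarrow> (int list \<Rightarrow> 'a::real_vector) \<Rightarrow> 'a" where
  "pieri_sum \<theta> N lam r F =
     (\<Sum>I | I \<subseteq> {1..N} \<and> card I = r. pieri_coeff \<theta> N (entry lam) I *\<^sub>R F (badd I lam))"

lemma pieri_normed_sum:
  fixes \<phi> :: "(nat \<Rightarrow> int) \<Rightarrow> 'a::real_normed_vector"
  assumes "\<theta> > 0" "lam \<in> GT N"
  shows "pieri_sum \<theta> N lam r (\<lambda>nu. normed_sum \<theta> N nu \<phi>) =
     (\<Sum>I | I \<subseteq> {1..N} \<and> card I = r. normed_sum \<theta> N lam (\<lambda>\<xi>. \<phi> (\<lambda>i. \<xi> i + ind I i)))"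
proof -
  have "pieri_sum \<theta> N lam r (\<lambda>nu. normed_sum \<theta> N nu \<phi>) = (\<Sum>I | I \<subseteq> {1..N} \<and> card I = r.
     if badd I lam \<in> GT N then pieri_coeff \<theta> N (entry lam) I *\<^sub>R normed_sum \<theta> N (badd I lam) \<phi> else 0)"
    unfolding pieri_sum_def by (intro sum.cong refl) (auto simp: pieri_coeff_zero[OF assms(2)])
  then show ?thesis using pieri[OF assms(1), where 'a = 'a and N = N] assms(2) unfolding pieri_holds_def by simp
qed

lemma normed_sum_badd_all:
  fixes \<phi> :: "(nat \<Rightarrow> int) \<Rightarrow> 'a::real_normed_vector"
  assumes "\<theta> > 0" "lam \<in> GT N"
  shows "normed_sum \<theta> N (badd {1..N} lam) \<phi> = normed_sum \<theta> N lam (\<lambda>\<xi>. \<phi> (\<lambda>i. \<xi> i + ind {1..N} i))"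
proof -
  have "{I. I \<subseteq> {1..N} \<and> card I = N} = {{1..N}}"
    using card_subset_eq[of "{1..N}"] by auto
  moreover have "pieri_coeff \<theta> N (entry lam) {1..N} = 1" by (simp add: pieri_coeff_def)
  ultimately show ?thesis using pieri_normed_sum[OF assms, of N \<phi>] by (simp add: pieri_sum_def)
qed

text \<open>The coefficient of the leading set {1..r} is positive, so the Pieri sum can be solved
  for its term once all others are known. The index type of F and H stays abstract: it will be a
  unit, a test function, or the parameter u.\<close>

lemma pieri_unique:
  assumes \<theta>: "\<theta> > 0" and lam: "lam \<in> GT N"
    and zero: "F (replicate N 0) = (H (replicate N 0) :: 'i \<Rightarrow> 'a::real_vector)"
    and up: "\<And>lam r u. \<lbrakk>lam \<in> GT N; F lam = H lam\<rbrakk> \<Longrightarrow>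
       pieri_sum \<theta> N lam r (\<lambda>nu. F nu u) = pieri_sum \<theta> N lam r (\<lambda>nu. H nu u)"
    and down: "\<And>lam. \<lbrakk>lam \<in> GT N; F (badd {1..N} lam) = H (badd {1..N} lam)\<rbrakk> \<Longrightarrow> F lam = H lam"
  shows "F lam = H lam"
  using lam zero
proof (rule GT_induct)
  fix lam r assume lam: "lam \<in> GT N" "r \<in> {1..N}" "F lam = H lam" "badd {1..r} lam \<in> GT N"
    and IH: "\<And>I. \<lbrakk>I \<subseteq> {1..N}; card I = r; I \<noteq> {1..r}; badd I lam \<in> GT N\<rbrakk> \<Longrightarrow> F (badd I lam) = H (badd I lam)"
  show "F (badd {1..r} lam) = H (badd {1..r} lam)"
  proof
    fix u
    define S where "S = {I. I \<subseteq> {1..N} \<and> card I = r}"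
    have S: "finite S" "{1..r} \<in> S" using lam(2) by (auto simp: S_def)
    have "pieri_coeff \<theta> N (entry lam) I *\<^sub>R F (badd I lam) u = pieri_coeff \<theta> N (entry lam) I *\<^sub>R H (badd I lam) u"
      if "I \<in> S - {{1..r}}" for I
      using IH[of I] pieri_coeff_zero[OF lam(1), of I \<theta>] that by (cases "badd I lam \<in> GT N") (auto simp: S_def)
    then have "(\<Sum>I\<in>S - {{1..r}}. pieri_coeff \<theta> N (entry lam) I *\<^sub>R F (badd I lam) u) =
        (\<Sum>I\<in>S - {{1..r}}. pieri_coeff \<theta> N (entry lam) I *\<^sub>R H (badd I lam) u)" by (rule sum.cong[OF refl])
    moreover have "(\<Sum>I\<in>S. pieri_coeff \<theta> N (entry lam) I *\<^sub>R F (badd I lam) u) =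
        (\<Sum>I\<in>S. pieri_coeff \<theta> N (entry lam) I *\<^sub>R H (badd I lam) u)"
      using up[OF lam(1,3), of r u] unfolding pieri_sum_def S_def .
    ultimately have "pieri_coeff \<theta> N (entry lam) {1..r} *\<^sub>R F (badd {1..r} lam) u = pieri_coeff \<theta> N (entry lam) {1..r} *\<^sub>R H (badd {1..r} lam) u"
      by (simp add: sum.remove[OF S])
    then show "F (badd {1..r} lam) u = H (badd {1..r} lam) u"
      using pieri_coeff_initial_pos[OF lam(1) _ \<theta>, of r] lam(2) by simp
  qed
qed (use down in auto)


section \<open>Value at all ones and symmetry\<close>

lemma pieri_coeff_sum_prod:
  fixes c :: "nat \<Rightarrow> real"
  assumes lam: "lam \<in> GT N" and \<theta>: "\<theta> > 0"
    and c: "\<And>s. s > 0 \<Longrightarrow> (\<Sum>I\<in>Pow {1..N}. s ^ card I * (pieri_coeff \<theta> N (entry lam) I * (\<Prod>i\<in>I. c i))) = (\<Prod>i\<in>{1..N}. 1 + s * d i)"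
  shows "(\<Sum>I | I \<subseteq> {1..N} \<and> card I = r. pieri_coeff \<theta> N (entry lam) I * (\<Prod>i\<in>I. c i)) =
     (\<Sum>I | I \<subseteq> {1..N} \<and> card I = r. \<Prod>i\<in>I. d i)"
proof -
  have "(\<Prod>i\<in>{1..N}. 1 + s * d i) = (\<Sum>I\<in>Pow {1..N}. s ^ card I * (\<Prod>i\<in>I. d i))" for s
    using prod_add[of "{1..N}" "\<lambda>i. s * d i" "\<lambda>_. 1"] by (simp add: add.commute prod.distrib)
  then have "(\<Sum>I | I \<in> Pow {1..N} \<and> card I = r. pieri_coeff \<theta> N (entry lam) I * (\<Prod>i\<in>I. c i)) =
     (\<Sum>I | I \<in> Pow {1..N} \<and> card I = r. \<Prod>i\<in>I. d i)"
    using c by (intro graded_coeff_eq) auto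
  then show ?thesis by simp
qed

lemma inj_shifted:
  assumes "lam \<in> GT N" "\<theta> > 0"
  shows "inj_on (shifted \<theta> (entry lam)) {1..N}"
proof (rule linorder_inj_onI)
  fix i j :: nat assume "i < j" "i \<in> {1..N}" "j \<in> {1..N}"
  then have "(i, j) \<in> pairs N" by (auto simp: pairs_def)
  from shifted_diff_ge[OF assms(1) this assms(2)]
  show "shifted \<theta> (entry lam) i \<noteq> shifted \<theta> (entry lam) j" using assms(2) by auto
qed auto

text \<open>The kernel sum with an empty second set is (1 + s)^N. Equivalently, the constant
  function is consistent with the Pieri relation.\<close>

lemma pieri_coeff_sum:
  assumes lam: "lam \<in> GT N" and \<theta>: "\<theta> > 0"
  shows "(\<Sum>I | I \<subseteq> {1..N} \<and> card I = r. pieri_coeff \<theta> N (entry lam) I) = real (card {I. I \<subseteq> {1..N} \<and> card I = r})"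
proof -
  have "(\<Sum>I\<in>Pow {1..N}. s ^ card I * (pieri_coeff \<theta> N (entry lam) I * (\<Prod>i\<in>I. 1))) = (\<Prod>i\<in>{1..N}. 1 + s * 1)" for s
    using kernel_sum_image[OF _ inj_shifted[OF lam \<theta>], of "\<lambda>_. 0" "{}" s \<theta>]
      kernel_sum_empty_right[of "shifted \<theta> (entry lam) ` {1..N}" s \<theta>] inj_shifted[OF lam \<theta>]
    by (simp add: pieri_coeff_def card_image)
  then show ?thesis using pieri_coeff_sum_prod[OF lam \<theta>, of "\<lambda>_. 1" "\<lambda>_. 1" r] by simp
qed

lemma below_replicate: "below n (replicate (Suc n) 0) = {replicate n 0}"
proof -
  have e: "entry (replicate (Suc n) (0::int)) i = 0" if "i \<in> {1..Suc n}" for i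
    using that nth_replicate[of "i - 1" "Suc n" "0::int"] by (auto simp: entry_def simp del: replicate.simps)
  have e': "entry (replicate n (0::int)) i = 0" if "i \<in> {1..n}" for i
    using that nth_replicate[of "i - 1" n "0::int"] by (auto simp: entry_def simp del: nth_replicate)
  have "mu = replicate n 0" if mu: "mu \<in> below n (replicate (Suc n) 0)" for mu
  proof (rule entry_eqI[of _ n])
    show "length mu = n" using mu by (simp add: below_GT GT_length)
    fix i assume i: "i \<in> {1..n}"
    then have "entry (replicate (Suc n) 0) (Suc i) \<le> entry mu i" "entry mu i \<le> entry (replicate (Suc n) 0) i"
      using mu by (auto simp: below_def simp del: replicate.simps)
    then show "entry mu i = entry (replicate n 0) i" using e[of i] e[of "Suc i"] e'[OF i] i by auto
  qed simp
  moreover have "replicate n 0 \<in> below n (replicate (Suc n) 0)"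
    using e e' by (auto simp: below_def GT_iff simp del: replicate.simps)
  ultimately show ?thesis by blast
qed

lemma step_sum_zero:
  "step_sum \<theta> N (replicate N 0) \<phi> = step_sum \<theta> N (replicate N 0) (\<lambda>_. 1 :: real) *\<^sub>R \<phi> (\<lambda>_. 0)"
proof (induction N arbitrary: \<phi>)
  case (Suc n)
  have "(\<lambda>_. 0)(Suc n := sum_list (replicate (Suc n) (0::int)) - sum_list (replicate n 0)) = (\<lambda>_. 0)"
    by (auto simp: sum_list_replicate simp del: replicate.simps)
  then show ?case
    by (simp add: below_replicate Suc[of "\<lambda>\<xi>. \<phi> (\<xi>(Suc n := _))"] del: replicate.simps)
qed simp

lemma normed_sum_zero:
  "normed_sum \<theta> N (replicate N 0) \<phi> = normed_sum \<theta> N (replicate N 0) (\<lambda>_. 1 :: real) *\<^sub>R \<phi> (\<lambda>_. 0)"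
  unfolding normed_sum_def by (subst step_sum_zero) simp

definition unit_const :: "real \<Rightarrow> nat \<Rightarrow> real" where
  "unit_const \<theta> N = normed_sum \<theta> N (replicate N 0) (\<lambda>_. 1)"

lemma step_sum_pos:
  assumes "lam \<in> GT N" "\<theta> > 0"
  shows "step_sum \<theta> N lam (\<lambda>_. 1 :: real) > 0"
  using assms(1)
proof (induction N arbitrary: lam)
  case (Suc n)
  have "(\<lambda>i. lam ! i) ` {..<n} \<subseteq> UNIV" by simp
  define mu where "mu = take n lam"
  have len: "length lam = Suc n" using Suc by (simp add: GT_length)
  have ent: "entry mu i = entry lam i" if "i \<in> {1..n}" for i using that by (auto simp: mu_def entry_def)
  have "entry lam (Suc i) \<le> entry lam i" if "i \<in> {1..n}" for i using Suc.prems that by (auto simp: GT_iff)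
  then have "mu \<in> below n lam" using len ent by (auto simp: below_def GT_iff mu_def)
  then have "below n lam \<noteq> {}" by blast
  then show ?case
    using jack_branch_gamma(2)[OF Suc.prems _ assms(2)] Suc.IH[OF below_GT]
    by (auto intro!: sum_pos finite_below mult_pos_pos)
qed simp

lemma replicate_GT: "replicate N 0 \<in> GT N"
  by (auto simp: GT_iff entry_def)

lemma unit_const_pos: "\<theta> > 0 \<Longrightarrow> unit_const \<theta> N > 0"
  unfolding unit_const_def normed_sum_def
  by (simp add: step_sum_pos level_norm_pos replicate_GT)

text \<open>This is the evaluation of Jack polynomials at ones up to a constant independent of the
  signature. Both sides obey the same Pieri relation because the coefficients sum to the number of
  subsets.\<close>

lemma normed_sum_one:
  assumes \<theta>: "\<theta> > 0" and lam: "lam \<in> GT N"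
  shows "normed_sum \<theta> N lam (\<lambda>_. 1 :: real) = unit_const \<theta> N"
proof -
  define F H where "F = (\<lambda>lam (u::unit). normed_sum \<theta> N lam (\<lambda>_. 1 :: real))" and "H = (\<lambda>(lam::int list) (u::unit). unit_const \<theta> N)"
  have "F lam = H lam"
    using \<theta> lam
  proof (rule pieri_unique)
    show "F (replicate N 0) = H (replicate N 0)" by (simp add: F_def H_def unit_const_def)
    show "pieri_sum \<theta> N lam r (\<lambda>nu. F nu u) = pieri_sum \<theta> N lam r (\<lambda>nu. H nu u)"
      if "lam \<in> GT N" "F lam = H lam" for lam r u
    proof -
      have "normed_sum \<theta> N lam (\<lambda>_. 1 :: real) = unit_const \<theta> N" using that(2) by (simp add: F_def H_def fun_eq_iff)
      then have "pieri_sum \<theta> N lam r (\<lambda>nu. F nu u) = real (card {I. I \<subseteq> {1..N} \<and> card I = r}) * unit_const \<theta> N"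
        unfolding F_def pieri_normed_sum[OF \<theta> that(1)] by simp
      also have "\<dots> = pieri_sum \<theta> N lam r (\<lambda>nu. H nu u)"
        unfolding H_def pieri_sum_def pieri_coeff_sum[OF that(1) \<theta>, symmetric] by (simp add: sum_distrib_right)
      finally show ?thesis .
    qed
    show "F lam = H lam" if "lam \<in> GT N" "F (badd {1..N} lam) = H (badd {1..N} lam)" for lam
      using that normed_sum_badd_all[OF \<theta> that(1), of "\<lambda>_. 1 :: real"] by (simp add: F_def H_def fun_eq_iff)
  qed
  then show ?thesis by (simp add: F_def H_def fun_eq_iff)
qed

text \<open>The right-hand side of the Pieri relation runs over all sets of a given size, hence is
  invariant under permuting coordinates, and uniqueness transfers this to the sums themselves. It is
  the symmetry of Jack polynomials, invisible in the branching rule.\<close>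

lemma normed_sum_permute:
  fixes \<phi> :: "(nat \<Rightarrow> int) \<Rightarrow> 'a::real_normed_vector"
  assumes \<theta>: "\<theta> > 0" and lam: "lam \<in> GT N" and \<pi>: "\<pi> permutes {1..N}"
  shows "normed_sum \<theta> N lam (\<lambda>\<xi>. \<phi> (\<lambda>i. \<xi> (\<pi> i))) = normed_sum \<theta> N lam \<phi>"
proof -
  define F H where "F = (\<lambda>lam (\<phi> :: (nat \<Rightarrow> int) \<Rightarrow> 'a). normed_sum \<theta> N lam (\<lambda>\<xi>. \<phi> (\<lambda>i. \<xi> (\<pi> i))))"
    and "H = (\<lambda>lam (\<phi> :: (nat \<Rightarrow> int) \<Rightarrow> 'a). normed_sum \<theta> N lam \<phi>)"
  have "F lam = H lam"
    using \<theta> lam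
  proof (rule pieri_unique)
    show "F (replicate N 0) = H (replicate N 0)"
    proof
      fix \<phi>
      show "F (replicate N 0) \<phi> = H (replicate N 0) \<phi>"
        unfolding F_def H_def by (simp add: normed_sum_zero[of _ _ "\<lambda>\<xi>. \<phi> (\<lambda>i. \<xi> (\<pi> i))"] normed_sum_zero[of _ _ \<phi>])
    qed
    show "pieri_sum \<theta> N lam r (\<lambda>nu. F nu \<phi>) = pieri_sum \<theta> N lam r (\<lambda>nu. H nu \<phi>)"
      if lam: "lam \<in> GT N" "F lam = H lam" for lam r \<phi>
    proof -
      define S where "S = {I. I \<subseteq> {1..N} \<and> card I = r}"
      have F: "F lam \<psi> = H lam \<psi>" for \<psi> using lam(2) by simp
      have ind: "ind I (\<pi> i) = ind (inv \<pi> ` I) i" for I i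
        using permutes_inverses[OF \<pi>] unfolding ind_def by (metis image_iff)
      have bij: "bij_betw (image (inv \<pi>)) S S"
      proof (rule bij_betw_byWitness[where f' = "image \<pi>"])
        show "\<forall>a\<in>S. \<pi> ` inv \<pi> ` a = a" "\<forall>a\<in>S. inv \<pi> ` \<pi> ` a = a"
          using permutes_inverses[OF \<pi>] by (auto simp: image_image)
        show "image (inv \<pi>) ` S \<subseteq> S"
          using permutes_inv[OF \<pi>] permutes_image[OF permutes_inv[OF \<pi>]]
          by (auto simp: S_def card_image permutes_inj_on dest: subsetD)
        show "image \<pi> ` S \<subseteq> S"
          using permutes_image[OF \<pi>]
          by (auto simp: S_def card_image permutes_inj_on[OF \<pi>] dest: subsetD)
      qed
      have "pieri_sum \<theta> N lam r (\<lambda>nu. F nu \<phi>) = (\<Sum>I\<in>S. F lam (\<lambda>\<xi>. \<phi> (\<lambda>i. \<xi> i + ind (inv \<pi> ` I) i)))"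
        unfolding F_def pieri_normed_sum[OF \<theta> lam(1)] S_def ind ..
      also have "\<dots> = (\<Sum>I\<in>S. H lam (\<lambda>\<xi>. \<phi> (\<lambda>i. \<xi> i + ind (inv \<pi> ` I) i)))" by (simp only: F)
      also have "\<dots> = (\<Sum>I\<in>S. H lam (\<lambda>\<xi>. \<phi> (\<lambda>i. \<xi> i + ind I i)))"
        by (rule sum.reindex_bij_betw[OF bij])
      also have "\<dots> = pieri_sum \<theta> N lam r (\<lambda>nu. H nu \<phi>)"
        unfolding H_def pieri_normed_sum[OF \<theta> lam(1)] S_def ..
      finally show ?thesis .
    qed
    show "F lam = H lam" if lam: "lam \<in> GT N" "F (badd {1..N} lam) = H (badd {1..N} lam)" for lam
    proof
      fix \<phi> :: "(nat \<Rightarrow> int) \<Rightarrow> 'a"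
      \<comment> \<open>Undoes the shift by all ones, so that the hypothesis on
        \<open>badd {1..N} lam\<close> can be applied to it.\<close>
      define \<phi>' where "\<phi>' = (\<lambda>\<xi>. \<phi> (\<lambda>i. \<xi> i - ind {1..N} i))"
      have "ind {1..N} (\<pi> i) = ind {1..N} i" for i
        using permutes_in_image[OF \<pi>] by (simp add: ind_def)
      then have "F lam \<phi> = F (badd {1..N} lam) \<phi>'" "H lam \<phi> = H (badd {1..N} lam) \<phi>'"
        unfolding F_def H_def normed_sum_badd_all[OF \<theta> lam(1)] by (simp_all add: \<phi>'_def)
      then show "F lam \<phi> = H lam \<phi>" using lam(2) by simp
    qed
  qed
  then show ?thesis by (simp add: F_def H_def fun_eq_iff)
qed

section \<open>The Gamma transform of one increment\<close>

definition generic :: "real \<Rightarrow> real \<Rightarrow> bool" where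
  "generic \<theta> u \<longleftrightarrow> (\<forall>p q :: int. u \<noteq> of_int p + \<theta> * of_int q)"

lemma generic_shift: "generic \<theta> u \<Longrightarrow> generic \<theta> (u + of_int p + \<theta> * of_int q)"
  unfolding generic_def
proof (intro allI notI)
  fix p' q' :: int
  assume *: "\<forall>p q :: int. u \<noteq> of_int p + \<theta> * of_int q" "u + of_int p + \<theta> * of_int q = of_int p' + \<theta> * of_int q'"
  then have "u = of_int (p' - p) + \<theta> * of_int (q' - q)" by (simp add: algebra_simps)
  then show False using *(1) by blast
qed

lemma generic_not_nonpos: "generic \<theta> u \<Longrightarrow> u \<notin> \<int>\<^sub>\<le>\<^sub>0"
  unfolding generic_def by (metis add.right_neutral mult_zero_right nonpos_Ints_cases of_int_0)

lemma generic_Gamma: "generic \<theta> u \<Longrightarrow> Gamma u \<noteq> 0" "generic \<theta> u \<Longrightarrow> Gamma (u + 1) = u * Gamma u"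
  using generic_not_nonpos by (auto simp: Gamma_eq_zero_iff Gamma_plus1)

definition gamma_weight :: "real \<Rightarrow> nat \<Rightarrow> real \<Rightarrow> int \<Rightarrow> real" where
  "gamma_weight \<theta> N u k = Gamma (u - of_int k) / Gamma (u - of_int k + \<theta> * real N)"

definition gamma_prod :: "real \<Rightarrow> nat \<Rightarrow> real \<Rightarrow> (nat \<Rightarrow> int) \<Rightarrow> real" where
  "gamma_prod \<theta> N u a = (\<Prod>i\<in>{1..N}. Gamma (u - of_int (a i) + \<theta> * (real i - 1)) / Gamma (u - of_int (a i) + \<theta> * real i))"

lemma gamma_prod_zero:
  assumes "generic \<theta> u"
  shows "gamma_prod \<theta> N u (\<lambda>_. 0) = Gamma u / Gamma (u + \<theta> * real N)"
proof (induction N)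
  case 0
  then show ?case using generic_Gamma[OF assms] by (simp add: gamma_prod_def)
next
  case (Suc n)
  have "Gamma (u + \<theta> * real n) \<noteq> 0"
    using generic_shift[OF assms, of 0 "int n"] by (intro generic_Gamma) auto
  then show ?case using Suc by (simp add: gamma_prod_def)
qed

text \<open>Adding the boxes I multiplies the product by the \<open>\<rho> i\<close> with i in I.
  The kernel identity with a one-point second set evaluates the generating function as (1 + s)^(N -
  1) times 1 + s X, where X is the effect of lowering u by one; this is the generating function of
  weights that equal X at index 1 and 1 elsewhere.\<close>

lemma gamma_prod_pieri:
  assumes \<theta>: "\<theta> > 0" and lam: "lam \<in> GT N" and u: "generic \<theta> u" and N: "N \<ge> 1"
  shows "pieri_sum \<theta> N lam r (\<lambda>nu. gamma_prod \<theta> N u (entry nu)) =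
     (\<Sum>I | I \<subseteq> {1..N} \<and> card I = r. gamma_prod \<theta> N (u - of_int (ind I 1)) (entry lam))"
proof -
  define l where "l = shifted \<theta> (entry lam)"
  \<comment> \<open>With this point the quotient of consecutive Gamma ratios in row i becomes (l i -
    w - \<theta>) / (l i - w), which is the kernel factor of the set {w}.\<close>
  define w where "w = u - 1 - \<theta>"
  define \<rho> where "\<rho> = (\<lambda>i. (l i - w - \<theta>) / (l i - w))"
  define X where "X = (\<Prod>i\<in>{1..N}. \<rho> i)"
  have len: "length lam = N" using lam by (rule GT_length)
  define f where "f = (\<lambda>u i (k::int). Gamma (u - of_int k + \<theta> * (real i - 1)) / Gamma (u - of_int k + \<theta> * real i))"
  have gen1: "generic \<theta> (u - of_int k + \<theta> * real i)" "generic \<theta> (u - of_int k + \<theta> * (real i - 1))"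
     for k i
    using generic_shift[OF u, of "- k" "int i"] generic_shift[OF u, of "- k" "int i - 1"] by simp_all
  have lw: "l i - w \<noteq> 0" for i
    using generic_not_nonpos[OF gen1(2), of "entry lam i + 1" i] by (auto simp: l_def w_def shifted_def algebra_simps)
  have step: "f u i (entry lam i + 1) = f u i (entry lam i) * \<rho> i" for i
  proof -
    define y where "y = u - of_int (entry lam i + 1) + \<theta> * (real i - 1)"
    define z where "z = u - of_int (entry lam i + 1) + \<theta> * real i"
    have g: "generic \<theta> y" "generic \<theta> z" unfolding y_def z_def by (rule gen1)+
    have "f u i (entry lam i + 1) = Gamma y / Gamma z" "f u i (entry lam i) = Gamma (y + 1) / Gamma (z + 1)"
      by (simp_all add: f_def y_def z_def algebra_simps)
    moreover have "y \<noteq> 0" "z \<noteq> 0" using g generic_not_nonpos by auto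
    moreover have "\<rho> i = z / y"
    proof -
      have "l i - w - \<theta> = - z" "l i - w = - y" by (simp_all add: l_def w_def y_def z_def shifted_def algebra_simps)
      then show ?thesis by (simp add: \<rho>_def)
    qed
    ultimately show ?thesis using generic_Gamma[OF g(1)] generic_Gamma[OF g(2)] by simp
  qed
  have up: "gamma_prod \<theta> N u (entry (badd I lam)) = gamma_prod \<theta> N u (entry lam) * (\<Prod>i\<in>I. \<rho> i)" if "I \<subseteq> {1..N}" for I
  proof -
    have "gamma_prod \<theta> N u (entry (badd I lam)) = (\<Prod>i\<in>{1..N}. f u i (entry (badd I lam) i))"
      by (simp add: gamma_prod_def f_def)
    also have "\<dots> = (\<Prod>i\<in>{1..N}. f u i (entry lam i) * (if i \<in> I then \<rho> i else 1))"
    proof (intro prod.cong refl)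
      fix i assume "i \<in> {1..N}"
      then have "entry (badd I lam) i = entry lam i + (if i \<in> I then 1 else 0)"
        using len by (simp add: entry_badd raise_def ind_def)
      then show "f u i (entry (badd I lam) i) = f u i (entry lam i) * (if i \<in> I then \<rho> i else 1)"
        using step by simp
    qed
    also have "\<dots> = gamma_prod \<theta> N u (entry lam) * (\<Prod>i\<in>{1..N}. if i \<in> I then \<rho> i else 1)"
      unfolding prod.distrib gamma_prod_def f_def ..
    also have "(\<Prod>i\<in>{1..N}. if i \<in> I then \<rho> i else 1) = (\<Prod>i\<in>I. \<rho> i)"
      using that by (subst prod.inter_restrict[symmetric]) (auto simp: Int_absorb1)
    finally show ?thesis .
  qed
  have down: "gamma_prod \<theta> N (u - 1) (entry lam) = gamma_prod \<theta> N u (entry lam) * X"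
  proof -
    have "gamma_prod \<theta> N (u - 1) (entry lam) = gamma_prod \<theta> N u (entry (badd {1..N} lam))"
      unfolding gamma_prod_def using len by (intro prod.cong refl) (auto simp: entry_badd raise_def ind_def algebra_simps)
    then show ?thesis using up[of "{1..N}"] by (simp add: X_def)
  qed
  define d where "d = (\<lambda>i::nat. if i = 1 then X else 1)"
  have C: "(\<Sum>I | I \<subseteq> {1..N} \<and> card I = r. pieri_coeff \<theta> N (entry lam) I * (\<Prod>i\<in>I. \<rho> i)) =
     (\<Sum>I | I \<subseteq> {1..N} \<and> card I = r. \<Prod>i\<in>I. d i)"
  proof (rule pieri_coeff_sum_prod[OF lam \<theta>])
    fix s :: real assume s: "s > 0"
    have inj: "inj_on l {1..N}" unfolding l_def by (rule inj_shifted[OF lam \<theta>])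
    define P where "P = (\<Prod>i\<in>{1..N}. l i - w)"
    have P: "P \<noteq> 0" using lw by (simp add: P_def)
    have PQ: "(\<Prod>i\<in>I. l i - w - \<theta>) * (\<Prod>i\<in>{1..N} - I. l i - w) = P * (\<Prod>i\<in>I. \<rho> i)" if "I \<subseteq> {1..N}" for I
    proof -
      have "(\<Prod>i\<in>I. l i - w - \<theta>) = (\<Prod>i\<in>I. (l i - w) * \<rho> i)" using lw by (simp add: \<rho>_def)
      then show ?thesis unfolding P_def prod.subset_diff[OF that finite_atLeastAtMost] by (simp add: prod.distrib)
    qed
    have "kernel_sum s \<theta> (l ` {1..N}) {w} = (\<Sum>I\<in>Pow {1..N}. s ^ card I * (pieri_coeff \<theta> N (entry lam) I *
        ((\<Prod>i\<in>I. l i - w - \<theta>) * (\<Prod>i\<in>{1..N} - I. l i - w))))"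
      using kernel_sum_image[OF _ inj, of "\<lambda>x. x" "{w}" s \<theta>]
      by (simp add: pieri_coeff_def l_def[symmetric] mult.assoc)
    also have "\<dots> = (\<Sum>I\<in>Pow {1..N}. P * (s ^ card I * (pieri_coeff \<theta> N (entry lam) I * (\<Prod>i\<in>I. \<rho> i))))"
      by (intro sum.cong refl) (simp only: PQ Pow_iff mult_ac)
    finally have L: "kernel_sum s \<theta> (l ` {1..N}) {w} = P * (\<Sum>I\<in>Pow {1..N}. s ^ card I * (pieri_coeff \<theta> N (entry lam) I * (\<Prod>i\<in>I. \<rho> i)))"
      by (simp only: sum_distrib_left)
    have "kernel_sum s (- \<theta>) {w} (l ` {1..N}) = (\<Prod>i\<in>{1..N}. w - l i) + s * (\<Prod>i\<in>{1..N}. w - l i + \<theta>)"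
      unfolding kernel_sum_def kernel_term_def Pow_insert Pow_empty using inj by (simp add: prod.reindex)
    also have "(\<Prod>i\<in>{1..N}. w - l i) = (-1) ^ N * P"
    proof -
      have "(\<Prod>i\<in>{1..N}. w - l i) = (\<Prod>i\<in>{1..N}. (-1) * (l i - w))" by simp
      then show ?thesis unfolding P_def by (simp only: prod.distrib prod_constant card_atLeastAtMost diff_Suc_1)
    qed
    also have "(\<Prod>i\<in>{1..N}. w - l i + \<theta>) = (-1) ^ N * (P * X)"
    proof -
      have "(\<Prod>i\<in>{1..N}. w - l i + \<theta>) = (\<Prod>i\<in>{1..N}. (-1) * ((l i - w) * \<rho> i))"
        using lw by (intro prod.cong refl) (simp add: \<rho>_def)
      then show ?thesis unfolding P_def X_def by (simp only: prod.distrib prod_constant card_atLeastAtMost diff_Suc_1)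
    qed
    finally have R: "kernel_sum s (- \<theta>) {w} (l ` {1..N}) = (-1) ^ N * P * (1 + s * X)" by (simp add: algebra_simps)
    have "(1 + s) * kernel_sum s \<theta> (l ` {1..N}) {w} = (-1) ^ N * (1 + s) ^ N * kernel_sum s (- \<theta>) {w} (l ` {1..N})"
      using kernel_identity[of "l ` {1..N}" "{w}" s \<theta>] inj by (simp add: card_image)
    also have "\<dots> = ((-1) ^ N * (-1) ^ N) * ((1 + s) ^ N * (P * (1 + s * X)))"
      unfolding R by (simp only: mult_ac)
    also have "(-1) ^ N * (-1) ^ N = (1::real)" by (simp flip: power_mult_distrib)
    also have "(1 + s) ^ N = (1 + s) * (1 + s) ^ (N - 1)" using N by (metis power_eq_if not_one_le_zero)
    finally have "(1 + s) * (P * (\<Sum>I\<in>Pow {1..N}. s ^ card I * (pieri_coeff \<theta> N (entry lam) I * (\<Prod>i\<in>I. \<rho> i)))) =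
        (1 + s) * (P * ((1 + s) ^ (N - 1) * (1 + s * X)))"
      unfolding L by (simp only: mult_ac mult_1)
    then have "(\<Sum>I\<in>Pow {1..N}. s ^ card I * (pieri_coeff \<theta> N (entry lam) I * (\<Prod>i\<in>I. \<rho> i))) = (1 + s) ^ (N - 1) * (1 + s * X)"
      using s P by (simp add: mult_cancel_left)
    also have "\<dots> = (\<Prod>i\<in>{1..N}. 1 + s * d i)"
    proof -
      have "{1..N} = insert 1 {2..N}" using N by auto
      moreover have "(\<Prod>i\<in>{2..N}. 1 + s * d i) = (\<Prod>i\<in>{2..N}. 1 + s)" by (intro prod.cong) (auto simp: d_def)
      ultimately show ?thesis by (simp add: d_def)
    qed
    finally show "(\<Sum>I\<in>Pow {1..N}. s ^ card I * (pieri_coeff \<theta> N (entry lam) I * (\<Prod>i\<in>I. \<rho> i))) = (\<Prod>i\<in>{1..N}. 1 + s * d i)" .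
  qed
  have "pieri_sum \<theta> N lam r (\<lambda>nu. gamma_prod \<theta> N u (entry nu)) =
     gamma_prod \<theta> N u (entry lam) * (\<Sum>I | I \<subseteq> {1..N} \<and> card I = r. \<Prod>i\<in>I. d i)"
    unfolding pieri_sum_def C[symmetric] sum_distrib_left by (intro sum.cong refl) (simp add: up mult_ac)
  also have "\<dots> = (\<Sum>I | I \<subseteq> {1..N} \<and> card I = r. gamma_prod \<theta> N (u - of_int (ind I 1)) (entry lam))"
    unfolding sum_distrib_left
  proof (rule sum.cong[OF refl])
    fix I assume I: "I \<in> {I. I \<subseteq> {1..N} \<and> card I = r}"
    then have "finite I" using finite_subset by auto
    then have "(\<Prod>i\<in>I. d i) = (if 1 \<in> I then X else 1)" unfolding d_def by (simp add: prod.delta)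
    then show "gamma_prod \<theta> N u (entry lam) * (\<Prod>i\<in>I. d i) = gamma_prod \<theta> N (u - of_int (ind I 1)) (entry lam)"
      using down by (auto simp: ind_def)
  qed
  finally show ?thesis .
qed

text \<open>Uniqueness with u as index: raising the first increment by one amounts to lowering u by
  one, so both sides satisfy the same relation. They are set to 0 at non-generic u, where Gamma
  functions may meet a pole.\<close>

theorem normed_sum_gamma_weight:
  assumes \<theta>: "\<theta> > 0" and lam: "lam \<in> GT N" and u: "generic \<theta> u" and N: "N \<ge> 1"
  shows "normed_sum \<theta> N lam (\<lambda>\<xi>. gamma_weight \<theta> N u (\<xi> 1)) = unit_const \<theta> N * gamma_prod \<theta> N u (entry lam)"
proof -
  define F H where "F = (\<lambda>lam u. if generic \<theta> u then normed_sum \<theta> N lam (\<lambda>\<xi>. gamma_weight \<theta> N u (\<xi> 1)) else 0)"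
    and "H = (\<lambda>lam u. if generic \<theta> u then unit_const \<theta> N * gamma_prod \<theta> N u (entry lam) else 0)"
  have gen: "generic \<theta> (u + of_int k)" if "generic \<theta> u" for u k using generic_shift[OF that, of k 0] by simp
  have "F lam = H lam"
    using \<theta> lam
  proof (rule pieri_unique)
    show "F (replicate N 0) = H (replicate N 0)"
    proof
      fix u
      have "gamma_prod \<theta> N u (entry (replicate N 0)) = gamma_prod \<theta> N u (\<lambda>_. 0)"
        unfolding gamma_prod_def by (intro prod.cong refl) (auto simp: entry_def)
      then show "F (replicate N 0) u = H (replicate N 0) u"
        unfolding F_def H_def by (subst normed_sum_zero) (simp add: gamma_prod_zero gamma_weight_def unit_const_def)
    qed
    show "pieri_sum \<theta> N lam r (\<lambda>nu. F nu u) = pieri_sum \<theta> N lam r (\<lambda>nu. H nu u)"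
      if lam: "lam \<in> GT N" "F lam = H lam" for lam r u
    proof (cases "generic \<theta> u")
      case True
      have *: "normed_sum \<theta> N lam (\<lambda>\<xi>. gamma_weight \<theta> N (u - of_int k) (\<xi> 1)) = unit_const \<theta> N * gamma_prod \<theta> N (u - of_int k) (entry lam)" for k
        using fun_cong[OF lam(2), of "u - of_int k"] gen[OF True, of "- k"] by (simp add: F_def H_def)
      have "gamma_weight \<theta> N u (x + k) = gamma_weight \<theta> N (u - of_int k) x" for x k
        by (simp add: gamma_weight_def algebra_simps)
      then have "pieri_sum \<theta> N lam r (\<lambda>nu. F nu u) =
         unit_const \<theta> N * (\<Sum>I | I \<subseteq> {1..N} \<and> card I = r. gamma_prod \<theta> N (u - of_int (ind I 1)) (entry lam))"
        using True pieri_normed_sum[OF \<theta> lam(1), of r "\<lambda>\<xi>. gamma_weight \<theta> N u (\<xi> 1)"]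
        unfolding sum_distrib_left *[symmetric] by (simp add: F_def)
      also have "\<dots> = pieri_sum \<theta> N lam r (\<lambda>nu. H nu u)"
        unfolding gamma_prod_pieri[OF \<theta> lam(1) True N, symmetric]
        using True by (simp add: H_def pieri_sum_def sum_distrib_left mult_ac)
      finally show ?thesis .
    qed (simp add: F_def H_def)
    show "F lam = H lam" if lam: "lam \<in> GT N" "F (badd {1..N} lam) = H (badd {1..N} lam)" for lam
    proof
      fix u
      have "gamma_weight \<theta> N (u + 1) (k + 1) = gamma_weight \<theta> N u k" for k
        by (simp add: gamma_weight_def algebra_simps)
      moreover have "gamma_prod \<theta> N (u + 1) (entry (badd {1..N} lam)) = gamma_prod \<theta> N u (entry lam)"
        unfolding gamma_prod_def using GT_length[OF lam(1)]
        by (intro prod.cong refl) (auto simp: entry_badd raise_def ind_def algebra_simps)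
      ultimately show "F lam u = H lam u"
        using fun_cong[OF lam(2), of "u + 1"] gen[of u 1] gen[of "u + 1" "-1"] N
        unfolding F_def H_def normed_sum_badd_all[OF \<theta> lam(1)] by (auto simp: ind_def split: if_splits)
    qed
  qed
  then show ?thesis using u by (simp add: F_def H_def fun_eq_iff split: if_splits)
qed

section \<open>Random chains of signatures\<close>

text \<open>Levels above N are pinned to [], so a chain is determined by its levels up to N and the
  extension by one level is injective.\<close>

fun chains :: "nat \<Rightarrow> int list \<Rightarrow> (nat \<Rightarrow> int list) set" where
  "chains 0 lam = {(\<lambda>_. [])(0 := lam)}"
| "chains (Suc n) lam = (\<Union>mu\<in>below n lam. (\<lambda>p. p(Suc n := lam)) ` chains n mu)"

lemma chainsD:
  assumes "p \<in> chains N lam"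
  shows "p N = lam" and "k > N \<Longrightarrow> p k = []" and "k < N \<Longrightarrow> p k \<in> below k (p (Suc k))"
proof -
  have "p N = lam \<and> (\<forall>k>N. p k = []) \<and> (\<forall>k<N. p k \<in> below k (p (Suc k)))"
    using assms
  proof (induction N arbitrary: lam p)
    case (Suc n)
    then obtain mu q where q: "mu \<in> below n lam" "q \<in> chains n mu" "p = q(Suc n := lam)" by auto
    show ?case using Suc.IH[OF q(2)] q by (auto simp: less_Suc_eq)
  qed auto
  then show "p N = lam" "k > N \<Longrightarrow> p k = []" "k < N \<Longrightarrow> p k \<in> below k (p (Suc k))" by auto
qed

lemma chains_GT: "p \<in> chains N lam \<Longrightarrow> lam \<in> GT N \<Longrightarrow> k \<le> N \<Longrightarrow> p k \<in> GT k"
  using chainsD(1)[of p N lam] chainsD(3)[of p N lam k] below_GT by (cases "k = N") auto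

lemma finite_chains: "finite (chains N lam)"
  by (induction N arbitrary: lam) (auto simp: finite_below)

definition partition_sum :: "real \<Rightarrow> nat \<Rightarrow> int list \<Rightarrow> real" where
  "partition_sum \<theta> N lam = step_sum \<theta> N lam (\<lambda>_. 1)"

text \<open>The branching weights, reweighted by the partition sums of both levels so that they add
  up to 1 over \<open>mu\<close>.\<close>

definition transition :: "real \<Rightarrow> nat \<Rightarrow> int list \<Rightarrow> int list \<Rightarrow> real" where
  "transition \<theta> n lam mu = jack_branch \<theta> n lam mu * partition_sum \<theta> n mu / partition_sum \<theta> (Suc n) lam"

definition chain_prob :: "real \<Rightarrow> nat \<Rightarrow> (nat \<Rightarrow> int list) \<Rightarrow> real" where
  "chain_prob \<theta> N p = (\<Prod>k<N. transition \<theta> k (p (Suc k)) (p k))"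

definition expect :: "real \<Rightarrow> nat \<Rightarrow> int list \<Rightarrow> ((nat \<Rightarrow> int list) \<Rightarrow> 'a::real_vector) \<Rightarrow> 'a" where
  "expect \<theta> N lam f = (\<Sum>p\<in>chains N lam. chain_prob \<theta> N p *\<^sub>R f p)"

lemma expect_Suc:
  "expect \<theta> (Suc n) lam f = (\<Sum>mu\<in>below n lam. transition \<theta> n lam mu *\<^sub>R expect \<theta> n mu (\<lambda>p. f (p(Suc n := lam))))"
proof -
  have inj: "inj_on (\<lambda>p. p(Suc n := lam)) (chains n mu)" for mu
  proof (rule inj_onI)
    fix p q assume pq: "p \<in> chains n mu" "q \<in> chains n mu" "p(Suc n := lam) = q(Suc n := lam)"
    have "p k = q k" for k
      using fun_cong[OF pq(3), of k] chainsD(2)[OF pq(1), of k] chainsD(2)[OF pq(2), of k] by (cases "k = Suc n") auto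
    then show "p = q" by auto
  qed
  have prob: "chain_prob \<theta> (Suc n) (p(Suc n := lam)) = transition \<theta> n lam mu * chain_prob \<theta> n p" if "p \<in> chains n mu" for p mu
    using chainsD(1)[OF that] by (simp add: chain_prob_def mult.commute)
  have "expect \<theta> (Suc n) lam f = (\<Sum>mu\<in>below n lam. \<Sum>p\<in>(\<lambda>p. p(Suc n := lam)) ` chains n mu. chain_prob \<theta> (Suc n) p *\<^sub>R f p)"
    unfolding expect_def chains.simps
  proof (rule sum.UNION_disjoint[OF finite_below])
    show "\<forall>i\<in>below n lam. finite ((\<lambda>p. p(Suc n := lam)) ` chains n i)" by (simp add: finite_chains)
    show "\<forall>i\<in>below n lam. \<forall>j\<in>below n lam. i \<noteq> j \<longrightarrow> (\<lambda>p. p(Suc n := lam)) ` chains n i \<inter> (\<lambda>p. p(Suc n := lam)) ` chains n j = {}"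
    proof (intro ballI impI equals0I)
      fix i j x assume "i \<noteq> j" "x \<in> (\<lambda>p. p(Suc n := lam)) ` chains n i \<inter> (\<lambda>p. p(Suc n := lam)) ` chains n j"
      then obtain p q where pq: "p \<in> chains n i" "q \<in> chains n j" "x = p(Suc n := lam)" "x = q(Suc n := lam)" by blast
      then have "x n = p n" "x n = q n" by auto (metis fun_upd_other n_not_Suc_n)
      then have "x n = i" "x n = j" using chainsD(1)[OF pq(1)] chainsD(1)[OF pq(2)] by auto
      then show False using \<open>i \<noteq> j\<close> by simp
    qed
  qed
  also have "\<dots> = (\<Sum>mu\<in>below n lam. transition \<theta> n lam mu *\<^sub>R expect \<theta> n mu (\<lambda>p. f (p(Suc n := lam))))"
    unfolding expect_def scaleR_sum_right
    by (rule sum.cong[OF refl]) (simp add: sum.reindex[OF inj] prob)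
  finally show ?thesis .
qed

lemma expect_0: "expect \<theta> 0 lam f = f ((\<lambda>_. [])(0 := lam))"
  by (simp add: expect_def chain_prob_def)

lemma expect_cong: "(\<And>p. p \<in> chains N lam \<Longrightarrow> f p = g p) \<Longrightarrow> expect \<theta> N lam f = expect \<theta> N lam g"
  unfolding expect_def by (intro sum.cong) auto

lemma partition_sum_pos: "lam \<in> GT N \<Longrightarrow> \<theta> > 0 \<Longrightarrow> partition_sum \<theta> N lam > 0"
  unfolding partition_sum_def by (rule step_sum_pos)

lemma transition_nonneg: "lam \<in> GT (Suc n) \<Longrightarrow> mu \<in> below n lam \<Longrightarrow> \<theta> > 0 \<Longrightarrow> transition \<theta> n lam mu \<ge> 0"
  unfolding transition_def
  using jack_branch_gamma(2)[of lam n mu \<theta>] partition_sum_pos[of lam "Suc n" \<theta>] partition_sum_pos[of mu n \<theta>] below_GT[of mu n lam]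
  by (auto intro!: divide_nonneg_pos mult_nonneg_nonneg less_imp_le)

lemma chain_prob_nonneg: "p \<in> chains N lam \<Longrightarrow> lam \<in> GT N \<Longrightarrow> \<theta> > 0 \<Longrightarrow> chain_prob \<theta> N p \<ge> 0"
  unfolding chain_prob_def using chains_GT[of p N lam] chainsD(3)[of p N lam]
  by (intro prod_nonneg ballI transition_nonneg) auto

section \<open>Increments as random variables\<close>

definition incr :: "(nat \<Rightarrow> int list) \<Rightarrow> nat \<Rightarrow> int" where
  "incr p i = sum_list (p i) - sum_list (p (i - 1))"

text \<open>Zero outside {1..N}, to agree with the vector that \<open>step_sum\<close> builds from
  the zero function.\<close>

definition incs :: "nat \<Rightarrow> (nat \<Rightarrow> int list) \<Rightarrow> nat \<Rightarrow> int" where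
  "incs N p i = (if i \<in> {1..N} then incr p i else 0)"

lemma step_sum_expect:
  assumes "lam \<in> GT N" "\<theta> > 0"
  shows "step_sum \<theta> N lam \<phi> = partition_sum \<theta> N lam *\<^sub>R expect \<theta> N lam (\<lambda>p. \<phi> (incs N p))"
  using assms(1)
proof (induction N arbitrary: lam \<phi>)
  case 0
  have "incs 0 p = (\<lambda>_. 0)" for p by (auto simp: incs_def)
  then show ?case by (simp add: partition_sum_def expect_0)
next
  case (Suc n)
  have Z: "partition_sum \<theta> (Suc n) lam \<noteq> 0" using partition_sum_pos[OF Suc.prems assms(2)] by simp
  have "(incs n p)(Suc n := sum_list lam - sum_list mu) = incs (Suc n) (p(Suc n := lam))" if "p \<in> chains n mu" for p mu
    using chainsD(1)[OF that] by (auto simp: incs_def incr_def fun_eq_iff)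
  then have "expect \<theta> n mu (\<lambda>p. \<phi> ((incs n p)(Suc n := sum_list lam - sum_list mu))) =
      expect \<theta> n mu (\<lambda>p. \<phi> (incs (Suc n) (p(Suc n := lam))))" for mu
    by (intro expect_cong) simp
  then show ?case
    unfolding step_sum.simps expect_Suc scaleR_sum_right scaleR_scaleR
    by (intro sum.cong refl) (simp add: Suc.IH[OF below_GT] transition_def Z)
qed

text \<open>Normalized sums become expectations after division by \<open>unit_const\<close>, since
  that is their value at the function 1 for every signature.\<close>

lemma expect_incs:
  assumes "lam \<in> GT N" "\<theta> > 0"
  shows "expect \<theta> N lam (\<lambda>p. \<phi> (incs N p)) = (1 / unit_const \<theta> N) *\<^sub>R normed_sum \<theta> N lam \<phi>"
  unfolding normed_sum_one[OF assms(2,1), symmetric]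
  using partition_sum_pos[OF assms] level_norm_pos[OF assms]
  by (simp add: normed_sum_def step_sum_expect[OF assms, of \<phi>] flip: partition_sum_def)

lemma expect_one:
  assumes "lam \<in> GT N" "\<theta> > 0"
  shows "expect \<theta> N lam (\<lambda>_. 1 :: real) = 1"
  using expect_incs[OF assms, of "\<lambda>_. 1 :: real"] unit_const_pos[OF assms(2), of N]
  by (simp add: normed_sum_one[OF assms(2,1)])

lemma expect_add: "expect \<theta> N lam (\<lambda>p. f p + g p) = expect \<theta> N lam f + expect \<theta> N lam g"
  by (simp add: expect_def scaleR_add_right sum.distrib)

lemma expect_diff: "expect \<theta> N lam (\<lambda>p. f p - g p) = expect \<theta> N lam f - expect \<theta> N lam g"
  by (simp add: expect_def scaleR_diff_right sum_subtractf)

lemma expect_cmult: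
  fixes c :: "'a::real_normed_field"
  shows "expect \<theta> N lam (\<lambda>p. c * f p) = c * expect \<theta> N lam f"
  by (simp add: expect_def sum_distrib_left)

lemma expect_sum: "finite A \<Longrightarrow> expect \<theta> N lam (\<lambda>p. \<Sum>i\<in>A. f i p) = (\<Sum>i\<in>A. expect \<theta> N lam (f i))"
  unfolding expect_def scaleR_sum_right by (rule sum.swap)

lemma expect_const:
  fixes c :: "'a::real_normed_field"
  assumes "lam \<in> GT N" "\<theta> > 0"
  shows "expect \<theta> N lam (\<lambda>_. c) = c"
  using expect_one[OF assms] by (simp add: expect_def flip: scaleR_sum_left)

lemma expect_mono:
  fixes f g :: "_ \<Rightarrow> real"
  assumes "lam \<in> GT N" "\<theta> > 0" "\<And>p. p \<in> chains N lam \<Longrightarrow> f p \<le> g p"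
  shows "expect \<theta> N lam f \<le> expect \<theta> N lam g"
  unfolding expect_def using assms chain_prob_nonneg by (intro sum_mono) (auto intro!: mult_left_mono)

lemma expect_nonneg:
  fixes f :: "_ \<Rightarrow> real"
  assumes "lam \<in> GT N" "\<theta> > 0" "\<And>p. p \<in> chains N lam \<Longrightarrow> 0 \<le> f p"
  shows "0 \<le> expect \<theta> N lam f"
  unfolding expect_def using assms chain_prob_nonneg by (intro sum_nonneg) auto

lemma norm_expect_le:
  fixes f :: "_ \<Rightarrow> 'a::real_normed_vector"
  assumes "lam \<in> GT N" "\<theta> > 0" "\<And>p. p \<in> chains N lam \<Longrightarrow> norm (f p) \<le> g p"
  shows "norm (expect \<theta> N lam f) \<le> expect \<theta> N lam g"
  unfolding expect_def
proof (rule order_trans[OF norm_sum], rule sum_mono)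
  fix p assume "p \<in> chains N lam"
  then show "norm (chain_prob \<theta> N p *\<^sub>R f p) \<le> chain_prob \<theta> N p *\<^sub>R g p"
    using assms chain_prob_nonneg[of p N lam \<theta>] by (simp add: mult_left_mono)
qed

lemma expect_of_real:
  "expect \<theta> N lam (\<lambda>p. of_real (f p) :: 'a::real_normed_field) = of_real (expect \<theta> N lam f)"
  by (simp add: expect_def scaleR_conv_of_real)

section \<open>Conditioning on the levels above\<close>

definition depends_ge :: "nat \<Rightarrow> ((nat \<Rightarrow> int list) \<Rightarrow> 'a) \<Rightarrow> bool" where
  "depends_ge M h \<longleftrightarrow> (\<forall>p q. (\<forall>k\<ge>M. p k = q k) \<longrightarrow> h p = h q)"

definition depends_le :: "nat \<Rightarrow> ((nat \<Rightarrow> int list) \<Rightarrow> 'a) \<Rightarrow> bool" where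
  "depends_le M f \<longleftrightarrow> (\<forall>p q. (\<forall>k\<le>M. p k = q k) \<longrightarrow> f p = f q)"

text \<open>The Markov property: given level M, the levels below it follow the chain law started at
  \<open>p M\<close>, so a function of them may be replaced by its conditional mean.\<close>

lemma expect_tower:
  fixes h f :: "_ \<Rightarrow> 'a::real_normed_field"
  assumes lam: "lam \<in> GT N" and \<theta>: "\<theta> > 0" and MN: "M \<le> N" and h: "depends_ge M h" and f: "depends_le M f"
  shows "expect \<theta> N lam (\<lambda>p. h p * f p) = expect \<theta> N lam (\<lambda>p. h p * expect \<theta> M (p M) f)"
  using MN lam h
proof (induction N arbitrary: lam h rule: dec_induct)
  case base
  define c where "c = h ((\<lambda>_. [])(M := lam))"
  have c: "h p = c" if "p \<in> chains M lam" for p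
  proof -
    have "p k = ((\<lambda>_. [])(M := lam)) k" if "k \<ge> M" for k
      using chainsD(1,2)[OF \<open>p \<in> _\<close>] that by (cases "k = M") auto
    then show ?thesis using base(2) unfolding depends_ge_def c_def by blast
  qed
  have "expect \<theta> M lam (\<lambda>p. h p * f p) = expect \<theta> M lam (\<lambda>p. c * f p)"
    by (rule expect_cong) (simp add: c)
  moreover have "expect \<theta> M lam (\<lambda>p. h p * expect \<theta> M (p M) f) = expect \<theta> M lam (\<lambda>p. c * expect \<theta> M lam f)"
    by (rule expect_cong) (simp add: c chainsD(1))
  ultimately show ?case using base(1) \<theta> by (simp add: expect_cmult expect_const)
next
  case (step n)
  have dep: "depends_ge M (\<lambda>p. h (p(Suc n := lam)))"
    unfolding depends_ge_def
  proof (intro allI impI)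
    fix p q :: "nat \<Rightarrow> int list" assume "\<forall>k\<ge>M. p k = q k"
    then have "\<forall>k\<ge>M. (p(Suc n := lam)) k = (q(Suc n := lam)) k" by simp
    then show "h (p(Suc n := lam)) = h (q(Suc n := lam))" using step.prems(2) unfolding depends_ge_def by blast
  qed
  have f': "f (p(Suc n := lam)) = f p" for p
  proof -
    have "\<forall>k\<le>M. (p(Suc n := lam)) k = p k" using step.hyps by simp
    then show ?thesis using f unfolding depends_le_def by blast
  qed
  have M: "(p(Suc n := lam)) M = p M" for p :: "nat \<Rightarrow> int list" using step.hyps by simp
  show ?case
    unfolding expect_Suc f' M
    by (intro sum.cong refl) (simp only: step.IH[OF below_GT dep])
qed

lemma expect_permute:
  fixes \<phi> :: "(nat \<Rightarrow> int) \<Rightarrow> 'a::real_normed_vector"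
  assumes "lam \<in> GT N" "\<theta> > 0" "\<pi> permutes {1..N}"
  shows "expect \<theta> N lam (\<lambda>p. \<phi> (\<lambda>i. incs N p (\<pi> i))) = expect \<theta> N lam (\<lambda>p. \<phi> (incs N p))"
  using expect_incs[OF assms(1,2), of "\<lambda>\<xi>. \<phi> (\<lambda>i. \<xi> (\<pi> i))"] expect_incs[OF assms(1,2), of \<phi>]
    normed_sum_permute[OF assms(2,1,3), of \<phi>] by simp

lemma expect_incr_swap:
  fixes \<phi> :: "int \<Rightarrow> 'a::real_normed_vector"
  assumes lam: "lam \<in> GT N" and \<theta>: "\<theta> > 0" and ij: "i \<in> {1..N}" "j \<in> {1..N}"
  shows "expect \<theta> N lam (\<lambda>p. \<phi> (incr p i)) = expect \<theta> N lam (\<lambda>p. \<phi> (incr p j))"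
proof -
  have "Transposition.transpose i j permutes {1..N}" using ij by (rule permutes_swap_id)
  from expect_permute[OF lam \<theta> this, of "\<lambda>\<xi>. \<phi> (\<xi> i)"]
  show ?thesis using ij by (simp add: incs_def)
qed

text \<open>By exchangeability the increment at any level has the law of the first one, for which
  the transform was evaluated.\<close>

lemma expect_gamma_weight:
  assumes lam: "lam \<in> GT N" and \<theta>: "\<theta> > 0" and u: "generic \<theta> u" and i: "i \<in> {1..N}"
  shows "expect \<theta> N lam (\<lambda>p. gamma_weight \<theta> N u (incr p i)) = gamma_prod \<theta> N u (entry lam)"
proof -
  have N: "1 \<in> {1..N}" using i by auto
  have "expect \<theta> N lam (\<lambda>p. gamma_weight \<theta> N u (incr p i)) = expect \<theta> N lam (\<lambda>p. gamma_weight \<theta> N u (incs N p 1))"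
    unfolding expect_incr_swap[OF lam \<theta> i N, where \<phi> = "gamma_weight \<theta> N u"] using N by (simp add: incs_def)
  also have "\<dots> = gamma_prod \<theta> N u (entry lam)"
    using expect_incs[OF lam \<theta>, of "\<lambda>\<xi>. gamma_weight \<theta> N u (\<xi> 1)"] normed_sum_gamma_weight[OF \<theta> lam u] N unit_const_pos[OF \<theta>, of N]
    by simp
  finally show ?thesis .
qed

lemma below_sum_bounds:
  assumes lam: "lam \<in> GT (Suc n)" and mu: "mu \<in> below n lam"
  shows "entry lam (Suc n) \<le> sum_list lam - sum_list mu" "sum_list lam - sum_list mu \<le> entry lam 1"
proof -
  have s: "sum_list lam = (\<Sum>i\<in>{1..Suc n}. entry lam i)" "sum_list mu = (\<Sum>i\<in>{1..n}. entry mu i)"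
    using sum_list_entry[OF GT_length[OF lam]] sum_list_entry[OF GT_length[OF below_GT[OF mu]]] by auto
  have b: "entry lam (Suc i) \<le> entry mu i" "entry mu i \<le> entry lam i" if "i \<in> {1..n}" for i
    using mu that by (auto simp: below_def)
  have "(\<Sum>i\<in>{1..n}. entry mu i) \<le> (\<Sum>i\<in>{1..n}. entry lam i)" by (rule sum_mono) (rule b)
  then show "entry lam (Suc n) \<le> sum_list lam - sum_list mu" unfolding s by simp
  have "(\<Sum>i\<in>{1..n}. entry lam (Suc i)) \<le> (\<Sum>i\<in>{1..n}. entry mu i)" by (rule sum_mono) (rule b)
  moreover have "(\<Sum>i\<in>{1..n}. entry lam (Suc i)) = (\<Sum>i\<in>{Suc 1..Suc n}. entry lam i)"
    by (rule sum.shift_bounds_cl_Suc_ivl[symmetric])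
  moreover have "(\<Sum>i\<in>{1..Suc n}. entry lam i) = entry lam 1 + (\<Sum>i\<in>{Suc 1..Suc n}. entry lam i)"
    by (rule sum.atLeast_Suc_atMost) simp
  ultimately show "sum_list lam - sum_list mu \<le> entry lam 1" unfolding s by simp
qed

lemma chain_entry_bounds:
  assumes p: "p \<in> chains N lam" and lam: "lam \<in> GT N" and k: "1 \<le> k" "k \<le> N"
  shows "entry lam N \<le> entry (p k) k" "entry (p k) 1 \<le> entry lam 1"
proof -
  have "entry lam N \<le> entry (p k) k \<and> entry (p k) 1 \<le> entry lam 1" using k(2)
  proof (induction k rule: inc_induct)
    case base
    then show ?case using chainsD(1)[OF p] by simp
  next
    case (step j)
    have "p j \<in> below j (p (Suc j))" using chainsD(3)[OF p] step by simp
    then have "entry (p (Suc j)) (Suc j) \<le> entry (p j) j" "entry (p j) 1 \<le> entry (p (Suc j)) 1"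
      using step k by (auto simp: below_def)
    then show ?case using step by linarith
  qed
  then show "entry lam N \<le> entry (p k) k" "entry (p k) 1 \<le> entry lam 1" by auto
qed

text \<open>Interlacing confines an increment to the range of its level, and these ranges are nested
  along the chain. Only this range of k matters when the weights are estimated.\<close>

lemma incr_bounds:
  assumes p: "p \<in> chains N lam" and lam: "lam \<in> GT N" and i: "i \<in> {1..N}"
  shows "entry lam N \<le> incr p i" "incr p i \<le> entry lam 1"
proof -
  obtain k where k: "i = Suc k" "k < N" using i by (cases i) auto
  have "p (Suc k) \<in> GT (Suc k)" "p k \<in> below k (p (Suc k))"
    using chains_GT[OF p lam] chainsD(3)[OF p] k by auto
  from below_sum_bounds[OF this] chain_entry_bounds[OF p lam, of "Suc k"] k
  show "entry lam N \<le> incr p i" "incr p i \<le> entry lam 1" by (auto simp: incr_def)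
qed

section \<open>Comparison of the transform along a chain\<close>

definition row_factor :: "real \<Rightarrow> real \<Rightarrow> nat \<Rightarrow> int \<Rightarrow> real" where
  "row_factor \<theta> u i k = Gamma (u - of_int k + \<theta> * (real i - 1)) / Gamma (u - of_int k + \<theta> * real i)"

lemma row_factor_pos: "of_int k < u \<Longrightarrow> \<theta> > 0 \<Longrightarrow> i \<ge> 1 \<Longrightarrow> row_factor \<theta> u i k > 0"
  unfolding row_factor_def by (intro divide_pos_pos Gamma_real_pos add_pos_nonneg) auto

lemma row_factor_nonneg: "of_int k < u \<Longrightarrow> \<theta> > 0 \<Longrightarrow> i \<ge> 1 \<Longrightarrow> row_factor \<theta> u i k \<ge> 0"
  using row_factor_pos by (metis less_eq_real_def)

lemma row_factor_Suc:
  assumes "of_int k + 1 < u" "\<theta> > 0" "i \<ge> 1"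
  shows "row_factor \<theta> u i (k + 1) = row_factor \<theta> u i k * (1 + \<theta> / (u - of_int k - 1 + \<theta> * (real i - 1)))"
proof -
  define y where "y = u - of_int k - 1 + \<theta> * (real i - 1)"
  have y: "y > 0" unfolding y_def using assms by (intro add_pos_nonneg) auto
  have "Gamma (y + 1) = y * Gamma y" "Gamma (y + \<theta> + 1) = (y + \<theta>) * Gamma (y + \<theta>)"
    using y assms by (auto intro!: Gamma_plus1 elim!: nonpos_Ints_cases)
  moreover have "row_factor \<theta> u i (k + 1) = Gamma y / Gamma (y + \<theta>)" "row_factor \<theta> u i k = Gamma (y + 1) / Gamma (y + \<theta> + 1)"
    by (simp_all add: row_factor_def y_def algebra_simps)
  moreover have "1 + \<theta> / y = (y + \<theta>) / y" using y by (simp add: field_simps)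
  ultimately show ?thesis using y assms(2) unfolding y_def[symmetric] by simp
qed

text \<open>A box multiplies its row factor by 1 + \<theta> / x, with x the distance of the box from
  u. The upper, longer row has the smaller distances, so it gains more from the same number d of
  boxes.\<close>

lemma row_factor_ratio:
  assumes "b \<le> a" "of_int (a + int d) < u" "\<theta> > 0" "1 \<le> i" "i \<le> j"
  shows "row_factor \<theta> u i a * row_factor \<theta> u j (b + int d) \<le> row_factor \<theta> u i (a + int d) * row_factor \<theta> u j b"
  using assms(2)
proof (induction d)
  case (Suc d)
  have lt: "of_int (a + int d) + 1 < u" "of_int (b + int d) + 1 < u" using Suc.prems assms(1) by auto
  define x where "x = u - of_int (a + int d) - 1 + \<theta> * (real i - 1)"
  define y where "y = u - of_int (b + int d) - 1 + \<theta> * (real j - 1)"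
  have "\<theta> * (real i - 1) \<le> \<theta> * (real j - 1)" using assms by (intro mult_left_mono) auto
  moreover have "real_of_int b \<le> real_of_int a" using assms(1) by simp
  ultimately have "x \<le> y" unfolding x_def y_def of_int_add by linarith
  moreover have "0 < x" using lt assms unfolding x_def by (intro add_pos_nonneg) auto
  ultimately have xy: "0 < x" "x \<le> y" by auto
  have e: "row_factor \<theta> u i (a + int (Suc d)) = row_factor \<theta> u i (a + int d) * (1 + \<theta> / x)"
    "row_factor \<theta> u j (b + int (Suc d)) = row_factor \<theta> u j (b + int d) * (1 + \<theta> / y)"
    using row_factor_Suc[OF lt(1) assms(3), of i] row_factor_Suc[OF lt(2) assms(3), of j] assms
    by (simp_all add: x_def y_def algebra_simps)
  have pos: "row_factor \<theta> u i (a + int d) > 0" "row_factor \<theta> u j b > 0"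
    using lt assms by (auto intro!: row_factor_pos)
  have "row_factor \<theta> u i a * row_factor \<theta> u j (b + int d) * (1 + \<theta> / y) \<le>
      row_factor \<theta> u i (a + int d) * row_factor \<theta> u j b * (1 + \<theta> / x)"
  proof (rule mult_mono)
    show "1 + \<theta> / y \<le> 1 + \<theta> / x" using xy assms(3) by (auto intro!: divide_left_mono)
    show "0 \<le> 1 + \<theta> / y" using xy assms(3) by (auto intro!: add_nonneg_nonneg)
  qed (use Suc lt pos in auto)
  then show ?case unfolding e by (simp add: mult_ac)
qed simp

text \<open>Append to \<open>mu\<close> an extra row holding
  \<open>sum_list lam - sum_list mu\<close> boxes, then return its boxes to rows 1, 2, ..., n until
  \<open>lam\<close> is restored. Every move goes from the last row to an upper row that is at least
  as long as what remains, hence increases the product.\<close>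

lemma gamma_prod_below:
  assumes lam: "lam \<in> GT (Suc n)" and mu: "mu \<in> below n lam" and u: "of_int (entry lam 1) < u" and \<theta>: "\<theta> > 0"
  shows "gamma_prod \<theta> n u (entry mu) * row_factor \<theta> u (Suc n) (sum_list lam - sum_list mu) \<le> gamma_prod \<theta> (Suc n) u (entry lam)"
proof -
  \<comment> \<open>Length of the extra row while the last t rows of \<open>mu\<close> still wait to
    be filled. Interlacing keeps it below the next row of \<open>lam\<close>, which is the condition
    for the next move.\<close>
  define c where "c = (\<lambda>t. entry lam (Suc n) + (\<Sum>i\<in>{Suc n - t..n}. entry lam i - entry mu i))"
  have lam_lt: "of_int (entry lam i) < u" if "i \<in> {1..Suc n}" for i
    using GT_antimono[OF lam, of 1 i] that u by simp
  have b: "entry lam (Suc i) \<le> entry mu i" "entry mu i \<le> entry lam i" if "i \<in> {1..n}" for i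
    using mu that by (auto simp: below_def)
  have mu_lt: "of_int (entry mu i) < u" if "i \<in> {1..n}" for i
    using b[OF that] lam_lt[of i] that by simp
  have claim: "(\<Prod>i\<in>{Suc n - t..n}. row_factor \<theta> u i (entry mu i)) * row_factor \<theta> u (Suc n) (c t) \<le>
      (\<Prod>i\<in>{Suc n - t..n}. row_factor \<theta> u i (entry lam i)) * row_factor \<theta> u (Suc n) (entry lam (Suc n)) \<and> c t \<le> entry lam (Suc n - t)"
    if "t \<le> n" for t
    using that
  proof (induction t)
    case (Suc t)
    define i where "i = n - t"
    have i: "i \<in> {1..n}" "Suc n - Suc t = i" "Suc n - t = Suc i" using Suc.prems by (auto simp: i_def)
    have ins: "{i..n} = insert i {Suc i..n}" using i by auto
    have IH: "(\<Prod>k\<in>{Suc i..n}. row_factor \<theta> u k (entry mu k)) * row_factor \<theta> u (Suc n) (c t) \<le>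
      (\<Prod>k\<in>{Suc i..n}. row_factor \<theta> u k (entry lam k)) * row_factor \<theta> u (Suc n) (entry lam (Suc n))" "c t \<le> entry lam (Suc i)"
      using Suc i by auto
    have ct: "c (Suc t) = c t + (entry lam i - entry mu i)" unfolding c_def i ins by simp
    define d where "d = nat (entry lam i - entry mu i)"
    have d: "entry lam i = entry mu i + int d" using b[OF i(1)] by (simp add: d_def)
    have "row_factor \<theta> u i (entry mu i) * row_factor \<theta> u (Suc n) (c t + int d) \<le>
        row_factor \<theta> u i (entry mu i + int d) * row_factor \<theta> u (Suc n) (c t)"
    proof (rule row_factor_ratio)
      show "c t \<le> entry mu i" using IH(2) b(1)[OF i(1)] by simp
      show "of_int (entry mu i + int d) < u" using lam_lt[of i] i d by auto
    qed (use i \<theta> in auto)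
    then have r: "row_factor \<theta> u i (entry mu i) * row_factor \<theta> u (Suc n) (c (Suc t)) \<le>
        row_factor \<theta> u i (entry lam i) * row_factor \<theta> u (Suc n) (c t)"
      unfolding ct using d by simp
    have pm: "(\<Prod>k\<in>{Suc i..n}. row_factor \<theta> u k (entry mu k)) \<ge> 0"
      using mu_lt \<theta> by (intro prod_nonneg ballI row_factor_nonneg) auto
    have pl: "row_factor \<theta> u i (entry lam i) \<ge> 0"
      using lam_lt[of i] i \<theta> by (intro row_factor_nonneg) auto
    have "(\<Prod>k\<in>{i..n}. row_factor \<theta> u k (entry mu k)) * row_factor \<theta> u (Suc n) (c (Suc t)) =
        (\<Prod>k\<in>{Suc i..n}. row_factor \<theta> u k (entry mu k)) * (row_factor \<theta> u i (entry mu i) * row_factor \<theta> u (Suc n) (c (Suc t)))"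
      unfolding ins by simp
    also have "\<dots> \<le> (\<Prod>k\<in>{Suc i..n}. row_factor \<theta> u k (entry mu k)) * (row_factor \<theta> u i (entry lam i) * row_factor \<theta> u (Suc n) (c t))"
      using r pm by (rule mult_left_mono)
    also have "\<dots> = row_factor \<theta> u i (entry lam i) * ((\<Prod>k\<in>{Suc i..n}. row_factor \<theta> u k (entry mu k)) * row_factor \<theta> u (Suc n) (c t))"
      by (simp only: mult_ac)
    also have "\<dots> \<le> row_factor \<theta> u i (entry lam i) * ((\<Prod>k\<in>{Suc i..n}. row_factor \<theta> u k (entry lam k)) * row_factor \<theta> u (Suc n) (entry lam (Suc n)))"
      using IH(1) pl by (rule mult_left_mono)
    also have "\<dots> = (\<Prod>k\<in>{i..n}. row_factor \<theta> u k (entry lam k)) * row_factor \<theta> u (Suc n) (entry lam (Suc n))"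
      unfolding ins by simp
    finally show ?case unfolding i(2) ct using IH(2) b(1)[OF i(1)] by simp
  qed (simp add: c_def)
  have "sum_list lam - sum_list mu = c n"
    unfolding c_def sum_list_entry[OF GT_length[OF lam]] sum_list_entry[OF GT_length[OF below_GT[OF mu]]] by (simp add: sum_subtractf)
  then show ?thesis using claim[of n] unfolding gamma_prod_def row_factor_def[symmetric] by simp
qed

text \<open>Division by the value at 0 removes the common size of the Gamma quotients; what is left
  tends to \<open>(1 + \<theta> / v) powi k\<close>.\<close>

definition rel_weight :: "real \<Rightarrow> nat \<Rightarrow> real \<Rightarrow> int \<Rightarrow> real" where
  "rel_weight \<theta> N u k = gamma_weight \<theta> N u k / gamma_weight \<theta> N u 0"

definition rel_prod :: "real \<Rightarrow> nat \<Rightarrow> real \<Rightarrow> int list \<Rightarrow> real" where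
  "rel_prod \<theta> N u lam = gamma_prod \<theta> N u (entry lam) / gamma_weight \<theta> N u 0"

lemma expect_rel_weight:
  assumes "lam \<in> GT N" "\<theta> > 0" "generic \<theta> u" "i \<in> {1..N}"
  shows "expect \<theta> N lam (\<lambda>p. rel_weight \<theta> N u (incr p i)) = rel_prod \<theta> N u lam"
  using expect_cmult[of \<theta> N lam "1 / gamma_weight \<theta> N u 0" "\<lambda>p. gamma_weight \<theta> N u (incr p i)"]
    expect_gamma_weight[OF assms] by (simp add: rel_weight_def rel_prod_def)

text \<open>For k \<ge> 0 the factor only grows with k. For k < 0 each step divides by 1 + \<theta>
  / x with x \<ge> u, a loss of at most u / (u + \<theta>).\<close>

lemma row_factor_lower:
  assumes u: "u > 0" "of_int k < u" and \<theta>: "\<theta> > 0" and i: "i \<ge> 1"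
  shows "row_factor \<theta> u i 0 * (u / (u + \<theta>)) ^ nat \<bar>k\<bar> \<le> row_factor \<theta> u i k"
proof (cases "k \<ge> 0")
  case True
  define d where "d = nat k"
  have k: "k = int d" using True by (simp add: d_def)
  have "row_factor \<theta> u i 0 * (u / (u + \<theta>)) ^ d \<le> row_factor \<theta> u i (int d)"
    using u(2) unfolding k
  proof (induction d)
    case (Suc d)
    have "(u / (u + \<theta>)) ^ Suc d \<le> (u / (u + \<theta>)) ^ d" using u \<theta> by (intro power_decreasing) auto
    then have "row_factor \<theta> u i 0 * (u / (u + \<theta>)) ^ Suc d \<le> row_factor \<theta> u i 0 * (u / (u + \<theta>)) ^ d"
      using u \<theta> i row_factor_pos[of 0 u \<theta> i] by (intro mult_left_mono) auto
    also have "\<dots> \<le> row_factor \<theta> u i (int d)" using Suc by simp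
    also have "\<dots> \<le> row_factor \<theta> u i (int d) * (1 + \<theta> / (u - of_int (int d) - 1 + \<theta> * (real i - 1)))"
      using Suc.prems \<theta> i row_factor_pos[of "int d" u \<theta> i] by (simp add: mult_le_cancel_left1)
    also have "\<dots> = row_factor \<theta> u i (int d + 1)"
      using Suc.prems \<theta> i by (intro row_factor_Suc[symmetric]) auto
    finally show ?case by (simp add: add.commute)
  qed simp
  then show ?thesis unfolding k by simp
next
  case False
  define d where "d = nat (- k)"
  have k: "k = - int d" using False by (simp add: d_def)
  have "row_factor \<theta> u i 0 * (u / (u + \<theta>)) ^ d \<le> row_factor \<theta> u i (- int d)"
  proof (induction d)
    case (Suc d)
    define x where "x = u + real d + \<theta> * (real i - 1)"
    have x: "x \<ge> u" using \<theta> i by (simp add: x_def)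
    have e: "row_factor \<theta> u i (- int d) = row_factor \<theta> u i (- int (Suc d)) * (1 + \<theta> / x)"
      using row_factor_Suc[of "- int (Suc d)" u \<theta> i] u \<theta> i by (simp add: x_def algebra_simps)
    have pos: "row_factor \<theta> u i (- int (Suc d)) > 0" using u \<theta> i by (intro row_factor_pos) auto
    have "row_factor \<theta> u i 0 * (u / (u + \<theta>)) ^ Suc d = row_factor \<theta> u i 0 * (u / (u + \<theta>)) ^ d * (u / (u + \<theta>))" by simp
    also have "\<dots> \<le> row_factor \<theta> u i (- int d) * (u / (u + \<theta>))"
      using Suc u \<theta> by (intro mult_right_mono) auto
    also have "\<dots> = row_factor \<theta> u i (- int (Suc d)) * ((1 + \<theta> / x) * (u / (u + \<theta>)))" unfolding e by simp
    also have "\<dots> \<le> row_factor \<theta> u i (- int (Suc d)) * 1"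
    proof (rule mult_left_mono)
      have "(1 + \<theta> / x) * (u / (u + \<theta>)) \<le> (1 + \<theta> / u) * (u / (u + \<theta>))"
        using x u \<theta> by (intro mult_right_mono add_left_mono divide_left_mono) auto
      also have "1 + \<theta> / u = (u + \<theta>) / u" using u by (simp add: field_simps)
      also have "(u + \<theta>) / u * (u / (u + \<theta>)) = 1" using u \<theta> by simp
      finally show "(1 + \<theta> / x) * (u / (u + \<theta>)) \<le> 1" .
    qed (use pos in simp)
    finally show ?case by simp
  qed simp
  then show ?thesis unfolding k by simp
qed

lemma gamma_weight_zero_Suc: "u > 0 \<Longrightarrow> \<theta> > 0 \<Longrightarrow> gamma_weight \<theta> (Suc n) u 0 = gamma_weight \<theta> n u 0 * row_factor \<theta> u (Suc n) 0"
proof -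
  assume "u > 0" "\<theta> > 0"
  then have "Gamma (u + \<theta> * real n) > 0" by (intro Gamma_real_pos add_pos_nonneg) auto
  then show ?thesis by (simp add: gamma_weight_def row_factor_def)
qed

lemma gamma_weight_pos: "of_int k < u \<Longrightarrow> \<theta> > 0 \<Longrightarrow> gamma_weight \<theta> n u k > 0"
  unfolding gamma_weight_def by (intro divide_pos_pos Gamma_real_pos add_pos_nonneg) auto

lemma gamma_prod_nonneg:
  assumes "lam \<in> GT n" "n \<ge> 1 \<Longrightarrow> of_int (entry lam 1) < u" "\<theta> > 0"
  shows "gamma_prod \<theta> n u (entry lam) \<ge> 0"
  unfolding gamma_prod_def row_factor_def[symmetric]
proof (intro prod_nonneg ballI row_factor_nonneg)
  fix i assume "i \<in> {1..n}"
  then show "of_int (entry lam i) < u" using GT_antimono[OF assms(1), of 1 i] assms(2) by auto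
qed (use assms in auto)

lemma rel_prod_below:
  assumes lam: "lam \<in> GT (Suc n)" and mu: "mu \<in> below n lam" and u: "of_int (entry lam 1) < u" "u > 0" and \<theta>: "\<theta> > 0"
  shows "rel_prod \<theta> n u mu * (u / (u + \<theta>)) ^ nat \<bar>sum_list lam - sum_list mu\<bar> \<le> rel_prod \<theta> (Suc n) u lam"
proof -
  define k where "k = sum_list lam - sum_list mu"
  have k: "of_int k < u" using below_sum_bounds(2)[OF lam mu] u by (simp add: k_def)
  have mu0: "gamma_prod \<theta> n u (entry mu) \<ge> 0"
  proof (rule gamma_prod_nonneg[OF below_GT[OF mu] _ \<theta>])
    assume "1 \<le> n"
    then have "entry mu 1 \<le> entry lam 1" using mu by (auto simp: below_def)
    then show "of_int (entry mu 1) < u" using u by simp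
  qed
  have g: "gamma_weight \<theta> n u 0 > 0" "row_factor \<theta> u (Suc n) 0 > 0"
    using u \<theta> by (auto intro!: gamma_weight_pos row_factor_pos)
  have "gamma_prod \<theta> n u (entry mu) * (row_factor \<theta> u (Suc n) 0 * (u / (u + \<theta>)) ^ nat \<bar>k\<bar>) \<le>
      gamma_prod \<theta> n u (entry mu) * row_factor \<theta> u (Suc n) k"
    using row_factor_lower[OF u(2) k \<theta>, of "Suc n"] mu0 by (intro mult_left_mono) auto
  also have "\<dots> \<le> gamma_prod \<theta> (Suc n) u (entry lam)"
    unfolding k_def by (rule gamma_prod_below[OF lam mu u(1) \<theta>])
  finally have "gamma_prod \<theta> n u (entry mu) * (row_factor \<theta> u (Suc n) 0 * (u / (u + \<theta>)) ^ nat \<bar>k\<bar>) / (gamma_weight \<theta> n u 0 * row_factor \<theta> u (Suc n) 0)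
     \<le> gamma_prod \<theta> (Suc n) u (entry lam) / (gamma_weight \<theta> n u 0 * row_factor \<theta> u (Suc n) 0)"
    using g by (intro divide_right_mono) auto
  then show ?thesis
    unfolding rel_prod_def gamma_weight_zero_Suc[OF u(2) \<theta>] k_def[symmetric] using g by simp
qed

text \<open>With u of order N the base u / (u + \<theta>) tends to 1, so as long as the top
  increments stay bounded the transform of a lower level exceeds that of the full signature only
  slightly.\<close>

lemma rel_prod_chain:
  assumes lam: "lam \<in> GT N" and p: "p \<in> chains N lam" and u: "of_int (entry lam 1) < u" "u > 0" and \<theta>: "\<theta> > 0"
    and MN: "M \<le> N"
  shows "rel_prod \<theta> M u (p M) * (u / (u + \<theta>)) ^ (\<Sum>i\<in>{M<..N}. nat \<bar>incr p i\<bar>) \<le> rel_prod \<theta> N u lam"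
  using MN
proof (induction M rule: inc_induct)
  case base
  then show ?case using chainsD(1)[OF p] by simp
next
  case (step n)
  define q where "q = u / (u + \<theta>)"
  define S where "S = (\<Sum>i\<in>{Suc n<..N}. nat \<bar>incr p i\<bar>)"
  have "{n<..N} = insert (Suc n) {Suc n<..N}" using step by auto
  then have e: "(\<Sum>i\<in>{n<..N}. nat \<bar>incr p i\<bar>) = nat \<bar>sum_list (p (Suc n)) - sum_list (p n)\<bar> + S"
    by (simp add: incr_def S_def)
  have "p (Suc n) \<in> GT (Suc n)" "p n \<in> below n (p (Suc n))" "of_int (entry (p (Suc n)) 1) < u"
    using chains_GT[OF p lam] chainsD(3)[OF p] chain_entry_bounds(2)[OF p lam, of "Suc n"] step u by auto
  from rel_prod_below[OF this u(2) \<theta>]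
  have "rel_prod \<theta> n u (p n) * q ^ nat \<bar>sum_list (p (Suc n)) - sum_list (p n)\<bar> * q ^ S \<le> rel_prod \<theta> (Suc n) u (p (Suc n)) * q ^ S"
    using u \<theta> by (intro mult_right_mono) (auto simp: q_def)
  also have "\<dots> \<le> rel_prod \<theta> N u lam" using step unfolding q_def S_def by simp
  finally show ?case unfolding e q_def[symmetric] by (simp add: power_add mult.assoc)
qed

section \<open>Jack characters as expectations\<close>

lemma interlacing_eq_below:
  assumes "lam \<in> GT_pos (Suc n)"
  shows "interlacing n lam = below n lam"
proof -
  have lam: "lam \<in> GT (Suc n)" "\<And>i. i \<in> {1..Suc n} \<Longrightarrow> entry lam i \<ge> 0"
    using assms by (auto simp: GT_pos_def GT_def entry_def)
  have "mu \<in> GT_pos n" if mu: "mu \<in> below n lam" for mu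
  proof -
    have "a \<ge> 0" if a: "a \<in> set mu" for a
    proof -
      obtain i where "i \<in> {1..n}" "a = entry mu i" using in_set_entry[OF GT_length[OF below_GT[OF mu]] a] by blast
      moreover have "entry lam (Suc i) \<le> entry mu i" using mu \<open>i \<in> _\<close> by (auto simp: below_def)
      ultimately show ?thesis using lam(2)[of "Suc i"] by auto
    qed
    then show ?thesis using below_GT[OF mu] by (simp add: GT_pos_def)
  qed
  then show ?thesis by (auto simp: interlacing_def below_def GT_pos_def entry_def)
qed

lemma jack_pos_step_sum:
  assumes "lam \<in> GT_pos (Suc n)"
  shows "jack_pos \<theta> (Suc n) lam x = step_sum \<theta> (Suc n) lam (\<lambda>\<xi>. \<Prod>i\<in>{1..Suc n}. x i ^ nat (\<xi> i))"
  using assms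
proof (induction n arbitrary: lam)
  case 0
  then have lam: "length lam = 1" by (simp add: GT_pos_def GT_def)
  have "below 0 lam = {[]}" by (auto simp: below_def GT_def)
  moreover have "sum_list lam = part lam 1" using lam by (cases lam) auto
  ultimately show ?case by (simp add: jack_branch_def)
next
  case (Suc n)
  have e: "(\<Prod>i\<in>{1..Suc (Suc n)}. x i ^ nat ((\<xi>(Suc (Suc n) := d)) i)) = x (Suc (Suc n)) ^ nat d * (\<Prod>i\<in>{1..Suc n}. x i ^ nat (\<xi> i))"
    for \<xi> :: "nat \<Rightarrow> int" and d
  proof -
    have "{1..Suc (Suc n)} = insert (Suc (Suc n)) {1..Suc n}" by auto
    then show ?thesis by simp
  qed
  have lin: "step_sum \<theta> k mu (\<lambda>\<xi>. c * f \<xi>) = c * step_sum \<theta> k mu f" for k mu c and f :: "(nat \<Rightarrow> int) \<Rightarrow> complex"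
    by (induction k arbitrary: mu f) (auto simp: sum_distrib_left mult_ac)
  have "mu \<in> GT_pos (Suc n)" if "mu \<in> below (Suc n) lam" for mu
    using that interlacing_eq_below[OF Suc.prems] by (auto simp: interlacing_def)
  then show ?case
    unfolding jack_pos.simps step_sum.simps(2)[of _ "Suc n"] interlacing_eq_below[OF Suc.prems] e lin
    by (intro sum.cong refl) (simp only: Suc.IH scaleR_conv_of_real mult.assoc)
qed

lemma normed_sum_shift:
  fixes \<phi> :: "(nat \<Rightarrow> int) \<Rightarrow> 'a::real_normed_vector"
  assumes "\<theta> > 0" "lam \<in> GT N"
  shows "map (\<lambda>a. a + int K) lam \<in> GT N"
    "normed_sum \<theta> N (map (\<lambda>a. a + int K) lam) \<phi> = normed_sum \<theta> N lam (\<lambda>\<xi>. \<phi> (\<lambda>i. \<xi> i + int K * ind {1..N} i))"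
proof -
  have "map (\<lambda>a. a + int K) lam \<in> GT N \<and> (\<forall>\<phi> :: (nat \<Rightarrow> int) \<Rightarrow> 'a. normed_sum \<theta> N (map (\<lambda>a. a + int K) lam) \<phi> =
      normed_sum \<theta> N lam (\<lambda>\<xi>. \<phi> (\<lambda>i. \<xi> i + int K * ind {1..N} i)))"
  proof (induction K)
    case 0
    then show ?case using assms by simp
  next
    case (Suc K)
    have "length lam = N" using assms by (simp add: GT_length)
    then have "map (\<lambda>a. a + int (Suc K)) lam = badd {1..N} (map (\<lambda>a. a + int K) lam)"
      by (intro nth_equalityI) (auto simp: badd_def raise_def ind_def entry_def)
    moreover have "(\<lambda>i. \<xi> i + int K * ind {1..N} i + ind {1..N} i) = (\<lambda>i. \<xi> i + int (Suc K) * ind {1..N} i)" for \<xi>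
      by (simp add: algebra_simps)
    ultimately show ?case using Suc normed_sum_badd_all[OF assms(1), of "map (\<lambda>a. a + int K) lam" N, where 'a = 'a] badd_all_GT
      by (simp only:) blast
  qed
  then show "map (\<lambda>a. a + int K) lam \<in> GT N"
    "normed_sum \<theta> N (map (\<lambda>a. a + int K) lam) \<phi> = normed_sum \<theta> N lam (\<lambda>\<xi>. \<phi> (\<lambda>i. \<xi> i + int K * ind {1..N} i))" by auto
qed

definition jack_const :: "real \<Rightarrow> nat \<Rightarrow> int list \<Rightarrow> real" where
  "jack_const \<theta> N lam = level_norm \<theta> N (entry (map (\<lambda>a. a + int (nat (- part lam N))) lam)) * unit_const \<theta> N"

text \<open>The shift by K adds K to every increment, and the power of the product of the variables
  that this produces is the one divided out in \<open>jack\<close>.\<close>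

lemma jack_expect:
  assumes \<theta>: "\<theta> > 0" and lam: "lam \<in> GT N" and N: "N \<ge> 1" and x: "\<And>i. i \<in> {1..N} \<Longrightarrow> x i \<noteq> 0"
  shows "jack_const \<theta> N lam > 0"
    and "jack \<theta> N lam x = of_real (jack_const \<theta> N lam) * expect \<theta> N lam (\<lambda>p. \<Prod>i\<in>{1..N}. x i powi incr p i)"
proof -
  define K where "K = nat (- part lam N)"
  define nu where "nu = map (\<lambda>a. a + int K) lam"
  have nu: "nu \<in> GT N" unfolding nu_def by (rule normed_sum_shift(1)[OF \<theta> lam])
  obtain n where n: "N = Suc n" using N by (cases N) auto
  have len: "length lam = N" using lam by (rule GT_length)
  have bound: "entry lam i + int K \<ge> 0" if "i \<in> {1..N}" for i
    using GT_antimono[OF lam, of i N] that by (auto simp: K_def entry_def)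
  have pos: "nu \<in> GT_pos N"
  proof -
    have "a \<ge> 0" if "a \<in> set nu" for a
    proof -
      obtain b where b: "b \<in> set lam" "a = b + int K" using \<open>a \<in> set nu\<close> by (auto simp: nu_def)
      then obtain i where "i \<in> {1..N}" "b = entry lam i" using in_set_entry[OF len b(1)] by blast
      then show ?thesis using bound b by auto
    qed
    then show ?thesis using nu by (simp add: GT_pos_def)
  qed
  define c where "c = level_norm \<theta> N (entry nu) * unit_const \<theta> N"
  have c: "c > 0" unfolding c_def using level_norm_pos[OF nu \<theta>] unit_const_pos[OF \<theta>] by simp
  have c': "jack_const \<theta> N lam = c" by (simp add: jack_const_def c_def nu_def K_def)
  show "jack_const \<theta> N lam > 0" using c c' by simp
  have "jack_pos \<theta> N nu x = step_sum \<theta> N nu (\<lambda>\<xi>. \<Prod>i\<in>{1..N}. x i ^ nat (\<xi> i))"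
    using jack_pos_step_sum[of nu n] pos unfolding n by simp
  also have "\<dots> = level_norm \<theta> N (entry nu) *\<^sub>R normed_sum \<theta> N nu (\<lambda>\<xi>. \<Prod>i\<in>{1..N}. x i ^ nat (\<xi> i))"
    using level_norm_pos[OF nu \<theta>] by (simp add: normed_sum_def)
  also have "\<dots> = level_norm \<theta> N (entry nu) *\<^sub>R normed_sum \<theta> N lam (\<lambda>\<xi>. \<Prod>i\<in>{1..N}. x i ^ nat (\<xi> i + int K * ind {1..N} i))"
    unfolding nu_def normed_sum_shift(2)[OF \<theta> lam] ..
  also have "\<dots> = c *\<^sub>R expect \<theta> N lam (\<lambda>p. \<Prod>i\<in>{1..N}. x i ^ nat (incs N p i + int K * ind {1..N} i))"
    unfolding c_def using unit_const_pos[OF \<theta>, of N]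
    by (subst expect_incs[OF lam \<theta>, where \<phi> = "\<lambda>\<xi>. \<Prod>i\<in>{1..N}. x i ^ nat (\<xi> i + int K * ind {1..N} i)"]) simp
  also have "expect \<theta> N lam (\<lambda>p. \<Prod>i\<in>{1..N}. x i ^ nat (incs N p i + int K * ind {1..N} i)) =
     expect \<theta> N lam (\<lambda>p. (\<Prod>i\<in>{1..N}. x i) ^ K * (\<Prod>i\<in>{1..N}. x i powi incr p i))"
  proof (rule expect_cong)
    fix p assume p: "p \<in> chains N lam"
    have "(\<Prod>i\<in>{1..N}. x i ^ nat (incs N p i + int K * ind {1..N} i)) = (\<Prod>i\<in>{1..N}. x i ^ K * x i powi incr p i)"
    proof (rule prod.cong[OF refl])
      fix i assume i: "i \<in> {1..N}"
      \<comment> \<open>No increment lies below the last entry of the signature, so the natural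
        exponent agrees with the integer power.\<close>
      have "incr p i + int K \<ge> 0" using incr_bounds(1)[OF p lam i] bound[of N] N by simp
      then have "x i ^ nat (incr p i + int K) = x i powi (incr p i + int K)" by (simp add: power_int_def)
      also have "\<dots> = x i powi incr p i * x i ^ K" using x[OF i] by (simp add: power_int_add)
      finally show "x i ^ nat (incs N p i + int K * ind {1..N} i) = x i ^ K * x i powi incr p i"
        using i by (simp add: incs_def ind_def mult.commute)
    qed
    then show "(\<Prod>i\<in>{1..N}. x i ^ nat (incs N p i + int K * ind {1..N} i)) = (\<Prod>i\<in>{1..N}. x i) ^ K * (\<Prod>i\<in>{1..N}. x i powi incr p i)"
      by (simp add: prod.distrib prod_power_distrib)
  qed
  finally have "jack_pos \<theta> N nu x = (\<Prod>i\<in>{1..N}. x i) ^ K * (of_real c * expect \<theta> N lam (\<lambda>p. \<Prod>i\<in>{1..N}. x i powi incr p i))"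
    by (simp add: expect_cmult scaleR_conv_of_real)
  moreover have "(\<Prod>i\<in>{1..N}. x i) ^ K \<noteq> 0" using x by simp
  ultimately show "jack \<theta> N lam x = of_real (jack_const \<theta> N lam) * expect \<theta> N lam (\<lambda>p. \<Prod>i\<in>{1..N}. x i powi incr p i)"
    unfolding jack_def Let_def K_def[symmetric] nu_def[symmetric] c' by simp
qed

text \<open>Exchangeability reverses the order of the increments, so that the m variables sit at the
  top m levels. Then all but the newest variable depend on the levels above the one conditioned
  on.\<close>

theorem jack_char_expect:
  assumes \<theta>: "\<theta> > 0" and lam: "lam \<in> GT N" and m: "1 \<le> m" "m \<le> N" and x: "\<And>i. i \<in> {1..m} \<Longrightarrow> x i \<noteq> 0"
  shows "jack_char \<theta> N m lam x = expect \<theta> N lam (\<lambda>p. \<Prod>i\<in>{1..m}. x i powi incr p (Suc N - i))"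
proof -
  have N: "N \<ge> 1" using m by simp
  define y where "y = (\<lambda>i. if i \<le> m then x i else 1)"
  have y: "y i \<noteq> 0" if "i \<in> {1..N}" for i using x that by (auto simp: y_def)
  have "jack_char \<theta> N m lam x = expect \<theta> N lam (\<lambda>p. \<Prod>i\<in>{1..N}. y i powi incr p i)"
    using jack_expect[OF \<theta> lam N, of y, OF y] jack_expect(2)[OF \<theta> lam N, of "\<lambda>_. 1"]
    by (simp add: jack_char_def y_def[symmetric] expect_const[OF lam \<theta>])
  also have "\<dots> = expect \<theta> N lam (\<lambda>p. \<Prod>i\<in>{1..m}. x i powi incs N p i)"
  proof (rule expect_cong)
    fix p
    have "(\<Prod>i\<in>{1..N}. y i powi incr p i) = (\<Prod>i\<in>{1..m}. y i powi incr p i)"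
      using m by (intro prod.mono_neutral_right) (auto simp: y_def)
    also have "\<dots> = (\<Prod>i\<in>{1..m}. x i powi incs N p i)"
      using m by (intro prod.cong) (auto simp: y_def incs_def)
    finally show "(\<Prod>i\<in>{1..N}. y i powi incr p i) = (\<Prod>i\<in>{1..m}. x i powi incs N p i)" .
  qed
  also have "\<dots> = expect \<theta> N lam (\<lambda>p. \<Prod>i\<in>{1..m}. x i powi incs N p (Suc N - i))"
  proof -
    define \<pi> where "\<pi> = (\<lambda>i. if i \<in> {1..N} then Suc N - i else i)"
    have "\<pi> permutes {1..N}"
    proof (rule bij_imp_permutes)
      show "bij_betw \<pi> {1..N} {1..N}"
        by (rule bij_betw_byWitness[where f' = \<pi>]) (auto simp: \<pi>_def)
    qed (auto simp: \<pi>_def)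
    from expect_permute[OF lam \<theta> this, where \<phi> = "\<lambda>\<xi>. \<Prod>i\<in>{1..m}. x i powi \<xi> i"]
    have "expect \<theta> N lam (\<lambda>p. \<Prod>i\<in>{1..m}. x i powi incs N p i) = expect \<theta> N lam (\<lambda>p. \<Prod>i\<in>{1..m}. x i powi incs N p (\<pi> i))" by simp
    also have "\<dots> = expect \<theta> N lam (\<lambda>p. \<Prod>i\<in>{1..m}. x i powi incs N p (Suc N - i))"
      using m by (intro expect_cong prod.cong refl) (auto simp: \<pi>_def)
    finally show ?thesis .
  qed
  also have "\<dots> = expect \<theta> N lam (\<lambda>p. \<Prod>i\<in>{1..m}. x i powi incr p (Suc N - i))"
    using m by (intro expect_cong prod.cong refl) (auto simp: incs_def)
  finally show ?thesis .
qed

section \<open>Box products over Young diagrams\<close>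

lemma GT_posD:
  assumes "nu \<in> GT_pos N"
  shows "length nu = N" "i \<in> {1..N} \<Longrightarrow> entry nu i \<ge> 0" "1 \<le> i \<Longrightarrow> i \<le> j \<Longrightarrow> j \<le> N \<Longrightarrow> entry nu j \<le> entry nu i"
proof -
  have nu: "nu \<in> GT N" using assms by (simp add: GT_pos_def)
  show l: "length nu = N" using nu by (rule GT_length)
  show "entry nu i \<ge> 0" if "i \<in> {1..N}"
  proof -
    have "entry nu i \<in> set nu" using that l by (auto simp: entry_def intro!: nth_mem)
    then show ?thesis using assms by (auto simp: GT_pos_def)
  qed
  show "1 \<le> i \<Longrightarrow> i \<le> j \<Longrightarrow> j \<le> N \<Longrightarrow> entry nu j \<le> entry nu i" by (rule GT_antimono[OF nu])
qed

lemma young_Sigma: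
  "length nu = N \<Longrightarrow> young nu = (SIGMA i:{1..N}. {1..nat (entry nu i)})"
  by (auto simp: young_def entry_def)

lemma finite_young [simp]: "finite (young nu)"
  unfolding young_Sigma[OF refl] by simp

lemma card_young:
  assumes "nu \<in> GT_pos N"
  shows "real (card (young nu)) = real_of_int (sum_list nu)"
proof -
  have "card (young nu) = (\<Sum>i\<in>{1..N}. nat (entry nu i))"
    using young_Sigma[OF GT_posD(1)[OF assms]] by simp
  also have "real \<dots> = real_of_int (\<Sum>i\<in>{1..N}. entry nu i)"
    using GT_posD(2)[OF assms] by simp
  also have "(\<Sum>i\<in>{1..N}. entry nu i) = sum_list nu" using sum_list_entry[OF GT_posD(1)[OF assms]] by simp
  finally show ?thesis .
qed

lemma young_down:
  assumes nu: "nu \<in> GT_pos N" and "(i, j) \<in> young nu" "1 \<le> i'" "i' \<le> i" "1 \<le> j'" "j' \<le> j"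
  shows "(i', j') \<in> young nu"
proof -
  have i: "i \<in> {1..N}" "int j \<le> entry nu i" using assms GT_posD(1)[OF nu] by (auto simp: young_def entry_def)
  then have "entry nu i \<le> entry nu i'" using GT_posD(3)[OF nu, of i' i] assms by auto
  then show ?thesis using i assms GT_posD(1)[OF nu] by (auto simp: young_def entry_def)
qed

text \<open>The i by j rectangle lies in the diagram. Applied to boxes of the k-th hook, this bounds
  both coordinates by the size divided by k.\<close>

lemma young_area:
  assumes nu: "nu \<in> GT_pos N" and ij: "(i, j) \<in> young nu"
  shows "real i * real j \<le> real_of_int (sum_list nu)"
proof -
  have "{1..i} \<times> {1..j} \<subseteq> young nu" using young_down[OF nu ij] by auto
  then have "card ({1..i} \<times> {1..j}) \<le> card (young nu)" by (intro card_mono) auto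
  then have "real (i * j) \<le> real (card (young nu))" by (intro of_nat_mono) simp
  then show ?thesis using card_young[OF nu] by simp
qed

lemma initial_segment_card:
  assumes "finite A" "\<And>k. k \<in> A \<Longrightarrow> 1 \<le> (k::nat)" "\<And>k j. \<lbrakk>k \<in> A; 1 \<le> j; j \<le> k\<rbrakk> \<Longrightarrow> j \<in> A"
  shows "A = {1..card A}"
proof (cases "A = {}")
  case False
  define r where "r = Max A"
  have r: "r \<in> A" using assms(1) False by (simp add: r_def)
  have "A = {1..r}"
  proof
    show "A \<subseteq> {1..r}" using assms(1,2) by (auto simp: r_def)
    show "{1..r} \<subseteq> A" using assms(3)[OF r] by auto
  qed
  then show ?thesis by (metis card_atLeastAtMost diff_Suc_1)
qed auto

lemma diag_len_iff:
  assumes nu: "nu \<in> GT_pos N" and "1 \<le> k"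
  shows "k \<le> diag_len nu \<longleftrightarrow> (k, k) \<in> young nu"
proof -
  have "{k. (k, k) \<in> young nu} = {1..diag_len nu}" unfolding diag_len_def
  proof (rule initial_segment_card)
    have "{k. (k, k) \<in> young nu} \<subseteq> fst ` young nu" by force
    then show "finite {k. (k, k) \<in> young nu}" by (rule finite_subset) simp
    show "1 \<le> k" if "k \<in> {k. (k, k) \<in> young nu}" for k using that by (auto simp: young_def)
    show "j \<in> {k. (k, k) \<in> young nu}" if "k \<in> {k. (k, k) \<in> young nu}" "1 \<le> j" "j \<le> k" for k j
      using young_down[OF nu, of k k j j] that by auto
  qed
  then have "k \<in> {k. (k, k) \<in> young nu} \<longleftrightarrow> k \<in> {1..diag_len nu}" by (simp only:)
  then show ?thesis using assms(2) by simp
qed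

lemma conj_part_iff:
  assumes nu: "nu \<in> GT_pos N" and "1 \<le> j"
  shows "(i, j) \<in> young nu \<longleftrightarrow> i \<in> {1..conj_part nu j}"
proof -
  have "{i. (i, j) \<in> young nu} = {1..conj_part nu j}" unfolding conj_part_def
  proof (rule initial_segment_card)
    have "{i. (i, j) \<in> young nu} \<subseteq> fst ` young nu" by force
    then show "finite {i. (i, j) \<in> young nu}" by (rule finite_subset) simp
    show "1 \<le> k" if "k \<in> {i. (i, j) \<in> young nu}" for k using that by (auto simp: young_def)
    show "i \<in> {i. (i, j) \<in> young nu}" if "k \<in> {i. (i, j) \<in> young nu}" "1 \<le> i" "i \<le> k" for k i
      using young_down[OF nu, of k j i j] that assms(2) by auto
  qed
  then have "i \<in> {i. (i, j) \<in> young nu} \<longleftrightarrow> i \<in> {1..conj_part nu j}" by (simp only:)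
  then show ?thesis by simp
qed

lemma young_row_iff: "nu \<in> GT_pos N \<Longrightarrow> i \<in> {1..N} \<Longrightarrow> (i, j) \<in> young nu \<longleftrightarrow> j \<in> {1..nat (entry nu i)}"
  by (auto simp: young_def entry_def GT_posD(1))

lemma frob_values:
  assumes nu: "nu \<in> GT_pos N" and k: "1 \<le> k" "k \<le> diag_len nu"
  shows "k \<in> {1..N}" "k \<le> nat (entry nu k)" "k \<le> conj_part nu k"
    "frob_a nu k = real (nat (entry nu k)) - real k + 1/2" "frob_b nu k = real (conj_part nu k) - real k + 1/2"
proof -
  have "(k, k) \<in> young nu" using diag_len_iff[OF nu k(1)] k by simp
  then show kN: "k \<in> {1..N}" using GT_posD(1)[OF nu] by (auto simp: young_def)
  show "k \<le> nat (entry nu k)" "k \<le> conj_part nu k"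
    using \<open>(k, k) \<in> young nu\<close> young_row_iff[OF nu kN] conj_part_iff[OF nu k(1)] by auto
  show "frob_a nu k = real (nat (entry nu k)) - real k + 1/2"
    using k GT_posD(2)[OF nu kN] by (simp add: frob_a_def entry_def)
  show "frob_b nu k = real (conj_part nu k) - real k + 1/2"
    using k by (simp add: frob_b_def)
qed

lemma frob_zero: "k > diag_len nu \<Longrightarrow> frob_a nu k = 0" "k > diag_len nu \<Longrightarrow> frob_b nu k = 0"
  by (auto simp: frob_a_def frob_b_def)

lemma frob_nonneg:
  assumes "nu \<in> GT_pos N" "1 \<le> k"
  shows "frob_a nu k \<ge> 0" "frob_b nu k \<ge> 0"
  using frob_values[OF assms] frob_zero[of nu k] by (cases "k \<le> diag_len nu"; force)+

lemma frob_antimono: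
  assumes nu: "nu \<in> GT_pos N" and k: "1 \<le> k"
  shows "frob_a nu k \<le> frob_a nu 1" "frob_b nu k \<le> frob_b nu 1"
proof -
  have "frob_a nu k \<le> frob_a nu 1 \<and> frob_b nu k \<le> frob_b nu 1"
  proof (cases "k \<le> diag_len nu")
    case True
    note v = frob_values[OF nu k True] frob_values[OF nu, of 1]
    have "entry nu k \<le> entry nu 1" using GT_posD(3)[OF nu, of 1 k] v(1) by auto
    moreover have "conj_part nu k \<le> conj_part nu 1"
      using conj_part_iff[OF nu, of k "conj_part nu k"] conj_part_iff[OF nu, of 1 "conj_part nu k"]
        young_down[OF nu, of "conj_part nu k" k "conj_part nu k" 1] v(3) k by auto
    ultimately show ?thesis using v k True by (auto simp: nat_mono)
  next
    case False
    then show ?thesis using frob_zero[of nu k] frob_nonneg[OF nu, of 1] by auto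
  qed
  then show "frob_a nu k \<le> frob_a nu 1" "frob_b nu k \<le> frob_b nu 1" by auto
qed

section \<open>Principal hooks, their arms and legs\<close>

definition hook :: "int list \<Rightarrow> nat \<Rightarrow> (nat \<times> nat) set" where
  "hook nu k = {b \<in> young nu. min (fst b) (snd b) = k}"

lemma hook_eq:
  assumes nu: "nu \<in> GT_pos N" and k: "1 \<le> k"
  shows "hook nu k = (if k \<le> diag_len nu then {k} \<times> {k..nat (entry nu k)} \<union> {k<..conj_part nu k} \<times> {k} else {})"
proof (cases "k \<le> diag_len nu")
  case True
  have kN: "k \<in> {1..N}" by (rule frob_values(1)[OF nu k True])
  have "(i, j) \<in> hook nu k \<longleftrightarrow> i = k \<and> j \<in> {k..nat (entry nu k)} \<or> i \<in> {k<..conj_part nu k} \<and> j = k" for i j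
  proof -
    have "(i, j) \<in> hook nu k \<longleftrightarrow> (i = k \<and> k \<le> j \<and> (k, j) \<in> young nu) \<or> (k < i \<and> j = k \<and> (i, k) \<in> young nu)"
      by (auto simp: hook_def min_def)
    then show ?thesis unfolding young_row_iff[OF nu kN] conj_part_iff[OF nu k]
      using k by (auto simp only: atLeastAtMost_iff greaterThanAtMost_iff)
  qed
  then show ?thesis using True by auto
next
  case False
  then have "(k, k) \<notin> young nu" using diag_len_iff[OF nu k] by simp
  moreover have "(k, k) \<in> young nu" if "b \<in> hook nu k" for b
    using young_down[OF nu, of "fst b" "snd b" k k] that k by (auto simp: hook_def)
  ultimately have "hook nu k = {}" by blast
  then show ?thesis using False by simp
qed

text \<open>The two halves in the modified Frobenius coordinates together account for the corner
  box.\<close>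

lemma card_hook:
  assumes nu: "nu \<in> GT_pos N" and k: "1 \<le> k"
  shows "real (card (hook nu k)) = frob_a nu k + frob_b nu k"
proof (cases "k \<le> diag_len nu")
  case True
  note v = frob_values[OF nu k True]
  have "card (hook nu k) = card ({k} \<times> {k..nat (entry nu k)}) + card ({k<..conj_part nu k} \<times> {k})"
    using True hook_eq[OF nu k] by (simp only: if_True, intro card_Un_disjoint) auto
  also have "\<dots> = (Suc (nat (entry nu k)) - k) + (conj_part nu k - k)" by simp
  finally show ?thesis using v by simp
qed (use hook_eq[OF nu k] frob_zero[of nu k] in auto)

lemma finite_hook [simp]: "finite (hook nu k)"
  by (simp add: hook_def)

lemma sum_hooks:
  fixes f :: "nat \<times> nat \<Rightarrow> real"
  shows "(\<Sum>k. \<Sum>b\<in>hook nu (Suc k). f b) = (\<Sum>b\<in>young nu. f b)"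
    "(\<Sum>k<K. \<Sum>b\<in>hook nu (Suc k). f b) = (\<Sum>b\<in>{b \<in> young nu. min (fst b) (snd b) \<le> K}. f b)"
proof -
  have un: "{b \<in> young nu. min (fst b) (snd b) \<le> K} = (\<Union>k\<in>{..<K}. hook nu (Suc k))" for K
  proof
    show "{b \<in> young nu. min (fst b) (snd b) \<le> K} \<subseteq> (\<Union>k\<in>{..<K}. hook nu (Suc k))"
    proof
      fix b assume b: "b \<in> {b \<in> young nu. min (fst b) (snd b) \<le> K}"
      then have "min (fst b) (snd b) \<ge> 1" by (auto simp: young_def)
      then have "b \<in> hook nu (Suc (min (fst b) (snd b) - 1))" "min (fst b) (snd b) - 1 < K" using b by (auto simp: hook_def)
      then show "b \<in> (\<Union>k\<in>{..<K}. hook nu (Suc k))" by blast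
    qed
  qed (auto simp: hook_def)
  show fin: "(\<Sum>k<K. \<Sum>b\<in>hook nu (Suc k). f b) = (\<Sum>b\<in>{b \<in> young nu. min (fst b) (snd b) \<le> K}. f b)" for K
    unfolding un by (subst sum.UNION_disjoint) (auto simp: hook_def)
  define K where "K = Max (insert 0 (fst ` young nu))"
  have K: "fst b \<le> K" if "b \<in> young nu" for b using that by (auto simp: K_def)
  have "(\<Sum>k. \<Sum>b\<in>hook nu (Suc k). f b) = (\<Sum>k<K. \<Sum>b\<in>hook nu (Suc k). f b)"
  proof (rule suminf_finite)
    fix k assume "k \<notin> {..<K}"
    then have "hook nu (Suc k) = {}" using K by (fastforce simp: hook_def)
    then show "(\<Sum>b\<in>hook nu (Suc k). f b) = 0" by simp
  qed simp
  also have "\<dots> = (\<Sum>b\<in>young nu. f b)"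
    unfolding fin by (rule sum.cong) (use K in \<open>auto simp: min_le_iff_disj\<close>)
  finally show "(\<Sum>k. \<Sum>b\<in>hook nu (Suc k). f b) = (\<Sum>b\<in>young nu. f b)" .
qed

definition box_prod :: "real \<Rightarrow> real \<Rightarrow> int list \<Rightarrow> real" where
  "box_prod \<theta> u nu = (\<Prod>(i, j)\<in>young nu. 1 + \<theta> / (u - real j + \<theta> * (real i - 1)))"

text \<open>\<open>ln (1 + \<theta> / z)\<close> and \<open>- \<theta> * ln (1 - 1 / z)\<close>
  differ by O(1 / z^2), and the second telescopes along the arm. With |z| \<ge> c N and O(N) boxes
  the total error is O(1 / N).\<close>

lemma arm_limit:
  fixes x :: "nat \<Rightarrow> real" and n :: "nat \<Rightarrow> nat"
  assumes \<theta>: "\<theta> > 0" and x: "(\<lambda>N. x N / real N) \<longlonglongrightarrow> y" and n: "(\<lambda>N. real (n N) / real N) \<longlonglongrightarrow> a"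
    and a: "a \<ge> 0" and y: "a < y \<or> y < 0"
  shows "(\<lambda>N. \<Sum>t<n N. ln (1 + \<theta> / (x N - real t))) \<longlonglongrightarrow> - \<theta> * ln (1 - a / y)"
proof -
  \<comment> \<open>Half the distance from y to the interval [0, a] of scaled positions of the
    arm.\<close>
  define c where "c = (if y < 0 then - y / 2 else (y - a) / 2)"
  have c: "c > 0" using y a by (auto simp: c_def)
  have ev_far: "eventually (\<lambda>N. \<forall>t<n N. \<bar>x N - real t\<bar> \<ge> c * real N) sequentially"
  proof (cases "y < 0")
    case True
    have "eventually (\<lambda>N. x N / real N < y / 2) sequentially" using x True by (intro order_tendstoD(2)) auto
    then show ?thesis using eventually_gt_at_top[of 0]
    proof eventually_elim
      case (elim N)
      then have "x N < - (c * real N)" using True by (simp add: c_def field_simps)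
      then show ?case by auto
    qed
  next
    case False
    have "(\<lambda>N. x N / real N - real (n N) / real N) \<longlonglongrightarrow> y - a" by (intro tendsto_intros x n)
    then have "eventually (\<lambda>N. x N / real N - real (n N) / real N > c) sequentially"
      using False y by (intro order_tendstoD(1)) (auto simp: c_def)
    then show ?thesis using eventually_gt_at_top[of 0]
    proof eventually_elim
      case (elim N)
      then have "x N - real (n N) > c * real N" by (simp add: field_simps)
      then show ?case by (auto intro: order_trans[OF less_imp_le] simp: abs_if)
    qed
  qed
  \<comment> \<open>Guarantees |\<theta> / z| \<le> 1/2 and |1 / z| \<le> 1/2, the range of the
    quadratic bound for the logarithm.\<close>
  have ev_big: "eventually (\<lambda>N. c * real N \<ge> 2 * \<theta> + 2) sequentially"
  proof -
    have "filterlim (\<lambda>N. c * real N) at_top sequentially"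
      using c by (intro filterlim_tendsto_pos_mult_at_top[OF tendsto_const] filterlim_real_sequentially)
    then show ?thesis by (auto simp: filterlim_at_top)
  qed
  have main: "eventually (\<lambda>N. \<bar>(\<Sum>t<n N. ln (1 + \<theta> / (x N - real t))) - (- \<theta> * ln (1 - real (n N) / x N))\<bar> \<le>
      (real (n N) / real N) * (2 * \<theta>\<^sup>2 + 2 * \<theta>) / c\<^sup>2 * (1 / real N)) sequentially"
    using ev_far ev_big eventually_gt_at_top[of 0]
  proof eventually_elim
    case (elim N)
    define X where "X = x N"
    have far: "\<bar>X - real t\<bar> \<ge> c * real N" "\<bar>X - real t\<bar> \<ge> 2 * \<theta> + 2" if "t < n N" for t using elim that by (force simp: X_def)+
    \<comment> \<open>Positivity is carried along in the induction because the logarithm splits a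
      product only into positive factors.\<close>
    have tel: "(\<Sum>t<k. ln (1 - 1 / (X - real t))) = ln (1 - real k / X) \<and> (k > 0 \<longrightarrow> 1 - real k / X > 0)" if "k \<le> n N" for k
      using that
    proof (induction k)
      case (Suc k)
      have z: "\<bar>X - real k\<bar> \<ge> 2" "X \<noteq> 0" using far(2)[of k] far(2)[of 0] Suc.prems \<theta> by auto
      have pos: "1 - 1 / (X - real k) > 0"
        using z by (cases "X - real k > 0") (auto simp: field_simps)
      have pos': "1 - real k / X > 0" using Suc by (cases "k = 0") auto
      have "ln (1 - real k / X) + ln (1 - 1 / (X - real k)) = ln ((1 - real k / X) * (1 - 1 / (X - real k)))"
        using pos pos' by (rule ln_mult_pos[symmetric, rotated])
      moreover have "(1 - real k / X) * (1 - 1 / (X - real k)) = 1 - real (Suc k) / X"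
      proof -
        have "1 - real k / X = (X - real k) / X" "1 - 1 / (X - real k) = (X - real k - 1) / (X - real k)"
          using z by (auto simp: field_simps)
        moreover have "X - real k \<noteq> 0" using z by auto
        ultimately have "(1 - real k / X) * (1 - 1 / (X - real k)) = (X - real k - 1) / X" by simp
        then show ?thesis using z by (simp add: field_simps)
      qed
      moreover have "(1 - real k / X) * (1 - 1 / (X - real k)) > 0"
        using pos' pos by (rule mult_pos_pos)
      ultimately have "ln (1 - real k / X) + ln (1 - 1 / (X - real k)) = ln (1 - real (Suc k) / X)"
        "1 - real (Suc k) / X > 0" by (simp_all only:)
      then show ?case using Suc by (simp del: of_nat_Suc)
    qed simp
    have eq: "(\<Sum>t<n N. ln (1 + \<theta> / (X - real t))) - (- \<theta> * ln (1 - real (n N) / X)) =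
        (\<Sum>t<n N. ln (1 + \<theta> / (X - real t)) + \<theta> * ln (1 - 1 / (X - real t)))"
    proof -
      have "(\<Sum>t<n N. ln (1 - 1 / (X - real t))) = ln (1 - real (n N) / X)" using tel[OF order_refl] by (rule conjunct1)
      then show ?thesis unfolding sum.distrib sum_distrib_left[symmetric] by (simp only: mult_minus_left diff_minus_eq_add)
    qed
    have "\<bar>\<Sum>t<n N. ln (1 + \<theta> / (X - real t)) + \<theta> * ln (1 - 1 / (X - real t))\<bar> \<le> (\<Sum>t<n N. \<bar>ln (1 + \<theta> / (X - real t)) + \<theta> * ln (1 - 1 / (X - real t))\<bar>)" by (rule sum_abs)
    also have "\<dots> \<le> (\<Sum>t<n N. (2 * \<theta>\<^sup>2 + 2 * \<theta>) / (c * real N)\<^sup>2)"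
    proof (rule sum_mono)
      fix t assume t: "t \<in> {..<n N}"
      define z where "z = X - real t"
      have z: "\<bar>z\<bar> \<ge> 2 * \<theta> + 2" "\<bar>z\<bar> \<ge> c * real N" using far[of t] t by (auto simp: z_def)
      have "\<bar>\<theta> / z\<bar> \<le> 1 / 2" "\<bar>- 1 / z\<bar> \<le> 1 / 2" using z \<theta> by (auto simp: abs_if field_simps split: if_splits)
      then have 1: "\<bar>ln (1 + \<theta> / z) - \<theta> / z\<bar> \<le> 2 * (\<theta> / z)\<^sup>2" "\<bar>ln (1 + - 1 / z) - - 1 / z\<bar> \<le> 2 * (- 1 / z)\<^sup>2"
        by (blast intro: abs_ln_one_plus_x_minus_x_bound)+
      have "ln (1 + \<theta> / z) + \<theta> * ln (1 - 1 / z) = (ln (1 + \<theta> / z) - \<theta> / z) + \<theta> * (ln (1 + - 1 / z) - - 1 / z)"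
        by (simp add: algebra_simps)
      also have "\<bar>\<dots>\<bar> \<le> 2 * (\<theta> / z)\<^sup>2 + \<theta> * (2 * (- 1 / z)\<^sup>2)"
        using 1 \<theta> by (intro order_trans[OF abs_triangle_ineq] add_mono) (auto simp: abs_mult intro!: mult_left_mono)
      also have "\<dots> = (2 * \<theta>\<^sup>2 + 2 * \<theta>) / z\<^sup>2" by (simp add: power_divide add_divide_distrib)
      also have "\<dots> \<le> (2 * \<theta>\<^sup>2 + 2 * \<theta>) / (c * real N)\<^sup>2"
      proof (rule divide_left_mono)
        have "(c * real N)\<^sup>2 \<le> \<bar>z\<bar>\<^sup>2" using z c by (intro power_mono) auto
        then show "(c * real N)\<^sup>2 \<le> z\<^sup>2" by simp
        have cN: "c * real N > 0" using c elim(3) by simp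
        then have "z \<noteq> 0" using z(2) by force
        then have "0 < z\<^sup>2" by (rule zero_less_power2[THEN iffD2])
        then show "0 < z\<^sup>2 * (c * real N)\<^sup>2" using zero_less_power[OF cN] by (rule mult_pos_pos)
      qed (use \<theta> in simp)
      finally show "\<bar>ln (1 + \<theta> / (X - real t)) + \<theta> * ln (1 - 1 / (X - real t))\<bar> \<le> (2 * \<theta>\<^sup>2 + 2 * \<theta>) / (c * real N)\<^sup>2"
        unfolding z_def .
    qed
    also have "\<dots> = (real (n N) / real N) * (2 * \<theta>\<^sup>2 + 2 * \<theta>) / c\<^sup>2 * (1 / real N)"
      by (simp add: power_mult_distrib power2_eq_square)
    finally show ?case unfolding eq[unfolded X_def] X_def .
  qed
  have "(\<lambda>N. (real (n N) / real N) * (2 * \<theta>\<^sup>2 + 2 * \<theta>) / c\<^sup>2 * (1 / real N)) \<longlonglongrightarrow> a * (2 * \<theta>\<^sup>2 + 2 * \<theta>) / c\<^sup>2 * 0"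
    using c by (intro tendsto_intros n lim_1_over_n) auto
  then have z: "(\<lambda>N. (real (n N) / real N) * (2 * \<theta>\<^sup>2 + 2 * \<theta>) / c\<^sup>2 * (1 / real N)) \<longlonglongrightarrow> 0" by simp
  have "(\<lambda>N. (\<Sum>t<n N. ln (1 + \<theta> / (x N - real t))) - (- \<theta> * ln (1 - real (n N) / x N))) \<longlonglongrightarrow> 0"
    using main by (intro Lim_null_comparison[OF _ z]) (simp only: real_norm_def)
  moreover have "(\<lambda>N. - \<theta> * ln (1 - real (n N) / x N)) \<longlonglongrightarrow> - \<theta> * ln (1 - a / y)"
  proof -
    have "(\<lambda>N. (real (n N) / real N) / (x N / real N)) \<longlonglongrightarrow> a / y"
      using y a by (intro tendsto_divide n x) auto
    then have "(\<lambda>N. real (n N) / x N) \<longlonglongrightarrow> a / y"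
      by (rule Lim_transform_eventually) (use eventually_gt_at_top[of 0] in \<open>eventually_elim, simp\<close>)
    moreover have "1 - a / y > 0" using y a by (auto simp: field_simps)
    ultimately show ?thesis
      by (intro tendsto_mult[OF tendsto_const] tendsto_ln tendsto_diff[OF tendsto_const]) auto
  qed
  ultimately have "(\<lambda>N. ((\<Sum>t<n N. ln (1 + \<theta> / (x N - real t))) - (- \<theta> * ln (1 - real (n N) / x N))) +
      (- \<theta> * ln (1 - real (n N) / x N))) \<longlonglongrightarrow> 0 + - \<theta> * ln (1 - a / y)"
    by (rule tendsto_add)
  then show ?thesis by (simp only: diff_add_cancel add_0)
qed

text \<open>Consecutive boxes of a leg are \<theta> apart, the same as the numerator, so here the
  product telescopes exactly.\<close>

lemma leg_sum:
  fixes z \<theta> :: real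
  assumes "k \<le> m" "\<And>i. i \<in> {k<..m} \<Longrightarrow> \<bar>z + \<theta> * (real i - 1)\<bar> \<ge> 2 * \<theta>" "\<theta> > 0"
  shows "(\<Sum>i\<in>{k<..m}. ln (1 + \<theta> / (z + \<theta> * (real i - 1)))) = ln ((z + \<theta> * real m) / (z + \<theta> * real k))"
proof -
  have "(\<Sum>i\<in>{k<..m}. ln (1 + \<theta> / (z + \<theta> * (real i - 1)))) = ln ((z + \<theta> * real m) / (z + \<theta> * real k)) \<and>
      (k < m \<longrightarrow> (z + \<theta> * real m) / (z + \<theta> * real k) > 0)"
    using assms(1,2)
  proof (induction m rule: dec_induct)
    case (step m)
    define d where "d = z + \<theta> * real m"
    have d: "\<bar>d\<bar> \<ge> 2 * \<theta>" using step(4)[of "Suc m"] step(1) by (simp add: d_def)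
    have pos: "1 + \<theta> / d > 0"
      using d assms(3) by (cases "d > 0") (auto simp: field_simps)
    have k0: "z + \<theta> * real k \<noteq> 0" using step(4)[of "Suc k"] step(1,2) assms(3) by force
    have IH: "(\<Sum>i\<in>{k<..m}. ln (1 + \<theta> / (z + \<theta> * (real i - 1)))) = ln (d / (z + \<theta> * real k))" "k < m \<Longrightarrow> d / (z + \<theta> * real k) > 0"
      using step(3) step(4) unfolding d_def by force+
    have pos': "d / (z + \<theta> * real k) > 0" using IH(2) k0 step(1) by (cases "k = m") (auto simp: d_def)
    have d0: "d \<noteq> 0" using d assms(3) by auto
    have e: "(z + \<theta> * real (Suc m)) / (z + \<theta> * real k) = d / (z + \<theta> * real k) * (1 + \<theta> / d)"
    proof -
      have "d * (1 + \<theta> / d) = d + \<theta>" using d0 by (simp add: distrib_left)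
      moreover have "z + \<theta> * real (Suc m) = d + \<theta>" by (simp add: d_def algebra_simps)
      ultimately show ?thesis by (simp only: times_divide_eq_left)
    qed
    have "{k<..Suc m} = insert (Suc m) {k<..m}" using step(1) by auto
    then have "(\<Sum>i\<in>{k<..Suc m}. ln (1 + \<theta> / (z + \<theta> * (real i - 1)))) = ln (1 + \<theta> / d) + ln (d / (z + \<theta> * real k))"
      using IH(1) by (simp add: d_def)
    also have "\<dots> = ln (d / (z + \<theta> * real k) * (1 + \<theta> / d))" using ln_mult_pos[OF pos' pos] by simp
    finally show ?case unfolding e using mult_pos_pos[OF pos' pos] by blast
  \<comment> \<open>For m = k the quotient is 1, or 0 / 0 = 0 by convention, and both have logarithm
    0.\<close>
  qed (cases "z + \<theta> * real k = 0", auto)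
  then show ?thesis by blast
qed

section \<open>Box products along a scaled sequence of diagrams\<close>

locale box_limit =
  fixes \<theta> y \<delta> :: real and nu :: "nat \<Rightarrow> int list" and \<alpha> \<beta> u :: "nat \<Rightarrow> real"
  assumes \<theta>: "\<theta> > 0"
    and nu: "\<And>N. N \<ge> 1 \<Longrightarrow> nu N \<in> GT_pos N"
    and \<alpha>: "\<And>i. i \<ge> 1 \<Longrightarrow> (\<lambda>N. frob_a (nu N) i / real N) \<longlonglongrightarrow> \<alpha> i"
    and \<beta>: "\<And>i. i \<ge> 1 \<Longrightarrow> (\<lambda>N. frob_b (nu N) i / real N) \<longlonglongrightarrow> \<beta> i"
    and \<delta>: "(\<lambda>N. real_of_int (sum_list (nu N)) / real N) \<longlonglongrightarrow> \<delta>"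
    and u: "(\<lambda>N. u N / real N) \<longlonglongrightarrow> y"
    and y: "\<alpha> 1 < y \<or> y < - \<theta> * \<beta> 1"
begin

lemma ev1: "eventually (\<lambda>N. N \<ge> 1 \<and> nu N \<in> GT_pos N) sequentially"
  using nu by (intro eventually_sequentiallyI[of 1]) auto

lemma nonneg:
  assumes "i \<ge> 1"
  shows "\<alpha> i \<ge> 0" "\<beta> i \<ge> 0"
proof -
  have "eventually (\<lambda>N. 0 \<le> frob_a (nu N) i / real N) sequentially" "eventually (\<lambda>N. 0 \<le> frob_b (nu N) i / real N) sequentially"
    using ev1 by (eventually_elim, use frob_nonneg assms in auto)+
  then show "\<alpha> i \<ge> 0" "\<beta> i \<ge> 0"
    using tendsto_lowerbound[OF \<alpha>[OF assms]] tendsto_lowerbound[OF \<beta>[OF assms]] by auto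
qed

lemma le1:
  assumes "i \<ge> 1"
  shows "\<alpha> i \<le> \<alpha> 1" "\<beta> i \<le> \<beta> 1"
proof -
  have "eventually (\<lambda>N. frob_a (nu N) i / real N \<le> frob_a (nu N) 1 / real N) sequentially"
    "eventually (\<lambda>N. frob_b (nu N) i / real N \<le> frob_b (nu N) 1 / real N) sequentially"
    using ev1 by (eventually_elim, use frob_antimono assms in \<open>auto intro!: divide_right_mono\<close>)+
  then show "\<alpha> i \<le> \<alpha> 1" "\<beta> i \<le> \<beta> 1"
    using tendsto_le[OF _ \<alpha>[of 1] \<alpha>[OF assms]] tendsto_le[OF _ \<beta>[of 1] \<beta>[OF assms]] by auto
qed

lemma y_cases: "(\<alpha> 1 < y \<and> 0 < y) \<or> (y < 0 \<and> y < - \<theta> * \<beta> 1)"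
proof -
  have "\<alpha> 1 \<ge> 0" "\<theta> * \<beta> 1 \<ge> 0" using nonneg[of 1] \<theta> by auto
  then show ?thesis using y by linarith
qed

lemma y0: "y \<noteq> 0" using y_cases by auto

definition dist :: "nat \<Rightarrow> nat \<times> nat \<Rightarrow> real" where
  "dist N b = u N - real (snd b) + \<theta> * (real (fst b) - 1)"

text \<open>On the scale N, y > \<alpha> 1 puts u beyond the end of every row, and y < - \<theta>
  \<beta> 1 beyond the end of every column; c is half of the gap.\<close>

lemma far: obtains c where "c > 0" "eventually (\<lambda>N. \<forall>b\<in>young (nu N). \<bar>dist N b\<bar> \<ge> c * real N) sequentially"
proof -
  have first: "real (snd b) \<le> frob_a (nu N) 1 + 1 / 2" "real (fst b) \<le> frob_b (nu N) 1 + 1 / 2" "1 \<le> fst b" "1 \<le> snd b"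
    if N: "nu N \<in> GT_pos N" and b: "b \<in> young (nu N)" for N b
  proof -
    obtain i j where [simp]: "b = (i, j)" by force
    have ij: "1 \<le> i" "1 \<le> j" using b by (auto simp: young_def)
    then show "1 \<le> fst b" "1 \<le> snd b" by auto
    have "(1, 1) \<in> young (nu N)" "(1, j) \<in> young (nu N)" "(i, 1) \<in> young (nu N)"
      using young_down[OF N, of i j] b ij by auto
    then have d: "1 \<le> diag_len (nu N)" "j \<le> nat (entry (nu N) 1)" "i \<le> conj_part (nu N) 1"
      using diag_len_iff[OF N, of 1] young_row_iff[OF N, of 1 j] conj_part_iff[OF N, of 1 i] GT_posD(1)[OF N]
      by (auto simp: young_def)
    then show "real (snd b) \<le> frob_a (nu N) 1 + 1 / 2" "real (fst b) \<le> frob_b (nu N) 1 + 1 / 2"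
      using frob_values(4,5)[OF N _ d(1)] by auto
  qed
  show thesis
  proof (cases "y > 0")
    case True
    define c where "c = (y - \<alpha> 1) / 2"
    have c: "c > 0" using y_cases True by (auto simp: c_def)
    have "(\<lambda>N. u N / real N - frob_a (nu N) 1 / real N - 1 / 2 * (1 / real N)) \<longlonglongrightarrow> y - \<alpha> 1 - 1 / 2 * 0"
      by (intro tendsto_intros u \<alpha> lim_1_over_n) auto
    then have "eventually (\<lambda>N. u N / real N - frob_a (nu N) 1 / real N - 1 / 2 * (1 / real N) > c) sequentially"
      using c by (intro order_tendstoD(1)) (auto simp: c_def)
    then have "eventually (\<lambda>N. \<forall>b\<in>young (nu N). \<bar>dist N b\<bar> \<ge> c * real N) sequentially"
      using ev1
    proof eventually_elim
      case (elim N)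
      then have "(u N - frob_a (nu N) 1 - 1 / 2) / real N > c" by (simp add: diff_divide_distrib)
      then have *: "u N - frob_a (nu N) 1 - 1 / 2 > c * real N" using elim by (simp add: pos_less_divide_eq)
      show ?case
      proof
        fix b assume b: "b \<in> young (nu N)"
        have "\<theta> * (real (fst b) - 1) \<ge> 0" using first(3)[OF _ b] elim \<theta> by simp
        then show "\<bar>dist N b\<bar> \<ge> c * real N" using * first(1)[OF _ b] elim by (simp add: dist_def)
      qed
    qed
    then show thesis using c that by blast
  next
    case False
    define c where "c = (- y - \<theta> * \<beta> 1) / 2"
    have c: "c > 0" using y_cases False by (auto simp: c_def)
    have "(\<lambda>N. u N / real N + \<theta> * (frob_b (nu N) 1 / real N)) \<longlonglongrightarrow> y + \<theta> * \<beta> 1"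
      by (intro tendsto_intros u \<beta>) auto
    then have "eventually (\<lambda>N. u N / real N + \<theta> * (frob_b (nu N) 1 / real N) < - c) sequentially"
    proof (rule order_tendstoD(2))
      show "y + \<theta> * \<beta> 1 < - c" using y_cases False by (simp add: c_def field_simps)
    qed
    then have "eventually (\<lambda>N. \<forall>b\<in>young (nu N). \<bar>dist N b\<bar> \<ge> c * real N) sequentially"
      using ev1
    proof eventually_elim
      case (elim N)
      then have "(u N + \<theta> * frob_b (nu N) 1) / real N < - c" by (simp add: add_divide_distrib)
      then have *: "u N + \<theta> * frob_b (nu N) 1 < - (c * real N)" using elim by (simp add: pos_divide_less_eq)
      show ?case
      proof
        fix b assume b: "b \<in> young (nu N)"
        have "\<theta> * (real (fst b) - 1) \<le> \<theta> * frob_b (nu N) 1" using first(2)[OF _ b] elim \<theta> by (intro mult_left_mono) auto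
        moreover have "real (snd b) \<ge> 0" by simp
        ultimately have "dist N b \<le> - (c * real N)" using * unfolding dist_def by linarith
        then show "\<bar>dist N b\<bar> \<ge> c * real N" by linarith
      qed
    qed
    then show thesis using c that by blast
  qed
qed

lemma ev_ge: "c > 0 \<Longrightarrow> eventually (\<lambda>N. c * real N \<ge> B) sequentially"
proof -
  assume "c > 0"
  then have "filterlim (\<lambda>N. c * real N) at_top sequentially"
    by (intro filterlim_tendsto_pos_mult_at_top[OF tendsto_const] filterlim_real_sequentially)
  then show ?thesis by (auto simp: filterlim_at_top)
qed

lemma far_big: "eventually (\<lambda>N. \<forall>b\<in>young (nu N). \<bar>dist N b\<bar> \<ge> 2 * \<theta>) sequentially"
proof -
  obtain c where c: "c > 0" "eventually (\<lambda>N. \<forall>b\<in>young (nu N). \<bar>dist N b\<bar> \<ge> c * real N) sequentially" by (rule far)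
  from c(2) ev_ge[OF c(1), of "2 * \<theta>"] show ?thesis by eventually_elim force
qed

definition log_box :: "nat \<Rightarrow> nat \<times> nat \<Rightarrow> real" where
  "log_box N b = ln (1 + \<theta> / dist N b)"

text \<open>Subtracting the first-order term \<theta> / u for each box makes the hooks summable
  uniformly in N. The subtracted total is \<theta> / u times the size of the diagram, so it
  converges separately and brings in \<delta>.\<close>

definition hook_sum :: "nat \<Rightarrow> nat \<Rightarrow> real" where
  "hook_sum N k = (\<Sum>b\<in>hook (nu N) k. log_box N b - \<theta> / u N)"

text \<open>In the k-th hook both coordinates are at most L = \<Delta> N / k by the area bound.
  Distances therefore differ from u by O(L), each corrected term is O(1 / (k N)), and there are at
  most 2 L boxes, which gives O(1 / k^2).\<close>

lemma hook_sum_bound: "\<exists>C. eventually (\<lambda>N. \<forall>k\<ge>1. \<bar>hook_sum N k\<bar> \<le> C / (real k)\<^sup>2) sequentially"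
proof -
  obtain c where c: "c > 0" "eventually (\<lambda>N. \<forall>b\<in>young (nu N). \<bar>dist N b\<bar> \<ge> c * real N) sequentially" by (rule far)
  define \<Delta> where "\<Delta> = \<bar>\<delta>\<bar> + 1"
  have \<Delta>: "\<Delta> > 0" by (simp add: \<Delta>_def)
  have "eventually (\<lambda>N. real_of_int (sum_list (nu N)) / real N < \<Delta>) sequentially"
    using \<delta> by (rule order_tendstoD(2)) (auto simp: \<Delta>_def)
  then have ev\<Delta>: "eventually (\<lambda>N. real_of_int (sum_list (nu N)) \<le> \<Delta> * real N) sequentially"
    using ev1 by eventually_elim (auto simp: field_simps)
  define c' where "c' = \<bar>y\<bar> / 2"
  have c': "c' > 0" using y0 by (simp add: c'_def)
  have "(\<lambda>N. \<bar>u N / real N\<bar>) \<longlonglongrightarrow> \<bar>y\<bar>" by (intro tendsto_rabs u)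
  then have "eventually (\<lambda>N. \<bar>u N / real N\<bar> > c') sequentially" using y0 by (intro order_tendstoD(1)) (auto simp: c'_def)
  then have evu: "eventually (\<lambda>N. \<bar>u N\<bar> \<ge> c' * real N) sequentially"
    using ev1 by eventually_elim (auto simp: field_simps abs_divide)
  \<comment> \<open>The first summand is the quadratic error of the logarithm, the second the error
    of replacing the distance of a box by u.\<close>
  define C1 where "C1 = 2 * \<theta>\<^sup>2 * \<Delta> / c\<^sup>2 + \<theta> * (1 + \<theta>) * \<Delta> / (c * c')"
  have C1: "C1 \<ge> 0" using \<theta> \<Delta> c c' by (simp add: C1_def)
  have "eventually (\<lambda>N. \<forall>k\<ge>1. \<bar>hook_sum N k\<bar> \<le> (C1 * 2 * \<Delta>) / (real k)\<^sup>2) sequentially"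
    using c(2) ev\<Delta> evu ev1 far_big
  proof eventually_elim
    case (elim N)
    have N: "real N > 0" "nu N \<in> GT_pos N" using elim by auto
    show ?case
    proof (intro allI impI)
      fix k :: nat assume k: "k \<ge> 1"
      define L where "L = \<Delta> * real N / real k"
      have bd: "real i \<le> L" "real j \<le> L" "real k \<le> L" if "(i, j) \<in> hook (nu N) k" for i j
      proof -
        have ij: "k \<le> i" "k \<le> j" "(i, j) \<in> young (nu N)" using that by (auto simp: hook_def)
        have a: "real i * real j \<le> \<Delta> * real N" using young_area[OF N(2) ij(3)] elim by linarith
        have "real i * real k \<le> real i * real j" "real k * real j \<le> real i * real j"
          using ij by (auto intro!: mult_left_mono mult_right_mono)
        then show "real i \<le> L" "real j \<le> L" using a k by (auto simp: L_def field_simps)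
        then show "real k \<le> L" using ij by linarith
      qed
      have tm: "\<bar>log_box N b - \<theta> / u N\<bar> \<le> C1 / (real k * real N)" if b: "b \<in> hook (nu N) k" for b
      proof -
        obtain i j where ij: "b = (i, j)" by force
        have bY: "b \<in> young (nu N)" using b by (simp add: hook_def)
        define D where "D = dist N b"
        have D: "\<bar>D\<bar> \<ge> c * real N" "\<bar>D\<bar> \<ge> 2 * \<theta>" using elim bY by (auto simp: D_def)
        have cN: "c * real N > 0" "c' * real N > 0" using c c' N by auto
        then have D0: "D \<noteq> 0" "u N \<noteq> 0" using D elim by auto
        have "\<bar>\<theta> / D\<bar> \<le> 1 / 2" using D \<theta> by (auto simp: abs_divide field_simps)
        then have "\<bar>ln (1 + \<theta> / D) - \<theta> / D\<bar> \<le> 2 * (\<theta> / D)\<^sup>2" by (rule abs_ln_one_plus_x_minus_x_bound)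
        also have "\<dots> = 2 * \<theta>\<^sup>2 / \<bar>D\<bar>\<^sup>2" by (simp add: power_divide)
        also have "\<dots> \<le> 2 * \<theta>\<^sup>2 / (c * real N)\<^sup>2"
        proof (rule divide_left_mono)
          show "(c * real N)\<^sup>2 \<le> \<bar>D\<bar>\<^sup>2" using D(1) cN by (intro power_mono) auto
          show "0 < \<bar>D\<bar>\<^sup>2 * (c * real N)\<^sup>2" using cN D0 by (simp only: zero_less_power2 zero_less_power zero_less_abs_iff mult_pos_pos)
        qed (use \<theta> in simp)
        also have "\<dots> = 2 * \<theta>\<^sup>2 / c\<^sup>2 / real N * (1 / real N)" by (simp add: power2_eq_square)
        also have "\<dots> \<le> 2 * \<theta>\<^sup>2 / c\<^sup>2 / real N * (\<Delta> / real k)"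
        proof (rule mult_left_mono)
          \<comment> \<open>The hook is nonempty here, so k \<le> L and hence k \<le> \<Delta> N;
            this trades a factor 1 / N for a multiple of 1 / k.\<close>
          have "1 * real k \<le> real k * real k" using k by (intro mult_right_mono) auto
          also have "\<dots> \<le> L * real k" using bd[of i j] b ij by (intro mult_right_mono) auto
          also have "\<dots> = \<Delta> * real N" using k by (simp add: L_def)
          finally show "1 / real N \<le> \<Delta> / real k" using k N by (simp add: field_simps)
        qed (use c in simp)
        finally have 1: "\<bar>ln (1 + \<theta> / D) - \<theta> / D\<bar> \<le> 2 * \<theta>\<^sup>2 * \<Delta> / c\<^sup>2 / (real k * real N)" by (simp add: mult_ac)
        have "\<theta> / D - \<theta> / u N = \<theta> * (u N - D) / (D * u N)" using D0 by (simp add: field_simps)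
        then have "\<bar>\<theta> / D - \<theta> / u N\<bar> = \<theta> * \<bar>u N - D\<bar> / (\<bar>D\<bar> * \<bar>u N\<bar>)" using \<theta> by (simp add: abs_mult abs_divide)
        also have "\<dots> \<le> \<theta> * ((1 + \<theta>) * L) / ((c * real N) * (c' * real N))"
        proof (rule frac_le)
          have ge1: "real i \<ge> 1" using bY ij by (auto simp: young_def)
          have "u N - D = real j - \<theta> * (real i - 1)" by (simp add: D_def dist_def ij)
          then have "\<bar>u N - D\<bar> \<le> real j + \<theta> * (real i - 1)" using \<theta> ge1 by (auto intro!: order_trans[OF abs_triangle_ineq4] simp: abs_mult)
          also have "\<dots> \<le> L + \<theta> * L" using bd[of i j] b ij \<theta> by (intro add_mono mult_left_mono) auto
          finally have "\<bar>u N - D\<bar> \<le> (1 + \<theta>) * L" by (simp add: algebra_simps)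
          then show "\<theta> * \<bar>u N - D\<bar> \<le> \<theta> * ((1 + \<theta>) * L)" using \<theta> by simp
          show "c * real N * (c' * real N) \<le> \<bar>D\<bar> * \<bar>u N\<bar>" using D(1) elim(3) cN by (intro mult_mono) auto
          show "0 \<le> \<theta> * ((1 + \<theta>) * L)" using \<theta> \<Delta> N by (simp add: L_def)
          show "0 < c * real N * (c' * real N)" using cN by simp
        qed
        also have "\<dots> = \<theta> * (1 + \<theta>) * \<Delta> / (c * c') / (real k * real N)" using N k c c' by (simp add: L_def field_simps)
        finally have 2: "\<bar>\<theta> / D - \<theta> / u N\<bar> \<le> \<theta> * (1 + \<theta>) * \<Delta> / (c * c') / (real k * real N)" .
        have "\<bar>log_box N b - \<theta> / u N\<bar> \<le> \<bar>ln (1 + \<theta> / D) - \<theta> / D\<bar> + \<bar>\<theta> / D - \<theta> / u N\<bar>"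
          by (simp add: log_box_def D_def)
        then show ?thesis using 1 2 by (simp add: C1_def add_divide_distrib)
      qed
      have "hook (nu N) k \<subseteq> {k} \<times> {1..nat \<lfloor>L\<rfloor>} \<union> {1..nat \<lfloor>L\<rfloor>} \<times> {k}"
      proof
        fix b assume b: "b \<in> hook (nu N) k"
        obtain i j where ij: "b = (i, j)" by force
        have "i \<le> nat \<lfloor>L\<rfloor>" "j \<le> nat \<lfloor>L\<rfloor>" using bd[of i j] b ij by (auto simp: le_nat_floor)
        moreover have "1 \<le> i" "1 \<le> j" "min i j = k" using b ij by (auto simp: hook_def young_def)
        ultimately show "b \<in> {k} \<times> {1..nat \<lfloor>L\<rfloor>} \<union> {1..nat \<lfloor>L\<rfloor>} \<times> {k}" using ij by (auto simp: min_def split: if_splits)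
      qed
      then have "card (hook (nu N) k) \<le> card ({k} \<times> {1..nat \<lfloor>L\<rfloor>} \<union> {1..nat \<lfloor>L\<rfloor>} \<times> {k})" by (intro card_mono) auto
      also have "\<dots> \<le> card ({k} \<times> {1..nat \<lfloor>L\<rfloor>}) + card ({1..nat \<lfloor>L\<rfloor>} \<times> {k})" by (rule card_Un_le)
      also have "\<dots> = 2 * nat \<lfloor>L\<rfloor>" by simp
      finally have "real (card (hook (nu N) k)) \<le> real (2 * nat \<lfloor>L\<rfloor>)" by simp
      also have "\<dots> \<le> 2 * L"
      proof -
        have "L \<ge> 0" using \<Delta> N by (simp add: L_def)
        then show ?thesis using of_nat_floor[of L] by simp
      qed
      finally have cd: "real (card (hook (nu N) k)) \<le> 2 * L" .
      have "\<bar>hook_sum N k\<bar> \<le> (\<Sum>b\<in>hook (nu N) k. C1 / (real k * real N))"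
        unfolding hook_sum_def by (rule order_trans[OF sum_abs sum_mono]) (rule tm)
      also have "\<dots> = real (card (hook (nu N) k)) * (C1 / (real k * real N))" by simp
      also have "\<dots> \<le> 2 * L * (C1 / (real k * real N))" using cd C1 by (intro mult_right_mono) auto
      also have "\<dots> = (C1 * 2 * \<Delta>) / (real k)\<^sup>2" using N by (simp add: L_def power2_eq_square)
      finally show "\<bar>hook_sum N k\<bar> \<le> (C1 * 2 * \<Delta>) / (real k)\<^sup>2" .
    qed
  qed
  then show ?thesis by blast
qed

definition log_term :: "nat \<Rightarrow> real" where
  "log_term k = ln (1 + \<theta> * \<beta> k / y) - \<theta> * ln (1 - \<alpha> k / y)"

lemma log_pos:
  assumes "k \<ge> 1"
  shows "1 + \<theta> * \<beta> k / y > 0" "1 - \<alpha> k / y > 0"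
proof -
  have "\<theta> * \<beta> k \<le> \<theta> * \<beta> 1" "0 \<le> \<theta> * \<beta> k" using le1[OF assms] nonneg[OF assms] \<theta> by auto
  then show "1 + \<theta> * \<beta> k / y > 0" "1 - \<alpha> k / y > 0"
    using y_cases le1[OF assms] nonneg[OF assms] by (auto simp: field_simps)
qed

lemma hook_sum_limit:
  assumes k: "k \<ge> 1"
  shows "(\<lambda>N. hook_sum N k) \<longlonglongrightarrow> log_term k - \<theta> / y * (\<alpha> k + \<beta> k)"
proof -
  \<comment> \<open>\<open>n\<close> counts the boxes of the arm with the corner, and
    \<open>w\<close> below is the last row of the leg. Their defaults 0 and k, used when the
    diagonal is shorter than k, make both contributions vanish.\<close>
  define n where "n = (\<lambda>N. if k \<le> diag_len (nu N) then Suc (nat (entry (nu N) k)) - k else 0)"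
  define w where "w = (\<lambda>N. if k \<le> diag_len (nu N) then conj_part (nu N) k else k)"
  \<comment> \<open>Arm and leg lengths differ from the Frobenius coordinates by bounded amounts,
    which disappear after division by N.\<close>
  have sq: "(\<lambda>N. real (f N) / real N) \<longlonglongrightarrow> a" if g: "(\<lambda>N. g N / real N) \<longlonglongrightarrow> a"
    and fg: "eventually (\<lambda>N. \<bar>real (f N) - g N\<bar> \<le> B) sequentially" for f :: "nat \<Rightarrow> nat" and g a B
  proof -
    have z: "(\<lambda>N. B * (1 / real N)) \<longlonglongrightarrow> 0" by (rule tendsto_mult_right_zero[OF lim_1_over_n])
    have "eventually (\<lambda>N. norm (real (f N) / real N - g N / real N) \<le> B * (1 / real N)) sequentially"
      using fg
    proof eventually_elim
      case (elim N)
      have "real (f N) / real N - g N / real N = (real (f N) - g N) / real N" by (rule diff_divide_distrib[symmetric])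
      then show ?case using elim by (simp add: abs_divide divide_right_mono)
    qed
    from Lim_null_comparison[OF this z] have "(\<lambda>N. real (f N) / real N - g N / real N) \<longlonglongrightarrow> 0" .
    from tendsto_add[OF this g] show ?thesis by simp
  qed
  have n_lim: "(\<lambda>N. real (n N) / real N) \<longlonglongrightarrow> \<alpha> k"
  proof (rule sq[OF \<alpha>[OF k]])
    show "eventually (\<lambda>N. \<bar>real (n N) - frob_a (nu N) k\<bar> \<le> 1) sequentially" using ev1
    proof eventually_elim
      case (elim N)
      then show ?case using frob_values[of "nu N" N k] frob_zero[of "nu N" k] k
        by (cases "k \<le> diag_len (nu N)") (auto simp: n_def)
    qed
  qed
  have w_lim: "(\<lambda>N. real (w N) / real N) \<longlonglongrightarrow> \<beta> k"
  proof (rule sq[OF \<beta>[OF k]])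
    show "eventually (\<lambda>N. \<bar>real (w N) - frob_b (nu N) k\<bar> \<le> real k) sequentially" using ev1
    proof eventually_elim
      case (elim N)
      then show ?case using frob_values[of "nu N" N k] frob_zero[of "nu N" k] k
        by (cases "k \<le> diag_len (nu N)") (auto simp: w_def)
    qed
  qed
  have shift: "(\<lambda>N. (u N + b) / real N) \<longlonglongrightarrow> y" for b
  proof -
    have "(\<lambda>N. u N / real N + b * (1 / real N)) \<longlonglongrightarrow> y + b * 0" by (intro tendsto_intros u lim_1_over_n)
    then show ?thesis by (simp add: add_divide_distrib)
  qed
  define x where "x = (\<lambda>N. u N + (- real k + \<theta> * (real k - 1)))"
  have arm: "(\<lambda>N. \<Sum>t<n N. ln (1 + \<theta> / (x N - real t))) \<longlonglongrightarrow> - \<theta> * ln (1 - \<alpha> k / y)"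
    unfolding x_def using y_cases le1[OF k] nonneg[OF k] by (intro arm_limit \<theta> shift n_lim) auto
  have leg: "(\<lambda>N. ln ((u N - real k + \<theta> * real (w N)) / (u N - real k + \<theta> * real k))) \<longlonglongrightarrow> ln ((y + \<theta> * \<beta> k) / y)"
  proof -
    have "(\<lambda>N. ((u N + (- real k)) / real N + \<theta> * (real (w N) / real N)) / ((u N + (- real k + \<theta> * real k)) / real N)) \<longlonglongrightarrow> (y + \<theta> * \<beta> k) / y"
      by (intro tendsto_intros shift w_lim y0)
    then have "(\<lambda>N. (u N - real k + \<theta> * real (w N)) / (u N - real k + \<theta> * real k)) \<longlonglongrightarrow> (y + \<theta> * \<beta> k) / y"
    proof (rule Lim_transform_eventually)
      show "eventually (\<lambda>N. ((u N + (- real k)) / real N + \<theta> * (real (w N) / real N)) / ((u N + (- real k + \<theta> * real k)) / real N) =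
         (u N - real k + \<theta> * real (w N)) / (u N - real k + \<theta> * real k)) sequentially"
        using ev1
      proof eventually_elim
        case (elim N)
        have "((u N + (- real k)) / real N + \<theta> * (real (w N) / real N)) = (u N - real k + \<theta> * real (w N)) / real N"
          "u N + (- real k + \<theta> * real k) = u N - real k + \<theta> * real k"
          by (simp_all add: add_divide_distrib)
        moreover have "(a / real N) / (b / real N) = a / b" for a b using elim by simp
        ultimately show ?case by (simp only:)
      qed
    qed
    moreover have "(y + \<theta> * \<beta> k) / y > 0" using log_pos(1)[OF k] y0 by (simp add: add_divide_distrib)
    ultimately show ?thesis by (intro tendsto_ln) auto
  qed
  have lin: "(\<lambda>N. \<theta> / (u N / real N) * (frob_a (nu N) k / real N + frob_b (nu N) k / real N)) \<longlonglongrightarrow> \<theta> / y * (\<alpha> k + \<beta> k)"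
    by (intro tendsto_intros u \<alpha> \<beta> k y0)
  have "(\<lambda>N. (\<Sum>t<n N. ln (1 + \<theta> / (x N - real t))) + ln ((u N - real k + \<theta> * real (w N)) / (u N - real k + \<theta> * real k))
     - \<theta> / (u N / real N) * (frob_a (nu N) k / real N + frob_b (nu N) k / real N)) \<longlonglongrightarrow>
     - \<theta> * ln (1 - \<alpha> k / y) + ln ((y + \<theta> * \<beta> k) / y) - \<theta> / y * (\<alpha> k + \<beta> k)"
    by (intro tendsto_diff tendsto_add arm leg lin)
  moreover have "ln ((y + \<theta> * \<beta> k) / y) = ln (1 + \<theta> * \<beta> k / y)" using y0 by (simp add: add_divide_distrib)
  ultimately have "(\<lambda>N. (\<Sum>t<n N. ln (1 + \<theta> / (x N - real t))) + ln ((u N - real k + \<theta> * real (w N)) / (u N - real k + \<theta> * real k))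
     - \<theta> / (u N / real N) * (frob_a (nu N) k / real N + frob_b (nu N) k / real N)) \<longlonglongrightarrow> log_term k - \<theta> / y * (\<alpha> k + \<beta> k)"
    by (simp add: log_term_def)
  then show ?thesis
  proof (rule Lim_transform_eventually)
    show "eventually (\<lambda>N. (\<Sum>t<n N. ln (1 + \<theta> / (x N - real t))) + ln ((u N - real k + \<theta> * real (w N)) / (u N - real k + \<theta> * real k))
     - \<theta> / (u N / real N) * (frob_a (nu N) k / real N + frob_b (nu N) k / real N) = hook_sum N k) sequentially"
      using ev1 far_big
    proof eventually_elim
      case (elim N)
      then have N: "nu N \<in> GT_pos N" "real N > 0" by auto
      have "(\<Sum>b\<in>hook (nu N) k. log_box N b) = (\<Sum>t<n N. ln (1 + \<theta> / (x N - real t))) + ln ((u N - real k + \<theta> * real (w N)) / (u N - real k + \<theta> * real k))"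
      proof (cases "k \<le> diag_len (nu N)")
        case True
        have h: "hook (nu N) k = {k} \<times> {k..nat (entry (nu N) k)} \<union> {k<..conj_part (nu N) k} \<times> {k}" using hook_eq[OF N(1) k] True by simp
        have "(\<Sum>b\<in>hook (nu N) k. log_box N b) = (\<Sum>b\<in>{k} \<times> {k..nat (entry (nu N) k)}. log_box N b) + (\<Sum>b\<in>{k<..conj_part (nu N) k} \<times> {k}. log_box N b)"
          unfolding h by (rule sum.union_disjoint) auto
        also have "(\<Sum>b\<in>{k} \<times> {k..nat (entry (nu N) k)}. log_box N b) = (\<Sum>j\<in>{k..nat (entry (nu N) k)}. log_box N (k, j))"
          by (rule sum.reindex_bij_witness[of _ "\<lambda>j. (k, j)" snd]) auto
        also have "\<dots> = (\<Sum>t<n N. ln (1 + \<theta> / (x N - real t)))"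
          using True by (intro sum.reindex_bij_witness[of _ "\<lambda>t. t + k" "\<lambda>j. j - k"])
            (auto simp: n_def x_def log_box_def dist_def algebra_simps of_nat_diff)
        also have "(\<Sum>b\<in>{k<..conj_part (nu N) k} \<times> {k}. log_box N b) = (\<Sum>i\<in>{k<..conj_part (nu N) k}. log_box N (i, k))"
          by (rule sum.reindex_bij_witness[of _ "\<lambda>i. (i, k)" fst]) auto
        also have "\<dots> = (\<Sum>i\<in>{k<..w N}. ln (1 + \<theta> / (u N - real k + \<theta> * (real i - 1))))"
          using True by (simp add: w_def log_box_def dist_def)
        also have "\<dots> = ln ((u N - real k + \<theta> * real (w N)) / (u N - real k + \<theta> * real k))"
        proof (rule leg_sum)
          show "k \<le> w N" using frob_values(3)[OF N(1) k True] by (simp add: w_def True)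
          fix i assume "i \<in> {k<..w N}"
          then have "(i, k) \<in> hook (nu N) k" using h True by (auto simp: w_def)
          then have "(i, k) \<in> young (nu N)" by (simp add: hook_def)
          then have "\<bar>dist N (i, k)\<bar> \<ge> 2 * \<theta>" using elim by blast
          then show "\<bar>u N - real k + \<theta> * (real i - 1)\<bar> \<ge> 2 * \<theta>" by (simp add: dist_def)
        qed (rule \<theta>)
        finally show ?thesis .
      next
        case False
        then show ?thesis using hook_eq[OF N(1) k] by (cases "u N - real k + \<theta> * real k = 0") (auto simp: n_def w_def)
      qed
      moreover have "hook_sum N k = (\<Sum>b\<in>hook (nu N) k. log_box N b) - real (card (hook (nu N) k)) * (\<theta> / u N)"
        by (simp add: hook_sum_def sum_subtractf)
      moreover have "\<theta> / (u N / real N) * (frob_a (nu N) k / real N + frob_b (nu N) k / real N) = (frob_a (nu N) k + frob_b (nu N) k) * (\<theta> / u N)"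
        using N by (simp add: add_divide_distrib[symmetric])
      ultimately show ?case using card_hook[OF N(1) k] by (simp only:)
    qed
  qed
qed

text \<open>The first n hooks are disjoint parts of the diagram, so their sizes are bounded by its
  size, and \<delta> bounds the partial sums.\<close>

lemma summable_\<alpha>\<beta>: "summable (\<lambda>k. \<alpha> (Suc k) + \<beta> (Suc k))"
proof (rule summableI_nonneg_bounded)
  show "0 \<le> \<alpha> (Suc n) + \<beta> (Suc n)" for n using nonneg[of "Suc n"] by simp
  show "(\<Sum>i<n. \<alpha> (Suc i) + \<beta> (Suc i)) \<le> \<delta>" for n
  proof (rule tendsto_le[OF _ \<delta>])
    show "(\<lambda>N. \<Sum>i<n. frob_a (nu N) (Suc i) / real N + frob_b (nu N) (Suc i) / real N) \<longlonglongrightarrow> (\<Sum>i<n. \<alpha> (Suc i) + \<beta> (Suc i))"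
      by (intro tendsto_sum tendsto_add \<alpha> \<beta>) auto
    show "eventually (\<lambda>N. (\<Sum>i<n. frob_a (nu N) (Suc i) / real N + frob_b (nu N) (Suc i) / real N) \<le> real_of_int (sum_list (nu N)) / real N) sequentially"
      using ev1
    proof eventually_elim
      case (elim N)
      have "(\<Sum>i<n. frob_a (nu N) (Suc i) + frob_b (nu N) (Suc i)) = (\<Sum>i<n. \<Sum>b\<in>hook (nu N) (Suc i). 1)"
        using card_hook[of "nu N" N] elim by simp
      also have "\<dots> = real (card {b \<in> young (nu N). min (fst b) (snd b) \<le> n})" unfolding sum_hooks(2) by simp
      also have "\<dots> \<le> real (card (young (nu N)))" by (intro of_nat_mono card_mono) auto
      also have "\<dots> = real_of_int (sum_list (nu N))" using card_young elim by blast
      finally show ?case by (simp add: add_divide_distrib[symmetric] sum_divide_distrib[symmetric] divide_right_mono)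
    qed
  qed auto
qed

text \<open>Tannery's theorem exchanges the limit with the sum over hooks. The removed first-order
  part returns as \<theta> \<delta> / y, while the hooks subtract \<theta> / y times the sum of all
  coordinates; the difference is the contribution of \<gamma>.\<close>

lemma summable_log_term: "summable (\<lambda>k. log_term (Suc k))"
  and box_prod_limit: "(\<lambda>N. box_prod \<theta> (u N) (nu N)) \<longlonglongrightarrow>
    exp (\<theta> / y * (\<delta> - (\<Sum>k. \<alpha> (Suc k) + \<beta> (Suc k))) + (\<Sum>k. log_term (Suc k)))"
proof -
  obtain C where C: "eventually (\<lambda>N. \<forall>k\<ge>1. \<bar>hook_sum N k\<bar> \<le> C / (real k)\<^sup>2) sequentially" using hook_sum_bound by blast
  have sC: "summable (\<lambda>k. C / (real (Suc k))\<^sup>2)"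
    using inverse_squares_sums summable_mult[of "\<lambda>k. 1 / (real (Suc k))\<^sup>2" C] by (auto simp: sums_iff)
  have "eventually (\<lambda>(k, N). norm (hook_sum N (Suc k)) \<le> C / (real (Suc k))\<^sup>2) (at_top \<times>\<^sub>F sequentially)"
    using eventually_prodI[OF eventually_True[of at_top] C] by (rule eventually_mono) auto
  from tannerys_theorem[OF hook_sum_limit this sC]
  have T: "summable (\<lambda>k. norm (log_term (Suc k) - \<theta> / y * (\<alpha> (Suc k) + \<beta> (Suc k))))"
    "(\<lambda>N. \<Sum>k. hook_sum N (Suc k)) \<longlonglongrightarrow> (\<Sum>k. log_term (Suc k) - \<theta> / y * (\<alpha> (Suc k) + \<beta> (Suc k)))" by auto
  have s1: "summable (\<lambda>k. \<theta> / y * (\<alpha> (Suc k) + \<beta> (Suc k)))" by (intro summable_mult summable_\<alpha>\<beta>)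
  from summable_add[OF summable_norm_cancel[OF T(1)] s1]
  show s2: "summable (\<lambda>k. log_term (Suc k))" by simp
  have "(\<Sum>k. log_term (Suc k) - \<theta> / y * (\<alpha> (Suc k) + \<beta> (Suc k))) = (\<Sum>k. log_term (Suc k)) - \<theta> / y * (\<Sum>k. \<alpha> (Suc k) + \<beta> (Suc k))"
    using suminf_diff[OF s2 s1] suminf_mult[OF summable_\<alpha>\<beta>, of "\<theta> / y"] by simp
  then have "(\<lambda>N. (\<Sum>k. hook_sum N (Suc k)) + \<theta> / (u N / real N) * (real_of_int (sum_list (nu N)) / real N)) \<longlonglongrightarrow>
     ((\<Sum>k. log_term (Suc k)) - \<theta> / y * (\<Sum>k. \<alpha> (Suc k) + \<beta> (Suc k))) + \<theta> / y * \<delta>"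
    using T(2) by (intro tendsto_intros u \<delta> y0) auto
  then have "(\<lambda>N. exp ((\<Sum>k. hook_sum N (Suc k)) + \<theta> / (u N / real N) * (real_of_int (sum_list (nu N)) / real N))) \<longlonglongrightarrow>
    exp (\<theta> / y * (\<delta> - (\<Sum>k. \<alpha> (Suc k) + \<beta> (Suc k))) + (\<Sum>k. log_term (Suc k)))"
    by (intro tendsto_exp) (simp add: algebra_simps)
  then show "(\<lambda>N. box_prod \<theta> (u N) (nu N)) \<longlonglongrightarrow>
    exp (\<theta> / y * (\<delta> - (\<Sum>k. \<alpha> (Suc k) + \<beta> (Suc k))) + (\<Sum>k. log_term (Suc k)))"
  proof (rule Lim_transform_eventually)
    show "eventually (\<lambda>N. exp ((\<Sum>k. hook_sum N (Suc k)) + \<theta> / (u N / real N) * (real_of_int (sum_list (nu N)) / real N)) = box_prod \<theta> (u N) (nu N)) sequentially"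
      using ev1 far_big
    proof eventually_elim
      case (elim N)
      have "(\<Sum>k. hook_sum N (Suc k)) = (\<Sum>b\<in>young (nu N). log_box N b - \<theta> / u N)"
        unfolding hook_sum_def by (rule sum_hooks(1))
      also have "\<dots> = (\<Sum>b\<in>young (nu N). log_box N b) - real (card (young (nu N))) * (\<theta> / u N)" by (simp add: sum_subtractf)
      finally have e: "(\<Sum>k. hook_sum N (Suc k)) + \<theta> / (u N / real N) * (real_of_int (sum_list (nu N)) / real N) = (\<Sum>b\<in>young (nu N). log_box N b)"
        using card_young[of "nu N" N] elim by simp
      have "1 + \<theta> / dist N b > 0" if "b \<in> young (nu N)" for b
      proof -
        have "\<bar>dist N b\<bar> \<ge> 2 * \<theta>" using elim that by blast
        then show ?thesis using \<theta> by (cases "dist N b > 0") (auto simp: field_simps)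
      qed
      then show ?case unfolding e by (simp add: exp_sum log_box_def box_prod_def dist_def case_prod_unfold)
    qed
  qed
qed

end

section \<open>The transform as a box product\<close>

lemma generic_nonzero: "generic \<theta> u \<Longrightarrow> u \<noteq> 0"
  using generic_not_nonpos[of \<theta> u] by auto

lemma row_factor_generic_Suc:
  fixes i :: nat
  assumes u: "generic \<theta> u"
  defines "D \<equiv> \<lambda>k. u - of_int k - 1 + \<theta> * (real i - 1)"
  shows "D k \<noteq> 0" "D k + \<theta> \<noteq> 0" "row_factor \<theta> u i (k + 1) = row_factor \<theta> u i k * (1 + \<theta> / D k)"
proof -
  have g: "generic \<theta> (D k)" "generic \<theta> (D k + \<theta>)"
    using generic_shift[OF u, of "- k - 1" "int i - 1"] generic_shift[OF u, of "- k - 1" "int i"]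
    by (simp_all add: D_def algebra_simps)
  then show nz: "D k \<noteq> 0" "D k + \<theta> \<noteq> 0" by (auto dest: generic_nonzero)
  have "row_factor \<theta> u i (k + 1) = Gamma (D k) / Gamma (D k + \<theta>)" "row_factor \<theta> u i k = Gamma (D k + 1) / Gamma (D k + \<theta> + 1)"
    by (simp_all add: row_factor_def D_def algebra_simps)
  moreover have "1 + \<theta> / D k = (D k + \<theta>) / D k" using nz by (simp add: field_simps)
  ultimately show "row_factor \<theta> u i (k + 1) = row_factor \<theta> u i k * (1 + \<theta> / D k)"
    using generic_Gamma[OF g(1)] generic_Gamma[OF g(2)] nz by simp
qed

text \<open>Removing a box divides by 1 + \<theta> / D, and this equals multiplication by 1 +
  \<theta> / (- (D + \<theta>)). So negative entries also give box factors, at a reflected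
  parameter.\<close>

lemma row_factor_boxes:
  assumes u: "generic \<theta> u"
  shows "row_factor \<theta> u i (int d) = row_factor \<theta> u i 0 * (\<Prod>j\<in>{1..d}. 1 + \<theta> / (u - real j + \<theta> * (real i - 1)))"
    "row_factor \<theta> u i (- int d) = row_factor \<theta> u i 0 * (\<Prod>j\<in>{1..d}. 1 + \<theta> / (1 - u - \<theta> * real i - real j))"
proof -
  show "row_factor \<theta> u i (int d) = row_factor \<theta> u i 0 * (\<Prod>j\<in>{1..d}. 1 + \<theta> / (u - real j + \<theta> * (real i - 1)))"
  proof (induction d)
    case (Suc d)
    have "{1..Suc d} = insert (Suc d) {1..d}" by auto
    then show ?case using row_factor_generic_Suc(3)[OF u, where i = i and k = "int d"] Suc by (simp add: algebra_simps)
  qed simp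
  show "row_factor \<theta> u i (- int d) = row_factor \<theta> u i 0 * (\<Prod>j\<in>{1..d}. 1 + \<theta> / (1 - u - \<theta> * real i - real j))"
  proof (induction d)
    case (Suc d)
    define D where "D = u - of_int (- int (Suc d)) - 1 + \<theta> * (real i - 1)"
    have D: "D \<noteq> 0" "D + \<theta> \<noteq> 0" "row_factor \<theta> u i (- int d) = row_factor \<theta> u i (- int (Suc d)) * (1 + \<theta> / D)"
      using row_factor_generic_Suc[OF u, where i = i and k = "- int (Suc d)"] by (simp_all add: D_def)
    have "1 - u - \<theta> * real i - real (Suc d) = - (D + \<theta>)" by (simp add: D_def algebra_simps)
    moreover have "1 + \<theta> / - (D + \<theta>) = D / (D + \<theta>)" using D by (simp add: field_simps)
    moreover have "(1 + \<theta> / D) * (D / (D + \<theta>)) = 1"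
    proof -
      have "1 + \<theta> / D = (D + \<theta>) / D" using D by (simp add: field_simps)
      then show ?thesis using D by simp
    qed
    ultimately have "row_factor \<theta> u i (- int (Suc d)) = row_factor \<theta> u i (- int d) * (1 + \<theta> / (1 - u - \<theta> * real i - real (Suc d)))"
      unfolding D(3) by (simp only: mult.assoc mult_1_right)
    moreover have "{1..Suc d} = insert (Suc d) {1..d}" by auto
    ultimately show ?case using Suc by (simp add: mult_ac)
  qed simp
qed

lemma pos_neg_part:
  assumes lam: "lam \<in> GT N"
  shows "pos_part lam \<in> GT_pos N" "neg_part lam \<in> GT_pos N"
    "i \<in> {1..N} \<Longrightarrow> entry (pos_part lam) i = max (entry lam i) 0"
    "i \<in> {1..N} \<Longrightarrow> entry (neg_part lam) i = max (- entry lam (Suc N - i)) 0"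
proof -
  have len: "length lam = N" using lam by (rule GT_length)
  show e: "entry (pos_part lam) i = max (entry lam i) 0" if "i \<in> {1..N}" for i
    using that len by (auto simp: entry_def pos_part_def)
  show e': "entry (neg_part lam) i = max (- entry lam (Suc N - i)) 0" if "i \<in> {1..N}" for i
  proof -
    have "i - 1 < length lam" "length lam - Suc (i - 1) = Suc N - i - 1" using that len by auto
    then show ?thesis using that len by (simp add: entry_def neg_part_def rev_nth)
  qed
  have l: "length (pos_part lam) = N" "length (neg_part lam) = N" using len by (auto simp: pos_part_def neg_part_def)
  have "pos_part lam \<in> GT N"
    unfolding GT_iff
  proof (intro conjI l ballI)
    fix i assume i: "i \<in> {1..<N}"
    then have "entry lam (Suc i) \<le> entry lam i" using GT_antimono[OF lam, of i "Suc i"] by auto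
    then show "entry (pos_part lam) (Suc i) \<le> entry (pos_part lam) i" using i e[of i] e[of "Suc i"] by auto
  qed
  then show "pos_part lam \<in> GT_pos N" by (auto simp: GT_pos_def pos_part_def)
  have "neg_part lam \<in> GT N"
    unfolding GT_iff
  proof (intro conjI l ballI)
    fix i assume i: "i \<in> {1..<N}"
    then have "entry lam (Suc N - i) \<le> entry lam (Suc N - Suc i)"
      using GT_antimono[OF lam, of "Suc N - Suc i" "Suc N - i"] by auto
    then show "entry (neg_part lam) (Suc i) \<le> entry (neg_part lam) i" using i e'[of i] e'[of "Suc i"] by auto
  qed
  then show "neg_part lam \<in> GT_pos N" by (auto simp: GT_pos_def neg_part_def)
qed

lemma box_prod_rows:
  assumes "nu \<in> GT_pos N"
  shows "box_prod \<theta> u nu = (\<Prod>i\<in>{1..N}. \<Prod>j\<in>{1..nat (entry nu i)}. 1 + \<theta> / (u - real j + \<theta> * (real i - 1)))"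
  unfolding box_prod_def young_Sigma[OF GT_posD(1)[OF assms]] by (rule prod.Sigma[symmetric]) auto

text \<open>Counting the rows from below turns the reflected factors of the negative entries into
  the box product of \<open>neg_part\<close> at 1 - u - \<theta> N.\<close>

lemma rel_prod_boxes:
  assumes lam: "lam \<in> GT N" and u: "generic \<theta> u"
  shows "rel_prod \<theta> N u lam = box_prod \<theta> u (pos_part lam) * box_prod \<theta> (1 - u - \<theta> * real N) (neg_part lam)"
proof -
  have nz: "row_factor \<theta> u i 0 \<noteq> 0" for i
  proof -
    have "generic \<theta> (u + \<theta> * (real i - 1))" "generic \<theta> (u + \<theta> * real i)"
      using generic_shift[OF u, of 0 "int i - 1"] generic_shift[OF u, of 0 "int i"] by simp_all
    then show ?thesis using generic_Gamma(1) by (simp add: row_factor_def)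
  qed
  have "gamma_weight \<theta> N u 0 = (\<Prod>i\<in>{1..N}. row_factor \<theta> u i 0)"
    using gamma_prod_zero[OF u, of N] by (simp add: gamma_weight_def gamma_prod_def row_factor_def)
  then have "rel_prod \<theta> N u lam = (\<Prod>i\<in>{1..N}. row_factor \<theta> u i (entry lam i) / row_factor \<theta> u i 0)"
    unfolding rel_prod_def gamma_prod_def row_factor_def[symmetric] by (simp add: prod_dividef)
  also have "\<dots> = (\<Prod>i\<in>{1..N}. (\<Prod>j\<in>{1..nat (max (entry lam i) 0)}. 1 + \<theta> / (u - real j + \<theta> * (real i - 1))) *
      (\<Prod>j\<in>{1..nat (max (- entry lam i) 0)}. 1 + \<theta> / (1 - u - \<theta> * real i - real j)))"
  proof (rule prod.cong[OF refl])
    fix i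
    show "row_factor \<theta> u i (entry lam i) / row_factor \<theta> u i 0 = (\<Prod>j\<in>{1..nat (max (entry lam i) 0)}. 1 + \<theta> / (u - real j + \<theta> * (real i - 1))) *
      (\<Prod>j\<in>{1..nat (max (- entry lam i) 0)}. 1 + \<theta> / (1 - u - \<theta> * real i - real j))"
    proof (cases "entry lam i \<ge> 0")
      case True
      then have "entry lam i = int (nat (entry lam i))" by simp
      then show ?thesis using row_factor_boxes(1)[OF u, of i "nat (entry lam i)"] nz True by (simp add: max_def)
    next
      case False
      then have "entry lam i = - int (nat (- entry lam i))" by simp
      then show ?thesis using row_factor_boxes(2)[OF u, of i "nat (- entry lam i)"] nz False by (simp add: max_def)
    qed
  qed
  also have "\<dots> = (\<Prod>i\<in>{1..N}. \<Prod>j\<in>{1..nat (max (entry lam i) 0)}. 1 + \<theta> / (u - real j + \<theta> * (real i - 1))) *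
      (\<Prod>i\<in>{1..N}. \<Prod>j\<in>{1..nat (max (- entry lam i) 0)}. 1 + \<theta> / (1 - u - \<theta> * real i - real j))"
    by (rule prod.distrib)
  also have "(\<Prod>i\<in>{1..N}. \<Prod>j\<in>{1..nat (max (entry lam i) 0)}. 1 + \<theta> / (u - real j + \<theta> * (real i - 1))) = box_prod \<theta> u (pos_part lam)"
    unfolding box_prod_rows[OF pos_neg_part(1)[OF lam]] using pos_neg_part(3)[OF lam] by (intro prod.cong refl) auto
  also have "(\<Prod>i\<in>{1..N}. \<Prod>j\<in>{1..nat (max (- entry lam i) 0)}. 1 + \<theta> / (1 - u - \<theta> * real i - real j)) =
      (\<Prod>i\<in>{1..N}. \<Prod>j\<in>{1..nat (entry (neg_part lam) i)}. 1 + \<theta> / (1 - u - \<theta> * real N - real j + \<theta> * (real i - 1)))"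
  proof (rule prod.reindex_bij_witness[of _ "\<lambda>i. Suc N - i" "\<lambda>i. Suc N - i"])
    fix i assume i: "i \<in> {1..N}"
    have "real (Suc N - i) - 1 = real N - real i" using i by auto
    then have e: "1 - u - \<theta> * real N - real j + \<theta> * (real (Suc N - i) - 1) = 1 - u - \<theta> * real i - real j" for j
      by (simp only:) (simp add: algebra_simps)
    have in1: "Suc N - i \<in> {1..N}" using i by auto
    have "Suc N - (Suc N - i) = i" using i by auto
    then show "(\<Prod>j\<in>{1..nat (entry (neg_part lam) (Suc N - i))}. 1 + \<theta> / (1 - u - \<theta> * real N - real j + \<theta> * (real (Suc N - i) - 1))) =
        (\<Prod>j\<in>{1..nat (max (- entry lam i) 0)}. 1 + \<theta> / (1 - u - \<theta> * real i - real j))"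
      unfolding e using pos_neg_part(4)[OF lam in1] by (simp only:)
  qed auto
  also have "\<dots> = box_prod \<theta> (1 - u - \<theta> * real N) (neg_part lam)"
    unfolding box_prod_rows[OF pos_neg_part(2)[OF lam]] ..
  finally show ?thesis .
qed

section \<open>Bounds for the weights\<close>

lemma rel_weight_zero: "generic \<theta> u \<Longrightarrow> rel_weight \<theta> N u 0 = 1"
proof -
  assume u: "generic \<theta> u"
  have "generic \<theta> (u + \<theta> * real N)" using generic_shift[OF u, of 0 "int N"] by simp
  then show ?thesis using generic_Gamma[OF u] generic_Gamma(1) by (simp add: rel_weight_def gamma_weight_def)
qed

lemma rel_weight_Suc:
  assumes u: "generic \<theta> u"
  shows "u - of_int k - 1 \<noteq> 0" "u - of_int k - 1 + \<theta> * real N \<noteq> 0"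
    "rel_weight \<theta> N u (k + 1) = rel_weight \<theta> N u k * (1 + \<theta> * real N / (u - of_int k - 1))"
proof -
  define D where "D = u - of_int k - 1"
  have g: "generic \<theta> D" "generic \<theta> (D + \<theta> * real N)"
    using generic_shift[OF u, of "- k - 1" 0] generic_shift[OF u, of "- k - 1" "int N"] by (simp_all add: D_def algebra_simps)
  then have nz: "D \<noteq> 0" "D + \<theta> * real N \<noteq> 0" by (auto dest: generic_nonzero)
  then show "u - of_int k - 1 \<noteq> 0" "u - of_int k - 1 + \<theta> * real N \<noteq> 0" by (auto simp: D_def)
  have "gamma_weight \<theta> N u (k + 1) = Gamma D / Gamma (D + \<theta> * real N)" "gamma_weight \<theta> N u k = Gamma (D + 1) / Gamma (D + \<theta> * real N + 1)"
    by (simp_all add: gamma_weight_def D_def algebra_simps)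
  moreover have "1 + \<theta> * real N / D = (D + \<theta> * real N) / D" using nz by (simp add: field_simps)
  ultimately have "gamma_weight \<theta> N u (k + 1) = gamma_weight \<theta> N u k * (1 + \<theta> * real N / D)"
    using generic_Gamma[OF g(1)] generic_Gamma[OF g(2)] nz by simp
  then show "rel_weight \<theta> N u (k + 1) = rel_weight \<theta> N u k * (1 + \<theta> * real N / (u - of_int k - 1))"
    unfolding D_def by (simp add: rel_weight_def)
qed

lemma rel_weight_pos: "of_int k < u \<Longrightarrow> u > 0 \<Longrightarrow> \<theta> > 0 \<Longrightarrow> rel_weight \<theta> N u k > 0"
  unfolding rel_weight_def by (auto intro!: divide_pos_pos gamma_weight_pos)

text \<open>Each step up multiplies by 1 + \<theta> N / D, where D is positive and at most
  u.\<close>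

lemma rel_weight_ge:
  assumes u: "generic \<theta> u" and \<theta>: "\<theta> > 0" and d: "real d < u"
  shows "(1 + \<theta> * real N / u) ^ d \<le> rel_weight \<theta> N u (int d)"
  using d
proof (induction d)
  case (Suc d)
  define D where "D = u - of_int (int d) - 1"
  have D: "0 < D" "D \<le> u" using Suc.prems by (auto simp: D_def)
  have "(1 + \<theta> * real N / u) ^ d * (1 + \<theta> * real N / u) \<le> rel_weight \<theta> N u (int d) * (1 + \<theta> * real N / D)"
  proof (rule mult_mono)
    show IH: "(1 + \<theta> * real N / u) ^ d \<le> rel_weight \<theta> N u (int d)" using Suc by simp
    show "0 \<le> rel_weight \<theta> N u (int d)" by (rule order_trans[OF _ IH]) (use D \<theta> in simp)
    show "1 + \<theta> * real N / u \<le> 1 + \<theta> * real N / D" using D \<theta> by (intro add_mono divide_left_mono order_refl) auto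
    show "0 \<le> 1 + \<theta> * real N / u" using D \<theta> by (intro add_nonneg_nonneg) auto
  qed
  then show ?case using rel_weight_Suc(3)[OF u, where k = "int d" and N = N] by (simp add: D_def mult.commute add.commute)
qed (simp add: rel_weight_zero[OF u])

lemma rel_weight_le:
  assumes u: "generic \<theta> u" and \<theta>: "\<theta> > 0" and d: "real d \<le> L" "L < u"
  shows "rel_weight \<theta> N u (int d) \<le> (1 + \<theta> * real N / (u - L)) ^ d"
  using d(1)
proof (induction d)
  case (Suc d)
  define D where "D = u - of_int (int d) - 1"
  have D: "0 < u - L" "u - L \<le> D" using Suc.prems d by (auto simp: D_def)
  have "rel_weight \<theta> N u (int d) * (1 + \<theta> * real N / D) \<le> (1 + \<theta> * real N / (u - L)) ^ d * (1 + \<theta> * real N / (u - L))"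
    using Suc D \<theta> by (intro mult_mono add_mono divide_left_mono order_refl zero_le_power add_nonneg_nonneg divide_nonneg_nonneg) auto
  then show ?case using rel_weight_Suc(3)[OF u, where k = "int d" and N = N] by (simp add: D_def mult.commute add.commute)
qed (simp add: rel_weight_zero[OF u])

lemma rel_weight_neg_le_one:
  assumes u: "generic \<theta> u" and \<theta>: "\<theta> > 0" and pos: "u > 0"
  shows "rel_weight \<theta> N u (- int d) \<le> 1"
proof (induction d)
  case (Suc d)
  have e: "rel_weight \<theta> N u (- int d) = rel_weight \<theta> N u (- int (Suc d)) * (1 + \<theta> * real N / (u + real d))"
    using rel_weight_Suc(3)[OF u, where k = "- int (Suc d)" and N = N] by simp
  have "rel_weight \<theta> N u (- int (Suc d)) > 0" using pos \<theta> by (intro rel_weight_pos) auto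
  moreover have "1 + \<theta> * real N / (u + real d) \<ge> 1" using pos \<theta> by simp
  ultimately have "rel_weight \<theta> N u (- int (Suc d)) \<le> rel_weight \<theta> N u (- int d)" unfolding e by (simp add: mult_le_cancel_left1)
  then show ?case using Suc by simp
qed (simp add: rel_weight_zero[OF u])

text \<open>At a negative parameter the roles are reversed: a step down in k multiplies by 1 +
  \<theta> N / D with D at most U - \<theta> N, so negative k are exponentially favoured.\<close>

lemma rel_weight_neg_ge:
  assumes u: "generic \<theta> (- U)" and \<theta>: "\<theta> > 0" and d: "real d \<le> U - \<theta> * real N"
  shows "(1 + \<theta> * real N / (U - \<theta> * real N)) ^ d \<le> rel_weight \<theta> N (- U) (- int d)"
  using d
proof (induction d)
  case (Suc d)
  define W where "W = U - \<theta> * real N"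
  define D where "D = W - real d"
  have D: "0 < D" "D \<le> W" using Suc.prems by (auto simp: D_def W_def)
  have nz: "D + \<theta> * real N > 0" using D \<theta> by (intro add_pos_nonneg) auto
  have "rel_weight \<theta> N (- U) (- int d) = rel_weight \<theta> N (- U) (- int (Suc d)) * (1 + \<theta> * real N / (- (D + \<theta> * real N)))"
    using rel_weight_Suc(3)[OF u, where k = "- int (Suc d)" and N = N] by (simp add: D_def W_def)
  moreover have "(1 + \<theta> * real N / (- (D + \<theta> * real N))) * (1 + \<theta> * real N / D) = 1"
  proof -
    have "1 + \<theta> * real N / (- (D + \<theta> * real N)) = D / (D + \<theta> * real N)" "1 + \<theta> * real N / D = (D + \<theta> * real N) / D"
      using D nz by (auto simp: field_simps)
    then show ?thesis using D nz by simp
  qed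
  ultimately have e: "rel_weight \<theta> N (- U) (- int (Suc d)) = rel_weight \<theta> N (- U) (- int d) * (1 + \<theta> * real N / D)"
    by (simp only: mult.assoc mult_1_right)
  have IH: "(1 + \<theta> * real N / W) ^ d \<le> rel_weight \<theta> N (- U) (- int d)" using Suc by (simp add: W_def)
  have "(1 + \<theta> * real N / W) ^ d * (1 + \<theta> * real N / W) \<le> rel_weight \<theta> N (- U) (- int d) * (1 + \<theta> * real N / D)"
  proof (rule mult_mono[OF IH])
    show "1 + \<theta> * real N / W \<le> 1 + \<theta> * real N / D" using D \<theta> by (intro add_mono divide_left_mono order_refl) auto
    show "0 \<le> rel_weight \<theta> N (- U) (- int d)"
    proof (rule order_trans[OF _ IH])
      show "0 \<le> (1 + \<theta> * real N / W) ^ d" using D \<theta> by (intro zero_le_power add_nonneg_nonneg) auto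
    qed
    show "0 \<le> 1 + \<theta> * real N / W" using D \<theta> by (intro add_nonneg_nonneg) auto
  qed
  then show ?case unfolding e W_def by (simp add: mult.commute)
qed (simp add: rel_weight_zero[OF u])

text \<open>For k \<ge> 0 each factor is 1 - \<theta> N / (U + d + 1), nonnegative because U exceeds
  \<theta> N. For negative k the geometric lower bound applies.\<close>

lemma rel_weight_negative_nonneg:
  assumes u: "generic \<theta> (- U)" and \<theta>: "\<theta> > 0" and k: "- real_of_int k \<le> U - \<theta> * real N" "\<theta> * real N < U"
  shows "rel_weight \<theta> N (- U) k \<ge> 0"
proof (cases "k \<ge> 0")
  case True
  have "rel_weight \<theta> N (- U) (int d) \<ge> 0" for d
  proof (induction d)
    case (Suc d)
    have "- U - of_int (int d) - 1 = - (U + real d + 1)" by simp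
    then have "1 + \<theta> * real N / (- U - of_int (int d) - 1) = 1 - \<theta> * real N / (U + real d + 1)"
      by (simp only: divide_minus_right)
    also have "\<dots> \<ge> 0"
    proof -
      have "\<theta> * real N \<ge> 0" using \<theta> by simp
      then have "\<theta> * real N \<le> U + real d + 1" "U + real d + 1 > 0" using k by linarith+
      then show ?thesis by (simp add: divide_le_eq_1)
    qed
    finally show ?case using Suc rel_weight_Suc(3)[OF u, where k = "int d" and N = N] by (simp add: add.commute)
  qed (simp add: rel_weight_zero[OF u])
  from this[of "nat k"] show ?thesis using True by simp
next
  case False
  have "0 \<le> (1 + \<theta> * real N / (U - \<theta> * real N)) ^ nat (- k)" using k \<theta> by (intro zero_le_power add_nonneg_nonneg) auto
  also have "\<dots> \<le> rel_weight \<theta> N (- U) (- int (nat (- k)))" using False k by (intro rel_weight_neg_ge u \<theta>) auto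
  finally show ?thesis using False by simp
qed

text \<open>The excluded values form a countable set, and an open interval is uncountable.\<close>

lemma generic_exists:
  assumes "a < b"
  shows "\<exists>u. generic \<theta> u \<and> a < u \<and> u < b"
proof -
  define S where "S = (\<lambda>(p, q). of_int p + \<theta> * of_int q) ` (UNIV :: (int \<times> int) set)"
  have "countable S" unfolding S_def by (intro countable_image) auto
  moreover have "uncountable {a<..<b}" using assms by (simp add: uncountable_open_interval)
  ultimately have "\<not> {a<..<b} \<subseteq> S" using countable_subset by blast
  then obtain u where "u \<in> {a<..<b}" "u \<notin> S" by blast
  then show ?thesis by (intro exI[of _ u]) (auto simp: generic_def S_def)
qed

text \<open>The number M of variables need only be asymptotic to N, because the weight will also be
  used at levels N - j.\<close>

lemma rel_weight_limit:
  assumes gen: "eventually (\<lambda>N. generic \<theta> (u N)) sequentially"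
    and u: "(\<lambda>N. u N / real N) \<longlonglongrightarrow> v" and v: "v > 0" and \<theta>: "\<theta> > 0"
    and M: "(\<lambda>N. real (M N) / real N) \<longlonglongrightarrow> 1"
  shows "(\<lambda>N. rel_weight \<theta> (M N) (u N) k) \<longlonglongrightarrow> (1 + \<theta> / v) powi k"
proof -
  have fac: "(\<lambda>N. 1 + \<theta> * real (M N) / (u N - b)) \<longlonglongrightarrow> 1 + \<theta> / v" for b
  proof -
    have "(\<lambda>N. u N / real N - b * (1 / real N)) \<longlonglongrightarrow> v - b * 0" by (intro tendsto_intros u lim_1_over_n)
    then have "(\<lambda>N. 1 + \<theta> * (real (M N) / real N) / (u N / real N - b * (1 / real N))) \<longlonglongrightarrow> 1 + \<theta> * 1 / v"
      using v by (intro tendsto_intros M) auto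
    then have "(\<lambda>N. 1 + \<theta> * (real (M N) / real N) / (u N / real N - b * (1 / real N))) \<longlonglongrightarrow> 1 + \<theta> / v" by simp
    then show ?thesis
    proof (rule Lim_transform_eventually)
      show "eventually (\<lambda>N. 1 + \<theta> * (real (M N) / real N) / (u N / real N - b * (1 / real N)) = 1 + \<theta> * real (M N) / (u N - b)) sequentially"
        using eventually_gt_at_top[of 0] by eventually_elim (simp add: diff_divide_distrib[symmetric])
    qed
  qed
  have x: "1 + \<theta> / v > 0" using v \<theta> by (intro add_pos_pos) auto
  have "(\<lambda>N. rel_weight \<theta> (M N) (u N) (int d)) \<longlonglongrightarrow> (1 + \<theta> / v) ^ d" for d
  proof (induction d)
    case 0
    show ?case by (rule Lim_transform_eventually[OF tendsto_const]) (use gen in \<open>eventually_elim, simp add: rel_weight_zero\<close>)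
  next
    case (Suc d)
    have "(\<lambda>N. rel_weight \<theta> (M N) (u N) (int d) * (1 + \<theta> * real (M N) / (u N - (real d + 1)))) \<longlonglongrightarrow> (1 + \<theta> / v) ^ d * (1 + \<theta> / v)"
      by (intro tendsto_mult Suc fac)
    then have "(\<lambda>N. rel_weight \<theta> (M N) (u N) (int d) * (1 + \<theta> * real (M N) / (u N - (real d + 1)))) \<longlonglongrightarrow> (1 + \<theta> / v) ^ Suc d"
      by (simp add: mult.commute)
    then show ?case
    proof (rule Lim_transform_eventually)
      show "eventually (\<lambda>N. rel_weight \<theta> (M N) (u N) (int d) * (1 + \<theta> * real (M N) / (u N - (real d + 1))) = rel_weight \<theta> (M N) (u N) (int (Suc d))) sequentially"
        using gen
      proof eventually_elim
        case (elim N)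
        then show ?case using rel_weight_Suc(3)[OF elim, where k = "int d" and N = "M N"] by (simp add: add.commute diff_diff_eq)
      qed
    qed
  qed
  moreover have "(\<lambda>N. rel_weight \<theta> (M N) (u N) (- int d)) \<longlonglongrightarrow> inverse (1 + \<theta> / v) ^ d" for d
  proof (induction d)
    case 0
    show ?case by (rule Lim_transform_eventually[OF tendsto_const]) (use gen in \<open>eventually_elim, simp add: rel_weight_zero\<close>)
  next
    case (Suc d)
    have "(\<lambda>N. rel_weight \<theta> (M N) (u N) (- int d) / (1 + \<theta> * real (M N) / (u N - (- real d)))) \<longlonglongrightarrow> inverse (1 + \<theta> / v) ^ d / (1 + \<theta> / v)"
      using x by (intro tendsto_divide Suc fac) auto
    then have "(\<lambda>N. rel_weight \<theta> (M N) (u N) (- int d) / (1 + \<theta> * real (M N) / (u N - (- real d)))) \<longlonglongrightarrow> inverse (1 + \<theta> / v) ^ Suc d"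
      by (simp add: divide_inverse mult.commute)
    then show ?case
    proof (rule Lim_transform_eventually)
      show "eventually (\<lambda>N. rel_weight \<theta> (M N) (u N) (- int d) / (1 + \<theta> * real (M N) / (u N - (- real d))) = rel_weight \<theta> (M N) (u N) (- int (Suc d))) sequentially"
        using gen
      proof eventually_elim
        case (elim N)
        define D where "D = u N + real d"
        have D: "D \<noteq> 0" "D + \<theta> * real (M N) \<noteq> 0" "rel_weight \<theta> (M N) (u N) (- int d) = rel_weight \<theta> (M N) (u N) (- int (Suc d)) * (1 + \<theta> * real (M N) / D)"
          using rel_weight_Suc(1)[OF elim, of "- int (Suc d)"] rel_weight_Suc(2,3)[OF elim, where k = "- int (Suc d)" and N = "M N"] by (simp_all add: D_def)
        have "1 + \<theta> * real (M N) / D = (D + \<theta> * real (M N)) / D" using D by (simp add: field_simps)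
        then have "1 + \<theta> * real (M N) / D \<noteq> 0" using D by simp
        moreover have "u N - (- real d) = D" by (simp add: D_def)
        ultimately show ?case using D(3) by simp
      qed
    qed
  qed
  ultimately have "(\<lambda>N. rel_weight \<theta> (M N) (u N) (int (nat k))) \<longlonglongrightarrow> (1 + \<theta> / v) ^ nat k"
    "(\<lambda>N. rel_weight \<theta> (M N) (u N) (- int (nat (- k)))) \<longlonglongrightarrow> inverse (1 + \<theta> / v) ^ nat (- k)" by blast+
  then show ?thesis
    by (cases "k \<ge> 0") (simp_all add: power_int_def)
qed

section \<open>Limits along a Vershik--Kerov sequence\<close>

lemma vk_box_limit:
  assumes vk: "vk_limits nu \<alpha> \<beta> \<gamma>" and nu: "\<And>N. N \<ge> 1 \<Longrightarrow> nu N \<in> GT_pos N" and \<theta>: "\<theta> > 0"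
    and u: "(\<lambda>N. u N / real N) \<longlonglongrightarrow> y" and y: "\<alpha> 1 < y \<or> y < - \<theta> * \<beta> 1"
  shows "box_limit \<theta> y (\<gamma> + (\<Sum>i. \<alpha> (Suc i) + \<beta> (Suc i))) nu \<alpha> \<beta> u"
proof -
  from vk obtain \<delta> where \<delta>: "(\<lambda>N. real_of_int (sum_list (nu N)) / real N) \<longlonglongrightarrow> \<delta>" "\<gamma> = \<delta> - (\<Sum>i. \<alpha> (Suc i) + \<beta> (Suc i))"
    by (auto simp: vk_limits_def)
  then have "\<gamma> + (\<Sum>i. \<alpha> (Suc i) + \<beta> (Suc i)) = \<delta>" by simp
  then show ?thesis using vk nu \<theta> u y \<delta> by unfold_locales (auto simp: vk_limits_def)
qed

lemma scaled_index_limit: "(\<lambda>N. c * real N / real N) \<longlonglongrightarrow> c"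
  by (rule tendsto_eventually, rule eventually_sequentiallyI[of 1]) auto

text \<open>\<beta> 1 \<le> 1 is geometric: a column of a diagram with N rows has at most N
  boxes.\<close>

lemma vk_coordinates:
  assumes vk: "vk_limits nu \<alpha> \<beta> \<gamma>" and nu: "\<And>N. N \<ge> 1 \<Longrightarrow> nu N \<in> GT_pos N"
  shows "i \<ge> 1 \<Longrightarrow> 0 \<le> \<alpha> i" "i \<ge> 1 \<Longrightarrow> 0 \<le> \<beta> i" "i \<ge> 1 \<Longrightarrow> \<alpha> i \<le> \<alpha> 1" "i \<ge> 1 \<Longrightarrow> \<beta> i \<le> \<beta> 1" "\<beta> 1 \<le> 1"
    "summable (\<lambda>k. \<alpha> (Suc k) + \<beta> (Suc k))"
proof -
  \<comment> \<open>The conclusions mention neither \<theta> nor u, so any admissible instance of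
    the locale will do.\<close>
  interpret box_limit 1 "\<alpha> 1 + 1" "\<gamma> + (\<Sum>i. \<alpha> (Suc i) + \<beta> (Suc i))" nu \<alpha> \<beta> "\<lambda>N. (\<alpha> 1 + 1) * real N"
    by (rule vk_box_limit[OF vk nu _ scaled_index_limit]) auto
  show "i \<ge> 1 \<Longrightarrow> 0 \<le> \<alpha> i" "i \<ge> 1 \<Longrightarrow> 0 \<le> \<beta> i" "i \<ge> 1 \<Longrightarrow> \<alpha> i \<le> \<alpha> 1" "i \<ge> 1 \<Longrightarrow> \<beta> i \<le> \<beta> 1"
    by (rule nonneg le1; simp)+
  show "summable (\<lambda>k. \<alpha> (Suc k) + \<beta> (Suc k))" by (rule summable_\<alpha>\<beta>)
  have "frob_b (nu N) 1 / real N \<le> 1" if N: "N \<ge> 1" for N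
  proof (cases "1 \<le> diag_len (nu N)")
    case True
    have "{i. (i, 1) \<in> young (nu N)} \<subseteq> {1..N}" using GT_posD(1)[OF nu[OF N]] by (auto simp: young_def)
    then have "conj_part (nu N) 1 \<le> N" unfolding conj_part_def using card_mono[of "{1..N}"] by fastforce
    moreover have "frob_b (nu N) 1 = real (conj_part (nu N) 1) - real 1 + 1/2"
      by (rule frob_values[OF nu[OF N] _ True]) simp
    ultimately show ?thesis using N by (simp add: field_simps)
  next
    case False
    then show ?thesis by (simp add: frob_b_def)
  qed
  then have "eventually (\<lambda>N. frob_b (nu N) 1 / real N \<le> 1) sequentially" by (rule eventually_sequentiallyI)
  then show "\<beta> 1 \<le> 1" using tendsto_upperbound[OF \<beta>[of 1]] by auto
qed

text \<open>A nonempty first row exceeds its Frobenius coordinate by 1/2. The slack 1/2 in the slope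
  absorbs this and the error of the limit, and still lies below any slope \<alpha> 1 + 1.\<close>

lemma vk_first_row:
  assumes vk: "vk_limits nu \<alpha> \<beta> \<gamma>" and nu: "\<And>N. N \<ge> 1 \<Longrightarrow> nu N \<in> GT_pos N"
  shows "eventually (\<lambda>N. real_of_int (entry (nu N) 1) \<le> (\<alpha> 1 + 1/2) * real N) sequentially"
proof -
  have "(\<lambda>N. frob_a (nu N) 1 / real N) \<longlonglongrightarrow> \<alpha> 1" using vk by (auto simp: vk_limits_def)
  then have "eventually (\<lambda>N. frob_a (nu N) 1 / real N < \<alpha> 1 + 1/4) sequentially"
    by (rule order_tendstoD) simp
  moreover have "eventually (\<lambda>N. N \<ge> 2) sequentially" by (rule eventually_ge_at_top)
  ultimately show ?thesis
  proof eventually_elim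
    case (elim N)
    have n: "nu N \<in> GT_pos N" using nu elim(2) by simp
    have "real_of_int (entry (nu N) 1) \<le> frob_a (nu N) 1 + 1/2"
    proof (cases "1 \<le> diag_len (nu N)")
      case True
      then show ?thesis using frob_values(4)[OF n _ True] by simp
    next
      case False
      then have "(1, 1) \<notin> young (nu N)" using diag_len_iff[OF n, of 1] by simp
      then have "entry (nu N) 1 \<le> 0" using elim(2) GT_posD(1)[OF n] by (auto simp: young_def entry_def)
      then show ?thesis using frob_nonneg(1)[OF n, of 1] by simp
    qed
    moreover have "frob_a (nu N) 1 < (\<alpha> 1 + 1/4) * real N" using elim by (simp add: field_simps)
    moreover have "1/2 \<le> 1/4 * real N" using elim by simp
    ultimately show ?case unfolding distrib_right by linarith
  qed
qed

definition log_sum :: "real \<Rightarrow> real \<Rightarrow> (nat \<Rightarrow> real) \<Rightarrow> (nat \<Rightarrow> real) \<Rightarrow> real" where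
  "log_sum \<theta> y \<alpha> \<beta> = (\<Sum>k. ln (1 + \<theta> * \<beta> (Suc k) / y) - \<theta> * ln (1 - \<alpha> (Suc k) / y))"

lemma vk_box_prod_limit:
  assumes vk: "vk_limits nu \<alpha> \<beta> \<gamma>" and nu: "\<And>N. N \<ge> 1 \<Longrightarrow> nu N \<in> GT_pos N" and \<theta>: "\<theta> > 0"
    and u: "(\<lambda>N. u N / real N) \<longlonglongrightarrow> y" and y: "\<alpha> 1 < y \<or> y < - \<theta> * \<beta> 1"
  shows "(\<lambda>N. box_prod \<theta> (u N) (nu N)) \<longlonglongrightarrow> exp (\<theta> / y * \<gamma> + log_sum \<theta> y \<alpha> \<beta>)"
    "summable (\<lambda>k. ln (1 + \<theta> * \<beta> (Suc k) / y) - \<theta> * ln (1 - \<alpha> (Suc k) / y))"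
    "k \<ge> 1 \<Longrightarrow> 1 + \<theta> * \<beta> k / y > 0" "k \<ge> 1 \<Longrightarrow> 1 - \<alpha> k / y > 0"
proof -
  interpret box_limit \<theta> y "\<gamma> + (\<Sum>i. \<alpha> (Suc i) + \<beta> (Suc i))" nu \<alpha> \<beta> u
    by (rule vk_box_limit[OF vk nu \<theta> u y])
  show "(\<lambda>N. box_prod \<theta> (u N) (nu N)) \<longlonglongrightarrow> exp (\<theta> / y * \<gamma> + log_sum \<theta> y \<alpha> \<beta>)"
    using box_prod_limit by (simp add: log_sum_def log_term_def)
  show "summable (\<lambda>k. ln (1 + \<theta> * \<beta> (Suc k) / y) - \<theta> * ln (1 - \<alpha> (Suc k) / y))"
    using summable_log_term by (simp add: log_term_def)
  show "k \<ge> 1 \<Longrightarrow> 1 + \<theta> * \<beta> k / y > 0" "k \<ge> 1 \<Longrightarrow> 1 - \<alpha> k / y > 0" by (rule log_pos; simp)+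
qed

section \<open>A fixed Vershik--Kerov sequence\<close>

locale vk_setting =
  fixes \<theta> :: real and lam :: "nat \<Rightarrow> int list" and \<omega> :: boundary_point
  assumes \<theta>: "\<theta> > 0" and vk: "vk_sequence lam \<omega>"
begin

abbreviation "\<alpha> \<equiv> alpha_pos \<omega>"
abbreviation "\<beta> \<equiv> beta_pos \<omega>"
abbreviation "\<alpha>' \<equiv> alpha_neg \<omega>"
abbreviation "\<beta>' \<equiv> beta_neg \<omega>"

lemma lam: "N \<ge> 1 \<Longrightarrow> lam N \<in> GT N"
  using vk by (simp add: vk_sequence_def)

lemma vk_parts:
  "vk_limits (\<lambda>N. pos_part (lam N)) \<alpha> \<beta> (gamma_pos \<omega>)" "vk_limits (\<lambda>N. neg_part (lam N)) \<alpha>' \<beta>' (gamma_neg \<omega>)"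
  using vk by (simp_all add: vk_sequence_def)

lemma parts_GT: "N \<ge> 1 \<Longrightarrow> pos_part (lam N) \<in> GT_pos N" "N \<ge> 1 \<Longrightarrow> neg_part (lam N) \<in> GT_pos N"
  using pos_neg_part lam by auto

lemmas pos_coordinates = vk_coordinates[OF vk_parts(1) parts_GT(1)]
lemmas neg_coordinates = vk_coordinates[OF vk_parts(2) parts_GT(2)]

text \<open>The second factor is taken at - (y + \<theta>), the limit of the reflected parameter
  divided by N. With y = \<theta> / (x - 1) the result is the limit function at x; see
  \<open>Psi_real\<close>.\<close>

definition transform_limit :: "real \<Rightarrow> real" where
  "transform_limit y = exp (\<theta> / y * gamma_pos \<omega> + log_sum \<theta> y \<alpha> \<beta>)
     * exp (\<theta> / (- (y + \<theta>)) * gamma_neg \<omega> + log_sum \<theta> (- (y + \<theta>)) \<alpha>' \<beta>')"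

text \<open>Because \<beta> 1 and \<beta>' 1 are at most 1, a parameter beyond the rows of one
  diagram has its reflection beyond the columns of the other.\<close>

lemma transform_regime:
  assumes y: "\<alpha> 1 < y \<or> y < - (\<theta> + \<alpha>' 1)"
  shows "\<alpha> 1 < y \<or> y < - \<theta> * \<beta> 1" "\<alpha>' 1 < - (y + \<theta>) \<or> - (y + \<theta>) < - \<theta> * \<beta>' 1"
proof -
  have "\<theta> * \<beta> 1 \<le> \<theta>" "\<theta> * \<beta>' 1 \<le> \<theta>" using pos_coordinates(5) neg_coordinates(5) \<theta> by auto
  then show "\<alpha> 1 < y \<or> y < - \<theta> * \<beta> 1" "\<alpha>' 1 < - (y + \<theta>) \<or> - (y + \<theta>) < - \<theta> * \<beta>' 1"
    using y pos_coordinates(1)[of 1] neg_coordinates(1)[of 1] by auto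
qed

lemma reflected_limit:
  assumes "(\<lambda>N. u N / real N) \<longlonglongrightarrow> y"
  shows "(\<lambda>N. (1 - u N - \<theta> * real N) / real N) \<longlonglongrightarrow> - (y + \<theta>)"
proof -
  have "(\<lambda>N. 1 / real N - u N / real N - \<theta>) \<longlonglongrightarrow> 0 - y - \<theta>"
    by (intro tendsto_diff tendsto_const assms lim_1_over_n)
  then show ?thesis
  proof (rule Lim_transform_eventually[OF tendsto_eq_rhs])
    show "\<forall>\<^sub>F N in sequentially. 1 / real N - u N / real N - \<theta> = (1 - u N - \<theta> * real N) / real N"
      by (rule eventually_sequentiallyI[of 1]) (simp add: field_simps)
  qed simp
qed

lemma rel_prod_limit:
  assumes gen: "eventually (\<lambda>N. generic \<theta> (u N)) sequentially" and u: "(\<lambda>N. u N / real N) \<longlonglongrightarrow> y"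
    and y: "\<alpha> 1 < y \<or> y < - (\<theta> + \<alpha>' 1)"
  shows "(\<lambda>N. rel_prod \<theta> N (u N) (lam N)) \<longlonglongrightarrow> transform_limit y"
proof -
  have "(\<lambda>N. box_prod \<theta> (u N) (pos_part (lam N)) * box_prod \<theta> (1 - u N - \<theta> * real N) (neg_part (lam N)))
      \<longlonglongrightarrow> transform_limit y"
    unfolding transform_limit_def
    by (intro tendsto_mult vk_box_prod_limit(1) vk_parts parts_GT \<theta> u transform_regime[OF y] reflected_limit)
  then show ?thesis
  proof (rule Lim_transform_eventually)
    show "\<forall>\<^sub>F N in sequentially. box_prod \<theta> (u N) (pos_part (lam N)) * box_prod \<theta> (1 - u N - \<theta> * real N) (neg_part (lam N))
        = rel_prod \<theta> N (u N) (lam N)"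
      using gen eventually_ge_at_top[of 1] by eventually_elim (simp add: rel_prod_boxes lam)
  qed
qed

lemma extreme_rows:
  "eventually (\<lambda>N. real_of_int (entry (lam N) 1) \<le> (\<alpha> 1 + 1/2) * real N) sequentially"
  "eventually (\<lambda>N. - real_of_int (entry (lam N) N) \<le> (\<alpha>' 1 + 1/2) * real N) sequentially"
proof -
  have first: "eventually (\<lambda>N. real_of_int (entry (pos_part (lam N)) 1) \<le> (\<alpha> 1 + 1/2) * real N) sequentially"
    "eventually (\<lambda>N. real_of_int (entry (neg_part (lam N)) 1) \<le> (\<alpha>' 1 + 1/2) * real N) sequentially"
    by (rule vk_first_row[OF vk_parts(1) parts_GT(1)], simp, rule vk_first_row[OF vk_parts(2) parts_GT(2)], simp)
  show "eventually (\<lambda>N. real_of_int (entry (lam N) 1) \<le> (\<alpha> 1 + 1/2) * real N) sequentially"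
    using first(1) eventually_ge_at_top[of 1]
  proof eventually_elim
    case (elim N)
    then show ?case using pos_neg_part(3)[OF lam, of N 1] by auto
  qed
  show "eventually (\<lambda>N. - real_of_int (entry (lam N) N) \<le> (\<alpha>' 1 + 1/2) * real N) sequentially"
    using first(2) eventually_ge_at_top[of 1]
  proof eventually_elim
    case (elim N)
    then show ?case using pos_neg_part(4)[OF lam, of N 1] by auto
  qed
qed

lemma generic_sequence:
  obtains u where "\<And>N. generic \<theta> (u N)" "\<And>N. y * real N - 1 < u N" "\<And>N. u N < y * real N" "(\<lambda>N. u N / real N) \<longlonglongrightarrow> y"
proof -
  have "\<exists>u. generic \<theta> u \<and> y * real N - 1 < u \<and> u < y * real N" for N
    by (rule generic_exists) simp
  then obtain u where u: "\<And>N. generic \<theta> (u N) \<and> y * real N - 1 < u N \<and> u N < y * real N" by metis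
  have "(\<lambda>N. u N / real N) \<longlonglongrightarrow> y"
  proof (rule tendsto_sandwich)
    show "\<forall>\<^sub>F N in sequentially. y - 1 / real N \<le> u N / real N" "\<forall>\<^sub>F N in sequentially. u N / real N \<le> y"
      using u by (auto intro!: eventually_sequentiallyI[of 1] simp: field_simps less_imp_le)
    have "(\<lambda>N. y - 1 / real N) \<longlonglongrightarrow> y - 0" by (intro tendsto_intros lim_1_over_n)
    then show "(\<lambda>N. y - 1 / real N) \<longlonglongrightarrow> y" by simp
  qed simp
  then show thesis using u that by blast
qed

text \<open>Both one-sided transforms dominate a geometric weight, so their bounded expectations control both tails.\<close>

lemma exponential_moment:
  obtains r C :: real where "r > 1"
    "eventually (\<lambda>N. \<forall>i\<in>{1..N}. expect \<theta> N (lam N) (\<lambda>p. r ^ nat \<bar>incr p i\<bar>) \<le> C) sequentially"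
proof -
  \<comment> \<open>The margin 1, against 1/2 in \<open>extreme_rows\<close>, keeps the parameters
    off all entries even when a generic choice moves them by up to 1, as soon as N \<ge> 2.\<close>
  define v V where "v = \<alpha> 1 + 1" and "V = - (\<theta> + \<alpha>' 1 + 1)"
  have ge: "\<alpha> 1 \<ge> 0" "\<alpha>' 1 \<ge> 0" using pos_coordinates(1) neg_coordinates(1) by auto
  obtain u where u: "\<And>N. generic \<theta> (u N)" "\<And>N. v * real N - 1 < u N" "\<And>N. u N < v * real N" "(\<lambda>N. u N / real N) \<longlonglongrightarrow> v"
    using generic_sequence[of v] by blast
  obtain w where w: "\<And>N. generic \<theta> (w N)" "\<And>N. V * real N - 1 < w N" "\<And>N. w N < V * real N" "(\<lambda>N. w N / real N) \<longlonglongrightarrow> V"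
    using generic_sequence[of V] by blast
  \<comment> \<open>The two candidates bound from below the growth factors 1 + \<theta> N / u and 1
    + \<theta> N / (U - \<theta> N) of the weights, using u < v N and U - \<theta> N \<le>
    (\<alpha>' 1 + 2) N.\<close>
  define r where "r = min (1 + \<theta> / v) (1 + \<theta> / (\<alpha>' 1 + 2))"
  have r: "r > 1" "r \<le> 1 + \<theta> / v" "r \<le> 1 + \<theta> / (\<alpha>' 1 + 2)" using ge \<theta> by (auto simp: r_def v_def)
  have "(\<lambda>N. rel_prod \<theta> N (u N) (lam N) + rel_prod \<theta> N (w N) (lam N)) \<longlonglongrightarrow> transform_limit v + transform_limit V"
    using u w by (intro tendsto_add rel_prod_limit) (auto simp: v_def V_def)
  then have "eventually (\<lambda>N. rel_prod \<theta> N (u N) (lam N) + rel_prod \<theta> N (w N) (lam N) < transform_limit v + transform_limit V + 1) sequentially"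
    by (rule order_tendstoD) simp
  then have "eventually (\<lambda>N. \<forall>i\<in>{1..N}. expect \<theta> N (lam N) (\<lambda>p. r ^ nat \<bar>incr p i\<bar>) \<le> transform_limit v + transform_limit V + 1) sequentially"
    using extreme_rows eventually_ge_at_top[of 2]
  proof eventually_elim
    case (elim N)
    have L: "lam N \<in> GT N" using elim lam by simp
    have Npos: "real N \<ge> 2" using elim by simp
    have upos: "u N > 0" "(\<alpha> 1 + 1/2) * real N < u N"
    proof -
      have "(\<alpha> 1 + 1/2) * real N \<le> v * real N - 1" using Npos by (simp add: v_def field_simps)
      moreover have "(\<alpha> 1 + 1/2) * real N \<ge> 0" using ge by simp
      ultimately show "u N > 0" "(\<alpha> 1 + 1/2) * real N < u N" using u(2)[of N] by linarith+
    qed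
    define U where "U = - w N"
    have gU: "generic \<theta> (- U)" using w(1)[of N] by (simp add: U_def)
    have U: "(\<alpha>' 1 + 1) * real N < U - \<theta> * real N" "U - \<theta> * real N \<le> (\<alpha>' 1 + 2) * real N"
      using w(2,3)[of N] Npos by (simp_all add: U_def V_def algebra_simps)
    have Upos: "(\<alpha>' 1 + 1/2) * real N < U - \<theta> * real N" "\<theta> * real N < U"
    proof -
      have "(\<alpha>' 1 + 1/2) * real N \<le> (\<alpha>' 1 + 1) * real N" "(\<alpha>' 1 + 1) * real N \<ge> 0" using ge by (auto intro: mult_right_mono)
      then show "(\<alpha>' 1 + 1/2) * real N < U - \<theta> * real N" "\<theta> * real N < U" using U by linarith+
    qed
    show ?case
    proof
      fix i assume i: "i \<in> {1..N}"
      \<comment> \<open>The weight that matches the sign of k dominates the geometric term; of the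
        other weight only nonnegativity is used.\<close>
      have key: "r ^ nat \<bar>k\<bar> \<le> rel_weight \<theta> N (u N) k + rel_weight \<theta> N (- U) k"
        if k: "entry (lam N) N \<le> k" "k \<le> entry (lam N) 1" for k
      proof -
        have kb: "real_of_int k \<le> (\<alpha> 1 + 1/2) * real N" "- real_of_int k \<le> (\<alpha>' 1 + 1/2) * real N"
          using k elim by linarith+
        have p1: "rel_weight \<theta> N (u N) k > 0" using kb upos \<theta> by (intro rel_weight_pos) auto
        have p2: "rel_weight \<theta> N (- U) k \<ge> 0" using kb Upos by (intro rel_weight_negative_nonneg gU \<theta>) auto
        show ?thesis
        proof (cases "k \<ge> 0")
          case True
          have "r \<le> 1 + \<theta> * real N / u N"
          proof -
            have "\<theta> / v = \<theta> * real N / (v * real N)" using Npos by simp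
            also have "\<dots> \<le> \<theta> * real N / u N" using u(3)[of N] upos \<theta> ge Npos by (intro divide_left_mono mult_pos_pos) (auto simp: v_def)
            finally have "\<theta> / v \<le> \<theta> * real N / u N" .
            then show ?thesis using r by linarith
          qed
          then have "r ^ nat k \<le> (1 + \<theta> * real N / u N) ^ nat k" using r by (intro power_mono) auto
          also have "\<dots> \<le> rel_weight \<theta> N (u N) (int (nat k))"
            using True kb upos by (intro rel_weight_ge u \<theta>) auto
          finally show ?thesis using True p2 by simp
        next
          case False
          have "r \<le> 1 + \<theta> * real N / (U - \<theta> * real N)"
          proof -
            have "\<theta> / (\<alpha>' 1 + 2) \<le> \<theta> * real N / (U - \<theta> * real N)" 
              using mult_left_mono[OF U(2), of \<theta>] Upos \<theta> ge Npos by (simp add: divide_le_eq le_divide_eq mult_ac)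
            then show ?thesis using r by linarith
          qed
          then have "r ^ nat (- k) \<le> (1 + \<theta> * real N / (U - \<theta> * real N)) ^ nat (- k)" using r by (intro power_mono) auto
          also have "\<dots> \<le> rel_weight \<theta> N (- U) (- int (nat (- k)))"
            using False kb Upos by (intro rel_weight_neg_ge gU \<theta>) auto
          finally show ?thesis using False p1 by simp
        qed
      qed
      have "expect \<theta> N (lam N) (\<lambda>p. r ^ nat \<bar>incr p i\<bar>)
          \<le> expect \<theta> N (lam N) (\<lambda>p. rel_weight \<theta> N (u N) (incr p i) + rel_weight \<theta> N (- U) (incr p i))"
        using incr_bounds[OF _ L i] by (intro expect_mono L \<theta> key) auto
      also have "\<dots> = rel_prod \<theta> N (u N) (lam N) + rel_prod \<theta> N (- U) (lam N)"
        by (simp add: expect_add expect_rel_weight[OF L \<theta> _ i] u gU)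
      also have "\<dots> \<le> transform_limit v + transform_limit V + 1" using elim(1) by (simp add: U_def)
      finally show "expect \<theta> N (lam N) (\<lambda>p. r ^ nat \<bar>incr p i\<bar>) \<le> transform_limit v + transform_limit V + 1" .
    qed
  qed
  then show thesis by (rule that[OF r(1)])
qed

end

section \<open>The limit function\<close>

text \<open>The principal power is holomorphic on the right half-plane, so on a compact convex part
  of Re s \<ge> 1/2 the bounded derivative gives a Lipschitz estimate.\<close>

lemma inverse_powr_near_one:
  fixes \<theta> R :: real
  assumes R: "R \<ge> 0"
  obtains C where "C \<ge> 0"
    "\<And>s. Re s \<ge> 1/2 \<Longrightarrow> norm (s - 1) \<le> R \<Longrightarrow> norm (1 / s powr of_real \<theta> - 1) \<le> C * norm (s - 1)"
proof -
  define S where "S = {s. 1/2 \<le> Re s} \<inter> cball 1 R"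
  define h where "h = (\<lambda>s::complex. 1 / s powr of_real \<theta>)"
  have "compact S" unfolding S_def by (intro closed_Int_compact closed_halfspace_Re_ge compact_cball)
  have "convex S" unfolding S_def by (intro convex_Int convex_halfspace_Re_ge convex_cball)
  have op: "open {s. 0 < Re s}" by (rule open_halfspace_Re_gt)
  have nonneg: "s \<notin> \<real>\<^sub>\<le>\<^sub>0" "s \<noteq> 0" if "0 < Re s" for s :: complex
    using that by (auto simp: complex_nonpos_Reals_iff)
  have hol: "h holomorphic_on {s. 0 < Re s}"
    unfolding h_def using nonneg by (intro holomorphic_intros) auto
  have "continuous_on S (deriv h)"
    by (rule continuous_on_subset[OF holomorphic_on_imp_continuous_on[OF holomorphic_deriv[OF hol op]]]) (auto simp: S_def)
  then have "bounded (deriv h ` S)" using \<open>compact S\<close> by (intro compact_imp_bounded compact_continuous_image)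
  then obtain C where C: "\<And>s. s \<in> S \<Longrightarrow> norm (deriv h s) \<le> C" by (auto simp: bounded_iff)
  have "1 \<in> S" using R by (simp add: S_def)
  have "norm (h s - h 1) \<le> C * norm (s - 1)" if "s \<in> S" for s
  proof (rule field_differentiable_bound[OF \<open>convex S\<close> _ C that \<open>1 \<in> S\<close>])
    fix z assume "z \<in> S"
    then have "(h has_field_derivative deriv h z) (at z)"
      by (intro holomorphic_derivI[OF hol op]) (auto simp: S_def)
    then show "(h has_field_derivative deriv h z) (at z within S)" by (rule has_field_derivative_at_within)
  qed
  moreover have "C \<ge> 0" using C[OF \<open>1 \<in> S\<close>] norm_ge_zero[of "deriv h 1"] by linarith
  ultimately show thesis using that[of C] by (auto simp: S_def h_def dist_norm norm_minus_commute)
qed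

lemma mult_near_one:
  fixes a b :: complex
  assumes a: "norm (a - 1) \<le> A * e" and b: "norm (b - 1) \<le> B * e" and e: "0 \<le> e" "e \<le> E" and nn: "A \<ge> 0" "B \<ge> 0"
  shows "norm (a * b - 1) \<le> (A + B + A * B * E) * e"
proof -
  have "a * b - 1 = (a - 1) * (b - 1) + ((a - 1) + (b - 1))" by (simp add: algebra_simps)
  then have "norm (a * b - 1) \<le> norm (a - 1) * norm (b - 1) + (norm (a - 1) + norm (b - 1))"
    by (metis (no_types) norm_triangle_le norm_mult norm_triangle_ineq add_left_mono order_trans)
  also have "\<dots> \<le> (A * e) * (B * E) + (A * e + B * e)"
  proof (intro add_mono mult_mono a b)
    show "norm (b - 1) \<le> B * E" using b mult_left_mono[OF e(2) nn(2)] by linarith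
  qed (use e nn in auto)
  finally show ?thesis by (simp add: algebra_simps)
qed

lemma one_sided_factor_near_one:
  fixes \<theta> A :: real
  assumes \<theta>: "\<theta> > 0" and A: "A \<ge> 0"
  obtains C where "C \<ge> 0"
    "\<And>a b e w. 0 \<le> a \<Longrightarrow> a \<le> A \<Longrightarrow> 0 \<le> b \<Longrightarrow> b \<le> 1 \<Longrightarrow> norm w \<le> 3 \<Longrightarrow> Re (1 - of_real a * w / of_real \<theta>) \<ge> 1/2 \<Longrightarrow>
      norm ((1 + of_real b * w) / (1 - of_real a * w / of_real \<theta>) powr of_real \<theta> - 1) \<le> C * (a + b)"
proof -
  have R: "3 * A / \<theta> \<ge> 0" using \<theta> A by simp
  obtain C where C: "C \<ge> 0"
    "\<And>s. Re s \<ge> 1/2 \<Longrightarrow> norm (s - 1) \<le> 3 * A / \<theta> \<Longrightarrow> norm (1 / s powr of_real \<theta> - 1) \<le> C * norm (s - 1)"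
    using inverse_powr_near_one[OF R, of \<theta>] by metis
  define D where "D = 3 + C * (3 / \<theta>) + 3 * (C * (3 / \<theta>)) * (A + 1)"
  show thesis
  proof (rule that[of D])
    show "D \<ge> 0" using C \<theta> A by (simp add: D_def)
    fix a b :: real and w :: complex
    assume a: "0 \<le> a" "a \<le> A" and b: "0 \<le> b" "b \<le> 1" and w: "norm w \<le> 3" and Re: "Re (1 - of_real a * w / of_real \<theta>) \<ge> 1/2"
    define s where "s = 1 - of_real a * w / of_real \<theta>"
    have ns: "norm (s - 1) = a * norm w / \<theta>" using a \<theta> by (simp add: s_def norm_divide norm_mult)
    have aw: "a * norm w \<le> a * 3" "a * 3 \<le> A * 3" using a w by (auto intro: mult_left_mono)
    have ns3: "norm (s - 1) \<le> (3 / \<theta>) * a" unfolding ns using aw \<theta> by (simp add: field_simps)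
    have "norm (s - 1) \<le> 3 * A / \<theta>" unfolding ns using aw \<theta> by (simp add: divide_right_mono)
    then have "norm (1 / s powr of_real \<theta> - 1) \<le> C * norm (s - 1)" using Re by (intro C(2)) (auto simp: s_def)
    also have "\<dots> \<le> C * ((3 / \<theta>) * a)" using ns3 C(1) by (rule mult_left_mono)
    also have "\<dots> \<le> (C * (3 / \<theta>)) * (a + b)" unfolding mult.assoc using C(1) \<theta> b by (intro mult_left_mono) auto
    finally have p: "norm (1 / s powr of_real \<theta> - 1) \<le> (C * (3 / \<theta>)) * (a + b)" .
    have "norm ((1 + of_real b * w) - 1) = b * norm w" using b by (simp add: norm_mult)
    also have "\<dots> \<le> b * 3" using b w by (intro mult_left_mono) auto
    also have "\<dots> \<le> 3 * (a + b)" using a by simp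
    finally have q: "norm ((1 + of_real b * w) - 1) \<le> 3 * (a + b)" .
    have "norm ((1 + of_real b * w) * (1 / s powr of_real \<theta>) - 1) \<le> D * (a + b)"
      unfolding D_def by (rule mult_near_one[OF q p]) (use a b C(1) \<theta> in auto)
    then show "norm ((1 + of_real b * w) / (1 - of_real a * w / of_real \<theta>) powr of_real \<theta> - 1) \<le> D * (a + b)"
      by (simp add: s_def)
  qed
qed

context vk_setting
begin

text \<open>The bound 1/2 keeps the annulus away from 0. The other bound keeps the base of every
  power at real part at least 1/2, away from the branch cut, and makes \<theta> / (x - 1) exceed
  \<alpha> 1 + 1 for real x in (1, 1 + radius).\<close>

definition radius :: real where
  "radius = min (1/2) (\<theta> / (4 * (\<alpha> 1 + \<alpha>' 1 + 1)))"

lemma radius_bounds: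
  shows "radius > 0" "radius \<le> 1/2" "\<alpha> 1 * radius \<le> \<theta> / 4" "\<alpha>' 1 * radius \<le> \<theta> / 4"
    "radius * (\<alpha> 1 + 1) \<le> \<theta> / 4"
proof -
  have ge: "\<alpha> 1 \<ge> 0" "\<alpha>' 1 \<ge> 0" using pos_coordinates(1) neg_coordinates(1) by auto
  show r: "radius > 0" using \<theta> ge by (auto simp: radius_def)
  show "radius \<le> 1/2" unfolding radius_def by (rule min.cobounded1)
  have "radius \<le> \<theta> / (4 * (\<alpha> 1 + \<alpha>' 1 + 1))" by (simp add: radius_def)
  then have *: "radius * (\<alpha> 1 + \<alpha>' 1 + 1) \<le> \<theta> / 4" using ge by (simp add: field_simps)
  have "\<alpha> 1 * radius \<ge> 0" "\<alpha>' 1 * radius \<ge> 0" using ge r by auto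
  then show "\<alpha> 1 * radius \<le> \<theta> / 4" "\<alpha>' 1 * radius \<le> \<theta> / 4" "radius * (\<alpha> 1 + 1) \<le> \<theta> / 4"
    using * r unfolding distrib_left by (auto simp: mult.commute)
qed

lemma annulus_radius:
  assumes z: "z \<in> annulus radius"
  shows "z \<noteq> 0" "norm (z - 1) \<le> 3" "norm (inverse z - 1) \<le> 3"
    "i \<ge> 1 \<Longrightarrow> Re (1 - of_real (\<alpha> i) * (z - 1) / of_real \<theta>) \<ge> 1/2"
    "i \<ge> 1 \<Longrightarrow> Re (1 - of_real (\<alpha>' i) * (inverse z - 1) / of_real \<theta>) \<ge> 1/2"
proof -
  have nz: "1 - radius < norm z" "norm z < 1 + radius" "norm z > 1/2" using z radius_bounds by (auto simp: annulus_def)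
  then show z0: "z \<noteq> 0" by auto
  show "norm (z - 1) \<le> 3" using norm_triangle_ineq4[of z 1] nz radius_bounds(2) by simp
  have "norm z > 0" using z0 by simp
  then have "1 / norm z < 2" using nz by (simp add: divide_less_eq)
  then show "norm (inverse z - 1) \<le> 3" using norm_triangle_ineq4[of "inverse z" 1] by (simp add: norm_divide inverse_eq_divide)
  \<comment> \<open>For r \<le> 1/2 one has (1 + 2 r)(1 - r) \<ge> 1, so inversion at most doubles
    the outer width of the annulus.\<close>
  have inv: "norm (inverse z) \<le> 1 + 2 * radius"
  proof -
    have "1 \<le> (1 + 2 * radius) * (1 - radius)" using radius_bounds(1,2) by (simp add: algebra_simps)
    also have "\<dots> \<le> (1 + 2 * radius) * norm z" using nz radius_bounds(1) by (intro mult_left_mono) auto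
    finally have "1 / norm z \<le> 1 + 2 * radius" using \<open>norm z > 0\<close> by (simp add: divide_le_eq)
    then show ?thesis by (simp add: norm_divide inverse_eq_divide)
  qed
  have key: "Re (1 - of_real a * (w - 1) / of_real \<theta>) \<ge> 1/2"
    if a: "0 \<le> a" "a * radius \<le> \<theta> / 4" and w: "norm w \<le> 1 + 2 * radius" for a and w :: complex
  proof -
    have "Re w - 1 \<le> 2 * radius" using complex_Re_le_cmod[of w] w by simp
    then have "a * (Re w - 1) \<le> a * (2 * radius)" using a(1) by (rule mult_left_mono)
    also have "\<dots> \<le> \<theta> / 2" using a(2) by simp
    finally show ?thesis using \<theta> by (simp add: field_simps)
  qed
  {
    assume i: "i \<ge> 1"
    have "\<alpha> i * radius \<le> \<alpha> 1 * radius" "\<alpha>' i * radius \<le> \<alpha>' 1 * radius"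
      using pos_coordinates(3)[OF _ i] neg_coordinates(3)[OF _ i] radius_bounds(1) by (auto intro: mult_right_mono)
    then have r: "\<alpha> i * radius \<le> \<theta> / 4" "\<alpha>' i * radius \<le> \<theta> / 4" using radius_bounds(3,4) by linarith+
    show "Re (1 - of_real (\<alpha> i) * (z - 1) / of_real \<theta>) \<ge> 1/2"
      using pos_coordinates(1)[OF _ i] r(1) nz radius_bounds(1) by (intro key) auto
    show "Re (1 - of_real (\<alpha>' i) * (inverse z - 1) / of_real \<theta>) \<ge> 1/2"
      using neg_coordinates(1)[OF _ i] r(2) inv by (intro key) auto
  }
qed

lemma open_annulus: "open (annulus d)"
  unfolding annulus_def by (intro open_Collect_conj open_Collect_less continuous_intros)

text \<open>Each one-sided factor deviates from 1 by at most a multiple of its coordinates,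
  uniformly on the annulus, and the coordinates are summable.\<close>

lemma Psi_factor_near_one:
  obtains M where "summable M" "\<And>k z. z \<in> annulus radius \<Longrightarrow> norm (Psi_factor \<omega> \<theta> (Suc k) z - 1) \<le> M k"
proof -
  define A where "A = \<alpha> 1 + \<alpha>' 1"
  have ge: "\<alpha> 1 \<ge> 0" "\<alpha>' 1 \<ge> 0" using pos_coordinates(1) neg_coordinates(1) by auto
  then have "A \<ge> 0" by (simp add: A_def)
  from one_sided_factor_near_one[OF \<theta> this] obtain C where C: "C \<ge> 0"
    "\<And>a b e w. 0 \<le> a \<Longrightarrow> a \<le> A \<Longrightarrow> 0 \<le> b \<Longrightarrow> b \<le> 1 \<Longrightarrow> norm w \<le> 3 \<Longrightarrow> Re (1 - of_real a * w / of_real \<theta>) \<ge> 1/2 \<Longrightarrow>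
      norm ((1 + of_real b * w) / (1 - of_real a * w / of_real \<theta>) powr of_real \<theta> - 1) \<le> C * (a + b)"
    by metis
  define e where "e = (\<lambda>k. \<alpha> (Suc k) + \<beta> (Suc k) + (\<alpha>' (Suc k) + \<beta>' (Suc k)))"
  define D where "D = C + C + C * C * (2 * A + 2)"
  show thesis
  proof (rule that[of "\<lambda>k. D * e k"])
    show "summable (\<lambda>k. D * e k)"
      unfolding e_def by (intro summable_mult summable_add[OF pos_coordinates(6) neg_coordinates(6)]) auto
    fix k z assume z: "z \<in> annulus radius"
    have c: "0 \<le> \<alpha> (Suc k)" "0 \<le> \<beta> (Suc k)" "0 \<le> \<alpha>' (Suc k)" "0 \<le> \<beta>' (Suc k)"
      "\<alpha> (Suc k) \<le> A" "\<alpha>' (Suc k) \<le> A" "\<beta> (Suc k) \<le> 1" "\<beta>' (Suc k) \<le> 1"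
      using pos_coordinates(1-4)[of "Suc k"] neg_coordinates(1-4)[of "Suc k"] pos_coordinates(5) neg_coordinates(5) ge by (auto simp: A_def)
    have "norm ((1 + of_real (\<beta> (Suc k)) * (z - 1)) / (1 - of_real (\<alpha> (Suc k)) * (z - 1) / of_real \<theta>) powr of_real \<theta> - 1)
        \<le> C * (\<alpha> (Suc k) + \<beta> (Suc k))"
      using c annulus_radius(2,3)[OF z] annulus_radius(4,5)[OF z, of "Suc k"] by (intro C(2)) auto
    also have "\<dots> \<le> C * e k" using C(1) c by (intro mult_left_mono) (auto simp: e_def)
    finally have 1: "norm ((1 + of_real (\<beta> (Suc k)) * (z - 1)) / (1 - of_real (\<alpha> (Suc k)) * (z - 1) / of_real \<theta>) powr of_real \<theta> - 1)
        \<le> C * e k" .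
    have "norm ((1 + of_real (\<beta>' (Suc k)) * (inverse z - 1)) / (1 - of_real (\<alpha>' (Suc k)) * (inverse z - 1) / of_real \<theta>) powr of_real \<theta> - 1)
        \<le> C * (\<alpha>' (Suc k) + \<beta>' (Suc k))"
      using c annulus_radius(2,3)[OF z] annulus_radius(4,5)[OF z, of "Suc k"] by (intro C(2)) auto
    also have "\<dots> \<le> C * e k" using C(1) c by (intro mult_left_mono) (auto simp: e_def)
    finally have 2: "norm ((1 + of_real (\<beta>' (Suc k)) * (inverse z - 1)) / (1 - of_real (\<alpha>' (Suc k)) * (inverse z - 1) / of_real \<theta>) powr of_real \<theta> - 1)
        \<le> C * e k" .
    show "norm (Psi_factor \<omega> \<theta> (Suc k) z - 1) \<le> D * e k"
      unfolding Psi_factor_def D_def by (rule mult_near_one[OF 1 2]) (use c C(1) in \<open>auto simp: e_def\<close>)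
  qed
qed

lemma Psi_product_convergent:
  assumes "z \<in> annulus radius"
  shows "convergent_prod (\<lambda>k. Psi_factor \<omega> \<theta> (Suc k) z)"
proof -
  obtain M where M: "summable M" "\<And>k z. z \<in> annulus radius \<Longrightarrow> norm (Psi_factor \<omega> \<theta> (Suc k) z - 1) \<le> M k"
    using Psi_factor_near_one by blast
  have "summable (\<lambda>k. norm (Psi_factor \<omega> \<theta> (Suc k) z - 1))"
    by (rule summable_comparison_test'[OF M(1)]) (use M(2)[OF assms] in simp)
  then show ?thesis by (intro abs_convergent_prod_imp_convergent_prod) (simp add: abs_convergent_prod_conv_summable)
qed

lemma Psi_factor_holomorphic: "Psi_factor \<omega> \<theta> (Suc k) holomorphic_on annulus radius"
proof -
  have nr: "s \<notin> \<real>\<^sub>\<le>\<^sub>0" "s \<noteq> 0" if "Re s \<ge> 1/2" for s :: complex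
    using that by (auto simp: complex_nonpos_Reals_iff)
  have S: "1 - of_real (\<alpha> (Suc k)) * (z - 1) / of_real \<theta> \<notin> \<real>\<^sub>\<le>\<^sub>0"
    "(1 - of_real (\<alpha> (Suc k)) * (z - 1) / of_real \<theta>) powr of_real \<theta> \<noteq> 0"
    "1 - of_real (\<alpha>' (Suc k)) * (inverse z - 1) / of_real \<theta> \<notin> \<real>\<^sub>\<le>\<^sub>0"
    "(1 - of_real (\<alpha>' (Suc k)) * (inverse z - 1) / of_real \<theta>) powr of_real \<theta> \<noteq> 0"
    if z: "z \<in> annulus radius" for z
    using nr[OF annulus_radius(4)[OF z, of "Suc k"]] nr[OF annulus_radius(5)[OF z, of "Suc k"]]
    by (simp_all only: powr_eq_0_iff de_Morgan_conj not_False_eq_True True_implies_equals le_add1 Suc_eq_plus1_left)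
  show ?thesis
    unfolding Psi_factor_def by (intro holomorphic_intros S annulus_radius(1)) (use \<theta> in simp_all)
qed

text \<open>The summable majorant makes the partial products converge uniformly on small discs, and
  the limit inherits holomorphy.\<close>

lemma Psi_holomorphic: "Psi \<omega> \<theta> holomorphic_on annulus radius"
proof -
  obtain M where M: "summable M" "\<And>k z. z \<in> annulus radius \<Longrightarrow> norm (Psi_factor \<omega> \<theta> (Suc k) z - 1) \<le> M k"
    using Psi_factor_near_one by blast
  have "(\<lambda>z. \<Prod>k. Psi_factor \<omega> \<theta> (Suc k) z) holomorphic_on annulus radius"
  proof (rule holomorphic_uniform_sequence[OF open_annulus])
    show "(\<lambda>z. \<Prod>k<n. Psi_factor \<omega> \<theta> (Suc k) z) holomorphic_on annulus radius" for n
      by (intro holomorphic_on_prod Psi_factor_holomorphic)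
    fix x assume "x \<in> annulus radius"
    then obtain d where d: "d > 0" "cball x d \<subseteq> annulus radius" using open_annulus open_contains_cball by blast
    have "uniformly_convergent_on (cball x d) (\<lambda>n z. \<Prod>k<n. Psi_factor \<omega> \<theta> (Suc k) z)"
    proof (rule uniformly_convergent_on_prod')
      show "continuous_on (cball x d) (Psi_factor \<omega> \<theta> (Suc n))" for n
        using holomorphic_on_imp_continuous_on[OF Psi_factor_holomorphic] d(2) by (rule continuous_on_subset)
      show "uniformly_convergent_on (cball x d) (\<lambda>N z. \<Sum>n<N. norm (Psi_factor \<omega> \<theta> (Suc n) z - 1))"
        using M d(2) by (intro Weierstrass_m_test'[of _ _ M]) auto
    qed simp
    then obtain l where l: "uniform_limit (cball x d) (\<lambda>n z. \<Prod>k<n. Psi_factor \<omega> \<theta> (Suc k) z) l sequentially"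
      by (auto simp: uniformly_convergent_on_def)
    have "l z = (\<Prod>k. Psi_factor \<omega> \<theta> (Suc k) z)" if z: "z \<in> cball x d" for z
    proof (rule LIMSEQ_unique)
      show "(\<lambda>n. \<Prod>k<Suc n. Psi_factor \<omega> \<theta> (Suc k) z) \<longlonglongrightarrow> l z"
        using tendsto_uniform_limitI[OF l z] by (rule LIMSEQ_Suc)
      show "(\<lambda>n. \<Prod>k<Suc n. Psi_factor \<omega> \<theta> (Suc k) z) \<longlonglongrightarrow> (\<Prod>k. Psi_factor \<omega> \<theta> (Suc k) z)"
        using convergent_prod_LIMSEQ[OF Psi_product_convergent] z d(2) by (auto simp: lessThan_Suc_atMost)
    qed
    then have "uniform_limit (cball x d) (\<lambda>n z. \<Prod>k<n. Psi_factor \<omega> \<theta> (Suc k) z) (\<lambda>z. \<Prod>k. Psi_factor \<omega> \<theta> (Suc k) z) sequentially"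
      using l by (subst (asm) uniform_limit_cong'[of _ _ "\<lambda>n z. \<Prod>k<n. Psi_factor \<omega> \<theta> (Suc k) z"]) auto
    then show "\<exists>d>0. cball x d \<subseteq> annulus radius \<and>
        uniform_limit (cball x d) (\<lambda>n z. \<Prod>k<n. Psi_factor \<omega> \<theta> (Suc k) z) (\<lambda>z. \<Prod>k. Psi_factor \<omega> \<theta> (Suc k) z) sequentially"
      using d by blast
  qed
  then show ?thesis
    unfolding Psi_def using annulus_radius(1) by (intro holomorphic_intros) auto
qed

text \<open>At x = 1 + \<theta> / v the arguments x - 1 and 1 / x - 1 equal \<theta> / y for y = v
  and y = - (v + \<theta>). The bases of the powers are then positive reals, so principal powers are
  exponentials of the logarithms occurring in the box limits.\<close>

lemma Psi_real:
  assumes x: "1 < x" "x < 1 + radius"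
  defines "v \<equiv> \<theta> / (x - 1)"
  shows "\<alpha> 1 + 1 < v" "Psi \<omega> \<theta> (of_real x) = of_real (transform_limit v)"
proof -
  have ge: "\<alpha> 1 \<ge> 0" "\<alpha>' 1 \<ge> 0" using pos_coordinates(1) neg_coordinates(1) by auto
  have "(x - 1) * (\<alpha> 1 + 1) \<le> radius * (\<alpha> 1 + 1)" using x ge by (intro mult_right_mono) auto
  then show v1: "\<alpha> 1 + 1 < v" using radius_bounds(5) \<theta> x by (simp add: v_def less_divide_eq mult.commute)
  have v0: "v > 0" using v1 ge by simp
  have xv: "x - 1 = \<theta> / v" "inverse x - 1 = \<theta> / (- (v + \<theta>))"
    using x \<theta> v0 by (auto simp: v_def field_simps)
  have y: "\<alpha> 1 < v \<or> v < - (\<theta> + \<alpha>' 1)" using v1 by simp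
  define t where "t = (\<lambda>k. ln (1 + \<theta> * \<beta> (Suc k) / v) - \<theta> * ln (1 - \<alpha> (Suc k) / v))"
  define t' where "t' = (\<lambda>k. ln (1 + \<theta> * \<beta>' (Suc k) / (- (v + \<theta>))) - \<theta> * ln (1 - \<alpha>' (Suc k) / (- (v + \<theta>))))"
  note B = vk_box_prod_limit[OF vk_parts(1) parts_GT(1) \<theta> scaled_index_limit transform_regime(1)[OF y]]
  note B' = vk_box_prod_limit[OF vk_parts(2) parts_GT(2) \<theta> scaled_index_limit transform_regime(2)[OF y]]
  have sum: "summable t" "summable t'" using B(2) B'(2) by (auto simp: t_def t'_def)
  have one: "(1 + of_real b * of_real w) / (1 - of_real a * of_real w / of_real \<theta>) powr of_real \<theta>
      = complex_of_real (exp (ln (1 + \<theta> * b / y) - \<theta> * ln (1 - a / y)))"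
    if "w = \<theta> / y" "1 + \<theta> * b / y > 0" "1 - a / y > 0" for a b w y
  proof -
    have e: "1 + complex_of_real b * of_real w = of_real (1 + \<theta> * b / y)"
      "1 - complex_of_real a * of_real w / of_real \<theta> = of_real (1 - a / y)"
      using \<theta> by (simp_all add: that(1))
    have "exp (ln (1 + \<theta> * b / y) - \<theta> * ln (1 - a / y)) = (1 + \<theta> * b / y) / (1 - a / y) powr \<theta>"
    proof -
      have "exp (ln A - \<theta> * ln B) = A / B powr \<theta>" if "A > 0" "B > 0" for A B :: real
        using that by (simp add: exp_diff powr_def)
      then show ?thesis using that(2,3) by blast
    qed
    then show ?thesis unfolding e powr_of_real[OF less_imp_le[OF that(3)]] by (simp only: of_real_divide)
  qed
  have fac: "Psi_factor \<omega> \<theta> (Suc k) (of_real x) = of_real (exp (t k + t' k))" for k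
  proof -
    have w: "complex_of_real x - 1 = of_real (x - 1)" "inverse (complex_of_real x) - 1 = of_real (inverse x - 1)" by simp_all
    have "1 + \<theta> * \<beta> (Suc k) / v > 0" "1 - \<alpha> (Suc k) / v > 0"
      "1 + \<theta> * \<beta>' (Suc k) / (- (v + \<theta>)) > 0" "1 - \<alpha>' (Suc k) / (- (v + \<theta>)) > 0"
      by (rule B(3) B(4) B'(3) B'(4); simp)+
    then show ?thesis
      unfolding Psi_factor_def w t_def t'_def by (simp only: one[OF xv(1)] one[OF xv(2)] exp_add of_real_mult)
  qed
  have xa: "complex_of_real x \<in> annulus radius" using x by (simp add: annulus_def)
  have "(\<Prod>k. Psi_factor \<omega> \<theta> (Suc k) (of_real x)) = of_real (exp (suminf t + suminf t'))"
  proof (rule LIMSEQ_unique)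
    show "(\<lambda>n. \<Prod>k\<le>n. Psi_factor \<omega> \<theta> (Suc k) (of_real x)) \<longlonglongrightarrow> (\<Prod>k. Psi_factor \<omega> \<theta> (Suc k) (of_real x))"
      by (rule convergent_prod_LIMSEQ[OF Psi_product_convergent[OF xa]])
    have "(\<lambda>n. \<Sum>k\<le>n. t k + t' k) \<longlonglongrightarrow> suminf t + suminf t'"
      using sums_add[OF summable_sums[OF sum(1)] summable_sums[OF sum(2)]] by (simp add: sums_def_le)
    then have "(\<lambda>n. complex_of_real (exp (\<Sum>k\<le>n. t k + t' k))) \<longlonglongrightarrow> of_real (exp (suminf t + suminf t'))"
      by (intro tendsto_of_real tendsto_exp)
    then show "(\<lambda>n. \<Prod>k\<le>n. Psi_factor \<omega> \<theta> (Suc k) (of_real x)) \<longlonglongrightarrow> of_real (exp (suminf t + suminf t'))"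
      by (simp add: fac exp_sum)
  qed
  moreover have "exp (of_real (gamma_pos \<omega>) * (of_real x - 1) + of_real (gamma_neg \<omega>) * (inverse (of_real x) - 1))
      = complex_of_real (exp (\<theta> / v * gamma_pos \<omega> + \<theta> / (- (v + \<theta>)) * gamma_neg \<omega>))"
  proof -
    have "of_real (gamma_pos \<omega>) * (of_real x - 1) + of_real (gamma_neg \<omega>) * (inverse (of_real x) - 1)
        = complex_of_real ((x - 1) * gamma_pos \<omega> + (inverse x - 1) * gamma_neg \<omega>)" by (simp add: mult.commute)
    then show ?thesis unfolding xv by (simp only: exp_of_real)
  qed
  ultimately show "Psi \<omega> \<theta> (of_real x) = of_real (transform_limit v)"
    by (simp add: Psi_def transform_limit_def log_sum_def t_def t'_def exp_add mult_ac)
qed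

end

section \<open>Convergence of characters\<close>

text \<open>At each n a point violating the bound is chosen if there is one. Uniformity in all
  variables thus reduces to convergence along arbitrary sequences of points.\<close>

lemma uniform_limit_sequenceI:
  fixes f :: "nat \<Rightarrow> 'a \<Rightarrow> 'b::metric_space"
  assumes "\<And>zs. (\<And>n. zs n \<in> S) \<Longrightarrow> (\<lambda>n. dist (f n (zs n)) (g (zs n))) \<longlonglongrightarrow> 0"
  shows "uniform_limit S f g sequentially"
proof (rule uniform_limitI)
  fix e :: real assume e: "e > 0"
  show "\<forall>\<^sub>F n in sequentially. \<forall>x\<in>S. dist (f n x) (g x) < e"
  proof (cases "S = {}")
    case False
    have "\<exists>z\<in>S. (\<exists>y\<in>S. dist (f n y) (g y) \<ge> e) \<longrightarrow> dist (f n z) (g z) \<ge> e" for n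
      using False by blast
    then obtain zs where zs: "\<And>n. zs n \<in> S" "\<And>n y. y \<in> S \<Longrightarrow> dist (f n y) (g y) \<ge> e \<Longrightarrow> dist (f n (zs n)) (g (zs n)) \<ge> e"
      by metis
    have "\<forall>\<^sub>F n in sequentially. dist (f n (zs n)) (g (zs n)) < e"
      using assms[OF zs(1)] e by (rule order_tendstoD)
    then show ?thesis
      by eventually_elim (meson zs(2) not_le)
  qed simp
qed

text \<open>If the convergence fails, Montel's theorem extracts from the violating indices a locally
  uniform limit. It vanishes on U, hence everywhere by the identity theorem, contradicting the
  violation on K.\<close>

lemma vitali_null:
  fixes F :: "nat \<Rightarrow> complex \<Rightarrow> complex"
  assumes S: "open S" "connected S"
    and F: "\<forall>\<^sub>F n in sequentially. F n holomorphic_on S \<and> (\<forall>z\<in>S. norm (F n z) \<le> B)"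
    and U: "U \<subseteq> S" "\<xi> \<in> S" "\<xi> islimpt U" "\<And>z. z \<in> U \<Longrightarrow> (\<lambda>n. F n z) \<longlonglongrightarrow> 0"
    and K: "compact K" "K \<subseteq> S"
  shows "uniform_limit K F (\<lambda>_. 0) sequentially"
proof (rule ccontr)
  assume "\<not> ?thesis"
  then obtain e where e: "e > 0" "\<not> (\<forall>\<^sub>F n in sequentially. \<forall>z\<in>K. norm (F n z) < e)"
    by (auto simp: uniform_limit_iff)
  obtain n0 where n0: "\<And>n. n \<ge> n0 \<Longrightarrow> F n holomorphic_on S \<and> (\<forall>z\<in>S. norm (F n z) \<le> B)"
    using F by (auto simp: eventually_sequentially)
  have "infinite {n. n0 \<le> n \<and> \<not> (\<forall>z\<in>K. norm (F n z) < e)}"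
    unfolding infinite_nat_iff_unbounded_le
  proof
    fix k
    from e(2) obtain n where "n \<ge> max n0 k" "\<not> (\<forall>z\<in>K. norm (F n z) < e)"
      unfolding eventually_sequentially by blast
    then show "\<exists>n\<ge>k. n \<in> {n. n0 \<le> n \<and> \<not> (\<forall>z\<in>K. norm (F n z) < e)}" by auto
  qed
  then obtain s :: "nat \<Rightarrow> nat" where s: "strict_mono s" "\<And>n. s n \<in> {n. n0 \<le> n \<and> \<not> (\<forall>z\<in>K. norm (F n z) < e)}"
    using infinite_enumerate by blast
  define H where "H = range (\<lambda>n. F (s n))"
  obtain g r where g: "g holomorphic_on S" "strict_mono (r :: nat \<Rightarrow> nat)"
    "\<And>x. x \<in> S \<Longrightarrow> ((\<lambda>n. F (s (r n)) x) \<longlongrightarrow> g x) sequentially"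
    "\<And>K. compact K \<Longrightarrow> K \<subseteq> S \<Longrightarrow> uniform_limit K ((\<lambda>n. F (s n)) \<circ> r) g sequentially"
  proof (rule Montel[OF S(1), of H "\<lambda>n. F (s n)"])
    show "h holomorphic_on S" if "h \<in> H" for h using that n0 s(2) by (auto simp: H_def)
    show "\<exists>B. \<forall>h\<in>H. \<forall>z\<in>K. norm (h z) \<le> B" if "compact K" "K \<subseteq> S" for K
      using that n0 s(2) by (intro exI[of _ B]) (auto simp: H_def)
  qed (auto simp: H_def)
  have "g z = 0" if z: "z \<in> U" for z
  proof (rule LIMSEQ_unique)
    show "(\<lambda>n. F (s (r n)) z) \<longlonglongrightarrow> g z" using g(3) z U(1) by blast
    show "(\<lambda>n. F (s (r n)) z) \<longlonglongrightarrow> 0"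
      using LIMSEQ_subseq_LIMSEQ[OF U(4)[OF z] strict_mono_o[OF s(1) g(2)]] by (simp add: o_def)
  qed
  then have g0: "g w = 0" if "w \<in> S" for w
    using analytic_continuation[OF g(1) S U(1-3) _ that] by blast
  have "\<forall>\<^sub>F n in sequentially. \<forall>z\<in>K. norm (F (s (r n)) z) < e"
    using uniform_limitD[OF g(4)[OF K] e(1)]
  proof eventually_elim
    case (elim n)
    show ?case
    proof
      fix z assume z: "z \<in> K"
      then have "g z = 0" using g0 K(2) by blast
      then show "norm (F (s (r n)) z) < e" using elim z by (auto simp: dist_norm)
    qed
  qed
  then obtain n where "\<forall>z\<in>K. norm (F (s (r n)) z) < e" by (auto simp: eventually_sequentially)
  then show False using s(2)[of "r n"] by blast
qed

lemma connected_open_annulus: "connected (annulus d)"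
proof (cases "d > 1")
  case True
  then have "annulus d = ball 0 (1 + d)" by (auto simp: annulus_def intro: less_le_trans[of _ 0])
  then show ?thesis by simp
next
  case False
  have "connected {x :: complex. 1 - d < norm (x - 0) \<and> norm (x - 0) < 1 + d}"
    by (rule connected_annulus) simp
  then show ?thesis by (simp add: annulus_def)
qed

lemma norm_powi_le:
  fixes z :: "'a::real_normed_field"
  assumes \<rho>: "\<rho> > 1" and z: "norm z \<le> \<rho>" "1 / \<rho> \<le> norm z"
  shows "norm (z powi k) \<le> \<rho> ^ nat \<bar>k\<bar>"
proof (cases "k \<ge> 0")
  case True
  then show ?thesis using power_mono[OF z(1), of "nat k"] by (simp add: power_int_def norm_power)
next
  case False
  have zp: "norm z > 0" using z(2) \<rho> by (smt (verit) divide_pos_pos)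
  then have "inverse (norm z) \<le> \<rho>" using z(2) \<rho> by (simp add: field_simps)
  then have "inverse (norm z) ^ nat (- k) \<le> \<rho> ^ nat (- k)" using zp by (intro power_mono) auto
  then show ?thesis using False by (simp add: power_int_def norm_power norm_inverse)
qed

lemma depends_ge_incr_prod:
  fixes \<phi> :: "nat \<Rightarrow> int \<Rightarrow> 'a::comm_monoid_mult"
  assumes "j \<le> N"
  shows "depends_ge (N - j) (\<lambda>p. \<Prod>i\<in>{1..j}. \<phi> i (incr p (Suc N - i)))"
  unfolding depends_ge_def
proof (intro allI impI prod.cong refl)
  fix p q :: "nat \<Rightarrow> int list" and i
  assume pq: "\<forall>k\<ge>N - j. p k = q k" and i: "i \<in> {1..j}"
  have "p (Suc N - i) = q (Suc N - i)" "p (Suc N - i - 1) = q (Suc N - i - 1)" using pq i assms by auto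
  then show "\<phi> i (incr p (Suc N - i)) = \<phi> i (incr q (Suc N - i))" by (simp add: incr_def)
qed

lemma depends_ge_map: "depends_ge M h \<Longrightarrow> depends_ge M (\<lambda>p. f (h p))"
  unfolding depends_ge_def by metis

lemma depends_le_incr: "depends_le M (\<lambda>p. f (incr p M))"
proof -
  have "incr p M = incr q M" if "\<forall>k\<le>M. p k = q k" for p q using that by (simp add: incr_def)
  then show ?thesis unfolding depends_le_def by metis
qed

section \<open>Control of large increments by exponential moments\<close>

locale vk_moment = vk_setting +
  fixes m :: nat and \<rho> C :: real
  assumes m: "m \<ge> 1" and \<rho>: "\<rho> > 1" and C: "C \<ge> 1"
    and moment: "\<forall>\<^sub>F N in sequentially. \<forall>i\<in>{1..N}. expect \<theta> N (lam N) (\<lambda>p. (\<rho> ^ (2 * m)) ^ nat \<bar>incr p i\<bar>) \<le> C"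
begin

text \<open>Dominates on a suitable annulus every monomial whose exponents are the top j
  increments.\<close>

definition envelope :: "nat \<Rightarrow> nat \<Rightarrow> (nat \<Rightarrow> int list) \<Rightarrow> real" where
  "envelope j N p = (\<Prod>i\<in>{1..j}. \<rho> ^ nat \<bar>incr p (Suc N - i)\<bar>)"

lemma envelope_Suc: "envelope (Suc j) N p = envelope j N p * \<rho> ^ nat \<bar>incr p (N - j)\<bar>"
  unfolding envelope_def by (simp add: prod.nat_ivl_Suc')

lemma envelope_ge_1: "envelope j N p \<ge> 1"
  unfolding envelope_def using \<rho> by (intro prod_ge_1) simp

lemma envelope_mono: "j \<le> k \<Longrightarrow> envelope j N p \<le> envelope k N p"
proof (induction k rule: dec_induct)
  case (step n)
  have "envelope n N p * 1 \<le> envelope n N p * \<rho> ^ nat \<bar>incr p (N - n)\<bar>"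
    using envelope_ge_1[of n N p] \<rho> by (intro mult_left_mono) auto
  then show ?case using step by (simp add: envelope_Suc)
qed simp

lemma envelope_square: "envelope j N p \<le> (envelope j N p)\<^sup>2"
  using envelope_ge_1[of j N p] by (simp add: power2_eq_square)

lemma incr_le_envelope:
  assumes "i \<in> {1..m}"
  shows "\<rho> ^ nat \<bar>incr p (Suc N - i)\<bar> \<le> envelope m N p"
proof -
  obtain j where j: "i = Suc j" "Suc j \<le> m" using assms by (cases i) auto
  have "1 * \<rho> ^ nat \<bar>incr p (N - j)\<bar> \<le> envelope j N p * \<rho> ^ nat \<bar>incr p (N - j)\<bar>"
    using envelope_ge_1 \<rho> by (intro mult_right_mono) auto
  then show ?thesis using envelope_mono[OF j(2), of N p] j(1) by (simp add: envelope_Suc)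
qed

text \<open>This explains the exponent 2 m in the moment hypothesis: 2 for the square, and m because
  a product of m nonnegative numbers is at most the m-th power of their sum.\<close>

lemma expect_envelope_square:
  "\<forall>\<^sub>F N in sequentially. expect \<theta> N (lam N) (\<lambda>p. (envelope m N p)\<^sup>2) \<le> real m * C"
  using moment eventually_ge_at_top[of m]
proof eventually_elim
  case (elim N)
  have L: "lam N \<in> GT N" using lam elim(2) m by simp
  have "(envelope m N p)\<^sup>2 \<le> (\<Sum>i\<in>{1..m}. (\<rho> ^ (2 * m)) ^ nat \<bar>incr p (Suc N - i)\<bar>)" (is "_ \<le> ?S") for p
  proof -
    have S0: "?S \<ge> 0" using \<rho> by (intro sum_nonneg) auto
    have "((envelope m N p)\<^sup>2) ^ m = (\<Prod>i\<in>{1..m}. (\<rho> ^ (2 * m)) ^ nat \<bar>incr p (Suc N - i)\<bar>)"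
      unfolding envelope_def prod_power_distrib power_mult[symmetric] by (simp add: mult_ac)
    also have "\<dots> \<le> (\<Prod>i\<in>{1..m}. ?S)"
    proof (rule prod_mono)
      fix i assume i: "i \<in> {1..m}"
      show "0 \<le> (\<rho> ^ (2 * m)) ^ nat \<bar>incr p (Suc N - i)\<bar> \<and> (\<rho> ^ (2 * m)) ^ nat \<bar>incr p (Suc N - i)\<bar> \<le> ?S"
        using \<rho> by (intro conjI member_le_sum[OF i]) auto
    qed
    finally have "((envelope m N p)\<^sup>2) ^ m \<le> ?S ^ m" by simp
    then show ?thesis using power_mono_iff[of "(envelope m N p)\<^sup>2" ?S m] S0 m by simp
  qed
  then have "expect \<theta> N (lam N) (\<lambda>p. (envelope m N p)\<^sup>2)
      \<le> expect \<theta> N (lam N) (\<lambda>p. \<Sum>i\<in>{1..m}. (\<rho> ^ (2 * m)) ^ nat \<bar>incr p (Suc N - i)\<bar>)"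
    by (intro expect_mono L \<theta>)
  also have "\<dots> = (\<Sum>i\<in>{1..m}. expect \<theta> N (lam N) (\<lambda>p. (\<rho> ^ (2 * m)) ^ nat \<bar>incr p (Suc N - i)\<bar>))"
    by (rule expect_sum) simp
  also have "\<dots> \<le> (\<Sum>i\<in>{1..m}. C)"
  proof (rule sum_mono)
    fix i assume "i \<in> {1..m}"
    then have "Suc N - i \<in> {1..N}" using elim(2) by auto
    then show "expect \<theta> N (lam N) (\<lambda>p. (\<rho> ^ (2 * m)) ^ nat \<bar>incr p (Suc N - i)\<bar>) \<le> C" using elim(1) by blast
  qed
  finally show ?case by simp
qed

text \<open>The square of the envelope has bounded expectation, so large increments can be cut off.\<close>

lemma dominated_expect:
  assumes D: "D \<ge> 0"
    and bound: "\<forall>\<^sub>F N in sequentially. \<forall>p\<in>chains N (lam N). 0 \<le> F N p \<and> F N p \<le> D * envelope m N p"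
    and small: "\<And>K e. e > 0 \<Longrightarrow> \<forall>\<^sub>F N in sequentially. \<forall>p\<in>chains N (lam N).
      (\<forall>i\<in>{1..m}. nat \<bar>incr p (Suc N - i)\<bar> \<le> K) \<longrightarrow> F N p \<le> e"
  shows "(\<lambda>N. expect \<theta> N (lam N) (F N)) \<longlonglongrightarrow> 0"
proof (rule LIMSEQ_I)
  fix e :: real assume e: "e > 0"
  have "(\<lambda>K. inverse (\<rho> ^ K)) \<longlonglongrightarrow> 0" using \<rho> by (intro LIMSEQ_inverse_realpow_zero)
  then have "(\<lambda>K. D * (real m * C) * inverse (\<rho> ^ K)) \<longlonglongrightarrow> D * (real m * C) * 0" by (intro tendsto_intros)
  then have "\<forall>\<^sub>F K in sequentially. D * (real m * C) * inverse (\<rho> ^ K) < e / 2"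
    using e by (intro order_tendstoD) auto
  then obtain K where K: "D * (real m * C) * inverse (\<rho> ^ K) < e / 2" by (auto simp: eventually_sequentially)
  have "\<forall>\<^sub>F N in sequentially. norm (expect \<theta> N (lam N) (F N) - 0) < e"
    using bound small[OF half_gt_zero[OF e], of K] expect_envelope_square eventually_ge_at_top[of 1]
  proof eventually_elim
    case (elim N)
    have L: "lam N \<in> GT N" using lam elim by simp
    have "F N p \<le> e / 2 + D * inverse (\<rho> ^ K) * (envelope m N p)\<^sup>2" if p: "p \<in> chains N (lam N)" for p
    proof (cases "\<forall>i\<in>{1..m}. nat \<bar>incr p (Suc N - i)\<bar> \<le> K")
      case True
      then have "F N p \<le> e / 2" using elim(2) p e by auto
      moreover have "0 \<le> D * inverse (\<rho> ^ K) * (envelope m N p)\<^sup>2" using D \<rho> by simp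
      ultimately show ?thesis by linarith
    next
      case False
      \<comment> \<open>Some increment reaches K, so the envelope is at least \<rho>^K, and one
        power of it can be traded for the factor \<rho>^(-K).\<close>
      then obtain i where i: "i \<in> {1..m}" "K \<le> nat \<bar>incr p (Suc N - i)\<bar>" by force
      have "\<rho> ^ K \<le> \<rho> ^ nat \<bar>incr p (Suc N - i)\<bar>" using i(2) \<rho> by (intro power_increasing) auto
      also have "\<dots> \<le> envelope m N p" by (rule incr_le_envelope[OF i(1)])
      finally have "1 \<le> inverse (\<rho> ^ K) * envelope m N p" using \<rho> by (simp add: field_simps)
      then have "envelope m N p * 1 \<le> envelope m N p * (inverse (\<rho> ^ K) * envelope m N p)"
        using envelope_ge_1[of m N p] by (intro mult_left_mono) auto
      then have "D * envelope m N p \<le> D * (inverse (\<rho> ^ K) * (envelope m N p)\<^sup>2)"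
        using D by (intro mult_left_mono) (auto simp: power2_eq_square mult_ac)
      moreover have "F N p \<le> D * envelope m N p" using elim(1) p by blast
      ultimately show ?thesis using e by (simp add: mult.assoc)
    qed
    then have "expect \<theta> N (lam N) (F N) \<le> expect \<theta> N (lam N) (\<lambda>p. e / 2 + D * inverse (\<rho> ^ K) * (envelope m N p)\<^sup>2)"
      by (intro expect_mono L \<theta>)
    also have "\<dots> = e / 2 + D * inverse (\<rho> ^ K) * expect \<theta> N (lam N) (\<lambda>p. (envelope m N p)\<^sup>2)"
      by (simp only: expect_add expect_cmult expect_const[OF L \<theta>])
    also have "\<dots> \<le> e / 2 + D * inverse (\<rho> ^ K) * (real m * C)"
      using elim(3) D \<rho> by (intro add_left_mono mult_left_mono) auto
    also have "\<dots> < e" using K by (simp add: mult_ac)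
    finally have "expect \<theta> N (lam N) (F N) < e" .
    moreover have "expect \<theta> N (lam N) (F N) \<ge> 0" using elim(1) by (intro expect_nonneg L \<theta>) auto
    ultimately show ?case by simp
  qed
  then show "\<exists>no. \<forall>n\<ge>no. norm (expect \<theta> n (lam n) (F n) - 0) < e" by (simp add: eventually_sequentially)
qed

text \<open>With L a bound for the entries, the growth factor of the weight is at most 1 + \<theta>
  N / (u - L). The term \<theta> / (\<rho> - 1) in the lower bound for v is what makes this at most
  \<rho>.\<close>

lemma weight_bounds:
  assumes u: "\<And>N. generic \<theta> (u N)" "\<And>N. v * real N - 1 < u N" and v: "v \<ge> \<alpha> 1 + 1 + \<theta> / (\<rho> - 1)"
  shows "\<forall>\<^sub>F N in sequentially. of_int (entry (lam N) 1) < u N \<and> 0 < u N \<and>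
    (\<forall>n\<le>N. \<forall>k\<le>entry (lam N) 1. 0 \<le> rel_weight \<theta> n (u N) k \<and> rel_weight \<theta> n (u N) k \<le> \<rho> ^ nat \<bar>k\<bar>)"
  using extreme_rows(1) eventually_ge_at_top[of 2]
proof eventually_elim
  case (elim N)
  define L where "L = (\<alpha> 1 + 1/2) * real N"
  have ge: "\<alpha> 1 \<ge> 0" using pos_coordinates(1) by auto
  have L0: "L \<ge> 0" using ge by (simp add: L_def)
  have "(\<alpha> 1 + 1 + \<theta> / (\<rho> - 1)) * real N \<le> v * real N" using v by (intro mult_right_mono) auto
  moreover have "1 \<le> 1/2 * real N" using elim(2) by simp
  ultimately have uL: "\<theta> / (\<rho> - 1) * real N < u N - L"
    using u(2)[of N] unfolding L_def distrib_right by linarith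
  have "0 \<le> \<theta> / (\<rho> - 1) * real N" using \<theta> \<rho> by simp
  then have Lu: "L < u N" using uL by linarith
  have upos: "u N > 0" using Lu L0 by linarith
  have "0 \<le> rel_weight \<theta> n (u N) k \<and> rel_weight \<theta> n (u N) k \<le> \<rho> ^ nat \<bar>k\<bar>" if n: "n \<le> N" and k: "k \<le> entry (lam N) 1" for n k
  proof -
    have kL: "real_of_int k \<le> L" using k elim(1) unfolding L_def by linarith
    have "rel_weight \<theta> n (u N) k > 0" using kL Lu upos \<theta> by (intro rel_weight_pos) auto
    moreover have "rel_weight \<theta> n (u N) k \<le> \<rho> ^ nat \<bar>k\<bar>"
    proof (cases "k \<ge> 0")
      case True
      have "\<theta> * real N < (\<rho> - 1) * (u N - L)" using uL \<rho> by (simp add: divide_less_eq mult.commute)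
      moreover have "\<theta> * real n \<le> \<theta> * real N" using n \<theta> by simp
      ultimately have "\<theta> * real n / (u N - L) \<le> \<rho> - 1" using Lu by (simp add: divide_le_eq)
      then have "(1 + \<theta> * real n / (u N - L)) ^ nat k \<le> \<rho> ^ nat k" using Lu \<theta> by (intro power_mono) auto
      moreover have "rel_weight \<theta> n (u N) (int (nat k)) \<le> (1 + \<theta> * real n / (u N - L)) ^ nat k"
        using True kL Lu by (intro rel_weight_le u \<theta>) auto
      ultimately show ?thesis using True by simp
    next
      case False
      have "rel_weight \<theta> n (u N) (- int (nat (- k))) \<le> 1" by (rule rel_weight_neg_le_one[OF u(1) \<theta> upos])
      moreover have "1 \<le> \<rho> ^ nat \<bar>k\<bar>" using \<rho> by simp
      ultimately show ?thesis using False by simp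
    qed
    ultimately show ?thesis by simp
  qed
  moreover have "of_int (entry (lam N) 1) < u N" using elim(1) Lu unfolding L_def by linarith
  ultimately show ?case using upos by blast
qed

lemma envelope_small:
  assumes "\<forall>i\<in>{1..m}. nat \<bar>incr p (Suc N - i)\<bar> \<le> K" "j \<le> m"
  shows "envelope j N p \<le> (\<rho> ^ K) ^ j"
proof -
  have "envelope j N p \<le> (\<Prod>i\<in>{1..j}. \<rho> ^ K)"
    unfolding envelope_def
  proof (rule prod_mono)
    fix i assume "i \<in> {1..j}"
    then have "nat \<bar>incr p (Suc N - i)\<bar> \<le> K" using assms by auto
    then show "0 \<le> \<rho> ^ nat \<bar>incr p (Suc N - i)\<bar> \<and> \<rho> ^ nat \<bar>incr p (Suc N - i)\<bar> \<le> \<rho> ^ K"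
      using \<rho> by (auto intro: power_increasing)
  qed
  then show ?thesis by simp
qed

text \<open>Weights with n N variables converge pointwise, hence uniformly for increments bounded by
  K, and the envelope with one more increment dominates the rest. It is applied with n N equal to N
  and to N - j.\<close>

lemma weight_error:
  assumes u: "\<And>N. generic \<theta> (u N)" "\<And>N. v * real N - 1 < u N" "(\<lambda>N. u N / real N) \<longlonglongrightarrow> v"
    and v: "v \<ge> \<alpha> 1 + 1 + \<theta> / (\<rho> - 1)" and j: "j < m"
    and n: "\<And>N. n N \<le> N" "(\<lambda>N. real (n N) / real N) \<longlonglongrightarrow> 1"
  shows "(\<lambda>N. expect \<theta> N (lam N) (\<lambda>p. envelope j N p *
      \<bar>(1 + \<theta> / v) powi incr p (N - j) - rel_weight \<theta> (n N) (u N) (incr p (N - j))\<bar>)) \<longlonglongrightarrow> 0"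
proof (rule dominated_expect[of 1])
  have ge: "\<alpha> 1 \<ge> 0" using pos_coordinates(1) by auto
  have q0: "\<theta> / (\<rho> - 1) > 0" using \<theta> \<rho> by simp
  then have vpos: "v > 0" "\<theta> / (\<rho> - 1) \<le> v" using v ge by linarith+
  then have "\<theta> / v \<le> \<rho> - 1" using \<rho> \<theta> by (simp add: divide_le_eq mult.commute)
  then have x: "1 \<le> 1 + \<theta> / v" "1 + \<theta> / v \<le> \<rho>" using vpos \<theta> by auto
  have powi: "0 \<le> (1 + \<theta> / v) powi k" "(1 + \<theta> / v) powi k \<le> \<rho> ^ nat \<bar>k\<bar>" for k
  proof -
    show "0 \<le> (1 + \<theta> / v) powi k" using x by simp
    have "1 / \<rho> \<le> 1" using \<rho> by simp
    then have "1 / \<rho> \<le> norm (1 + \<theta> / v)" unfolding real_norm_def using x(1) by linarith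
    then have "norm ((1 + \<theta> / v) powi k) \<le> \<rho> ^ nat \<bar>k\<bar>" using x by (intro norm_powi_le \<rho>) auto
    then show "(1 + \<theta> / v) powi k \<le> \<rho> ^ nat \<bar>k\<bar>" by simp
  qed
  show "\<forall>\<^sub>F N in sequentially. \<forall>p\<in>chains N (lam N). 0 \<le> envelope j N p *
      \<bar>(1 + \<theta> / v) powi incr p (N - j) - rel_weight \<theta> (n N) (u N) (incr p (N - j))\<bar> \<and>
      envelope j N p * \<bar>(1 + \<theta> / v) powi incr p (N - j) - rel_weight \<theta> (n N) (u N) (incr p (N - j))\<bar> \<le> 1 * envelope m N p"
    using weight_bounds[OF u(1,2) v] eventually_ge_at_top[of m]
  proof eventually_elim
    case (elim N)
    have L: "lam N \<in> GT N" using lam elim m by simp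
    show ?case
    proof
      fix p assume p: "p \<in> chains N (lam N)"
      define k where "k = incr p (N - j)"
      have "k \<le> entry (lam N) 1" unfolding k_def using elim j by (intro incr_bounds(2)[OF p L]) auto
      then have "0 \<le> rel_weight \<theta> (n N) (u N) k" "rel_weight \<theta> (n N) (u N) k \<le> \<rho> ^ nat \<bar>k\<bar>"
        using elim n(1) by blast+
      then have "\<bar>(1 + \<theta> / v) powi k - rel_weight \<theta> (n N) (u N) k\<bar> \<le> \<rho> ^ nat \<bar>k\<bar>"
        using powi[of k] by linarith
      then have "envelope j N p * \<bar>(1 + \<theta> / v) powi k - rel_weight \<theta> (n N) (u N) k\<bar> \<le> envelope (Suc j) N p"
        unfolding envelope_Suc k_def using envelope_ge_1[of j N p] by (intro mult_left_mono) auto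
      also have "\<dots> \<le> envelope m N p" using j by (intro envelope_mono) auto
      finally show "0 \<le> envelope j N p * \<bar>(1 + \<theta> / v) powi incr p (N - j) - rel_weight \<theta> (n N) (u N) (incr p (N - j))\<bar> \<and>
          envelope j N p * \<bar>(1 + \<theta> / v) powi incr p (N - j) - rel_weight \<theta> (n N) (u N) (incr p (N - j))\<bar> \<le> 1 * envelope m N p"
        using envelope_ge_1[of j N p] by (simp add: k_def)
    qed
  qed
  fix K :: nat and e :: real assume e: "e > 0"
  define E where "E = e / (\<rho> ^ K) ^ j"
  have E: "E > 0" using e \<rho> by (simp add: E_def)
  have "\<forall>\<^sub>F N in sequentially. \<bar>(1 + \<theta> / v) powi k - rel_weight \<theta> (n N) (u N) k\<bar> < E" for k
  proof -
    have "(\<lambda>N. rel_weight \<theta> (n N) (u N) k) \<longlonglongrightarrow> (1 + \<theta> / v) powi k"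
      using u(1) by (intro rel_weight_limit u(3) vpos \<theta> n(2)) auto
    from tendstoD[OF this E] show ?thesis by (simp add: dist_real_def abs_minus_commute)
  qed
  then have "\<forall>\<^sub>F N in sequentially. \<forall>k\<in>{- int K..int K}. \<bar>(1 + \<theta> / v) powi k - rel_weight \<theta> (n N) (u N) k\<bar> < E"
    by (intro eventually_ball_finite) auto
  then show "\<forall>\<^sub>F N in sequentially. \<forall>p\<in>chains N (lam N). (\<forall>i\<in>{1..m}. nat \<bar>incr p (Suc N - i)\<bar> \<le> K) \<longrightarrow>
      envelope j N p * \<bar>(1 + \<theta> / v) powi incr p (N - j) - rel_weight \<theta> (n N) (u N) (incr p (N - j))\<bar> \<le> e"
  proof (eventually_elim, intro ballI impI)
    fix N p
    assume small: "\<forall>k\<in>{- int K..int K}. \<bar>(1 + \<theta> / v) powi k - rel_weight \<theta> (n N) (u N) k\<bar> < E"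
      and K: "\<forall>i\<in>{1..m}. nat \<bar>incr p (Suc N - i)\<bar> \<le> K"
    have "nat \<bar>incr p (Suc N - Suc j)\<bar> \<le> K" using K j by (intro bspec[OF K]) auto
    then have "\<bar>(1 + \<theta> / v) powi incr p (N - j) - rel_weight \<theta> (n N) (u N) (incr p (N - j))\<bar> < E"
      by (intro bspec[OF small]) auto
    moreover have "envelope j N p \<le> (\<rho> ^ K) ^ j" using j by (intro envelope_small[OF K]) auto
    ultimately have "envelope j N p * \<bar>(1 + \<theta> / v) powi incr p (N - j) - rel_weight \<theta> (n N) (u N) (incr p (N - j))\<bar> \<le> (\<rho> ^ K) ^ j * E"
      using \<rho> by (intro mult_mono) auto
    then show "envelope j N p * \<bar>(1 + \<theta> / v) powi incr p (N - j) - rel_weight \<theta> (n N) (u N) (incr p (N - j))\<bar> \<le> e"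
      using \<rho> by (simp add: E_def)
  qed
qed simp

text \<open>When the top increments are at most K the exponent is at most j K, a constant, while the
  base u / (u + \<theta>) tends to 1.\<close>

lemma drift_error:
  assumes u: "\<And>N. v * real N - 1 < u N" "(\<lambda>N. u N / real N) \<longlonglongrightarrow> v" "\<forall>\<^sub>F N in sequentially. 0 < u N" and v: "v > 0" and j: "j < m"
  shows "(\<lambda>N. expect \<theta> N (lam N) (\<lambda>p. \<rho> ^ nat \<bar>incr p (N - j)\<bar> *
      (1 - (u N / (u N + \<theta>)) ^ (\<Sum>i\<in>{N - j<..N}. nat \<bar>incr p i\<bar>)))) \<longlonglongrightarrow> 0"
proof (rule dominated_expect[of 1])
  define q where "q = (\<lambda>N. u N / (u N + \<theta>))"
  have qa: "u N / (u N + \<theta>) = q N" for N by (simp add: q_def)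
  have q: "\<forall>\<^sub>F N in sequentially. 0 < q N \<and> q N \<le> 1" using u(3) by eventually_elim (use \<theta> in \<open>auto simp: q_def\<close>)
  show "\<forall>\<^sub>F N in sequentially. \<forall>p\<in>chains N (lam N).
      0 \<le> \<rho> ^ nat \<bar>incr p (N - j)\<bar> * (1 - (u N / (u N + \<theta>)) ^ (\<Sum>i\<in>{N - j<..N}. nat \<bar>incr p i\<bar>)) \<and>
      \<rho> ^ nat \<bar>incr p (N - j)\<bar> * (1 - (u N / (u N + \<theta>)) ^ (\<Sum>i\<in>{N - j<..N}. nat \<bar>incr p i\<bar>)) \<le> 1 * envelope m N p"
    using q unfolding qa
  proof (eventually_elim, intro ballI)
    fix N p assume q: "0 < q N \<and> q N \<le> 1"
    have r: "0 \<le> \<rho> ^ nat \<bar>incr p (N - j)\<bar>" "\<rho> ^ nat \<bar>incr p (N - j)\<bar> \<le> envelope m N p"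
      using incr_le_envelope[of "Suc j" p N] j \<rho> by auto
    have s: "0 \<le> 1 - q N ^ S" "1 - q N ^ S \<le> 1" for S using q by (auto intro: power_le_one)
    show "0 \<le> \<rho> ^ nat \<bar>incr p (N - j)\<bar> * (1 - q N ^ (\<Sum>i\<in>{N - j<..N}. nat \<bar>incr p i\<bar>)) \<and>
        \<rho> ^ nat \<bar>incr p (N - j)\<bar> * (1 - q N ^ (\<Sum>i\<in>{N - j<..N}. nat \<bar>incr p i\<bar>)) \<le> 1 * envelope m N p"
      using mult_mono[OF r(2) s(2)] mult_nonneg_nonneg[OF r(1) s(1)] envelope_ge_1[of m N p] s(1) by simp
  qed
  fix K :: nat and e :: real assume e: "e > 0"
  have "q \<longlonglongrightarrow> 1"
  proof -
    have "(\<lambda>N. (u N / real N) / (u N / real N + \<theta> * (1 / real N))) \<longlonglongrightarrow> v / (v + \<theta> * 0)"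
      using v by (intro tendsto_intros u(2) lim_1_over_n) auto
    then have "(\<lambda>N. (u N / real N) / (u N / real N + \<theta> * (1 / real N))) \<longlonglongrightarrow> 1" using v by simp
    then show ?thesis
    proof (rule Lim_transform_eventually)
      show "\<forall>\<^sub>F N in sequentially. (u N / real N) / (u N / real N + \<theta> * (1 / real N)) = q N"
        by (rule eventually_sequentiallyI[of 1]) (simp add: q_def flip: add_divide_distrib)
    qed
  qed
  then have "(\<lambda>N. \<rho> ^ K * (1 - q N ^ (j * K))) \<longlonglongrightarrow> \<rho> ^ K * (1 - 1 ^ (j * K))" by (intro tendsto_intros)
  then have "\<forall>\<^sub>F N in sequentially. \<rho> ^ K * (1 - q N ^ (j * K)) < e" using e by (intro order_tendstoD) auto
  then show "\<forall>\<^sub>F N in sequentially. \<forall>p\<in>chains N (lam N). (\<forall>i\<in>{1..m}. nat \<bar>incr p (Suc N - i)\<bar> \<le> K) \<longrightarrow>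
      \<rho> ^ nat \<bar>incr p (N - j)\<bar> * (1 - (u N / (u N + \<theta>)) ^ (\<Sum>i\<in>{N - j<..N}. nat \<bar>incr p i\<bar>)) \<le> e"
    using q eventually_ge_at_top[of m] unfolding qa
  proof (eventually_elim, intro ballI impI)
    fix N p
    assume small: "\<rho> ^ K * (1 - q N ^ (j * K)) < e" and q: "0 < q N \<and> q N \<le> 1" and N: "m \<le> N"
      and K: "\<forall>i\<in>{1..m}. nat \<bar>incr p (Suc N - i)\<bar> \<le> K"
    have "nat \<bar>incr p (Suc N - Suc j)\<bar> \<le> K" using j by (intro bspec[OF K]) auto
    then have r: "\<rho> ^ nat \<bar>incr p (N - j)\<bar> \<le> \<rho> ^ K" using \<rho> by (intro power_increasing) auto
    have "(\<Sum>i\<in>{N - j<..N}. nat \<bar>incr p i\<bar>) \<le> (\<Sum>i\<in>{N - j<..N}. K)"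
    proof (rule sum_mono)
      fix i assume i: "i \<in> {N - j<..N}"
      then have "nat \<bar>incr p (Suc N - (Suc N - i))\<bar> \<le> K" using j N by (intro bspec[OF K]) auto
      then show "nat \<bar>incr p i\<bar> \<le> K" using i by simp
    qed
    also have "\<dots> = j * K" using j N by simp
    finally have "q N ^ (j * K) \<le> q N ^ (\<Sum>i\<in>{N - j<..N}. nat \<bar>incr p i\<bar>)" using q by (intro power_decreasing) auto
    then have "\<rho> ^ nat \<bar>incr p (N - j)\<bar> * (1 - q N ^ (\<Sum>i\<in>{N - j<..N}. nat \<bar>incr p i\<bar>)) \<le> \<rho> ^ K * (1 - q N ^ (j * K))"
      using r \<rho> q by (intro mult_mono) (auto intro: power_le_one)
    then show "\<rho> ^ nat \<bar>incr p (N - j)\<bar> * (1 - q N ^ (\<Sum>i\<in>{N - j<..N}. nat \<bar>incr p i\<bar>)) \<le> e" using small by linarith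
  qed
qed simp

text \<open>Adjoins one variable at a real point x = 1 + \<theta> / v: against any
  bounded-by-envelope function of the upper levels, the new factor acts asymptotically as
  multiplication by the deterministic number X. The work is to show that the random transform of
  level N - j is close to X in mean, first alone and then weighted by the envelope.\<close>

lemma real_point_step:
  assumes j: "j < m" and v: "v \<ge> \<alpha> 1 + 1 + \<theta> / (\<rho> - 1)"
  obtains err X where "err \<longlonglongrightarrow> 0" "X \<longlonglongrightarrow> transform_limit v"
    "\<forall>\<^sub>F N in sequentially. \<forall>h :: _ \<Rightarrow> complex. depends_ge (N - j) h \<longrightarrow>
      (\<forall>p\<in>chains N (lam N). norm (h p) \<le> envelope j N p) \<longrightarrow>
      norm (expect \<theta> N (lam N) (\<lambda>p. h p * of_real ((1 + \<theta> / v) powi incr p (N - j)))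
        - of_real (X N) * expect \<theta> N (lam N) h) \<le> err N"
proof -
  have q0: "\<theta> / (\<rho> - 1) > 0" using \<theta> \<rho> by simp
  have ge: "\<alpha> 1 \<ge> 0" using pos_coordinates(1) by auto
  have vpos: "v > 0" "\<alpha> 1 < v" using v q0 ge by linarith+
  obtain u where u: "\<And>N. generic \<theta> (u N)" "\<And>N. v * real N - 1 < u N" "\<And>N. u N < v * real N" "(\<lambda>N. u N / real N) \<longlonglongrightarrow> v"
    by (rule generic_sequence[of v]) (rule that; assumption)
  define x where "x = 1 + \<theta> / v"
  \<comment> \<open>X is the transform of the full signature, Y below that of the random signature
    at level N - j, and w the weight whose conditional mean given the levels from N - j on is
    Y.\<close>
  define X where "X = (\<lambda>N. rel_prod \<theta> N (u N) (lam N))"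
  define Y where "Y = (\<lambda>N p. rel_prod \<theta> (N - j) (u N) (p (N - j)))"
  define w where "w = (\<lambda>N p. rel_weight \<theta> (N - j) (u N) (incr p (N - j)))"
  define G where "G = (\<lambda>N p. 1 - (u N / (u N + \<theta>)) ^ (\<Sum>i\<in>{N - j<..N}. nat \<bar>incr p i\<bar>))"
  define A where "A = (\<lambda>N. expect \<theta> N (lam N) (\<lambda>p. envelope j N p * \<bar>x powi incr p (N - j) - w N p\<bar>))"
  define A' where "A' = (\<lambda>N. expect \<theta> N (lam N) (\<lambda>p. envelope j N p * \<bar>x powi incr p (N - j) - rel_weight \<theta> N (u N) (incr p (N - j))\<bar>))"
  define R where "R = (\<lambda>N. expect \<theta> N (lam N) (\<lambda>p. envelope j N p * \<bar>Y N p - X N\<bar>))"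
  define T where "T = (\<lambda>N. expect \<theta> N (lam N) (\<lambda>p. \<bar>Y N p - X N\<bar>))"
  define Dr where "Dr = (\<lambda>N. expect \<theta> N (lam N) (\<lambda>p. \<rho> ^ nat \<bar>incr p (N - j)\<bar> * G N p))"
  have n: "(\<lambda>N. real (N - j) / real N) \<longlonglongrightarrow> 1"
  proof -
    have "(\<lambda>N. 1 - real j * (1 / real N)) \<longlonglongrightarrow> 1 - real j * 0" by (intro tendsto_intros lim_1_over_n)
    then have "(\<lambda>N. 1 - real j * (1 / real N)) \<longlonglongrightarrow> 1" by simp
    then show ?thesis
    proof (rule Lim_transform_eventually)
      show "\<forall>\<^sub>F N in sequentially. 1 - real j * (1 / real N) = real (N - j) / real N"
        by (rule eventually_sequentiallyI[of "Suc j"]) (simp add: field_simps of_nat_diff)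
    qed
  qed
  have n1: "(\<lambda>N. real N / real N) \<longlonglongrightarrow> 1" using scaled_index_limit[of 1] by simp
  note W = weight_bounds[OF u(1,2) v]
  have A: "A \<longlonglongrightarrow> 0" unfolding A_def w_def x_def
    by (rule weight_error[where n = "\<lambda>N. N - j", OF u(1,2,4) v j _ n]) simp
  have A': "A' \<longlonglongrightarrow> 0" unfolding A'_def x_def
    by (rule weight_error[where n = "\<lambda>N. N", OF u(1,2,4) v j _ n1]) simp
  have upos: "\<forall>\<^sub>F N in sequentially. 0 < u N" using W by eventually_elim simp
  have Dr: "Dr \<longlonglongrightarrow> 0" unfolding Dr_def G_def by (rule drift_error[OF u(2,4) upos vpos(1) j])
  define B where "B = real m * C"
  have ev: "\<forall>\<^sub>F N in sequentially. T N \<le> 2 * Dr N + (A' N + A N) \<and> 0 \<le> R N \<and> (\<forall>L>0. R N \<le> L * T N + (B + B * B) / L) \<and>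
      (\<forall>h :: _ \<Rightarrow> complex. depends_ge (N - j) h \<longrightarrow>
      (\<forall>p\<in>chains N (lam N). norm (h p) \<le> envelope j N p) \<longrightarrow>
      norm (expect \<theta> N (lam N) (\<lambda>p. h p * of_real (x powi incr p (N - j)))
        - of_real (X N) * expect \<theta> N (lam N) h) \<le> A N + R N)"
    using W expect_envelope_square eventually_ge_at_top[of m]
  proof eventually_elim
    case (elim N)
    have L: "lam N \<in> GT N" using lam elim m by simp
    have M: "N - j \<in> {1..N}" "N - j \<le> N" using j elim(3) by auto
    note up = elim(1)[THEN conjunct1] elim(1)[THEN conjunct2, THEN conjunct1]
    have wb: "0 \<le> rel_weight \<theta> n (u N) k" "rel_weight \<theta> n (u N) k \<le> \<rho> ^ nat \<bar>k\<bar>"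
      if "n \<le> N" "k \<le> entry (lam N) 1" for n k
      using elim(1) that by blast+
    have inc: "incr p (N - j) \<le> entry (lam N) 1" if "p \<in> chains N (lam N)" for p
      by (rule incr_bounds(2)[OF that L M(1)])
    have w: "0 \<le> w N p" "w N p \<le> \<rho> ^ nat \<bar>incr p (N - j)\<bar>" if "p \<in> chains N (lam N)" for p
      unfolding w_def by (intro wb M(2) inc that)+
    have pM: "p (N - j) \<in> GT (N - j)" if "p \<in> chains N (lam N)" for p
      by (rule chains_GT[OF that L M(2)])
    have YE: "Y N p = expect \<theta> (N - j) (p (N - j)) (w N)" if "p \<in> chains N (lam N)" for p
      unfolding Y_def w_def using M by (intro expect_rel_weight[symmetric] pM[OF that] \<theta> u(1)) auto
    have tower: "expect \<theta> N (lam N) (\<lambda>p. h p * w N p) = expect \<theta> N (lam N) (\<lambda>p. h p * Y N p)"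
      if "depends_ge (N - j) h" for h
    proof -
      have "expect \<theta> N (lam N) (\<lambda>p. h p * w N p) = expect \<theta> N (lam N) (\<lambda>p. h p * expect \<theta> (N - j) (p (N - j)) (w N))"
        using that unfolding w_def by (intro expect_tower[OF L \<theta> M(2)] depends_le_incr)
      also have "\<dots> = expect \<theta> N (lam N) (\<lambda>p. h p * Y N p)" by (rule expect_cong) (simp add: YE)
      finally show ?thesis .
    qed
    have towerc: "expect \<theta> N (lam N) (\<lambda>p. h p * of_real (w N p)) = expect \<theta> N (lam N) (\<lambda>p. h p * of_real (Y N p))"
      if "depends_ge (N - j) h" for h :: "_ \<Rightarrow> complex"
    proof -
      have "depends_le (N - j) (\<lambda>p. complex_of_real (w N p))"
        unfolding w_def by (rule depends_le_incr)
      from expect_tower[OF L \<theta> M(2) that this]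
      have "expect \<theta> N (lam N) (\<lambda>p. h p * of_real (w N p))
          = expect \<theta> N (lam N) (\<lambda>p. h p * expect \<theta> (N - j) (p (N - j)) (\<lambda>q. of_real (w N q)))" .
      also have "\<dots> = expect \<theta> N (lam N) (\<lambda>p. h p * of_real (Y N p))"
        by (rule expect_cong) (simp add: YE expect_of_real)
      finally show ?thesis .
    qed
    have Y0: "0 \<le> Y N p" if p: "p \<in> chains N (lam N)" for p
      unfolding YE[OF p]
    proof (rule expect_nonneg[OF pM[OF p] \<theta>])
      fix q assume q: "q \<in> chains (N - j) (p (N - j))"
      have "incr q (N - j) \<le> entry (p (N - j)) 1" using M by (intro incr_bounds(2)[OF q pM[OF p]]) auto
      also have "\<dots> \<le> entry (lam N) 1" using M by (intro chain_entry_bounds(2)[OF p L]) auto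
      finally show "0 \<le> w N q" unfolding w_def by (intro wb M(2))
    qed
    define Q where "Q = (\<lambda>p. (u N / (u N + \<theta>)) ^ (\<Sum>i\<in>{N - j<..N}. nat \<bar>incr p i\<bar>))"
    have GQ: "G N p = 1 - Q p" for p by (simp add: G_def Q_def)
    have "0 \<le> u N / (u N + \<theta>)" "u N / (u N + \<theta>) \<le> 1" using up \<theta> by auto
    then have Q: "Q p \<le> 1" for p unfolding Q_def by (intro power_le_one)
    then have G0: "0 \<le> G N p" for p by (simp add: GQ)
    have YX: "Y N p * Q p \<le> X N" if "p \<in> chains N (lam N)" for p
      unfolding Y_def X_def Q_def by (rule rel_prod_chain[OF L that up \<theta> M(2)])
    have Gdep: "depends_ge (N - j) (G N)"
    proof -
      have "(\<Sum>i\<in>{N - j<..N}. nat \<bar>incr p i\<bar>) = (\<Sum>i\<in>{N - j<..N}. nat \<bar>incr q i\<bar>)" if pq: "\<forall>k\<ge>N - j. p k = q k" for p q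
      proof (rule sum.cong[OF refl])
        fix i assume "i \<in> {N - j<..N}"
        then have "p i = q i" "p (i - 1) = q (i - 1)" using pq by auto
        then show "nat \<bar>incr p i\<bar> = nat \<bar>incr q i\<bar>" by (simp add: incr_def)
      qed
      then show ?thesis unfolding depends_ge_def G_def by metis
    qed
    have edep: "depends_ge (N - j) (envelope j N)"
      unfolding envelope_def using j elim(3) by (intro depends_ge_incr_prod) auto
    have EX: "X N = expect \<theta> N (lam N) (\<lambda>p. rel_weight \<theta> N (u N) (incr p (N - j)))"
      unfolding X_def by (rule expect_rel_weight[symmetric, OF L \<theta> u(1) M(1)])
    have EY: "expect \<theta> N (lam N) (Y N) = expect \<theta> N (lam N) (w N)"
      using tower[of "\<lambda>_. 1"] by (simp add: depends_ge_def)
    have T: "T N \<le> 2 * Dr N + (A' N + A N)"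
    proof -
      \<comment> \<open>The absolute value of t = Y - X is twice its positive part minus t. The
        comparison along the chain bounds the positive part by G Y, and the mean of t is controlled
        separately.\<close>
      have "\<bar>Y N p - X N\<bar> \<le> 2 * (G N p * Y N p) + (X N - Y N p)" if p: "p \<in> chains N (lam N)" for p
      proof -
        have "Y N p - X N \<le> G N p * Y N p" using YX[OF p] by (simp add: GQ algebra_simps)
        moreover have "0 \<le> G N p * Y N p" using G0 Y0[OF p] by simp
        ultimately show ?thesis by linarith
      qed
      then have "T N \<le> expect \<theta> N (lam N) (\<lambda>p. 2 * (G N p * Y N p) + (X N - Y N p))"
        unfolding T_def by (intro expect_mono L \<theta>)
      also have "\<dots> = 2 * expect \<theta> N (lam N) (\<lambda>p. G N p * w N p) + (X N - expect \<theta> N (lam N) (w N))"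
        using expect_diff[of \<theta> N "lam N" "\<lambda>_. X N" "Y N"]
        by (simp only: expect_add expect_cmult expect_const[OF L \<theta>] tower[OF Gdep] EY)
      also have "expect \<theta> N (lam N) (\<lambda>p. G N p * w N p) \<le> Dr N"
        unfolding Dr_def
      proof (rule expect_mono[OF L \<theta>])
        fix p assume p: "p \<in> chains N (lam N)"
        show "G N p * w N p \<le> \<rho> ^ nat \<bar>incr p (N - j)\<bar> * G N p"
          using mult_left_mono[OF w(2)[OF p] G0[of p]] by (simp add: mult.commute)
      qed
      \<comment> \<open>X and the mean of Y are the means of the weights with N and with N - j
        variables at the same increment. Both weights approximate x powi that increment; inserting
        the envelope, which is at least 1, only enlarges the errors.\<close>
      also have "X N - expect \<theta> N (lam N) (w N) \<le> A' N + A N"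
      proof -
        have "X N - expect \<theta> N (lam N) (w N) = expect \<theta> N (lam N) (\<lambda>p. rel_weight \<theta> N (u N) (incr p (N - j)) - w N p)"
          unfolding EX expect_diff ..
        also have "\<dots> \<le> A' N + A N"
          unfolding A'_def A_def expect_add[symmetric]
        proof (rule expect_mono[OF L \<theta>])
          fix p
          define a b where "a = x powi incr p (N - j) - rel_weight \<theta> N (u N) (incr p (N - j))" and "b = x powi incr p (N - j) - w N p"
          have "1 * \<bar>a\<bar> \<le> envelope j N p * \<bar>a\<bar>" "1 * \<bar>b\<bar> \<le> envelope j N p * \<bar>b\<bar>"
            using envelope_ge_1[of j N p] by (intro mult_right_mono; simp)+
          then have "b - a \<le> envelope j N p * \<bar>a\<bar> + envelope j N p * \<bar>b\<bar>" by linarith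
          then show "rel_weight \<theta> N (u N) (incr p (N - j)) - w N p \<le>
              envelope j N p * \<bar>x powi incr p (N - j) - rel_weight \<theta> N (u N) (incr p (N - j))\<bar>
              + envelope j N p * \<bar>x powi incr p (N - j) - w N p\<bar>" by (simp add: a_def b_def)
        qed
        finally show ?thesis .
      qed
      finally show ?thesis by simp
    qed
    have R0: "0 \<le> R N" unfolding R_def
    proof (rule expect_nonneg[OF L \<theta>])
      show "0 \<le> envelope j N p * \<bar>Y N p - X N\<bar>" for p using envelope_ge_1[of j N p] by simp
    qed
    have XB: "0 \<le> X N" "X N \<le> B"
    proof -
      show "0 \<le> X N" unfolding EX using inc by (intro expect_nonneg L \<theta> wb) auto
      have "X N \<le> expect \<theta> N (lam N) (\<lambda>p. (envelope m N p)\<^sup>2)"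
        unfolding EX
      proof (rule expect_mono[OF L \<theta>])
        fix p assume p: "p \<in> chains N (lam N)"
        have "rel_weight \<theta> N (u N) (incr p (N - j)) \<le> \<rho> ^ nat \<bar>incr p (N - j)\<bar>" using inc[OF p] by (intro wb) auto
        also have "\<dots> \<le> envelope m N p" using incr_le_envelope[of "Suc j" p N] j by simp
        also have "\<dots> \<le> (envelope m N p)\<^sup>2" by (rule envelope_square)
        finally show "rel_weight \<theta> N (u N) (incr p (N - j)) \<le> (envelope m N p)\<^sup>2" .
      qed
      then show "X N \<le> B" using elim(2) by (simp add: B_def)
    qed
    have sq: "expect \<theta> N (lam N) (\<lambda>p. (envelope j N p)\<^sup>2) \<le> B" "expect \<theta> N (lam N) (\<lambda>p. (envelope j N p)\<^sup>2 * Y N p) \<le> B"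
    proof -
      have "(envelope j N p)\<^sup>2 \<le> (envelope m N p)\<^sup>2" for p
        using envelope_mono[of j m N p] envelope_ge_1[of j N p] j by (intro power_mono) auto
      then have "expect \<theta> N (lam N) (\<lambda>p. (envelope j N p)\<^sup>2) \<le> expect \<theta> N (lam N) (\<lambda>p. (envelope m N p)\<^sup>2)"
        by (intro expect_mono L \<theta>)
      then show "expect \<theta> N (lam N) (\<lambda>p. (envelope j N p)\<^sup>2) \<le> B" using elim(2) by (simp add: B_def)
      have "expect \<theta> N (lam N) (\<lambda>p. (envelope j N p)\<^sup>2 * Y N p) = expect \<theta> N (lam N) (\<lambda>p. (envelope j N p)\<^sup>2 * w N p)"
        by (rule tower[symmetric, OF depends_ge_map[OF edep]])
      also have "\<dots> \<le> expect \<theta> N (lam N) (\<lambda>p. (envelope m N p)\<^sup>2)"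
      proof (rule expect_mono[OF L \<theta>])
        fix p assume p: "p \<in> chains N (lam N)"
        define r where "r = \<rho> ^ nat \<bar>incr p (N - j)\<bar>"
        have r: "1 \<le> r" using \<rho> by (simp add: r_def)
        have "w N p \<le> r" using w(2)[OF p] by (simp add: r_def)
        also have "\<dots> \<le> r\<^sup>2" using r by (simp add: power2_eq_square)
        finally have "(envelope j N p)\<^sup>2 * w N p \<le> (envelope j N p)\<^sup>2 * r\<^sup>2" by (intro mult_left_mono) auto
        also have "\<dots> = (envelope (Suc j) N p)\<^sup>2" by (simp add: envelope_Suc r_def power_mult_distrib)
        also have "\<dots> \<le> (envelope m N p)\<^sup>2"
          using envelope_mono[of "Suc j" m N p] envelope_ge_1[of "Suc j" N p] j by (intro power_mono) auto
        finally show "(envelope j N p)\<^sup>2 * w N p \<le> (envelope m N p)\<^sup>2" .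
      qed
      finally show "expect \<theta> N (lam N) (\<lambda>p. (envelope j N p)\<^sup>2 * Y N p) \<le> B" using elim(2) by (simp add: B_def)
    qed
    \<comment> \<open>Where the envelope is at most K the error is at most K times the unweighted
      one. Elsewhere the envelope is at most its square over K, and |Y - X| \<le> Y + X leaves two
      means bounded by B and B * B.\<close>
    have R: "R N \<le> K * T N + (B + B * B) / K" if K: "K > 0" for K
    proof -
      have "envelope j N p * \<bar>Y N p - X N\<bar> \<le> K * \<bar>Y N p - X N\<bar> + (1 / K) * ((envelope j N p)\<^sup>2 * Y N p + X N * (envelope j N p)\<^sup>2)"
        (is "?l \<le> ?a + ?b") if p: "p \<in> chains N (lam N)" for p
      proof (cases "envelope j N p \<le> K")
        case True
        then have "?l \<le> ?a" by (intro mult_right_mono) auto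
        moreover have "0 \<le> ?b" using K Y0[OF p] XB by simp
        ultimately show ?thesis by linarith
      next
        case False
        have "\<bar>Y N p - X N\<bar> \<le> Y N p + X N" using Y0[OF p] XB by linarith
        moreover have "envelope j N p \<le> (1 / K) * (envelope j N p)\<^sup>2"
          using False K envelope_ge_1[of j N p] by (simp add: le_divide_eq power2_eq_square)
        ultimately have "?l \<le> ((1 / K) * (envelope j N p)\<^sup>2) * (Y N p + X N)"
          using envelope_ge_1[of j N p] K by (intro mult_mono) auto
        also have "\<dots> = ?b" by (simp add: algebra_simps add_divide_distrib)
        also have "\<dots> \<le> ?a + ?b" using K by simp
        finally show ?thesis .
      qed
      then have "R N \<le> expect \<theta> N (lam N) (\<lambda>p. K * \<bar>Y N p - X N\<bar> + (1 / K) * ((envelope j N p)\<^sup>2 * Y N p + X N * (envelope j N p)\<^sup>2))"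
        unfolding R_def by (intro expect_mono L \<theta>)
      also have "\<dots> = K * T N + (1 / K) * (expect \<theta> N (lam N) (\<lambda>p. (envelope j N p)\<^sup>2 * Y N p) + X N * expect \<theta> N (lam N) (\<lambda>p. (envelope j N p)\<^sup>2))"
        by (simp only: expect_add expect_cmult T_def)
      also have "\<dots> \<le> K * T N + (1 / K) * (B + B * B)"
      proof (intro add_left_mono mult_left_mono add_mono sq)
        have "0 \<le> expect \<theta> N (lam N) (\<lambda>p. (envelope j N p)\<^sup>2)" by (intro expect_nonneg L \<theta>) simp
        then show "X N * expect \<theta> N (lam N) (\<lambda>p. (envelope j N p)\<^sup>2) \<le> B * B" using XB sq(1) by (intro mult_mono) auto
      qed (use K in simp)
      finally show ?thesis by simp
    qed
    have "norm (expect \<theta> N (lam N) (\<lambda>p. h p * of_real (x powi incr p (N - j))) - of_real (X N) * expect \<theta> N (lam N) h) \<le> A N + R N"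
      if h: "depends_ge (N - j) h" "\<forall>p\<in>chains N (lam N). norm (h p) \<le> envelope j N p" for h :: "_ \<Rightarrow> complex"
    proof -
      have "expect \<theta> N (lam N) (\<lambda>p. h p * of_real (x powi incr p (N - j))) - of_real (X N) * expect \<theta> N (lam N) h
          = (expect \<theta> N (lam N) (\<lambda>p. h p * of_real (x powi incr p (N - j))) - expect \<theta> N (lam N) (\<lambda>p. h p * of_real (w N p)))
            + (expect \<theta> N (lam N) (\<lambda>p. h p * of_real (Y N p)) - expect \<theta> N (lam N) (\<lambda>p. of_real (X N) * h p))"
        unfolding towerc[OF h(1)] expect_cmult by simp
      also have "\<dots> = expect \<theta> N (lam N) (\<lambda>p. h p * of_real (x powi incr p (N - j) - w N p))
            + expect \<theta> N (lam N) (\<lambda>p. h p * of_real (Y N p - X N))"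
        unfolding expect_diff[symmetric] by (simp only: of_real_diff right_diff_distrib mult.commute)
      finally have e: "expect \<theta> N (lam N) (\<lambda>p. h p * of_real (x powi incr p (N - j))) - of_real (X N) * expect \<theta> N (lam N) h = \<dots>" .
      have "norm (expect \<theta> N (lam N) (\<lambda>p. h p * of_real (x powi incr p (N - j) - w N p))) \<le> A N"
        unfolding A_def
      proof (rule norm_expect_le[OF L \<theta>])
        fix p assume "p \<in> chains N (lam N)"
        then show "norm (h p * complex_of_real (x powi incr p (N - j) - w N p)) \<le> envelope j N p * \<bar>x powi incr p (N - j) - w N p\<bar>"
          unfolding norm_mult norm_of_real using h(2) by (intro mult_right_mono) auto
      qed
      moreover have "norm (expect \<theta> N (lam N) (\<lambda>p. h p * of_real (Y N p - X N))) \<le> R N"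
        unfolding R_def
      proof (rule norm_expect_le[OF L \<theta>])
        fix p assume "p \<in> chains N (lam N)"
        then show "norm (h p * complex_of_real (Y N p - X N)) \<le> envelope j N p * \<bar>Y N p - X N\<bar>"
          unfolding norm_mult norm_of_real using h(2) by (intro mult_right_mono) auto
      qed
      ultimately show ?thesis unfolding e by (rule norm_triangle_mono)
    qed
    then show ?case using T R0 R by blast
  qed
  have T: "T \<longlonglongrightarrow> 0"
  proof (rule tendsto_sandwich)
    show "\<forall>\<^sub>F N in sequentially. 0 \<le> T N"
      using eventually_ge_at_top[of 1] by eventually_elim (auto simp: T_def intro!: expect_nonneg lam \<theta>)
    show "\<forall>\<^sub>F N in sequentially. T N \<le> 2 * Dr N + (A' N + A N)" using ev by eventually_elim blast
    have "(\<lambda>N. 2 * Dr N + (A' N + A N)) \<longlonglongrightarrow> 2 * 0 + (0 + 0)" by (intro tendsto_intros Dr A A')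
    then show "(\<lambda>N. 2 * Dr N + (A' N + A N)) \<longlonglongrightarrow> 0" by simp
  qed simp
  have R: "R \<longlonglongrightarrow> 0"
  proof (rule LIMSEQ_I)
    fix e :: real assume e: "e > 0"
    have B: "B > 0" unfolding B_def using m C by simp
    define S where "S = B + B * B"
    have "S > 0" using B by (simp add: S_def add_pos_pos)
    \<comment> \<open>Makes the truncation term equal to e / 2 for every N, so that only K times
      \<open>T N\<close> has to become small.\<close>
    define K where "K = 2 * S / e"
    have "K > 0" "S / K = e / 2" using e \<open>S > 0\<close> by (auto simp: K_def)
    then have K: "K > 0" "(B + B * B) / K = e / 2" by (simp_all add: S_def)
    have "(\<lambda>N. K * T N) \<longlonglongrightarrow> K * 0" by (intro tendsto_intros T)
    then have "\<forall>\<^sub>F N in sequentially. K * T N < e / 2" using e by (intro order_tendstoD) auto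
    then have "\<forall>\<^sub>F N in sequentially. norm (R N - 0) < e"
      using ev
    proof eventually_elim
      case (elim N)
      then have "R N \<le> K * T N + e / 2" "0 \<le> R N" using K by metis+
      then show ?case using elim(1) by simp
    qed
    then show "\<exists>no. \<forall>n\<ge>no. norm (R n - 0) < e" by (simp add: eventually_sequentially)
  qed
  show thesis
  proof (rule that[of "\<lambda>N. A N + R N" X])
    show "(\<lambda>N. A N + R N) \<longlonglongrightarrow> 0" using tendsto_add[OF A R] by simp
    show "X \<longlonglongrightarrow> transform_limit v"
      unfolding X_def using u vpos by (intro rel_prod_limit) auto
    show "\<forall>\<^sub>F N in sequentially. \<forall>h :: _ \<Rightarrow> complex. depends_ge (N - j) h \<longrightarrow>
      (\<forall>p\<in>chains N (lam N). norm (h p) \<le> envelope j N p) \<longrightarrow>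
      norm (expect \<theta> N (lam N) (\<lambda>p. h p * of_real ((1 + \<theta> / v) powi incr p (N - j)))
        - of_real (X N) * expect \<theta> N (lam N) h) \<le> A N + R N"
      using ev unfolding x_def by eventually_elim blast
  qed
qed

text \<open>The first bound gives |z| \<ge> 1 / \<rho>, so that the envelope dominates monomials;
  the second places the closed annulus of this width inside the domain of holomorphy.\<close>

definition gap :: real where
  "gap = min (1 - 1 / \<rho>) (radius / 2)"

lemma gap_bounds: "0 < gap" "gap < radius" "gap < 1" "gap \<le> 1 - 1 / \<rho>"
  using radius_bounds(1,2) \<rho> by (auto simp: gap_def)

lemma annulus_gap:
  assumes "z \<in> annulus gap"
  shows "z \<noteq> 0" "norm (z powi k) \<le> \<rho> ^ nat \<bar>k\<bar>"
proof -
  have z: "1 - gap < norm z" "norm z < 1 + gap" using assms by (auto simp: annulus_def)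
  then show "z \<noteq> 0" using gap_bounds(3) by auto
  \<comment> \<open>This is 2 - 1 / \<rho> \<le> \<rho>, so the bound on the inner radius also
    yields |z| \<le> \<rho>.\<close>
  have "0 \<le> (\<rho> - 1)\<^sup>2 / \<rho>" using \<rho> by simp
  also have "(\<rho> - 1)\<^sup>2 / \<rho> = \<rho> - 2 + 1 / \<rho>" using \<rho> by (simp add: power2_eq_square field_simps)
  finally have "norm z \<le> \<rho>" using z gap_bounds(4) by linarith
  moreover have "1 / \<rho> \<le> norm z" using z gap_bounds(4) by linarith
  ultimately show "norm (z powi k) \<le> \<rho> ^ nat \<bar>k\<bar>" by (intro norm_powi_le \<rho>)
qed

lemma compact_closed_annulus: "compact {z :: complex. 1 - d \<le> norm z \<and> norm z \<le> 1 + d}"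
proof -
  have "{z :: complex. 1 - d \<le> norm z \<and> norm z \<le> 1 + d} = cball 0 (1 + d) \<inter> {z. 1 - d \<le> norm z}" by auto
  moreover have "closed {z :: complex. 1 - d \<le> norm z}" by (intro closed_Collect_le continuous_intros)
  ultimately show ?thesis by (auto intro: compact_Int_closed)
qed

lemma Psi_bounded:
  obtains P where "P \<ge> 1" "\<And>z. z \<in> annulus gap \<Longrightarrow> norm (Psi \<omega> \<theta> z) \<le> P"
proof -
  define K where "K = {z :: complex. 1 - gap \<le> norm z \<and> norm z \<le> 1 + gap}"
  have sub: "annulus gap \<subseteq> K" "K \<subseteq> annulus radius" using gap_bounds by (auto simp: K_def annulus_def)
  have "continuous_on K (Psi \<omega> \<theta>)"
    by (rule continuous_on_subset[OF holomorphic_on_imp_continuous_on[OF Psi_holomorphic] sub(2)])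
  then have "bounded (Psi \<omega> \<theta> ` K)"
    unfolding K_def by (intro compact_imp_bounded compact_continuous_image compact_closed_annulus)
  then obtain P where "\<And>z. z \<in> K \<Longrightarrow> norm (Psi \<omega> \<theta> z) \<le> P" by (auto simp: bounded_iff)
  then show thesis using that[of "max P 1"] sub(1) by fastforce
qed

lemma monomial_le_envelope:
  assumes "\<And>i. i \<in> {1..j} \<Longrightarrow> z i \<in> annulus gap"
  shows "norm (\<Prod>i\<in>{1..j}. z i powi incr p (Suc N - i)) \<le> envelope j N p"
  unfolding envelope_def prod_norm[symmetric] using assms annulus_gap(2) by (intro prod_mono) auto

text \<open>Adding one variable: the expectation converges on a real segment by the previous lemma, and
  locally bounded holomorphic functions that vanish asymptotically there vanish everywhere.\<close>

lemma expect_monomial_limit: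
  assumes "j \<le> m" "\<And>N i. i \<in> {1..j} \<Longrightarrow> zs N i \<in> annulus (gap / 2)"
  shows "(\<lambda>N. expect \<theta> N (lam N) (\<lambda>p. \<Prod>i\<in>{1..j}. zs N i powi incr p (Suc N - i))
      - (\<Prod>i\<in>{1..j}. Psi \<omega> \<theta> (zs N i))) \<longlonglongrightarrow> 0"
  using assms
proof (induction j)
  case 0
  have "\<forall>\<^sub>F N in sequentially. expect \<theta> N (lam N) (\<lambda>p. 1) - (1 :: complex) = 0"
    using eventually_ge_at_top[of 1] by eventually_elim (simp add: expect_const lam \<theta>)
  then show ?case by (simp add: tendsto_eventually)
next
  case (Suc j)
  have sub: "annulus (gap / 2) \<subseteq> annulus gap" using gap_bounds(1) by (auto simp: annulus_def)
  have zs: "zs N i \<in> annulus gap" if "i \<in> {1..j}" for N i using Suc.prems(2)[of i N] that sub by auto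
  define h where "h = (\<lambda>N p. \<Prod>i\<in>{1..j}. zs N i powi incr p (Suc N - i))"
  define c where "c = (\<lambda>N. \<Prod>i\<in>{1..j}. Psi \<omega> \<theta> (zs N i))"
  \<comment> \<open>The first j variables may move with N, so there is no limit function to compare
    with. The difference itself is studied: as functions of the new variable w the F N are
    holomorphic and uniformly bounded for large N.\<close>
  define F where "F = (\<lambda>N w. expect \<theta> N (lam N) (\<lambda>p. h N p * w powi incr p (N - j)) - c N * Psi \<omega> \<theta> w)"
  have IH: "(\<lambda>N. expect \<theta> N (lam N) (h N) - c N) \<longlonglongrightarrow> 0"
    unfolding h_def c_def using Suc.prems by (intro Suc.IH) auto
  have h: "norm (h N p) \<le> envelope j N p" for N p unfolding h_def by (rule monomial_le_envelope) (rule zs)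
  obtain P where P: "P \<ge> 1" "\<And>z. z \<in> annulus gap \<Longrightarrow> norm (Psi \<omega> \<theta> z) \<le> P" using Psi_bounded by blast
  have c: "norm (c N) \<le> P ^ j" for N
  proof -
    have "norm (c N) \<le> (\<Prod>i\<in>{1..j}. P)"
      unfolding c_def prod_norm[symmetric] using P(2) zs by (intro prod_mono) auto
    then show ?thesis by simp
  qed
  have Eh: "norm (expect \<theta> N (lam N) g) \<le> real m * C"
    if "expect \<theta> N (lam N) (\<lambda>p. (envelope m N p)\<^sup>2) \<le> real m * C" "N \<ge> 1" "k \<le> m" "\<And>p. norm (g p) \<le> envelope k N p"
    for g :: "_ \<Rightarrow> complex" and k N
  proof -
    have "norm (g p) \<le> (envelope m N p)\<^sup>2" for p
      using that(4)[of p] envelope_mono[OF that(3), of N p] envelope_square[of m N p] by linarith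
    then have "norm (expect \<theta> N (lam N) g) \<le> expect \<theta> N (lam N) (\<lambda>p. (envelope m N p)\<^sup>2)"
      using that(2) by (intro norm_expect_le lam \<theta>)
    then show ?thesis using that(1) by linarith
  qed
  define v0 where "v0 = \<alpha> 1 + 1 + \<theta> / (\<rho> - 1)"
  have v0: "v0 > 0" using pos_coordinates(1)[of 1] \<theta> \<rho> by (simp add: v0_def add_nonneg_pos)
  \<comment> \<open>For 1 < x < 1 + s the parameter \<theta> / (x - 1) is at least v0, the threshold
    in \<open>real_point_step\<close>, and x stays in the annulus.\<close>
  define s where "s = min gap (\<theta> / v0)"
  have s: "s > 0" "s \<le> gap" "s \<le> \<theta> / v0" using gap_bounds(1) \<theta> v0 by (auto simp: s_def)
  \<comment> \<open>A real segment that accumulates at 1, an interior point of the annulus, as the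
    identity theorem requires.\<close>
  define U where "U = complex_of_real ` {1<..<1 + s}"
  have real: "(\<lambda>N. F N (of_real x)) \<longlonglongrightarrow> 0" if x: "1 < x" "x < 1 + s" for x
  proof -
    define v where "v = \<theta> / (x - 1)"
    have xr: "x < 1 + radius" using x s(2) gap_bounds(2) by linarith
    have xv: "x = 1 + \<theta> / v" using x \<theta> by (simp add: v_def)
    have "(x - 1) * v0 \<le> \<theta>"
    proof -
      have "(x - 1) * v0 \<le> (\<theta> / v0) * v0" using x s(3) v0 by (intro mult_right_mono) auto
      then show ?thesis using v0 by simp
    qed
    then have v: "v0 \<le> v" using x by (simp add: v_def le_divide_eq mult.commute)
    have jm: "j < m" using Suc.prems(1) by simp
    obtain err X where e: "err \<longlonglongrightarrow> 0" "X \<longlonglongrightarrow> transform_limit v"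
      "\<forall>\<^sub>F N in sequentially. \<forall>h :: _ \<Rightarrow> complex. depends_ge (N - j) h \<longrightarrow>
      (\<forall>p\<in>chains N (lam N). norm (h p) \<le> envelope j N p) \<longrightarrow>
      norm (expect \<theta> N (lam N) (\<lambda>p. h p * of_real ((1 + \<theta> / v) powi incr p (N - j)))
        - of_real (X N) * expect \<theta> N (lam N) h) \<le> err N"
      by (rule real_point_step[OF jm v[unfolded v0_def]]) (rule that; assumption)
    have Px: "Psi \<omega> \<theta> (of_real x) = of_real (transform_limit v)"
      unfolding v_def by (rule Psi_real(2)[OF x(1) xr])
    define D where "D = (\<lambda>N. expect \<theta> N (lam N) (\<lambda>p. h N p * complex_of_real x powi incr p (N - j)) - of_real (X N) * expect \<theta> N (lam N) (h N))"
    have D: "D \<longlonglongrightarrow> 0"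
    proof (rule Lim_null_comparison[OF _ e(1)])
      show "\<forall>\<^sub>F N in sequentially. norm (D N) \<le> err N"
        using e(3) eventually_ge_at_top[of m]
      proof eventually_elim
        case (elim N)
        have "depends_ge (N - j) (h N)"
          unfolding h_def using elim(2) jm by (intro depends_ge_incr_prod) auto
        then have "norm (expect \<theta> N (lam N) (\<lambda>p. h N p * of_real ((1 + \<theta> / v) powi incr p (N - j)))
            - of_real (X N) * expect \<theta> N (lam N) (h N)) \<le> err N" using elim(1) h by blast
        then show ?case unfolding D_def xv[symmetric] of_real_power_int .
      qed
    qed
    have bd: "\<forall>\<^sub>F N in sequentially. norm (expect \<theta> N (lam N) (h N)) \<le> real m * C"
      using expect_envelope_square eventually_ge_at_top[of 1]
    proof eventually_elim
      case (elim N)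
      then show ?case using jm h by (intro Eh[of N j]) auto
    qed
    have E1: "(\<lambda>N. of_real (X N - transform_limit v) * expect \<theta> N (lam N) (h N)) \<longlonglongrightarrow> 0"
    proof (rule Lim_null_comparison)
      show "\<forall>\<^sub>F N in sequentially. norm (complex_of_real (X N - transform_limit v) * expect \<theta> N (lam N) (h N)) \<le> \<bar>X N - transform_limit v\<bar> * (real m * C)"
        using bd by eventually_elim (auto simp: norm_mult intro!: mult_left_mono simp del: of_real_diff)
      have "(\<lambda>N. \<bar>X N - transform_limit v\<bar> * (real m * C)) \<longlonglongrightarrow> \<bar>transform_limit v - transform_limit v\<bar> * (real m * C)"
        by (intro tendsto_intros e(2))
      then show "(\<lambda>N. \<bar>X N - transform_limit v\<bar> * (real m * C)) \<longlonglongrightarrow> 0" by simp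
    qed
    \<comment> \<open>F at x splits into the error of adjoining the new variable, the error of X
      against its limit times a bounded expectation, and that limit times the error of the induction
      hypothesis.\<close>
    have "(\<lambda>N. D N + (of_real (X N - transform_limit v) * expect \<theta> N (lam N) (h N)
        + of_real (transform_limit v) * (expect \<theta> N (lam N) (h N) - c N))) \<longlonglongrightarrow> 0 + (0 + of_real (transform_limit v) * 0)"
      by (intro tendsto_add tendsto_mult tendsto_const D E1 IH)
    moreover have "D N + (of_real (X N - transform_limit v) * expect \<theta> N (lam N) (h N)
        + of_real (transform_limit v) * (expect \<theta> N (lam N) (h N) - c N)) = F N (of_real x)" for N
      by (simp add: D_def F_def Px algebra_simps)
    ultimately show ?thesis by simp
  qed
  have "uniform_limit {z. 1 - gap / 2 \<le> norm z \<and> norm z \<le> 1 + gap / 2} F (\<lambda>_. 0) sequentially"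
  proof (rule vitali_null[OF open_annulus connected_open_annulus])
    show "\<forall>\<^sub>F N in sequentially. F N holomorphic_on annulus gap \<and> (\<forall>w\<in>annulus gap. norm (F N w) \<le> real m * C + P ^ j * P)"
      using expect_envelope_square eventually_ge_at_top[of 1]
    proof eventually_elim
      case (elim N)
      have hol: "Psi \<omega> \<theta> holomorphic_on annulus gap"
        using gap_bounds(2) by (intro holomorphic_on_subset[OF Psi_holomorphic]) (auto simp: annulus_def)
      have "F N holomorphic_on annulus gap"
        unfolding F_def expect_def scaleR_conv_of_real
        by (intro holomorphic_intros hol) (use annulus_gap(1) in auto)
      moreover have "norm (F N w) \<le> real m * C + P ^ j * P" if w: "w \<in> annulus gap" for w
      proof -
        have "norm (h N p * w powi incr p (N - j)) \<le> envelope (Suc j) N p" for p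
          unfolding envelope_Suc norm_mult using envelope_ge_1[of j N p] by (intro mult_mono h annulus_gap(2)[OF w]) auto
        then have "norm (expect \<theta> N (lam N) (\<lambda>p. h N p * w powi incr p (N - j))) \<le> real m * C"
          using elim Suc.prems(1) by (intro Eh)
        moreover have "norm (c N * Psi \<omega> \<theta> w) \<le> P ^ j * P"
          unfolding norm_mult using P c w by (intro mult_mono) auto
        ultimately show ?thesis unfolding F_def by (rule norm_triangle_le_diff[OF add_mono])
      qed
      ultimately show ?case by blast
    qed
    show "U \<subseteq> annulus gap" using s by (auto simp: U_def annulus_def)
    show "(1 :: complex) \<in> annulus gap" using gap_bounds(1) by (simp add: annulus_def)
    show "1 islimpt U"
      unfolding islimpt_approachable
    proof (intro allI impI)
      fix e :: real assume e: "e > 0"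
      define t where "t = min (e / 2) (s / 2)"
      have t: "0 < t" "t < e" "t < s" using e s(1) by (auto simp: t_def)
      have "dist (complex_of_real (1 + t)) 1 = t" using t(1) by (simp add: dist_norm)
      then show "\<exists>x'\<in>U. x' \<noteq> 1 \<and> dist x' 1 < e"
        using t by (intro bexI[of _ "complex_of_real (1 + t)"]) (auto simp: U_def simp del: of_real_add)
    qed
    show "(\<lambda>N. F N z) \<longlonglongrightarrow> 0" if "z \<in> U" for z using that real by (auto simp: U_def)
    show "compact {z :: complex. 1 - gap / 2 \<le> norm z \<and> norm z \<le> 1 + gap / 2}" by (rule compact_closed_annulus)
    show "{z. 1 - gap / 2 \<le> norm z \<and> norm z \<le> 1 + gap / 2} \<subseteq> annulus gap" using gap_bounds(1) by (auto simp: annulus_def)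
  qed
  then have lim: "(\<lambda>N. F N (zs N (Suc j))) \<longlonglongrightarrow> 0"
    unfolding tendsto_iff
  proof (intro allI impI)
    fix e :: real
    assume "uniform_limit {z. 1 - gap / 2 \<le> norm z \<and> norm z \<le> 1 + gap / 2} F (\<lambda>_. 0) sequentially" "e > 0"
    from uniform_limitD[OF this] show "\<forall>\<^sub>F N in sequentially. dist (F N (zs N (Suc j))) 0 < e"
    proof eventually_elim
      case (elim N)
      have "zs N (Suc j) \<in> annulus (gap / 2)" by (rule Suc.prems(2)) simp
      then show ?case using elim by (auto simp: annulus_def)
    qed
  qed
  then show ?case by (simp add: F_def h_def c_def)
qed

text \<open>Halving the gap puts the annulus into a compact subset of the one where bounds and
  holomorphy hold. Since the variables were allowed to depend on N, the convergence along sequences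
  is already uniform convergence.\<close>

lemma jack_char_limit:
  "uniform_limit {z. \<forall>i\<in>{1..m}. z i \<in> annulus (gap / 2)} (\<lambda>N z. jack_char \<theta> N m (lam N) z)
     (\<lambda>z. \<Prod>i = 1..m. Psi \<omega> \<theta> (z i)) sequentially"
proof (rule uniform_limit_sequenceI)
  fix zs :: "nat \<Rightarrow> nat \<Rightarrow> complex"
  assume zs: "\<And>N. zs N \<in> {z. \<forall>i\<in>{1..m}. z i \<in> annulus (gap / 2)}"
  have "annulus (gap / 2) \<subseteq> annulus gap" using gap_bounds(1) by (auto simp: annulus_def)
  then have nz: "zs N i \<noteq> 0" if "i \<in> {1..m}" for N i using that zs[of N] annulus_gap(1) by blast
  have "(\<lambda>N. norm (expect \<theta> N (lam N) (\<lambda>p. \<Prod>i\<in>{1..m}. zs N i powi incr p (Suc N - i)) - (\<Prod>i\<in>{1..m}. Psi \<omega> \<theta> (zs N i)))) \<longlonglongrightarrow> 0"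
    using expect_monomial_limit[of m zs] zs by (intro tendsto_norm_zero) auto
  then show "(\<lambda>N. dist (jack_char \<theta> N m (lam N) (zs N)) (\<Prod>i = 1..m. Psi \<omega> \<theta> (zs N i))) \<longlonglongrightarrow> 0"
  proof (rule Lim_transform_eventually)
    show "\<forall>\<^sub>F N in sequentially. norm (expect \<theta> N (lam N) (\<lambda>p. \<Prod>i\<in>{1..m}. zs N i powi incr p (Suc N - i)) - (\<Prod>i\<in>{1..m}. Psi \<omega> \<theta> (zs N i)))
        = dist (jack_char \<theta> N m (lam N) (zs N)) (\<Prod>i = 1..m. Psi \<omega> \<theta> (zs N i))"
      using eventually_ge_at_top[of m]
    proof eventually_elim
      case (elim N)
      then have "lam N \<in> GT N" using lam m by simp
      then show ?case using jack_char_expect[OF \<theta> _ m elim nz] by (simp add: dist_norm)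
    qed
  qed
qed

end

text \<open>\<rho> is the 2 m-th root of the base for which moments are known, so the admissible
  width of the annulus depends on m.\<close>

lemma (in vk_setting) moment_setting:
  assumes "m \<ge> 1"
  obtains \<rho> C where "vk_moment \<theta> lam \<omega> m \<rho> C"
proof -
  obtain r C :: real where r: "r > 1"
    "\<forall>\<^sub>F N in sequentially. \<forall>i\<in>{1..N}. expect \<theta> N (lam N) (\<lambda>p. r ^ nat \<bar>incr p i\<bar>) \<le> C"
    by (rule exponential_moment) (rule that; assumption)
  have pow: "root (2 * m) r ^ (2 * m) = r" using r(1) assms by (intro real_root_pow_pos2) auto
  have "vk_moment \<theta> lam \<omega> m (root (2 * m) r) (max C 1)"
  proof unfold_locales
    show "root (2 * m) r > 1" using r(1) assms by simp
    show "\<forall>\<^sub>F N in sequentially. \<forall>i\<in>{1..N}. expect \<theta> N (lam N) (\<lambda>p. (root (2 * m) r ^ (2 * m)) ^ nat \<bar>incr p i\<bar>) \<le> max C 1"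
      unfolding pow using r(2) by eventually_elim fastforce
  qed (use assms in auto)
  then show thesis by (rule that)
qed

theorem theorem0p3:
  fixes \<theta> :: real and m :: nat and lam :: "nat \<Rightarrow> int list" and \<omega> :: boundary_point
  assumes "\<theta> > 0" and "m \<ge> 1" and "vk_sequence lam \<omega>"
  shows "(\<exists>U. open U \<and> sphere 0 1 \<subseteq> U \<and> Psi \<omega> \<theta> holomorphic_on U) \<and>
    (\<exists>\<delta>>0. Psi \<omega> \<theta> holomorphic_on annulus \<delta> \<and>
       uniform_limit {z. \<forall>i\<in>{1..m}. z i \<in> annulus \<delta>}
         (\<lambda>N z. jack_char \<theta> N m (lam N) z)
         (\<lambda>z. \<Prod>i = 1..m. Psi \<omega> \<theta> (z i))
         sequentially)"
proof -
  interpret vk_setting \<theta> lam \<omega> by unfold_locales (use assms in auto)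
  obtain \<rho> C where "vk_moment \<theta> lam \<omega> m \<rho> C" using moment_setting[OF assms(2)] by blast
  then interpret vk_moment \<theta> lam \<omega> m \<rho> C .
  have "sphere 0 1 \<subseteq> annulus radius" using radius_bounds(1) by (auto simp: annulus_def)
  then have "\<exists>U. open U \<and> sphere 0 1 \<subseteq> U \<and> Psi \<omega> \<theta> holomorphic_on U"
    using open_annulus Psi_holomorphic by blast
  moreover have "Psi \<omega> \<theta> holomorphic_on annulus (gap / 2)"
    using gap_bounds by (intro holomorphic_on_subset[OF Psi_holomorphic]) (auto simp: annulus_def)
  ultimately show ?thesis using jack_char_limit gap_bounds(1) by (intro conjI exI[of _ "gap / 2"]) auto
qed

end
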